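(* Let $M$ be a smooth manifold of dimension $n$. (a) If $n$ is even and $V_2$ is a $2$-vector field on $M$ of rank $n$ (at every point), then $V_2$ has constant coefficients if and only if $[V_2,V_2]=0$. (b) If $n$ is odd and $V_2$ is a $2$-vector field on $M$ of rank $n-1$ (at every point), then $V_2$ has constant coefficients if and only if the Pfaffian system $P=\{w\in T_x^\ast M: i_wV_2=0,\ x\in M\}$ is integrable and the restriction of $[V_2,V_2]$ to each integral submanifold of $P$ vanishes.
   Context: A $2$-vector field $V_2$ on $M$ has constant coefficients if for every $x\in M$ there is a coordinate system $(u^1,\dots,u^n)$ centred at $x$ such that all the functions $V_2(du^i,du^j)$, $1\le i<j\le n$, are constant on the coordinate domain. The rank of $V_2$ at $x$ is the rank of the linear map $T_x^\ast M\to T_xM$, $w\mapsto i_wV_2$, where $i_w$ is contraction with $w$. $[\cdot,\cdot]$ is the Schouten–Nijenhuis bracket of multivector fields, the local $\mathbb{R}$-bilinear operation given on decomposable multivector fields by $[X_1\wedge\cdots\wedge X_q,\,Y_1\wedge\cdots\wedge Y_r]=\sum_{i,j}(-1)^{i+j}[X_i,Y_j]\wedge X_1\wedge\cdots\wedge\widehat{X_i}\wedge\cdots\wedge X_q\wedge Y_1\wedge\cdots\wedge\widehat{Y_j}\wedge\cdots\wedge Y_r$. In case (b) $P$ is a subbundle of $T^\ast M$ of rank $1$. It is integrable if for every local section $\omega$ of $P$, $d\omega$ belongs to the ideal of differential forms generated by the local sections of $P$ (equivalently, the distribution $\ker P\subset TM$ of vectors annihilated by $P$ is involutive). The integral submanifolds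 of $P$ are the $(n-1)$-dimensional submanifolds $N$ with $T_xN=\ker P_x$ for all $x\in N$; the restriction of $[V_2,V_2]$ to $N$ is $[V_2,V_2]$ evaluated at the points of $N$. *)

theory Defs
  imports "HOL-Analysis.Analysis" "HOL-Library.Function_Algebras"
begin

section \<open>Function spaces as real vector spaces\<close>

instantiation "fun" :: (type, scaleR) scaleR
begin

definition scaleR_fun_def: "r *\<^sub>R f = (\<lambda>x. r *\<^sub>R f x)"

instance ..

end

lemma scaleR_fun_apply [simp]: "(r *\<^sub>R f) x = r *\<^sub>R f x"
  by (simp add: scaleR_fun_def)

instance "fun" :: (type, real_vector) real_vector
  by standard (simp_all add: fun_eq_iff scaleR_add_right scaleR_add_left)

text \<open>Linearity of a functional that is only of interest on a subspace of its type.\<close>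

definition linear_form_on :: "'a::real_vector set \<Rightarrow> ('a \<Rightarrow> real) \<Rightarrow> bool" where
  "linear_form_on S f \<longleftrightarrow>
     (\<forall>u\<in>S. \<forall>v\<in>S. f (u + v) = f u + f v) \<and> (\<forall>r. \<forall>u\<in>S. f (r *\<^sub>R u) = r * f u)"


section \<open>Smooth maps between open subsets of normed spaces\<close>

text \<open>To be used on open \<open>S\<close> only, as the derivatives are taken at the points of \<open>S\<close>, not within \<open>S\<close>.
  In finite dimension this is the usual notion of a \<open>C\<^sup>k\<close> map.\<close>

fun Ck_on :: "nat \<Rightarrow> 'a::real_normed_vector set \<Rightarrow> ('a \<Rightarrow> 'b::real_normed_vector) \<Rightarrow> bool" where
  "Ck_on 0 S f \<longleftrightarrow> continuous_on S f"
| "Ck_on (Suc k) S f \<longleftrightarrow>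
     (\<forall>x\<in>S. f differentiable (at x)) \<and> (\<forall>v. Ck_on k S (\<lambda>x. frechet_derivative f (at x) v))"

definition smooth_on :: "'a::real_normed_vector set \<Rightarrow> ('a \<Rightarrow> 'b::real_normed_vector) \<Rightarrow> bool" where
  "smooth_on S f \<longleftrightarrow> (\<forall>k. Ck_on k S f)"


section \<open>Smooth manifolds\<close>

text \<open>A chart is a pair of its domain and its coordinate map; the values of the
  coordinate map off the domain are irrelevant. The dimension is \<open>CARD('n)\<close>.\<close>

type_synonym ('m, 'n) chart = "'m set \<times> ('m \<Rightarrow> real ^ 'n)"

definition chart_inv :: "('m, 'n::finite) chart \<Rightarrow> real ^ 'n \<Rightarrow> 'm" where
  "chart_inv c = inv_into (fst c) (snd c)"

definition is_chart :: "'m topology \<Rightarrow> ('m, 'n::finite) chart \<Rightarrow> bool" where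
  "is_chart M c \<longleftrightarrow>
     openin M (fst c) \<and> open (snd c ` fst c) \<and>
     homeomorphic_map (subtopology M (fst c)) (top_of_set (snd c ` fst c)) (snd c)"

definition transition :: "('m, 'n::finite) chart \<Rightarrow> ('m, 'n) chart \<Rightarrow> real ^ 'n \<Rightarrow> real ^ 'n" where
  "transition c c' = snd c' \<circ> chart_inv c"

definition compatible :: "('m, 'n::finite) chart \<Rightarrow> ('m, 'n) chart \<Rightarrow> bool" where
  "compatible c c' \<longleftrightarrow>
     smooth_on (snd c ` (fst c \<inter> fst c')) (transition c c') \<and>
     smooth_on (snd c' ` (fst c \<inter> fst c')) (transition c' c)"

text \<open>\<open>A\<close> is a maximal smooth atlas, so its members are exactly the coordinate systems of the manifold.\<close>

definition smooth_manifold :: "'m topology \<Rightarrow> ('m, 'n::finite) chart set \<Rightarrow> bool" where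
  "smooth_manifold M A \<longleftrightarrow>
     Hausdorff_space M \<and> second_countable M \<and>
     (\<forall>c\<in>A. is_chart M c) \<and>
     (\<Union>c\<in>A. fst c) = topspace M \<and>
     (\<forall>c\<in>A. \<forall>c'\<in>A. compatible c c') \<and>
     (\<forall>c. is_chart M c \<and> (\<forall>c'\<in>A. compatible c c') \<longrightarrow> c \<in> A)"


section \<open>Tangent vectors and covectors\<close>

text \<open>A tangent vector at \<open>p\<close> is the family of its component vectors in all the charts around \<open>p\<close>,
  related by the Jacobians of the coordinate changes (and \<open>0\<close> at all other indices).\<close>

type_synonym ('m, 'n) tvec = "('m, 'n) chart \<Rightarrow> real ^ 'n"
type_synonym ('m, 'n) covec = "('m, 'n) tvec \<Rightarrow> real"

definition tangent_space ::
    "('m, 'n::finite) chart set \<Rightarrow> 'm \<Rightarrow> ('m, 'n) tvec set" where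
  "tangent_space A p =
     {v. (\<forall>c\<in>A. \<forall>c'\<in>A. p \<in> fst c \<inter> fst c' \<longrightarrow>
            v c' = frechet_derivative (transition c c') (at (snd c p)) (v c)) \<and>
         (\<forall>c. \<not> (c \<in> A \<and> p \<in> fst c) \<longrightarrow> v c = 0)}"

text \<open>The coordinate vector \<open>\<partial>/\<partial>u\<^sup>i\<close> at \<open>p\<close> of the chart \<open>c\<close>.\<close>

definition coord_vec ::
    "('m, 'n::finite) chart set \<Rightarrow> ('m, 'n) chart \<Rightarrow> 'n \<Rightarrow> 'm \<Rightarrow> ('m, 'n) tvec" where
  "coord_vec A c i p = (\<lambda>c'. if c' \<in> A \<and> p \<in> fst c'
     then frechet_derivative (transition c c') (at (snd c p)) (axis i 1) else 0)"

text \<open>Covectors are extended by \<open>0\<close> off the tangent space, to make equality of covectors meaningful.\<close>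

definition cotangent_space ::
    "('m, 'n::finite) chart set \<Rightarrow> 'm \<Rightarrow> ('m, 'n) covec set" where
  "cotangent_space A p =
     {w. linear_form_on (tangent_space A p) w \<and> (\<forall>v. v \<notin> tangent_space A p \<longrightarrow> w v = 0)}"

text \<open>The coordinate differential \<open>du\<^sup>i\<close> at \<open>p\<close> of the chart \<open>c\<close>.\<close>

definition coord_diff ::
    "('m, 'n::finite) chart set \<Rightarrow> ('m, 'n) chart \<Rightarrow> 'n \<Rightarrow> 'm \<Rightarrow> ('m, 'n) covec" where
  "coord_diff A c i p = (\<lambda>v. if v \<in> tangent_space A p then v c $ i else 0)"


section \<open>Vector fields and multivector fields\<close>

type_synonym ('m, 'n) vfield = "'m \<Rightarrow> ('m, 'n) tvec"

definition vector_field_on ::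
    "('m, 'n::finite) chart set \<Rightarrow> 'm set \<Rightarrow> ('m, 'n) vfield \<Rightarrow> bool" where
  "vector_field_on A U X \<longleftrightarrow>
     (\<forall>p\<in>U. X p \<in> tangent_space A p) \<and>
     (\<forall>c\<in>A. smooth_on (snd c ` (fst c \<inter> U)) (\<lambda>y. X (chart_inv c y) c))"

text \<open>In coordinates \<open>[X, Y]\<^sup>k = X(Y\<^sup>k) - Y(X\<^sup>k)\<close>.\<close>

definition lie_bracket ::
    "('m, 'n::finite) chart set \<Rightarrow> ('m, 'n) vfield \<Rightarrow> ('m, 'n) vfield \<Rightarrow> ('m, 'n) vfield" where
  "lie_bracket A X Y p = (\<lambda>c. if c \<in> A \<and> p \<in> fst c
     then frechet_derivative (\<lambda>y. Y (chart_inv c y) c) (at (snd c p)) (X p c)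
        - frechet_derivative (\<lambda>y. X (chart_inv c y) c) (at (snd c p)) (Y p c)
     else 0)"

text \<open>A \<open>q\<close>-vector at \<open>p\<close> is an alternating \<open>q\<close>-linear form on the cotangent space, taking
  the list of its arguments and extended by \<open>0\<close> to all other lists.\<close>

type_synonym ('m, 'n) mvec = "('m, 'n) covec list \<Rightarrow> real"

definition multivectors ::
    "('m, 'n::finite) chart set \<Rightarrow> 'm \<Rightarrow> nat \<Rightarrow> ('m, 'n) mvec set" where
  "multivectors A p q =
     {T. (\<forall>ws. length ws = q \<and> set ws \<subseteq> cotangent_space A p \<longrightarrow>
            (\<forall>i<q. linear_form_on (cotangent_space A p) (\<lambda>w. T (ws[i := w]))) \<and>
            (\<forall>i j. i < j \<and> j < q \<and> ws ! i = ws ! j \<longrightarrow> T ws = 0)) \<and>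
         (\<forall>ws. \<not> (length ws = q \<and> set ws \<subseteq> cotangent_space A p) \<longrightarrow> T ws = 0)}"

definition multivector_field ::
    "'m topology \<Rightarrow> ('m, 'n::finite) chart set \<Rightarrow> nat \<Rightarrow> ('m \<Rightarrow> ('m, 'n) mvec) \<Rightarrow> bool" where
  "multivector_field M A q V \<longleftrightarrow>
     (\<forall>p\<in>topspace M. V p \<in> multivectors A p q) \<and>
     (\<forall>c\<in>A. \<forall>is. length is = q \<longrightarrow>
        smooth_on (snd c ` fst c)
          (\<lambda>y. V (chart_inv c y) (map (\<lambda>i. coord_diff A c i (chart_inv c y)) is)))"

text \<open>The decomposable multivector \<open>X\<^sub>1 \<and> \<dots> \<and> X\<^sub>q\<close> at \<open>p\<close>: its value at \<open>w\<^sub>1, \<dots>, w\<^sub>q\<close> is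
  the determinant of the matrix of the \<open>w\<^sub>i(X\<^sub>j)\<close>.\<close>

definition wedge ::
    "('m, 'n::finite) chart set \<Rightarrow> 'm \<Rightarrow> ('m, 'n) tvec list \<Rightarrow> ('m, 'n) mvec" where
  "wedge A p vs = (\<lambda>ws. if length ws = length vs \<and> set ws \<subseteq> cotangent_space A p
     then \<Sum>\<pi> | \<pi> permutes {..<length vs}.
            of_int (sign \<pi>) * (\<Prod>i<length vs. (ws ! i) (vs ! \<pi> i))
     else 0)"


section \<open>The Schouten-Nijenhuis bracket\<close>

definition omit_nth :: "nat \<Rightarrow> 'a list \<Rightarrow> 'a list" where
  "omit_nth i xs = take i xs @ drop (Suc i) xs"

text \<open>The bracket of decomposable multivector fields. Counting the factors from 0 instead of 1
  does not change the signs \<open>(-1)\<^sup>i\<^sup>+\<^sup>j\<close>.\<close>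

definition decomposable_bracket ::
    "('m, 'n::finite) chart set \<Rightarrow> ('m, 'n) vfield list \<Rightarrow> ('m, 'n) vfield list \<Rightarrow>
     'm \<Rightarrow> ('m, 'n) mvec" where
  "decomposable_bracket A Xs Ys p =
     (\<Sum>i<length Xs. \<Sum>j<length Ys. (-1) ^ (i + j) *\<^sub>R
        wedge A p (map (\<lambda>X. X p)
          (lie_bracket A (Xs ! i) (Ys ! j) # omit_nth i Xs @ omit_nth j Ys)))"

text \<open>\<open>D\<close> writes \<open>V\<close> on \<open>U\<close> as a finite sum of decomposable \<open>q\<close>-vector fields.\<close>

definition decomposes ::
    "('m, 'n::finite) chart set \<Rightarrow> nat \<Rightarrow> 'm set \<Rightarrow> ('m \<Rightarrow> ('m, 'n) mvec) \<Rightarrow>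
     ('m, 'n) vfield list list \<Rightarrow> bool" where
  "decomposes A q U V D \<longleftrightarrow>
     (\<forall>Xs\<in>set D. length Xs = q \<and> (\<forall>X\<in>set Xs. vector_field_on A U X)) \<and>
     (\<forall>p\<in>U. V p = (\<Sum>Xs\<leftarrow>D. wedge A p (map (\<lambda>X. X p) Xs)))"

text \<open>The local bilinear extension of the bracket of decomposable fields: near every point a
  multivector field is a finite sum of decomposable ones, and the result does not depend on
  how the two arguments are so written. For degrees \<open>q, r \<ge> 1\<close>.\<close>

definition schouten ::
    "'m topology \<Rightarrow> ('m, 'n::finite) chart set \<Rightarrow> nat \<Rightarrow> nat \<Rightarrow>
     ('m \<Rightarrow> ('m, 'n) mvec) \<Rightarrow> ('m \<Rightarrow> ('m, 'n) mvec) \<Rightarrow> 'm \<Rightarrow> ('m, 'n) mvec" where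
  "schouten M A q r V W p =
     (THE T. \<exists>U D E. openin M U \<and> p \<in> U \<and> decomposes A q U V D \<and> decomposes A r U W E \<and>
        T = (\<Sum>Xs\<leftarrow>D. \<Sum>Ys\<leftarrow>E. decomposable_bracket A Xs Ys p))"


section \<open>Contraction, rank, constant coefficients\<close>

text \<open>For a 2-vector \<open>T\<close>, \<open>contract w T\<close> is the 1-vector \<open>T(w, \<cdot>)\<close>, a linear form on the cotangent
  space, that is, a tangent vector under the canonical isomorphism with the bidual.\<close>

definition contract :: "('m, 'n) covec \<Rightarrow> ('m, 'n) mvec \<Rightarrow> ('m, 'n) mvec" where
  "contract w T = (\<lambda>ws. T (w # ws))"

definition rank_at ::
    "('m, 'n::finite) chart set \<Rightarrow> ('m \<Rightarrow> ('m, 'n) mvec) \<Rightarrow> 'm \<Rightarrow> nat" where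
  "rank_at A V p = dim ((\<lambda>w. contract w (V p)) ` cotangent_space A p)"

definition constant_coefficients ::
    "'m topology \<Rightarrow> ('m, 'n::finite) chart set \<Rightarrow> ('m \<Rightarrow> ('m, 'n) mvec) \<Rightarrow> bool" where
  "constant_coefficients M A V \<longleftrightarrow>
     (\<forall>x\<in>topspace M. \<exists>c\<in>A. x \<in> fst c \<and> snd c x = 0 \<and>
        (\<forall>i j. \<exists>k. \<forall>p\<in>fst c. V p [coord_diff A c i p, coord_diff A c j p] = k))"


section \<open>Pfaffian systems\<close>

type_synonym ('m, 'n) form1 = "'m \<Rightarrow> ('m, 'n) covec"

definition form1_on ::
    "('m, 'n::finite) chart set \<Rightarrow> 'm set \<Rightarrow> ('m, 'n) form1 \<Rightarrow> bool" where
  "form1_on A U \<omega> \<longleftrightarrow>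
     (\<forall>p\<in>U. \<omega> p \<in> cotangent_space A p) \<and>
     (\<forall>c\<in>A. \<forall>i. smooth_on (snd c ` (fst c \<inter> U))
        (\<lambda>y. \<omega> (chart_inv c y) (coord_vec A c i (chart_inv c y))))"

text \<open>With \<open>\<omega> = \<Sum>\<^sub>j \<omega>\<^sub>j du\<^sup>j\<close> in some chart around the point, \<open>d\<omega> = \<Sum>\<^sub>j d\<omega>\<^sub>j \<and> du\<^sup>j\<close>;
  the choice of the chart does not matter.\<close>

definition ext_deriv ::
    "('m, 'n::finite) chart set \<Rightarrow> ('m, 'n) form1 \<Rightarrow> 'm \<Rightarrow> ('m, 'n) tvec \<Rightarrow> ('m, 'n) tvec \<Rightarrow> real" where
  "ext_deriv A \<omega> p u v =
     (let c = (SOME c. c \<in> A \<and> p \<in> fst c);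
          d\<omega> = (\<lambda>j. frechet_derivative
                  (\<lambda>y. \<omega> (chart_inv c y) (coord_vec A c j (chart_inv c y))) (at (snd c p)))
      in \<Sum>j\<in>UNIV. d\<omega> j (u c) * v c $ j - d\<omega> j (v c) * u c $ j)"

definition local_section ::
    "('m, 'n::finite) chart set \<Rightarrow> ('m \<Rightarrow> ('m, 'n) covec set) \<Rightarrow> 'm set \<Rightarrow> ('m, 'n) form1 \<Rightarrow> bool" where
  "local_section A P U \<omega> \<longleftrightarrow> form1_on A U \<omega> \<and> (\<forall>p\<in>U. \<omega> p \<in> P p)"

text \<open>For every local section \<open>\<omega>\<close>, the form \<open>d\<omega>\<close> is locally a finite sum \<open>\<Sum> \<alpha> \<and> \<theta>\<close> with
  1-forms \<open>\<alpha>\<close> and local sections \<open>\<theta>\<close>; such sums are the elements of degree 2 of the ideal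
  generated by the local sections.\<close>

definition pfaff_integrable ::
    "'m topology \<Rightarrow> ('m, 'n::finite) chart set \<Rightarrow> ('m \<Rightarrow> ('m, 'n) covec set) \<Rightarrow> bool" where
  "pfaff_integrable M A P \<longleftrightarrow>
     (\<forall>U \<omega>. openin M U \<and> local_section A P U \<omega> \<longrightarrow>
        (\<forall>x\<in>U. \<exists>W L. openin M W \<and> x \<in> W \<and> W \<subseteq> U \<and>
           (\<forall>(\<alpha>, \<theta>)\<in>set L. form1_on A W \<alpha> \<and> local_section A P W \<theta>) \<and>
           (\<forall>p\<in>W. \<forall>u\<in>tangent_space A p. \<forall>v\<in>tangent_space A p.
              ext_deriv A \<omega> p u v = (\<Sum>(\<alpha>, \<theta>)\<leftarrow>L. \<alpha> p u * \<theta> p v - \<alpha> p v * \<theta> p u))))"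

definition pfaff_kernel ::
    "('m, 'n::finite) chart set \<Rightarrow> ('m \<Rightarrow> ('m, 'n) covec set) \<Rightarrow> 'm \<Rightarrow> ('m, 'n) tvec set" where
  "pfaff_kernel A P p = {v \<in> tangent_space A p. \<forall>w\<in>P p. w v = 0}"

definition annihilator ::
    "('m, 'n::finite) chart set \<Rightarrow> ('m \<Rightarrow> ('m, 'n) mvec) \<Rightarrow> 'm \<Rightarrow> ('m, 'n) covec set" where
  "annihilator A V p = {w \<in> cotangent_space A p. contract w (V p) = 0}"


section \<open>Submanifolds\<close>

text \<open>A submanifold is an immersed one, given as a subset with its own topology \<open>N\<close>: it is covered
  by \<open>N\<close>-open sets which are slices of charts of the ambient manifold and on which \<open>N\<close> induces
  the ambient topology. The embedded submanifolds are those where \<open>N\<close> is a subspace topology.\<close>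

definition slice_chart ::
    "'m topology \<Rightarrow> ('m, 'n::finite) chart set \<Rightarrow> nat \<Rightarrow> 'm topology \<Rightarrow>
     ('m, 'n) chart \<Rightarrow> (real ^ 'n) set \<Rightarrow> bool" where
  "slice_chart M A k N c S \<longleftrightarrow>
     c \<in> A \<and> subspace S \<and> dim S = k \<and>
     openin N {p \<in> fst c. snd c p \<in> S} \<and>
     subtopology N {p \<in> fst c. snd c p \<in> S} = subtopology M {p \<in> fst c. snd c p \<in> S}"

definition submanifold ::
    "'m topology \<Rightarrow> ('m, 'n::finite) chart set \<Rightarrow> nat \<Rightarrow> 'm topology \<Rightarrow> bool" where
  "submanifold M A k N \<longleftrightarrow>
     topspace N \<subseteq> topspace M \<and> Hausdorff_space N \<and> second_countable N \<and>
     (\<forall>p\<in>topspace N. \<exists>c S. slice_chart M A k N c S \<and> p \<in> fst c \<and> snd c p \<in> S)"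

definition submanifold_tangent ::
    "'m topology \<Rightarrow> ('m, 'n::finite) chart set \<Rightarrow> nat \<Rightarrow> 'm topology \<Rightarrow> 'm \<Rightarrow> ('m, 'n) tvec set" where
  "submanifold_tangent M A k N p =
     {v \<in> tangent_space A p.
        \<exists>c S. slice_chart M A k N c S \<and> p \<in> fst c \<and> snd c p \<in> S \<and> v c \<in> S}"

text \<open>For a Pfaffian system of rank 1, so the dimension is \<open>CARD('n) - 1\<close>.\<close>

definition integral_submanifold ::
    "'m topology \<Rightarrow> ('m, 'n::finite) chart set \<Rightarrow> ('m \<Rightarrow> ('m, 'n) covec set) \<Rightarrow> 'm topology \<Rightarrow> bool" where
  "integral_submanifold M A P N \<longleftrightarrow>
     submanifold M A (CARD('n) - 1) N \<and>
     (\<forall>p\<in>topspace N. submanifold_tangent M A (CARD('n) - 1) N p = pfaff_kernel A P p)"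

end

theory Submission
  imports Defs
begin

text \<open>In a chart \<open>V\<close> is a skew matrix field, and \<open>[V, V]\<close> is twice its Jacobiator (up to sign); so constant
  coefficients force \<open>[V, V] = 0\<close>, and force the annihilator to be spanned by a constant covector.
  For the converse, let \<open>e = 0\<close> if the corank is \<open>0\<close>. If it is \<open>1\<close>, the Frobenius theorem for hyperplane
  fields gives a chart in which the annihilator is spanned by a constant unit covector \<open>e\<close>; hence there is a leaf
  through every point, and \<open>[V, V]\<close> vanishes everywhere. In both cases \<open>\<omega> = (V + e e\<^sup>T)\<^sup>-\<^sup>1 - e e\<^sup>T\<close> is a
  closed nondegenerate 2-form along the fibres of \<open>x \<mapsto> e \<bullet> x\<close>, and Moser's method applied to the segment from
  \<open>\<omega>(0)\<close> to \<open>\<omega>\<close> makes it constant. The leafwise primitive of \<open>\<omega> - \<omega>(0)\<close> vanishes to second order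
  at \<open>0\<close>, as does the height function of the leaves along rays; so both flows are fixed points of contractions
  up to time 1, and no general theory of differential equations is needed.\<close>

section \<open>Calculus of smooth maps\<close>

text \<open>One vector \<open>e\<close> with \<open>(e \<bullet> e) *\<^sub>R e = e\<close> lets
  both coranks share a proof: adding \<open>outer e\<close> makes the skew matrix invertible and
  respects the splitting into leaf and normal direction, so the leafwise inverse is given by a
  formula smooth on a whole ball. The deformation must start from the one matrix
  \<open>\<omega> 0\<close> on all leaves, because the coefficients have to be constant across the
  leaves too; this is possible since a constant form is closed on every leaf, and the flow, being
  tangent to the leaves, keeps \<open>e \<bullet> x\<close> fixed. The obstacle is analytic: smooth
  dependence of solutions on parameters up to time 1. For every time both right-hand sides vanish at
  the origin together with their derivative in the unknown, so over a compact time interval they are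
  Lipschitz with constant \<open>1/4\<close> near the origin. Times are bounded by 2, hence
  integration contracts by \<open>1/2\<close>; the linearized equations inherit the constant
  \<open>1/4\<close>, and so existence, parameter derivatives and the induction on their order rest
  on one kind of estimate.\<close>

abbreviation FD :: "('a::real_normed_vector \<Rightarrow> 'b::real_normed_vector) \<Rightarrow> 'a \<Rightarrow> 'a \<Rightarrow> 'b" where
  "FD f x \<equiv> frechet_derivative f (at x)"

lemma FD_works: "f differentiable (at x) \<Longrightarrow> (f has_derivative FD f x) (at x)"
  using frechet_derivative_works by blast

lemma Ck_on_has_derivative: "Ck_on (Suc k) S f \<Longrightarrow> x \<in> S \<Longrightarrow> (f has_derivative FD f x) (at x)"
  using FD_works by auto

lemma FD_eq: "(f has_derivative f') (at x) \<Longrightarrow> FD f x = f'"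
  using frechet_derivative_at by metis

lemma FD_cong:
  assumes "open S" "x \<in> S" "\<And>y. y \<in> S \<Longrightarrow> f y = g y"
  shows "FD f x = FD g x"
proof -
  have "(f has_derivative f') (at x) \<longleftrightarrow> (g has_derivative f') (at x)" for f'
    using has_derivative_transform_within_open[OF _ assms(1,2)] assms(3) by metis
  then show ?thesis by (simp add: frechet_derivative_def)
qed

lemma differentiable_cong_open:
  assumes "open S" "x \<in> S" "\<And>y. y \<in> S \<Longrightarrow> f y = g y" "f differentiable (at x)"
  shows "g differentiable (at x)"
proof -
  obtain D where "(f has_derivative D) (at x)" using assms(4) differentiable_def by blast
  from has_derivative_transform_within_open[OF this assms(1,2,3)] show ?thesis
    by (auto simp: differentiable_def)
qed

lemma Ck_on_cong:
  assumes "open S" "\<And>x. x \<in> S \<Longrightarrow> f x = g x" "Ck_on k S f"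
  shows "Ck_on k S g"
  using assms(2,3)
proof (induction k arbitrary: f g)
  case 0
  then show ?case using continuous_on_cong by (metis Ck_on.simps(1))
next
  case (Suc k)
  have "Ck_on k S (\<lambda>x. FD g x v)" for v
    by (rule Suc.IH[of "\<lambda>x. FD f x v"])
       (use Suc.prems FD_cong[OF assms(1)] in \<open>auto, metis\<close>)
  moreover have "\<forall>x\<in>S. g differentiable (at x)"
    using Suc.prems differentiable_cong_open[OF assms(1)] by (metis Ck_on.simps(2))
  ultimately show ?case by simp
qed

lemma smooth_on_cong:
  "open S \<Longrightarrow> (\<And>x. x \<in> S \<Longrightarrow> f x = g x) \<Longrightarrow> smooth_on S f \<Longrightarrow> smooth_on S g"
  unfolding smooth_on_def using Ck_on_cong by blast

lemma Ck_on_SucI: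
  assumes "open S" "\<And>x. x \<in> S \<Longrightarrow> (f has_derivative f' x) (at x)" "\<And>v. Ck_on k S (\<lambda>x. f' x v)"
  shows "Ck_on (Suc k) S f"
  using assms(2) Ck_on_cong[OF assms(1) _ assms(3)] FD_eq[OF assms(2)]
  by (auto simp: differentiable_def)

lemma Ck_on_pred: "Ck_on (Suc k) S f \<Longrightarrow> Ck_on k S f"
proof (induction k arbitrary: f)
  case 0
  then show ?case
    by (auto simp: continuous_at_imp_continuous_on differentiable_imp_continuous_within)
next
  case (Suc k)
  have "\<And>v. Ck_on k S (\<lambda>x. FD f x v)"
    by (rule Suc.IH) (use Suc.prems in auto)
  then show ?case using Suc.prems by auto
qed

lemma Ck_on_imp_continuous_on: "Ck_on k S f \<Longrightarrow> continuous_on S f"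
  by (induction k) (use Ck_on_pred in auto)

lemma Ck_on_mono: "Ck_on k S f \<Longrightarrow> j \<le> k \<Longrightarrow> Ck_on j S f"
  by (induction k) (auto simp: le_Suc_eq simp del: Ck_on.simps dest: Ck_on_pred)

lemma Ck_on_subset: "Ck_on k S f \<Longrightarrow> T \<subseteq> S \<Longrightarrow> Ck_on k T f"
  by (induction k arbitrary: f) (auto intro: continuous_on_subset)

lemma Ck_on_local:
  assumes "\<And>x. x \<in> S \<Longrightarrow> \<exists>T. open T \<and> x \<in> T \<and> Ck_on k T f"
  shows "Ck_on k S f"
  using assms
proof (induction k arbitrary: f)
  case 0
  have "continuous (at x) f" if "x \<in> S" for x
    using 0[OF that] by (auto simp: continuous_on_eq_continuous_at)
  then show ?case
    by (simp add: continuous_at_imp_continuous_on)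
next
  case (Suc k)
  have "Ck_on k S (\<lambda>x. FD f x v)" for v
  proof (rule Suc.IH)
    fix x assume "x \<in> S"
    from Suc.prems[OF this] show "\<exists>T. open T \<and> x \<in> T \<and> Ck_on k T (\<lambda>x. FD f x v)"
      by auto
  qed
  moreover have "\<forall>x\<in>S. f differentiable (at x)"
  proof
    fix x assume "x \<in> S"
    from Suc.prems[OF this] show "f differentiable (at x)" by auto
  qed
  ultimately show ?case by simp
qed

lemma smooth_on_subset: "smooth_on S f \<Longrightarrow> T \<subseteq> S \<Longrightarrow> smooth_on T f"
  unfolding smooth_on_def using Ck_on_subset by blast

lemma smooth_on_imp_continuous_on: "smooth_on S f \<Longrightarrow> continuous_on S f"
  unfolding smooth_on_def using Ck_on.simps(1) by blast

lemma smooth_on_differentiable: "smooth_on S f \<Longrightarrow> x \<in> S \<Longrightarrow> f differentiable (at x)"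
  unfolding smooth_on_def using Ck_on.simps(2) by blast

lemma smooth_on_has_derivative: "smooth_on S f \<Longrightarrow> x \<in> S \<Longrightarrow> (f has_derivative FD f x) (at x)"
  using FD_works smooth_on_differentiable by blast

lemma smooth_on_FD: "smooth_on S f \<Longrightarrow> smooth_on S (\<lambda>x. FD f x v)"
  unfolding smooth_on_def using Ck_on.simps(2) by blast

section \<open>Closure of C^k maps under algebraic operations and composition\<close>

lemma Ck_on_const: "Ck_on k S (\<lambda>x. c)"
proof (induction k arbitrary: c)
  case (Suc k)
  have "FD (\<lambda>x. c) x = (\<lambda>v. 0)" for x :: 'a
    by (rule FD_eq) (rule has_derivative_const)
  then show ?case using Suc by simp
qed auto

lemma Ck_on_bounded_linear:
  assumes "bounded_linear f"
  shows "Ck_on k S f"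
proof (cases k)
  case 0
  then show ?thesis using assms linear_continuous_on by auto
next
  case (Suc j)
  have d: "(f has_derivative f) (at x)" for x
    by (rule bounded_linear_imp_has_derivative[OF assms])
  then have "FD f x = f" for x by (rule FD_eq)
  then show ?thesis using d Suc Ck_on_const by (auto simp: differentiable_def)
qed

lemma Ck_on_add:
  assumes "open S" "Ck_on k S f" "Ck_on k S g"
  shows "Ck_on k S (\<lambda>x. f x + g x)"
  using assms(2,3)
proof (induction k arbitrary: f g)
  case 0
  then show ?case by (auto intro: continuous_intros)
next
  case (Suc k)
  show ?case
    by (rule Ck_on_SucI[OF assms(1), where f' = "\<lambda>x v. FD f x v + FD g x v"])
       (use Suc.prems in \<open>auto intro!: has_derivative_add Suc.IH Ck_on_has_derivative\<close>)
qed

lemma Ck_on_bilinear: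
  assumes "bounded_bilinear mul" "open (S :: 'a::real_normed_vector set)" "Ck_on k S f" "Ck_on k S g"
  shows "Ck_on k S (\<lambda>x. mul (f x) (g x))"
  using assms(3,4)
proof (induction k arbitrary: f g)
  case 0
  then show ?case using bounded_bilinear.continuous_on[OF assms(1)] by auto
next
  case (Suc k)
  show ?case
  proof (rule Ck_on_SucI[OF assms(2), where f' = "\<lambda>x v. mul (f x) (FD g x v) + mul (FD f x v) (g x)"])
    show "((\<lambda>x. mul (f x) (g x)) has_derivative (\<lambda>v. mul (f x) (FD g x v) + mul (FD f x v) (g x))) (at x)"
      if "x \<in> S" for x
      by (intro bounded_bilinear.FDERIV[OF assms(1)] Ck_on_has_derivative[OF Suc.prems(1)]
            Ck_on_has_derivative[OF Suc.prems(2)] that)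
    show "Ck_on k S (\<lambda>x. mul (f x) (FD g x v) + mul (FD f x v) (g x))" for v
      by (intro Ck_on_add[OF assms(2)] Suc.IH) (use Suc.prems Ck_on_pred in auto)
  qed
qed

lemma Ck_on_linear_comp:
  assumes "bounded_linear L" "Ck_on k S f" "open S"
  shows "Ck_on k S (\<lambda>x. L (f x))"
  using assms(2)
proof (induction k arbitrary: f)
  case 0
  then show ?case using bounded_linear.continuous_on[OF assms(1)] by auto
next
  case (Suc k)
  show ?case
    by (rule Ck_on_SucI[OF assms(3), where f' = "\<lambda>x v. L (FD f x v)"])
       (use Suc.prems in \<open>auto intro!: bounded_linear.has_derivative[OF assms(1)] Suc.IH Ck_on_has_derivative\<close>)
qed

lemma Ck_on_sum:
  assumes "open S" "\<And>i. i \<in> I \<Longrightarrow> Ck_on k S (f i)"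
  shows "Ck_on k S (\<lambda>x. \<Sum>i\<in>I. f i x)"
  using assms(2)
  by (induction I rule: infinite_finite_induct) (auto simp: Ck_on_const intro!: Ck_on_add[OF assms(1)])

text \<open>\<open>Ck_on\<close> differentiates in fixed directions, while the chain rule yields
  \<open>FD g (f x)\<close> in the direction \<open>FD f x v\<close>, which moves with
  \<open>x\<close>. Expanding that direction in the basis gives a finite sum of products covered by
  the induction hypothesis; this is why the middle space is Euclidean.\<close>

lemma Ck_on_compose:
  fixes f :: "'a::real_normed_vector \<Rightarrow> 'b::euclidean_space" and g :: "'b \<Rightarrow> 'c::real_normed_vector"
  assumes "open S" "Ck_on k S f" "Ck_on k T g" "open T" "f ` S \<subseteq> T"
  shows "Ck_on k S (\<lambda>x. g (f x))"
  using assms(2,3)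
proof (induction k arbitrary: g)
  case 0
  then show ?case using assms(5) by (auto intro: continuous_on_compose2)
next
  case (Suc k)
  show ?case
  proof (rule Ck_on_SucI[OF assms(1), where f' = "\<lambda>x v. FD g (f x) (FD f x v)"])
    fix x assume x: "x \<in> S"
    then have "(g has_derivative FD g (f x)) (at (f x))" "(f has_derivative FD f x) (at x)"
      using Ck_on_has_derivative[OF Suc.prems(1)] Ck_on_has_derivative[OF Suc.prems(2)] assms(5) by auto
    then show "((\<lambda>x. g (f x)) has_derivative (\<lambda>v. FD g (f x) (FD f x v))) (at x)"
      using has_derivative_compose by blast
  next
    fix v
    have eq: "FD g (f x) (FD f x v) = (\<Sum>b\<in>Basis. (FD f x v \<bullet> b) *\<^sub>R FD g (f x) b)" if "x \<in> S" for x
    proof -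
      have "(g has_derivative FD g (f x)) (at (f x))"
        using Ck_on_has_derivative[OF Suc.prems(2)] assms(5) that by auto
      then interpret bounded_linear "FD g (f x)" by (rule has_derivative_bounded_linear)
      have "FD g (f x) (FD f x v) = FD g (f x) (\<Sum>b\<in>Basis. (FD f x v \<bullet> b) *\<^sub>R b)"
        by (simp add: euclidean_representation)
      then show ?thesis by (simp add: sum scaleR)
    qed
    have "Ck_on k S (\<lambda>x. \<Sum>b\<in>Basis. (FD f x v \<bullet> b) *\<^sub>R FD g (f x) b)"
    proof (intro Ck_on_sum[OF assms(1)] Ck_on_bilinear[OF bounded_bilinear_scaleR assms(1)]
           Ck_on_bilinear[OF bounded_bilinear_inner assms(1)])
      show "Ck_on k S (\<lambda>x. FD g (f x) b)" for b
        by (rule Suc.IH) (use Suc.prems Ck_on_pred in auto)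
    qed (use Suc.prems Ck_on_const in auto)
    then show "Ck_on k S (\<lambda>x. FD g (f x) (FD f x v))"
      by (rule Ck_on_cong[OF assms(1), rotated]) (simp add: eq)
  qed
qed

text \<open>The derivative is again a polynomial in the inverse, which closes the induction on the
  order.\<close>

lemma Ck_on_inverse: "Ck_on k (- {0}) (inverse :: real \<Rightarrow> real)"
proof (induction k)
  case 0
  then show ?case by (auto intro: continuous_intros)
next
  case (Suc k)
  show ?case
  proof (rule Ck_on_SucI[where f' = "\<lambda>x v. (inverse x * inverse x) * (- v)"])
    show "Ck_on k (- {0}) (\<lambda>x. inverse x * inverse x * - v)" for v :: real
      by (intro Ck_on_bilinear[OF bounded_bilinear_mult] Suc Ck_on_const) auto
  qed (auto intro!: derivative_eq_intros)
qed

context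
  fixes S :: "'a::real_normed_vector set"
  assumes S: "open S"
begin

lemma smooth_on_const: "smooth_on S (\<lambda>x. c)"
  by (simp add: smooth_on_def Ck_on_const)

lemma smooth_on_bounded_linear: "bounded_linear f \<Longrightarrow> smooth_on S f"
  by (simp add: smooth_on_def Ck_on_bounded_linear)

lemma smooth_on_id: "smooth_on S (\<lambda>x. x)"
  by (simp add: smooth_on_bounded_linear)

lemma smooth_on_linear_comp: "bounded_linear L \<Longrightarrow> smooth_on S f \<Longrightarrow> smooth_on S (\<lambda>x. L (f x))"
  using S by (simp add: smooth_on_def Ck_on_linear_comp)

lemma smooth_on_bilinear:
  "bounded_bilinear mul \<Longrightarrow> smooth_on S f \<Longrightarrow> smooth_on S g \<Longrightarrow> smooth_on S (\<lambda>x. mul (f x) (g x))"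
  using S by (simp add: smooth_on_def Ck_on_bilinear)

lemma smooth_on_add: "smooth_on S f \<Longrightarrow> smooth_on S g \<Longrightarrow> smooth_on S (\<lambda>x. f x + g x)"
  using S by (simp add: smooth_on_def Ck_on_add)

lemma smooth_on_minus: "smooth_on S f \<Longrightarrow> smooth_on S (\<lambda>x. - f x)"
  by (rule smooth_on_linear_comp) (simp_all add: bounded_linear_minus)

lemma smooth_on_diff: "smooth_on S f \<Longrightarrow> smooth_on S g \<Longrightarrow> smooth_on S (\<lambda>x. f x - g x)"
  using smooth_on_add[of f "\<lambda>x. - g x"] smooth_on_minus[of g] by simp

lemma smooth_on_sum: "(\<And>i. i \<in> I \<Longrightarrow> smooth_on S (f i)) \<Longrightarrow> smooth_on S (\<lambda>x. \<Sum>i\<in>I. f i x)"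
  using S by (simp add: smooth_on_def Ck_on_sum)

lemmas smooth_on_scaleR = smooth_on_bilinear[OF bounded_bilinear_scaleR]

lemma smooth_on_mult:
  fixes f g :: "'a \<Rightarrow> real"
  shows "smooth_on S f \<Longrightarrow> smooth_on S g \<Longrightarrow> smooth_on S (\<lambda>x. f x * g x)"
  by (rule smooth_on_bilinear[OF bounded_bilinear_mult])

lemma smooth_on_inner:
  fixes f g :: "'a \<Rightarrow> 'b::real_inner"
  shows "smooth_on S f \<Longrightarrow> smooth_on S g \<Longrightarrow> smooth_on S (\<lambda>x. f x \<bullet> g x)"
  by (rule smooth_on_bilinear[OF bounded_bilinear_inner])

lemma smooth_on_Pair:
  assumes "smooth_on S f" "smooth_on S g"
  shows "smooth_on S (\<lambda>x. (f x, g x))"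
proof -
  have "smooth_on S (\<lambda>x. (f x, 0) + (0, g x))"
    by (rule smooth_on_add; rule smooth_on_linear_comp)
       (use assms in \<open>auto intro!: bounded_linear_Pair bounded_linear_zero bounded_linear_ident\<close>)
  then show ?thesis by simp
qed

lemma smooth_on_compose:
  fixes f :: "'a \<Rightarrow> 'b::euclidean_space"
  assumes "smooth_on T g" "smooth_on S f" "open T" "\<And>x. x \<in> S \<Longrightarrow> f x \<in> T"
  shows "smooth_on S (\<lambda>x. g (f x))"
  using assms S Ck_on_compose[of S _ f T g] unfolding smooth_on_def by blast

lemma smooth_on_inverse:
  fixes f :: "'a \<Rightarrow> real"
  assumes "smooth_on S f" "\<And>x. x \<in> S \<Longrightarrow> f x \<noteq> 0"
  shows "smooth_on S (\<lambda>x. inverse (f x))"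
  by (rule smooth_on_compose[of "- {0}"]) (use assms in \<open>auto simp: smooth_on_def Ck_on_inverse\<close>)

lemma smooth_on_divide:
  fixes f g :: "'a \<Rightarrow> real"
  assumes "smooth_on S f" "smooth_on S g" "\<And>x. x \<in> S \<Longrightarrow> g x \<noteq> 0"
  shows "smooth_on S (\<lambda>x. f x / g x)"
  unfolding divide_inverse by (intro smooth_on_mult smooth_on_inverse assms)

lemma smooth_on_prod:
  fixes f :: "'i \<Rightarrow> 'a \<Rightarrow> real"
  shows "(\<And>i. i \<in> I \<Longrightarrow> smooth_on S (f i)) \<Longrightarrow> smooth_on S (\<lambda>x. \<Prod>i\<in>I. f i x)"
  by (induction I rule: infinite_finite_induct) (auto simp: smooth_on_const smooth_on_mult)

lemma smooth_on_nth:
  fixes f :: "'a \<Rightarrow> 'b::real_normed_vector ^ 'n"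
  shows "smooth_on S f \<Longrightarrow> smooth_on S (\<lambda>x. f x $ i)"
  by (rule smooth_on_linear_comp) (simp_all add: bounded_linear_vec_nth)

lemma smooth_on_vec_lambda:
  fixes f :: "'n::finite \<Rightarrow> 'a \<Rightarrow> 'b::real_normed_vector"
  assumes "\<And>i. smooth_on S (f i)"
  shows "smooth_on S (\<lambda>x. \<chi> i. f i x)"
proof -
  have "bounded_linear (axis i :: 'b \<Rightarrow> 'b ^ 'n)" for i
  proof (rule bounded_linear_intro[of _ 1])
    fix x :: 'b
    have "(norm ((axis i x :: 'b ^ 'n) $ j))\<^sup>2 = (if j = i then (norm x)\<^sup>2 else 0)" for j
      by (simp add: axis_def)
    then show "norm (axis i x :: 'b ^ 'n) \<le> norm x * 1"
      by (simp add: norm_vec_def L2_set_def)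
  qed (simp_all add: vec_eq_iff axis_def)
  then have "smooth_on S (\<lambda>x. \<Sum>i\<in>UNIV. axis i (f i x) :: 'b ^ 'n)"
    by (intro smooth_on_sum) (blast intro: smooth_on_linear_comp assms)
  moreover have "(\<Sum>i\<in>UNIV. axis i (f i x)) = (\<chi> i. f i x)" for x
    by (simp add: vec_eq_iff axis_def)
  ultimately show ?thesis by simp
qed

lemma smooth_on_det:
  fixes f :: "'a \<Rightarrow> real ^ 'n ^ 'n"
  assumes "smooth_on S f"
  shows "smooth_on S (\<lambda>x. det (f x))"
  unfolding det_def
  by (intro smooth_on_sum smooth_on_mult smooth_on_const smooth_on_prod smooth_on_nth assms)

lemma smooth_on_matrix_vector_mult:
  fixes f :: "'a \<Rightarrow> real ^ 'n ^ 'm" and g :: "'a \<Rightarrow> real ^ 'n"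
  assumes "smooth_on S f" "smooth_on S g"
  shows "smooth_on S (\<lambda>x. f x *v g x)"
  unfolding matrix_vector_mult_def
  by (intro smooth_on_vec_lambda smooth_on_sum smooth_on_mult smooth_on_nth assms)

end

section \<open>Inverse matrices\<close>

lemma matrix_inv_mult:
  fixes A :: "real ^ 'n ^ 'n"
  assumes "det A \<noteq> 0"
  shows "A ** matrix_inv A = mat 1" "matrix_inv A ** A = mat 1"
proof -
  have "invertible A" using assms invertible_det_nz by blast
  then have "\<exists>B. A ** B = mat 1 \<and> B ** A = mat 1" by (simp add: invertible_def)
  from someI_ex[OF this] show "A ** matrix_inv A = mat 1" "matrix_inv A ** A = mat 1"
    by (simp_all add: matrix_inv_def)
qed

lemma matrix_inv_mult_vec:
  fixes A :: "real ^ 'n ^ 'n"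
  assumes "det A \<noteq> 0"
  shows "A *v (matrix_inv A *v x) = x" "matrix_inv A *v (A *v x) = x"
  using matrix_inv_mult[OF assms] by (simp_all add: matrix_vector_mul_assoc)

text \<open>Cramer's rule for the columns of the identity. It exhibits the entries of the inverse as
  quotients of polynomials in the entries of \<open>A\<close>, from which smoothness of the inverse
  is read off.\<close>

lemma matrix_inv_cramer:
  fixes A :: "real ^ 'n ^ 'n"
  assumes "det A \<noteq> 0"
  shows "matrix_inv A = (\<chi> i j. det (\<chi> k l. if l = i then axis j 1 $ k else A $ k $ l) / det A)"
    (is "_ = ?B")
proof -
  have "A *v column j ?B = axis j 1" for j
    by (simp add: cramer[OF assms] column_def)
  moreover have "(A ** ?B) $ i $ j = (A *v column j ?B) $ i" for i j
    by (simp add: matrix_matrix_mult_def matrix_vector_mult_def column_def)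
  ultimately have "(A ** ?B) $ i $ j = mat 1 $ i $ j" for i j
    by (simp add: mat_def axis_def)
  then have "A ** ?B = mat 1" by (simp add: vec_eq_iff)
  then have "matrix_inv A ** (A ** ?B) = matrix_inv A" by simp
  then show ?thesis using matrix_inv_mult(2)[OF assms] by (simp add: matrix_mul_assoc)
qed

lemma smooth_on_matrix_inv:
  fixes f :: "'a::real_normed_vector \<Rightarrow> real ^ 'n ^ 'n"
  assumes S: "open S" and f: "smooth_on S f" and nz: "\<And>x. x \<in> S \<Longrightarrow> det (f x) \<noteq> 0"
  shows "smooth_on S (\<lambda>x. matrix_inv (f x))"
proof -
  have "smooth_on S (\<lambda>x. if P then c else f x $ k $ l)" for P k l and c :: real
    using f by (cases P) (auto intro!: smooth_on_const[OF S] smooth_on_nth[OF S])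
  then have "smooth_on S (\<lambda>x. \<chi> i j. det (\<chi> k l. if l = i then axis j 1 $ k else f x $ k $ l) / det (f x))"
    by (intro smooth_on_vec_lambda[OF S] smooth_on_divide[OF S] smooth_on_det[OF S] f nz) auto
  then show ?thesis
    by (rule smooth_on_cong[OF S, rotated]) (simp add: matrix_inv_cramer nz)
qed


section \<open>Symmetry of second derivatives\<close>

lemma has_vector_derivative_line:
  assumes "f differentiable (at (a + s *\<^sub>R u))"
  shows "((\<lambda>s. f (a + s *\<^sub>R u)) has_vector_derivative FD f (a + s *\<^sub>R u) u) (at s)"
proof -
  have d: "(f has_derivative FD f (a + s *\<^sub>R u)) (at (a + s *\<^sub>R u))"
    using assms by (rule FD_works)
  interpret bounded_linear "FD f (a + s *\<^sub>R u)"
    using d by (rule has_derivative_bounded_linear)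
  have "((\<lambda>s. a + s *\<^sub>R u) has_derivative (\<lambda>t. t *\<^sub>R u)) (at s)"
    by (auto intro!: derivative_eq_intros)
  from has_derivative_compose[OF this d] show ?thesis
    by (simp add: has_vector_derivative_def scaleR)
qed

text \<open>The mean value theorem twice: first along \<open>u\<close>, for the difference of
  \<open>f\<close> on two parallel segments \<open>t *\<^sub>R v\<close> apart, then along
  \<open>v\<close> for the derivative in direction \<open>u\<close>.\<close>

lemma second_difference_quotient:
  fixes f :: "'a::real_normed_vector \<Rightarrow> real"
  assumes "t > 0"
    and d: "\<And>r s. 0 \<le> r \<Longrightarrow> r \<le> t \<Longrightarrow> 0 \<le> s \<Longrightarrow> s \<le> t \<Longrightarrow> f differentiable (at (x + s *\<^sub>R u + r *\<^sub>R v))"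
    and dd: "\<And>r s. 0 \<le> r \<Longrightarrow> r \<le> t \<Longrightarrow> 0 \<le> s \<Longrightarrow> s \<le> t \<Longrightarrow>
               (\<lambda>y. FD f y u) differentiable (at (x + s *\<^sub>R u + r *\<^sub>R v))"
  obtains r s where "0 < r" "r < t" "0 < s" "s < t"
    "f (x + t *\<^sub>R u + t *\<^sub>R v) - f (x + t *\<^sub>R u) - f (x + t *\<^sub>R v) + f x
      = t\<^sup>2 * FD (\<lambda>y. FD f y u) (x + s *\<^sub>R u + r *\<^sub>R v) v"
proof -
  have 1: "((\<lambda>s. f (x + s *\<^sub>R u + t *\<^sub>R v) - f (x + s *\<^sub>R u)) has_real_derivative
      FD f (x + s *\<^sub>R u + t *\<^sub>R v) u - FD f (x + s *\<^sub>R u) u) (at s)" if "0 \<le> s" "s \<le> t" for s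
    using has_vector_derivative_line[of f "x + t *\<^sub>R v" s u] has_vector_derivative_line[of f x s u]
      d[of t s] d[of 0 s] that assms(1)
    by (auto simp: algebra_simps has_real_derivative_iff_has_vector_derivative
        intro!: has_vector_derivative_diff)
  obtain s where s: "0 < s" "s < t" and
    eq1: "f (x + t *\<^sub>R u + t *\<^sub>R v) - f (x + t *\<^sub>R u) - (f (x + 0 *\<^sub>R u + t *\<^sub>R v) - f (x + 0 *\<^sub>R u))
      = (t - 0) * (FD f (x + s *\<^sub>R u + t *\<^sub>R v) u - FD f (x + s *\<^sub>R u) u)"
    using MVT2[OF assms(1) 1] by blast
  have 2: "((\<lambda>r. FD f (x + s *\<^sub>R u + r *\<^sub>R v) u) has_real_derivative
      FD (\<lambda>y. FD f y u) (x + s *\<^sub>R u + r *\<^sub>R v) v) (at r)" if "0 \<le> r" "r \<le> t" for r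
    using has_vector_derivative_line[of "\<lambda>y. FD f y u" "x + s *\<^sub>R u" r v] dd[of r s] that s
    by (auto simp: has_real_derivative_iff_has_vector_derivative)
  obtain r where r: "0 < r" "r < t" and
    eq2: "FD f (x + s *\<^sub>R u + t *\<^sub>R v) u - FD f (x + s *\<^sub>R u + 0 *\<^sub>R v) u
      = (t - 0) * FD (\<lambda>y. FD f y u) (x + s *\<^sub>R u + r *\<^sub>R v) v"
    using MVT2[OF assms(1) 2] by blast
  show ?thesis
    by (rule that[OF r s]) (use eq1 eq2 in \<open>simp add: power2_eq_square\<close>)
qed

text \<open>The second difference of \<open>f\<close> over the parallelogram with sides
  \<open>t *\<^sub>R u\<close> and \<open>t *\<^sub>R v\<close> is symmetric in \<open>u\<close> and
  \<open>v\<close>, so the two mixed derivatives agree at two points close to \<open>x\<close>. If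
  they differed at \<open>x\<close> by \<open>2 * e\<close>, continuity would exclude this.\<close>

lemma FD_symmetric_real:
  fixes f :: "'a::real_normed_vector \<Rightarrow> real"
  assumes S: "open S" "x \<in> S" and f: "smooth_on S f"
  shows "FD (\<lambda>y. FD f y u) x v = FD (\<lambda>y. FD f y v) x u"
proof (rule ccontr)
  define \<phi> where "\<phi> = (\<lambda>y. FD (\<lambda>y. FD f y u) y v)"
  define \<psi> where "\<psi> = (\<lambda>y. FD (\<lambda>y. FD f y v) y u)"
  assume "\<not> ?thesis"
  then have ne: "\<phi> x - \<psi> x \<noteq> 0" by (simp add: \<phi>_def \<psi>_def)
  have "continuous_on S (\<lambda>y. \<phi> y - \<psi> y)"
    unfolding \<phi>_def \<psi>_def
    by (intro continuous_on_diff smooth_on_imp_continuous_on smooth_on_FD f)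
  moreover have "continuous_on S \<phi>" "continuous_on S \<psi>"
    unfolding \<phi>_def \<psi>_def by (intro smooth_on_imp_continuous_on smooth_on_FD f)+
  ultimately have "isCont \<phi> x" "isCont \<psi> x" using S by (auto simp: continuous_on_eq_continuous_at)
  define e where "e = \<bar>\<phi> x - \<psi> x\<bar> / 2"
  have "e > 0" using ne by (simp add: e_def)
  obtain d1 where d1: "d1 > 0" "\<And>y. dist y x < d1 \<Longrightarrow> dist (\<phi> y) (\<phi> x) < e"
    using \<open>isCont \<phi> x\<close> \<open>e > 0\<close> unfolding continuous_at_eps_delta by blast
  obtain d2 where d2: "d2 > 0" "\<And>y. dist y x < d2 \<Longrightarrow> dist (\<psi> y) (\<psi> x) < e"
    using \<open>isCont \<psi> x\<close> \<open>e > 0\<close> unfolding continuous_at_eps_delta by blast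
  obtain d3 where d3: "d3 > 0" "ball x d3 \<subseteq> S" using S open_contains_ball by blast
  define d where "d = min d1 (min d2 d3)"
  \<comment> \<open>The denominator keeps all points
    \<open>x + s *\<^sub>R u + r *\<^sub>R v\<close> with \<open>r\<close> and \<open>s\<close> at
    most \<open>t\<close> within \<open>d\<close> of \<open>x\<close>; the summand 1 covers
    \<open>u = v = 0\<close>.\<close>
  define t where "t = d / (2 * (norm u + norm v + 1))"
  have d: "d > 0" using d1 d2 d3 by (simp add: d_def)
  then have t: "t > 0" by (simp add: t_def add_nonneg_pos)
  have near: "dist (x + s *\<^sub>R u + r *\<^sub>R v) x < d" if "0 \<le> r" "r \<le> t" "0 \<le> s" "s \<le> t" for r s
  proof -
    have "norm (s *\<^sub>R u + r *\<^sub>R v) \<le> t * norm u + t * norm v"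
      using that by (intro norm_triangle_le add_mono) (auto intro!: mult_right_mono)
    also have "\<dots> < t * (2 * (norm u + norm v + 1))"
      using t by (simp add: algebra_simps add_nonneg_pos add_pos_nonneg)
    also have "\<dots> = d" unfolding t_def by (simp add: add_nonneg_pos order_less_imp_not_eq2)
    finally show ?thesis by (simp add: dist_norm algebra_simps)
  qed
  have inS: "x + s *\<^sub>R u + r *\<^sub>R v \<in> S" if "0 \<le> r" "r \<le> t" "0 \<le> s" "s \<le> t" for r s
    using near[OF that] d3(2) by (auto simp: d_def dist_commute)
  obtain r s where rs: "0 < r" "r < t" "0 < s" "s < t" and 1:
    "f (x + t *\<^sub>R u + t *\<^sub>R v) - f (x + t *\<^sub>R u) - f (x + t *\<^sub>R v) + f x = t\<^sup>2 * \<phi> (x + s *\<^sub>R u + r *\<^sub>R v)"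
    unfolding \<phi>_def
    by (rule second_difference_quotient[OF t, of f x u v])
       (use inS smooth_on_differentiable[OF f] smooth_on_differentiable[OF smooth_on_FD[OF f]] in auto)
  obtain r' s' where rs': "0 < r'" "r' < t" "0 < s'" "s' < t" and 2:
    "f (x + t *\<^sub>R v + t *\<^sub>R u) - f (x + t *\<^sub>R v) - f (x + t *\<^sub>R u) + f x = t\<^sup>2 * \<psi> (x + s' *\<^sub>R v + r' *\<^sub>R u)"
    unfolding \<psi>_def
  proof (rule second_difference_quotient[OF t, of f x v u])
    fix r s assume "0 \<le> r" "r \<le> t" "0 \<le> s" "s \<le> t"
    then have "x + s *\<^sub>R v + r *\<^sub>R u \<in> S" using inS[of s r] by (simp add: algebra_simps)
    then show "f differentiable (at (x + s *\<^sub>R v + r *\<^sub>R u))"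
      "(\<lambda>y. FD f y v) differentiable (at (x + s *\<^sub>R v + r *\<^sub>R u))"
      using smooth_on_differentiable[OF f] smooth_on_differentiable[OF smooth_on_FD[OF f]] by auto
  qed blast
  have "t\<^sup>2 * \<phi> (x + s *\<^sub>R u + r *\<^sub>R v) = t\<^sup>2 * \<psi> (x + s' *\<^sub>R v + r' *\<^sub>R u)"
    unfolding 1[symmetric] 2[symmetric] by (simp add: algebra_simps)
  then have "\<phi> (x + s *\<^sub>R u + r *\<^sub>R v) = \<psi> (x + r' *\<^sub>R u + s' *\<^sub>R v)"
    using t by (simp add: algebra_simps)
  moreover have "dist (\<phi> (x + s *\<^sub>R u + r *\<^sub>R v)) (\<phi> x) < e"
    by (rule d1) (use near[of r s] rs in \<open>auto simp: d_def\<close>)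
  moreover have "dist (\<psi> (x + r' *\<^sub>R u + s' *\<^sub>R v)) (\<psi> x) < e"
    by (rule d2) (use near[of s' r'] rs' in \<open>auto simp: d_def\<close>)
  ultimately show False
    unfolding e_def dist_real_def by (auto simp: field_simps abs_if split: if_splits)
qed

lemma FD_linear_comp:
  assumes "bounded_linear L" "f differentiable (at x)"
  shows "FD (\<lambda>x. L (f x)) x v = L (FD f x v)"
  using FD_eq[OF bounded_linear.has_derivative[OF assms(1) FD_works[OF assms(2)]]] by simp

lemma FD_symmetric:
  fixes f :: "'a::real_normed_vector \<Rightarrow> real ^ 'n"
  assumes S: "open S" "x \<in> S" and f: "smooth_on S f"
  shows "FD (\<lambda>y. FD f y u) x v = FD (\<lambda>y. FD f y v) x u"
proof -
  have comp: "FD (\<lambda>y. FD f y u) x v $ i = FD (\<lambda>y. FD (\<lambda>y. f y $ i) y u) x v" for u v i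
  proof -
    have "FD (\<lambda>y. FD f y u) x v $ i = FD (\<lambda>y. FD f y u $ i) x v"
      by (rule FD_linear_comp[OF bounded_linear_vec_nth, symmetric])
         (rule smooth_on_differentiable[OF smooth_on_FD[OF f] S(2)])
    also have "\<dots> = FD (\<lambda>y. FD (\<lambda>y. f y $ i) y u) x v"
      by (intro fun_cong[OF FD_cong[OF S]] FD_linear_comp[OF bounded_linear_vec_nth, symmetric]
            smooth_on_differentiable[OF f])
    finally show ?thesis .
  qed
  have "smooth_on S (\<lambda>y. f y $ i)" for i by (rule smooth_on_nth[OF S(1) f])
  then show ?thesis unfolding vec_eq_iff comp using FD_symmetric_real[OF S] by blast
qed

text \<open>Leibniz's rule asks for the derivative in \<open>p\<close> as a continuous map into the
  bounded linear maps; in finite dimension this continuity can be checked on basis vectors.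
  Differentiability of \<open>f\<close> on \<open>W\<close> is two-sided also where \<open>s\<close>
  is 0 or 1.\<close>

lemma has_derivative_param_integral:
  fixes f :: "'a::euclidean_space \<times> real \<Rightarrow> 'b::euclidean_space"
  assumes U: "open U" and W: "U \<times> {0..1} \<subseteq> W" and f: "Ck_on (Suc k) W f" and "p \<in> U"
  shows "((\<lambda>p. integral {0..1} (\<lambda>s. f (p, s))) has_derivative
            (\<lambda>v. integral {0..1} (\<lambda>s. FD f (p, s) (v, 0)))) (at p)"
proof -
  define fx where "fx = (\<lambda>p s. Blinfun (\<lambda>v. FD f (p, s) (v, 0)))"
  have d: "(f has_derivative FD f (p, s)) (at (p, s))" if "p \<in> U" "s \<in> {0..1}" for p s
    by (rule Ck_on_has_derivative[OF f]) (use that W in auto)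
  have bl: "bounded_linear (\<lambda>v. FD f (p, s) (v, 0))" if "p \<in> U" "s \<in> {0..1}" for p s
    using bounded_linear_compose[OF has_derivative_bounded_linear[OF d[OF that]]
        bounded_linear_Pair[OF bounded_linear_ident bounded_linear_zero]] by simp
  have fx: "blinfun_apply (fx p s) = (\<lambda>v. FD f (p, s) (v, 0))" if "p \<in> U" "s \<in> {0..1}" for p s
    unfolding fx_def by (rule bounded_linear_Blinfun_apply[OF bl[OF that]])
  have dx: "((\<lambda>p. f (p, s)) has_derivative fx p s) (at p)" if "p \<in> U" "s \<in> {0..1}" for p s
  proof -
    have "((\<lambda>p. (p, s)) has_derivative (\<lambda>v. (v, 0))) (at p)" by (auto intro!: derivative_eq_intros)
    from has_derivative_compose[OF this d[OF that]] show ?thesis by (simp add: fx[OF that])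
  qed
  have FDk: "Ck_on k W (\<lambda>x. FD f x v)" for v
    using f by (simp only: Ck_on.simps)
  have cont: "continuous_on (U \<times> {0..1}) (\<lambda>x. FD f x v)" for v
    by (rule continuous_on_subset[OF Ck_on_imp_continuous_on[OF FDk] W])
  have cfx: "continuous_on (U \<times> {0..1}) (\<lambda>(p, s). fx p s)"
  proof (rule continuous_on_blinfun_componentwise)
    fix i :: 'a
    show "continuous_on (U \<times> {0..1}) (\<lambda>x. (case x of (p, s) \<Rightarrow> fx p s) i)"
      by (rule continuous_on_eq[OF cont[of "(i, 0)"]]) (auto simp: fx)
  qed
  have int: "(\<lambda>s. f (p, s)) integrable_on {0..1}" if "p \<in> U" for p
  proof (rule integrable_continuous_interval)
    have "continuous_on (U \<times> {0..1}) f"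
      using Ck_on_imp_continuous_on[OF f] W by (rule continuous_on_subset)
    then show "continuous_on {0..1} (\<lambda>s. f (p, s))"
      by (rule continuous_on_compose2) (use that in \<open>auto intro!: continuous_intros\<close>)
  qed
  have intx: "fx p integrable_on {0..1}" if "p \<in> U" for p
  proof (rule integrable_continuous_interval)
    have "continuous_on {0..1} (\<lambda>s::real. (p, s))" by (intro continuous_intros)
    from continuous_on_compose2[OF cfx this] show "continuous_on {0..1} (fx p)" using that by auto
  qed
  have D: "((\<lambda>p. integral {0..1} (\<lambda>s. f (p, s))) has_derivative
            (\<lambda>v. integral {0..1} (\<lambda>s. FD f (p, s) (v, 0)))) (at p)" if p: "p \<in> U" for p
  proof -
    obtain r where r: "r > 0" "ball p r \<subseteq> U" using U p open_contains_ball by blast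
    have "((\<lambda>p. integral (cbox 0 1) (\<lambda>s. f (p, s))) has_derivative integral (cbox 0 1) (fx p)) (at p within ball p r)"
    proof (rule leibniz_rule)
      show "((\<lambda>x. f (x, t)) has_derivative blinfun_apply (fx x t)) (at x within ball p r)"
        if "x \<in> ball p r" "t \<in> cbox 0 1" for x t
        by (rule has_derivative_at_withinI[OF dx]) (use that r in auto)
      show "continuous_on (ball p r \<times> cbox 0 1) (\<lambda>(x, t). fx x t)"
        by (rule continuous_on_subset[OF cfx]) (use r in auto)
    qed (use int r in \<open>auto simp: cbox_interval\<close>)
    then have "((\<lambda>p. integral {0..1} (\<lambda>s. f (p, s))) has_derivative integral {0..1} (fx p)) (at p)"
      using r by (simp add: at_within_open[of p "ball p r"] cbox_interval)
    moreover have eq: "blinfun_apply (integral {0..1} (fx p)) v = integral {0..1} (\<lambda>s. FD f (p, s) (v, 0))" for v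
      using blinfun_apply_integral[OF intx[OF p], of v] integral_cong[of "{0..1}" "\<lambda>s. fx p s v" "\<lambda>s. FD f (p, s) (v, 0)"]
      by (simp add: fx[OF p])
    have "blinfun_apply (integral {0..1} (fx p)) = (\<lambda>v. integral {0..1} (\<lambda>s. FD f (p, s) (v, 0)))"
      by (rule ext) (rule eq)
    ultimately show ?thesis by simp
  qed
  show ?thesis by (rule D[OF \<open>p \<in> U\<close>])
qed

lemma Ck_on_integral:
  fixes f :: "'a::euclidean_space \<times> real \<Rightarrow> 'b::euclidean_space"
  assumes U: "open U" and W: "U \<times> {0..1} \<subseteq> W" and f: "Ck_on k W f"
  shows "Ck_on k U (\<lambda>p. integral {0..1} (\<lambda>s. f (p, s)))"
  using f
proof (induction k arbitrary: f)
  case 0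
  have "continuous_on (U \<times> cbox 0 1) (\<lambda>(p, s). f (p, s))"
    using 0 W by (auto simp: cbox_interval split_def intro: continuous_on_subset)
  from integral_continuous_on_param[OF this] show ?case by (simp add: cbox_interval)
next
  case (Suc k)
  have "Ck_on k W (\<lambda>x. FD f x v)" for v
    using Suc.prems by (simp only: Ck_on.simps)
  then show ?case
    by (intro Ck_on_SucI[OF U has_derivative_param_integral[OF U W Suc.prems]] Suc.IH)
qed

lemma smooth_on_integral:
  fixes f :: "'a::euclidean_space \<times> real \<Rightarrow> 'b::euclidean_space"
  assumes "open U" "U \<times> {0..1} \<subseteq> W" "smooth_on W f"
  shows "smooth_on U (\<lambda>p. integral {0..1} (\<lambda>s. f (p, s)))"
  using assms Ck_on_integral unfolding smooth_on_def by blast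

section \<open>Smooth inverses and local injectivity\<close>

lemma matrix_FD_vector_mult:
  fixes f :: "real ^ 'n \<Rightarrow> real ^ 'm"
  assumes "f differentiable (at x)"
  shows "matrix (FD f x) *v v = FD f x v"
  using matrix_works[of "FD f x"] has_derivative_linear[OF FD_works[OF assms]] by simp

lemma smooth_on_matrix_FD:
  fixes f :: "real ^ 'n \<Rightarrow> real ^ 'm"
  assumes "open S" "smooth_on S f"
  shows "smooth_on S (\<lambda>x. matrix (FD f x))"
  unfolding matrix_def
  by (intro smooth_on_vec_lambda[OF assms(1)] smooth_on_nth[OF assms(1)] smooth_on_FD assms)

text \<open>Bootstrapping: the derivative of \<open>g\<close> at \<open>y\<close> is
  \<open>B (g y)\<close> with \<open>B\<close> smooth, so each order of differentiability of
  \<open>g\<close> yields the next. Openness of the image is invariance of domain.\<close>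

lemma smooth_on_inverse_map:
  fixes f g :: "real ^ 'n \<Rightarrow> real ^ 'n"
  assumes U: "open U" and f: "smooth_on U f" and gf: "\<And>x. x \<in> U \<Longrightarrow> g (f x) = x"
    and det: "\<And>x. x \<in> U \<Longrightarrow> det (matrix (FD f x)) \<noteq> 0"
  shows "open (f ` U)" "smooth_on (f ` U) g"
proof -
  show o: "open (f ` U)"
    by (rule invariance_of_domain[OF smooth_on_imp_continuous_on[OF f] U])
       (metis gf inj_onI)
  define B where "B = (\<lambda>x. matrix_inv (matrix (FD f x)))"
  have B: "smooth_on U B"
    unfolding B_def by (intro smooth_on_matrix_inv[OF U] smooth_on_matrix_FD[OF U f] det)
  have D: "(g has_derivative (\<lambda>v. B (g y) *v v)) (at y)" if "y \<in> f ` U" for y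
  proof -
    obtain x where x: "x \<in> U" "y = f x" using \<open>y \<in> f ` U\<close> by blast
    have "FD f x (B x *v v) = v" for v
      using matrix_FD_vector_mult[OF smooth_on_differentiable[OF f x(1)], of "B x *v v"]
        matrix_inv_mult_vec(1)[OF det[OF x(1)], of v] by (simp only: B_def)
    then have "FD f x \<circ> (*v) (B x) = id" by (simp add: fun_eq_iff)
    then have "(g has_derivative (*v) (B x)) (at (f x))"
      using has_derivative_inverse_on[where f = f and S = U and f' = "FD f" and g = g and g' = "\<lambda>x. (*v) (B x)" and x = x]
        U smooth_on_has_derivative[OF f] gf x(1) by blast
    then show ?thesis by (simp add: x gf)
  qed
  have "Ck_on k (f ` U) g" for k
  proof (induction k)
    case 0
    show ?case
      using has_derivative_continuous[OF D] by (simp add: continuous_at_imp_continuous_on)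
  next
    case (Suc k)
    show ?case
    proof (rule Ck_on_SucI[OF o D])
      fix v :: "real ^ 'n"
      have "bounded_linear (\<lambda>A :: real ^ 'n ^ 'n. A *v v)"
        unfolding linear_conv_bounded_linear[symmetric]
        by (rule linearI) (simp_all add: matrix_vector_mult_add_rdistrib scaleR_matrix_vector_assoc)
      moreover have "Ck_on k (f ` U) (\<lambda>y. B (g y))"
        by (rule Ck_on_compose[OF o Suc _ U]) (use B gf in \<open>auto simp: smooth_on_def\<close>)
      ultimately show "Ck_on k (f ` U) (\<lambda>y. B (g y) *v v)"
        using Ck_on_linear_comp o by blast
    qed
  qed
  then show "smooth_on (f ` U) g" by (simp add: smooth_on_def)
qed

text \<open>The inverse function theorem supplies a neighbourhood of injectivity, which is then cut
  down to the open set where the Jacobian determinant does not vanish.\<close>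

lemma smooth_locally_injective:
  fixes f :: "real ^ 'n \<Rightarrow> real ^ 'n"
  assumes U: "open U" "x \<in> U" and f: "smooth_on U f" and det: "det (matrix (FD f x)) \<noteq> 0"
  obtains U' where "open U'" "x \<in> U'" "U' \<subseteq> U" "inj_on f U'" "\<And>y. y \<in> U' \<Longrightarrow> det (matrix (FD f y)) \<noteq> 0"
proof -
  have bl: "bounded_linear (FD f y)" if "y \<in> U" for y
    using smooth_on_has_derivative[OF f that] has_derivative_bounded_linear by blast
  define f' where "f' = (\<lambda>y. Blinfun (FD f y))"
  have f': "blinfun_apply (f' y) = FD f y" if "y \<in> U" for y
    unfolding f'_def by (rule bounded_linear_Blinfun_apply[OF bl[OF that]])
  have cont: "continuous_on U f'"
  proof (rule continuous_on_blinfun_componentwise)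
    fix i :: "real ^ 'n"
    show "continuous_on U (\<lambda>x. f' x i)"
      by (rule continuous_on_eq[OF smooth_on_imp_continuous_on[OF smooth_on_FD[OF f, of i]]]) (simp add: f')
  qed
  define B where "B = matrix_inv (matrix (FD f x))"
  have "B *v FD f x v = v" for v
    using matrix_FD_vector_mult[OF smooth_on_differentiable[OF f U(2)], of v]
      matrix_inv_mult_vec(2)[OF det, of v] by (simp only: B_def)
  then have "Blinfun ((*v) B) o\<^sub>L f' x = id_blinfun"
    by (intro blinfun_eqI) (simp add: bounded_linear_Blinfun_apply f' U)
  from inverse_function_theorem[OF U(1) _ cont U(2) this]
  obtain U1 V g where U1: "open U1" "U1 \<subseteq> U" "x \<in> U1" "homeomorphism U1 V f g"
    using smooth_on_has_derivative[OF f] f' by metis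
  have "continuous_on U1 (\<lambda>y. det (matrix (FD f y)))"
    by (rule continuous_on_subset[OF smooth_on_imp_continuous_on[OF
          smooth_on_det[OF U(1) smooth_on_matrix_FD[OF U(1) f]]] U1(2)])
  then have "open (U1 \<inter> (\<lambda>y. det (matrix (FD f y))) -` (- {0}))"
    using U1(1) by (rule continuous_open_preimage) (simp add: open_Compl)
  moreover have "inj_on f U1"
    using homeomorphism_apply1[OF U1(4)] by (rule inj_on_inverseI)
  ultimately show ?thesis
    using U1 det by (intro that[of "U1 \<inter> (\<lambda>y. det (matrix (FD f y))) -` (- {0})"]) (auto simp: inj_on_def)
qed

section \<open>Smooth dependence of solutions of differential equations on parameters\<close>

text \<open>For \<open>t \<ge> 0\<close> this is the integral of \<open>f\<close> from \<open>0\<close> to \<open>t\<close>; the fixed domain of integration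
  spares the distinction of the sign of \<open>t\<close> and makes it an integral with parameters.\<close>

definition prim :: "(real \<Rightarrow> 'e::real_normed_vector) \<Rightarrow> real \<Rightarrow> 'e" where
  "prim f t = t *\<^sub>R integral {0..1} (\<lambda>s. f (s * t))"

text \<open>The bound 2 is matched to right-hand sides with Lipschitz constant \<open>1/4\<close>:
  integration from 0 then contracts by \<open>1/2\<close> on the entire interval, so that one fixed
  point gives the solution up to time 1 and no solutions have to be continued or glued.
  \<open>I\<close> is open so that time derivatives are two-sided.\<close>

locale time_interval =
  fixes I :: "real set"
  assumes open_I: "open I" and convex_I: "convex I" and zero_I: "0 \<in> I"
    and bound_I: "\<And>t. t \<in> I \<Longrightarrow> \<bar>t\<bar> \<le> 2"
begin

lemma scaled_I: "t \<in> I \<Longrightarrow> 0 \<le> s \<Longrightarrow> s \<le> 1 \<Longrightarrow> s * t \<in> I"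
  using convexD[OF convex_I, of t 0 s "1 - s"] zero_I by simp

lemma sub_interval:
  assumes "t \<in> I"
  obtains c d where "c < 0" "c < t" "0 < d" "t < d" "{c..d} \<subseteq> I"
proof -
  obtain e1 where e1: "e1 > 0" "cball (min 0 t) e1 \<subseteq> I"
    using open_I zero_I assms open_contains_cball by (metis min_def)
  obtain e2 where e2: "e2 > 0" "cball (max 0 t) e2 \<subseteq> I"
    using open_I zero_I assms open_contains_cball by (metis max_def)
  have 1: "min 0 t - e1 \<in> I" using e1 by (auto simp: dist_real_def)
  have 2: "max 0 t + e2 \<in> I" using e2 by (auto simp: dist_real_def)
  have "{min 0 t - e1..max 0 t + e2} \<subseteq> I"
    using closed_segment_subset[OF 1 2 convex_I] e1(1) e2(1)
    by (simp add: closed_segment_eq_real_ivl split: if_splits)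
  then show ?thesis
    by (intro that[of "min 0 t - e1" "max 0 t + e2"]) (use e1 e2 in auto)
qed

lemma continuous_scaled:
  assumes "continuous_on I f" "t \<in> I"
  shows "continuous_on {0..1} (\<lambda>s. f (s * t))"
  by (rule continuous_on_compose2[OF assms(1)])
     (use scaled_I[OF assms(2)] in \<open>auto intro!: continuous_intros\<close>)

text \<open>With an antiderivative \<open>G\<close> on a closed interval around 0 and
  \<open>t\<close>, substituting \<open>s * u\<close> for the variable gives
  \<open>prim f u = G u - G 0\<close>, for \<open>u\<close> of either sign.\<close>

lemma prim_derivative:
  fixes f :: "real \<Rightarrow> 'e::banach"
  assumes f: "continuous_on I f" and t: "t \<in> I"
  shows "(prim f has_vector_derivative f t) (at t)"
proof -
  obtain c d where cd: "c < 0" "c < t" "0 < d" "t < d" "{c..d} \<subseteq> I"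
    using sub_interval[OF t] by blast
  obtain G where G: "\<And>x. x \<in> {c..d} \<Longrightarrow> (G has_vector_derivative f x) (at x within {c..d})"
    using antiderivative_continuous[OF continuous_on_subset[OF f cd(5)]] by blast
  have eq: "G u - G 0 = prim f u" if u: "u \<in> {c<..<d}" for u
  proof -
    have st: "s * u \<in> {c..d}" if "s \<in> {0..1}" for s
    proof -
      have "s * u \<in> closed_segment 0 u"
        using that unfolding closed_segment_def by (auto intro!: exI[of _ s])
      also have "\<dots> \<subseteq> {c..d}" by (rule closed_segment_subset) (use u cd in auto)
      finally show ?thesis .
    qed
    have "((\<lambda>s. G (s * u)) has_vector_derivative u *\<^sub>R f (s * u)) (at s within {0..1})"
      if "s \<in> {0..1}" for s
    proof -
      have "((\<lambda>s. s * u) has_vector_derivative u) (at s within {0..1})"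
        by (auto intro!: derivative_eq_intros)
      moreover have "(G has_vector_derivative f (s * u)) (at (s * u) within (\<lambda>s. s * u) ` {0..1})"
        by (rule has_vector_derivative_within_subset[OF G]) (use st that in auto)
      ultimately show ?thesis using vector_diff_chain_within by (fastforce simp: o_def)
    qed
    then have "((\<lambda>s. u *\<^sub>R f (s * u)) has_integral G (1 * u) - G (0 * u)) {0..1}"
      by (intro fundamental_theorem_of_calculus) auto
    then show ?thesis by (simp add: prim_def integral_unique flip: integral_cmul)
  qed
  have "(G has_vector_derivative f t) (at t)"
    using G[of t] cd by (auto simp: at_within_Icc_at)
  then have "((\<lambda>u. G u - G 0) has_vector_derivative f t) (at t)"
    by (auto intro!: derivative_eq_intros)
  then show ?thesis
    by (rule has_vector_derivative_transform_within_open[where S = "{c<..<d}"]) (use cd eq in auto)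
qed

lemma prim_bound:
  fixes f :: "real \<Rightarrow> 'e::banach"
  assumes f: "continuous_on I f" and t: "t \<in> I" and B: "\<And>s. s \<in> I \<Longrightarrow> norm (f s) \<le> B"
  shows "norm (prim f t) \<le> 2 * B"
proof -
  have "norm (integral {0..1} (\<lambda>s. f (s * t))) \<le> B * (1 - 0)"
    by (rule integral_bound[OF _ continuous_scaled[OF f t]]) (use B scaled_I[OF t] in auto)
  then show ?thesis
    unfolding prim_def norm_scaleR
    using mult_mono[OF bound_I[OF t], of "norm (integral {0..1} (\<lambda>s. f (s * t)))" B] by simp
qed

lemma prim_diff:
  fixes f :: "real \<Rightarrow> 'e::banach"
  assumes "continuous_on I f" "continuous_on I g" "t \<in> I"
  shows "prim (\<lambda>s. f s - g s) t = prim f t - prim g t"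
  using continuous_scaled[OF assms(1,3)] continuous_scaled[OF assms(2,3)]
  by (simp add: prim_def integral_diff integrable_continuous_interval scaleR_diff_right)

lemma prim_cong: "t \<in> I \<Longrightarrow> (\<And>s. s \<in> I \<Longrightarrow> f s = g s) \<Longrightarrow> prim f t = prim g t"
  unfolding prim_def using scaled_I[of t] by (intro arg_cong[where f = "(*\<^sub>R) t"] integral_cong) auto

lemma continuous_prim:
  fixes f :: "real \<times> 'p::topological_space \<Rightarrow> 'e::banach"
  assumes "continuous_on (I \<times> U) f"
  shows "continuous_on (I \<times> U) (\<lambda>x. prim (\<lambda>s. f (s, snd x)) (fst x))"
proof -
  have "continuous_on ((I \<times> U) \<times> cbox 0 1) (\<lambda>(x, s). f (s * fst x, snd x))"
    unfolding split_def
    by (rule continuous_on_compose2[OF assms])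
       (use scaled_I in \<open>auto intro!: continuous_intros\<close>)
  from integral_continuous_on_param[OF this] show ?thesis
    unfolding prim_def by (auto intro!: continuous_intros)
qed

text \<open>Picard iteration for all parameters at once, so that uniform convergence gives joint
  continuity. The iterates stay in the ball of radius \<open>r\<close>: on it \<open>F\<close> is
  bounded by \<open>r / 4 + r / 4\<close>, and integration costs a factor 2. Successive differences
  are halved for the same reason.\<close>

lemma picard:
  fixes F :: "real \<times> 'p::topological_space \<times> 'e::banach \<Rightarrow> 'e"
  assumes F: "continuous_on (I \<times> U \<times> cball 0 r) F"
    and lip: "\<And>t p z z'. t \<in> I \<Longrightarrow> p \<in> U \<Longrightarrow> norm z \<le> r \<Longrightarrow> norm z' \<le> r \<Longrightarrow>
      norm (F (t, p, z) - F (t, p, z')) \<le> norm (z - z') / 4"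
    and F0: "\<And>t p. t \<in> I \<Longrightarrow> p \<in> U \<Longrightarrow> norm (F (t, p, 0)) \<le> r / 4" and r: "r \<ge> 0"
  obtains Z where "continuous_on (I \<times> U) Z"
    "\<And>t p. t \<in> I \<Longrightarrow> p \<in> U \<Longrightarrow> norm (Z (t, p)) \<le> r"
    "\<And>t p. t \<in> I \<Longrightarrow> p \<in> U \<Longrightarrow> Z (t, p) = prim (\<lambda>s. F (s, p, Z (s, p))) t"
proof -
  define Z where "Z = rec_nat (\<lambda>x. 0) (\<lambda>n f (x :: real \<times> 'p). prim (\<lambda>s. F (s, snd x, f (s, snd x))) (fst x))"
  have Z0: "Z 0 x = 0" for x by (simp add: Z_def)
  have ZS: "Z (Suc n) x = prim (\<lambda>s. F (s, snd x, Z n (s, snd x))) (fst x)" for n x by (simp add: Z_def)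
  have contF: "continuous_on (I \<times> U) (\<lambda>x. F (fst x, snd x, f x))"
    if "continuous_on (I \<times> U) f" "\<And>x. x \<in> I \<times> U \<Longrightarrow> norm (f x) \<le> r" for f
    by (rule continuous_on_compose2[OF F]) (use that in \<open>auto intro!: continuous_intros simp: mem_Times_iff\<close>)
  have contFs: "continuous_on I (\<lambda>s. F (s, p, f (s, p)))"
    if "continuous_on (I \<times> U) f" "\<And>x. x \<in> I \<times> U \<Longrightarrow> norm (f x) \<le> r" "p \<in> U" for f p
  proof -
    have "continuous_on I (\<lambda>s. (s, p))" by (intro continuous_intros)
    from continuous_on_compose2[OF contF[OF that(1,2)] this] show ?thesis using that(3) by auto
  qed
  have ZB: "continuous_on (I \<times> U) (Z n) \<and> (\<forall>x\<in>I \<times> U. norm (Z n x) \<le> r)" for n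
  proof (induction n)
    case 0
    then show ?case using r by (simp add: Z0 cong: continuous_on_cong)
  next
    case (Suc n)
    have "continuous_on (I \<times> U) (\<lambda>x. prim (\<lambda>s. F (s, snd x, Z n (s, snd x))) (fst x))"
      using continuous_prim[OF contF[of "Z n"]] Suc by simp
    moreover have "norm (Z (Suc n) x) \<le> r" if x: "x \<in> I \<times> U" for x
    proof -
      have "norm (F (s, snd x, Z n (s, snd x))) \<le> r / 2" if "s \<in> I" for s
      proof -
        have "norm (F (s, snd x, Z n (s, snd x)) - F (s, snd x, 0)) \<le> norm (Z n (s, snd x) - 0) / 4"
          by (rule lip) (use that x Suc r in auto)
        moreover have "norm (Z n (s, snd x)) \<le> r" using Suc x that by auto
        moreover have "norm (F (s, snd x, 0)) \<le> r / 4" using F0 x that by auto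
        ultimately show ?thesis
          using norm_triangle_sub[of "F (s, snd x, Z n (s, snd x))" "F (s, snd x, 0)"] by simp
      qed
      then have "norm (Z (Suc n) x) \<le> 2 * (r / 2)"
        unfolding ZS by (intro prim_bound contFs) (use Suc x in auto)
      then show ?thesis by simp
    qed
    ultimately show ?case by (simp add: ZS cong: continuous_on_cong)
  qed
  have contr: "norm (prim (\<lambda>s. F (s, p, f (s, p))) t - prim (\<lambda>s. F (s, p, g (s, p))) t) \<le> m / 2"
    if f: "continuous_on (I \<times> U) f" "\<And>x. x \<in> I \<times> U \<Longrightarrow> norm (f x) \<le> r"
      and g: "continuous_on (I \<times> U) g" "\<And>x. x \<in> I \<times> U \<Longrightarrow> norm (g x) \<le> r"
      and tp: "t \<in> I" "p \<in> U" and m: "\<And>s. s \<in> I \<Longrightarrow> norm (f (s, p) - g (s, p)) \<le> m" for f g t p m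
  proof -
    have "norm (prim (\<lambda>s. F (s, p, f (s, p)) - F (s, p, g (s, p))) t) \<le> 2 * (m / 4)"
    proof (rule prim_bound)
      show "continuous_on I (\<lambda>s. F (s, p, f (s, p)) - F (s, p, g (s, p)))"
        by (intro continuous_on_diff contFs f g tp)
      fix s assume s: "s \<in> I"
      have "norm (F (s, p, f (s, p)) - F (s, p, g (s, p))) \<le> norm (f (s, p) - g (s, p)) / 4"
        by (rule lip) (use s f g tp in auto)
      then show "norm (F (s, p, f (s, p)) - F (s, p, g (s, p))) \<le> m / 4" using m[OF s] by simp
    qed (rule tp)
    then show ?thesis by (simp add: prim_diff[OF contFs[OF f tp(2)] contFs[OF g tp(2)] tp(1)])
  qed
  have step: "norm (Z (Suc n) (t, p) - Z n (t, p)) \<le> r * (1/2) ^ n" if "t \<in> I" "p \<in> U" for n t p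
    using that
  proof (induction n arbitrary: t)
    case 0
    then show ?case using ZB[of "Suc 0"] by (auto simp: Z0)
  next
    case (Suc n)
    have "norm (prim (\<lambda>s. F (s, p, Z (Suc n) (s, p))) t - prim (\<lambda>s. F (s, p, Z n (s, p))) t) \<le> r * (1/2)^n / 2"
      by (rule contr) (use ZB Suc in auto)
    then show ?case by (subst (1 2) ZS) simp
  qed
  have "uniform_limit (I \<times> U) (\<lambda>n x. \<Sum>i<n. Z (Suc i) x - Z i x) (\<lambda>x. \<Sum>i. Z (Suc i) x - Z i x) sequentially"
    by (rule Weierstrass_m_test[where M = "\<lambda>n. r * (1/2) ^ n"])
       (use step in \<open>auto intro!: summable_mult summable_geometric\<close>)
  moreover have "(\<Sum>i<n. Z (Suc i) x - Z i x) = Z n x" for n x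
    using sum_lessThan_telescope[of "\<lambda>i. Z i x" n] by (simp add: Z0)
  ultimately obtain Y where lim: "uniform_limit (I \<times> U) Z Y sequentially" by auto
  have contY: "continuous_on (I \<times> U) Y"
    by (rule uniform_limit_theorem[OF _ lim]) (use ZB in auto)
  have Yr: "norm (Y x) \<le> r" if "x \<in> I \<times> U" for x
    by (rule Lim_norm_ubound[OF _ tendsto_uniform_limitI[OF lim that]]) (use ZB that in auto)
  \<comment> \<open>Both sides are within \<open>e / 2\<close> of the iterate
    \<open>Z (Suc N) (t, p)\<close> for large \<open>N\<close>; convergence uniform in time is what
    passes through the integral.\<close>
  have eq: "Y (t, p) = prim (\<lambda>s. F (s, p, Y (s, p))) t" if tp: "t \<in> I" "p \<in> U" for t p
  proof -
    have D: "dist (Y (t, p)) (prim (\<lambda>s. F (s, p, Y (s, p))) t) \<le> e" if e: "e > 0" for e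
    proof -
      have "\<forall>\<^sub>F n in sequentially. \<forall>x\<in>I \<times> U. dist (Z n x) (Y x) < e / 2"
        using lim e unfolding uniform_limit_iff by (meson half_gt_zero)
      then obtain N where N: "\<And>n x. n \<ge> N \<Longrightarrow> x \<in> I \<times> U \<Longrightarrow> dist (Z n x) (Y x) < e / 2"
        unfolding eventually_sequentially by blast
      have "norm (prim (\<lambda>s. F (s, p, Z N (s, p))) t - prim (\<lambda>s. F (s, p, Y (s, p))) t) \<le> (e / 2) / 2"
        by (rule contr) (use ZB contY Yr tp N[of N] in \<open>auto simp: dist_norm less_imp_le\<close>)
      then have "dist (Z (Suc N) (t, p)) (prim (\<lambda>s. F (s, p, Y (s, p))) t) \<le> e / 2"
        using e by (simp add: ZS dist_norm)
      moreover have "dist (Z (Suc N) (t, p)) (Y (t, p)) < e / 2" using N tp by auto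
      ultimately show ?thesis
        using dist_triangle3[of "Y (t, p)" "prim (\<lambda>s. F (s, p, Y (s, p))) t" "Z (Suc N) (t, p)"]
        by linarith
    qed
    have "dist (Y (t, p)) (prim (\<lambda>s. F (s, p, Y (s, p))) t) \<le> 0"
    proof (rule field_le_epsilon)
      fix e :: real assume "e > 0"
      from D[OF this] show "dist (Y (t, p)) (prim (\<lambda>s. F (s, p, Y (s, p))) t) \<le> 0 + e" by (simp only: add_0)
    qed
    then show ?thesis by simp
  qed
  show ?thesis by (rule that[OF contY]) (use Yr eq in auto)
qed

text \<open>A substitute for Gronwall's inequality: the supremum \<open>m\<close> of the norms
  satisfies \<open>m \<le> c + 3 / 4 * m\<close>. The crude bound \<open>M\<close> makes the
  supremum finite, without which it could not be absorbed.\<close>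

lemma self_bound:
  fixes g :: "real \<Rightarrow> 'e::real_normed_vector"
  assumes M: "\<And>t. t \<in> I \<Longrightarrow> norm (g t) \<le> M"
    and step: "\<And>t m. t \<in> I \<Longrightarrow> 0 \<le> m \<Longrightarrow> (\<And>s. s \<in> I \<Longrightarrow> norm (g s) \<le> m) \<Longrightarrow> norm (g t) \<le> c + 3 / 4 * m"
    and t: "t \<in> I"
  shows "norm (g t) \<le> 4 * c"
proof -
  define m where "m = (SUP t\<in>I. norm (g t))"
  have bdd: "bdd_above ((\<lambda>t. norm (g t)) ` I)" using M by (auto simp: bdd_above_def)
  have le: "norm (g s) \<le> m" if "s \<in> I" for s
    unfolding m_def by (rule cSUP_upper[OF that bdd])
  then have "0 \<le> m" using zero_I norm_ge_zero order_trans by blast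
  have "m \<le> c + 3 / 4 * m"
    unfolding m_def by (rule cSUP_least) (use zero_I step[OF _ \<open>0 \<le> m\<close> le] in \<open>auto simp: m_def\<close>)
  then show ?thesis using le[OF t] by simp
qed

end

text \<open>First-order Taylor expansion, uniformly over a compact set: the derivative is uniformly
  continuous on the compact neighbourhood \<open>K'\<close> of \<open>K\<close>, and the remainder
  is bounded by its oscillation on a small ball.\<close>

lemma uniform_derivative:
  fixes G :: "'a::euclidean_space \<Rightarrow> 'b::real_normed_vector"
  assumes W: "open W" and G: "Ck_on (Suc 0) W G" and K: "compact K" "K \<subseteq> W" and e: "e > 0"
  obtains d where "d > 0" "\<And>x y. x \<in> K \<Longrightarrow> norm (y - x) < d \<Longrightarrow> norm (G y - G x - FD G x (y - x)) \<le> e * norm (y - x)"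
proof -
  obtain d1 where d1: "d1 > 0" "(\<Union>x\<in>K. cball x d1) \<subseteq> W"
    using compact_subset_open_imp_cball_epsilon_subset[OF K(1) W K(2)] by blast
  define K' where "K' = {x + y | x y. x \<in> K \<and> y \<in> cball 0 d1}"
  have K': "compact K'" unfolding K'_def by (rule compact_sums[OF K(1) compact_cball])
  have ballK': "ball x d1 \<subseteq> K'" if "x \<in> K" for x
  proof
    fix y assume "y \<in> ball x d1"
    then have "y = x + (y - x)" "y - x \<in> cball 0 d1" by (auto simp: dist_norm norm_minus_commute)
    then show "y \<in> K'" unfolding K'_def using that by blast
  qed
  have K'W: "K' \<subseteq> W" unfolding K'_def using d1(2) by (fastforce simp: dist_norm)
  define G' where "G' = (\<lambda>x. Blinfun (FD G x))"
  have der: "(G has_derivative FD G x) (at x)" if "x \<in> W" for x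
    by (rule Ck_on_has_derivative[OF G that])
  have G': "blinfun_apply (G' x) = FD G x" if "x \<in> W" for x
    unfolding G'_def by (rule bounded_linear_Blinfun_apply[OF has_derivative_bounded_linear[OF der[OF that]]])
  have "continuous_on W G'"
  proof (rule continuous_on_blinfun_componentwise)
    fix i :: 'a
    have "continuous_on W (\<lambda>x. FD G x i)" using G by simp
    then show "continuous_on W (\<lambda>x. G' x i)" by (rule continuous_on_eq) (simp add: G')
  qed
  then have "uniformly_continuous_on K' G'"
    by (intro compact_uniformly_continuous K') (rule continuous_on_subset[OF _ K'W])
  then obtain d2 where d2: "d2 > 0" "\<And>x y. x \<in> K' \<Longrightarrow> y \<in> K' \<Longrightarrow> dist y x < d2 \<Longrightarrow> dist (G' y) (G' x) < e"
    unfolding uniformly_continuous_on_def using e by blast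
  show ?thesis
  proof (rule that[of "min d1 d2"])
    fix x y assume x: "x \<in> K" and y: "norm (y - x) < min d1 d2"
    define B where "B = ball x (min d1 d2)"
    have B: "B \<subseteq> K'" "B \<subseteq> W" using ballK'[OF x] K'W by (auto simp: B_def)
    have xB: "x \<in> B" using d1 d2 by (simp add: B_def)
    have "norm (G y - G x - FD G x (y - x)) \<le> norm (y - x) * e"
    proof (rule differentiable_bound_linearization[where S = B])
      fix t :: real assume t: "t \<in> {0..1}"
      have "t * norm (y - x) \<le> 1 * norm (y - x)" using t by (intro mult_right_mono) auto
      then show "x + t *\<^sub>R (y - x) \<in> B" using y t by (simp add: B_def dist_norm)
    next
      show "(G has_derivative FD G z) (at z within B)" if "z \<in> B" for z
        by (rule has_derivative_at_withinI[OF der]) (use that B in auto)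
    next
      fix z assume z: "z \<in> B"
      have "dist (G' z) (G' x) < e"
        by (rule d2) (use z xB B in \<open>auto simp: B_def dist_commute\<close>)
      moreover have "(\<lambda>i. FD G z i - FD G x i) = blinfun_apply (G' z - G' x)"
        using G'[of z] G'[of x] z xB B(2) by (auto simp: blinfun.diff_left subset_iff)
      then have "onorm (\<lambda>i. FD G z i - FD G x i) = norm (G' z - G' x)"
        by (simp add: norm_blinfun.rep_eq)
      ultimately show "onorm (FD G z - FD G x) \<le> e" by (simp add: dist_norm fun_diff_def)
    qed (rule xB)
    then show "norm (G y - G x - FD G x (y - x)) \<le> e * norm (y - x)" by (simp add: mult.commute)
  qed (use d1 d2 in auto)
qed

text \<open>The hypotheses of the induction on the order of differentiability; \<open>F\<close> is contracting
  in the unknown, which suffices for the flows below.\<close>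

definition param_ode :: "real set \<Rightarrow> 'p::euclidean_space set \<Rightarrow> (real \<times> 'p \<times> 'e::euclidean_space) set \<Rightarrow>
    (real \<times> 'p \<times> 'e \<Rightarrow> 'e) \<Rightarrow> (real \<times> 'p \<Rightarrow> 'e) \<Rightarrow> bool" where
  "param_ode I U W F Z \<longleftrightarrow> time_interval I \<and> open U \<and> open W \<and> continuous_on (I \<times> U) Z \<and>
     (\<forall>t\<in>I. \<forall>p\<in>U. (t, p, Z (t, p)) \<in> W \<and> Z (t, p) = prim (\<lambda>s. F (s, p, Z (s, p))) t) \<and>
     (\<forall>t p z z'. (t, p, z) \<in> W \<longrightarrow> (t, p, z') \<in> W \<longrightarrow> norm (F (t, p, z) - F (t, p, z')) \<le> norm (z - z') / 4)"

text \<open>Passes the Lipschitz constant \<open>1/4\<close> from \<open>F\<close> to its derivative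
  in the unknown. The linearized equation thus contracts with the same constant and falls under
  \<open>picard\<close> and under the induction in \<open>param_ode_Ck\<close>.\<close>

lemma partial_derivative_bound:
  assumes "open W" "(t, p, z) \<in> W" "(F has_derivative F') (at (t, p, z))"
    and lip: "\<And>z z'. (t, p, z) \<in> W \<Longrightarrow> (t, p, z') \<in> W \<Longrightarrow> norm (F (t, p, z) - F (t, p, z')) \<le> norm (z - z') / 4"
  shows "norm (F' (0, 0, w)) \<le> norm w / 4"
proof (rule field_le_epsilon)
  fix e :: real assume e: "e > 0"
  interpret F': bounded_linear F' using assms(3) by (rule has_derivative_bounded_linear)
  define e' where "e' = e / (norm w + 1)"
  have "norm w + 1 > 0" by (simp add: add_nonneg_pos)
  then have e': "e' > 0" "e' * norm w \<le> e"
    using e by (simp_all add: e'_def field_simps)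
  obtain d1 where d1: "d1 > 0" "\<And>y. norm (y - (t, p, z)) < d1 \<Longrightarrow>
      norm (F y - F (t, p, z) - F' (y - (t, p, z))) \<le> e' * norm (y - (t, p, z))"
    using assms(3) e'(1) unfolding has_derivative_at_alt by blast
  obtain d2 where d2: "d2 > 0" "ball (t, p, z) d2 \<subseteq> W"
    using assms(1,2) open_contains_ball by blast
  define s where "s = min d1 d2 / (2 * (norm w + 1))"
  have s: "s > 0" using d1 d2 by (simp add: s_def add_nonneg_pos)
  have "s * norm w < s * (2 * (norm w + 1))" using s by (simp add: add_nonneg_pos)
  also have "\<dots> = min d1 d2" unfolding s_def by (simp add: add_nonneg_pos order_less_imp_not_eq2)
  finally have sw: "s * norm w < min d1 d2" .
  have n: "norm ((t, p, z + s *\<^sub>R w) - (t, p, z)) = s * norm w" using s by (simp add: norm_Pair)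
  have F's: "F' ((t, p, z + s *\<^sub>R w) - (t, p, z)) = s *\<^sub>R F' (0, 0, w)"
    using F'.scaleR[of s "(0, 0, w)"] by simp
  have "(t, p, z + s *\<^sub>R w) \<in> ball (t, p, z) d2"
    using n sw s by (simp add: mem_ball dist_norm norm_minus_commute[of "(t, p, z)"])
  then have "(t, p, z + s *\<^sub>R w) \<in> W" using d2 by blast
  from lip[OF this assms(2)] have "norm (F (t, p, z + s *\<^sub>R w) - F (t, p, z)) \<le> s * norm w / 4"
    using s by simp
  moreover have "norm (F (t, p, z + s *\<^sub>R w) - F (t, p, z) - s *\<^sub>R F' (0, 0, w)) \<le> e' * (s * norm w)"
    using d1(2)[of "(t, p, z + s *\<^sub>R w)"] sw unfolding n F's by simp
  ultimately have "norm (s *\<^sub>R F' (0, 0, w)) \<le> s * norm w / 4 + e' * (s * norm w)"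
    by (smt (verit) norm_minus_commute norm_triangle_sub)
  then have "s * norm (F' (0, 0, w)) \<le> s * (norm w / 4 + e' * norm w)"
    using s by (simp add: algebra_simps)
  then show "norm (F' (0, 0, w)) \<le> norm w / 4 + e" using s e'(2) by simp
qed

section \<open>Differentiation of solutions with respect to parameters\<close>

lemma param_odeD:
  assumes "param_ode I U W F Z"
  shows "time_interval I" "open U" "open W" "continuous_on (I \<times> U) Z"
    "\<And>t p. t \<in> I \<Longrightarrow> p \<in> U \<Longrightarrow> (t, p, Z (t, p)) \<in> W"
    "\<And>t p. t \<in> I \<Longrightarrow> p \<in> U \<Longrightarrow> Z (t, p) = prim (\<lambda>s. F (s, p, Z (s, p))) t"
    "\<And>t p z z'. (t, p, z) \<in> W \<Longrightarrow> (t, p, z') \<in> W \<Longrightarrow> norm (F (t, p, z) - F (t, p, z')) \<le> norm (z - z') / 4"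
  using assms unfolding param_ode_def by blast+

text \<open>The candidate \<open>L\<close> for the derivative is built first, as the fixed point of
  the linearized equation in the space of bounded linear maps. The error \<open>R\<close> of the
  linear approximation obeys the linearized equation up to a Taylor remainder, and
  \<open>self_bound\<close> shows it to be small relative to the increment of the parameter. The
  relatively compact \<open>I'\<close> and \<open>U'\<close> provide the uniform bounds.\<close>

lemma param_ode_derivative:
  assumes ode: "param_ode I U W F Z" and F: "Ck_on (Suc 0) W F"
    and I': "time_interval I'" "closure I' \<subseteq> I" and U': "open U'" "compact (closure U')" "closure U' \<subseteq> U"
  obtains L where "continuous_on (I' \<times> U') L"
    "\<And>t p. t \<in> I' \<Longrightarrow> p \<in> U' \<Longrightarrow> ((\<lambda>p. Z (t, p)) has_derivative blinfun_apply (L (t, p))) (at p)"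
    "\<And>t p v. t \<in> I' \<Longrightarrow> p \<in> U' \<Longrightarrow>
       blinfun_apply (L (t, p)) v = prim (\<lambda>s. FD F (s, p, Z (s, p)) (0, v, blinfun_apply (L (s, p)) v)) t"
proof -
  note O = param_odeD[OF ode]
  interpret I: time_interval I by (rule O(1))
  interpret I': time_interval I' by (rule I'(1))
  have I'I: "t \<in> I" if "t \<in> I'" for t using that I'(2) closure_subset by blast
  have U'U: "p \<in> U" if "p \<in> U'" for p using that U'(3) closure_subset by blast
  have der: "(F has_derivative FD F (t, p, Z (t, p))) (at (t, p, Z (t, p)))" if "t \<in> I" "p \<in> U" for t p
    by (rule Ck_on_has_derivative[OF F O(5)[OF that]])
  have bl: "bounded_linear (FD F (t, p, Z (t, p)))" if "t \<in> I" "p \<in> U" for t p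
    by (rule has_derivative_bounded_linear[OF der[OF that]])
  have FDadd: "FD F (t, p, Z (t, p)) (0, v, w) = FD F (t, p, Z (t, p)) (0, v, 0) + FD F (t, p, Z (t, p)) (0, 0, w)"
    if "t \<in> I" "p \<in> U" for t p v w
    using linear_add[OF bounded_linear.linear[OF bl[OF that]], of "(0, v, 0)" "(0, 0, w)"] by simp
  have contFD: "continuous_on (I \<times> U) (\<lambda>x. FD F (fst x, snd x, Z x) h)" for h
    by (rule continuous_on_compose2[of W])
       (use F O in \<open>auto intro!: continuous_intros simp del: split_paired_All\<close>)
  define A where "A = (\<lambda>x. Blinfun (\<lambda>v. FD F (fst x, snd x, Z x) (0, v, 0)))"
  define B where "B = (\<lambda>x. Blinfun (\<lambda>w. FD F (fst x, snd x, Z x) (0, 0, w)))"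
  have A: "blinfun_apply (A (t, p)) = (\<lambda>v. FD F (t, p, Z (t, p)) (0, v, 0))" if "t \<in> I" "p \<in> U" for t p
    unfolding A_def fst_conv snd_conv
    by (intro bounded_linear_Blinfun_apply bounded_linear_compose[OF bl[OF that]] bounded_linear_Pair
          bounded_linear_zero bounded_linear_ident)
  have B: "blinfun_apply (B (t, p)) = (\<lambda>w. FD F (t, p, Z (t, p)) (0, 0, w))" if "t \<in> I" "p \<in> U" for t p
    unfolding B_def fst_conv snd_conv
    by (intro bounded_linear_Blinfun_apply bounded_linear_compose[OF bl[OF that]] bounded_linear_Pair
          bounded_linear_zero bounded_linear_ident)
  have contA: "continuous_on (I \<times> U) A"
  proof (rule continuous_on_blinfun_componentwise)
    fix i :: 'a
    show "continuous_on (I \<times> U) (\<lambda>x. blinfun_apply (A x) i)"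
      by (rule continuous_on_eq[OF contFD[of "(0, i, 0)"]]) (auto simp: A)
  qed
  have contB: "continuous_on (I \<times> U) B"
  proof (rule continuous_on_blinfun_componentwise)
    fix i :: 'b
    show "continuous_on (I \<times> U) (\<lambda>x. blinfun_apply (B x) i)"
      by (rule continuous_on_eq[OF contFD[of "(0, 0, i)"]]) (auto simp: B)
  qed
  have normB: "norm (blinfun_apply (B (t, p)) w) \<le> norm w / 4" if "t \<in> I" "p \<in> U" for t p w
    unfolding B[OF that]
    by (rule partial_derivative_bound[OF O(3) O(5)[OF that] der[OF that] O(7)])
  have nB: "norm (B (t, p)) \<le> 1 / 4" if "t \<in> I" "p \<in> U" for t p
    by (rule norm_blinfun_bound) (use normB[OF that] in auto)
  have clI': "compact (closure I')"
    using I'.bound_I by (auto simp: compact_closure bounded_iff intro!: exI[of _ 2])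
  have "compact (A ` (closure I' \<times> closure U'))"
    by (intro compact_continuous_image compact_Times clI' U'(2) continuous_on_subset[OF contA])
       (use I'(2) U'(3) in auto)
  then have "bounded (A ` (closure I' \<times> closure U'))" by (rule compact_imp_bounded)
  then obtain K0 where K0': "\<forall>y\<in>A ` (closure I' \<times> closure U'). norm y \<le> K0"
    unfolding bounded_iff by (elim exE)
  have K0: "norm (A x) \<le> K0" if "x \<in> closure I' \<times> closure U'" for x
    by (rule bspec[OF K0' imageI[OF that]])
  define K where "K = \<bar>K0\<bar>"
  have K: "norm (A (t, p)) \<le> K" if "t \<in> I'" "p \<in> U'" for t p
  proof -
    have "(t, p) \<in> closure I' \<times> closure U'"
      using that closure_subset[of I'] closure_subset[of U'] by blast
    from K0[OF this] show ?thesis by (simp add: K_def)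
  qed
  have K_nn: "K \<ge> 0" by (simp add: K_def)
  \<comment> \<open>At \<open>l = 0\<close> the right-hand side is \<open>A\<close>, bounded by
    \<open>K\<close>; since \<open>picard\<close> wants a quarter of the radius there, the radius is
    \<open>4 * K\<close>.\<close>
  have contF2: "continuous_on (I' \<times> U' \<times> cball 0 (4 * K)) (\<lambda>(t, p, l). A (t, p) + (B (t, p) o\<^sub>L l))"
    unfolding split_def
    by (intro continuous_intros continuous_on_compose2[OF contA] continuous_on_compose2[OF contB])
       (use I'I U'U in auto)
  obtain L where contL: "continuous_on (I' \<times> U') L"
    and normL: "\<And>t p. t \<in> I' \<Longrightarrow> p \<in> U' \<Longrightarrow> norm (L (t, p)) \<le> 4 * K"
    and eqL: "\<And>t p. t \<in> I' \<Longrightarrow> p \<in> U' \<Longrightarrow> L (t, p) = prim (\<lambda>s. A (s, p) + (B (s, p) o\<^sub>L L (s, p))) t"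
  proof (rule I'.picard[OF contF2])
    fix t p and z z' :: "'a \<Rightarrow>\<^sub>L 'b" assume tp: "t \<in> I'" "p \<in> U'"
    have "norm (B (t, p) o\<^sub>L (z - z')) \<le> norm (B (t, p)) * norm (z - z')"
      by (rule norm_blinfun_compose)
    also have "\<dots> \<le> 1 / 4 * norm (z - z')"
      by (rule mult_right_mono[OF nB]) (use tp I'I U'U in auto)
    finally show "norm ((case (t, p, z) of (t, p, l) \<Rightarrow> A (t, p) + (B (t, p) o\<^sub>L l)) -
           (case (t, p, z') of (t, p, l) \<Rightarrow> A (t, p) + (B (t, p) o\<^sub>L l))) \<le> norm (z - z') / 4"
      by (simp add: bounded_bilinear.diff_right[OF bounded_bilinear_blinfun_compose])
  qed (use K K_nn in \<open>auto simp: bounded_bilinear.zero_right[OF bounded_bilinear_blinfun_compose]\<close>)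
  have contLs: "continuous_on I' (\<lambda>s. L (s, p))" if "p \<in> U'" for p
    by (rule continuous_on_compose2[OF contL]) (use that in \<open>auto intro!: continuous_on_Pair continuous_on_id continuous_on_const\<close>)
  have contG: "continuous_on I' (\<lambda>s. A (s, p) + (B (s, p) o\<^sub>L L (s, p)))" if "p \<in> U'" for p
    by (intro continuous_intros contLs[OF that] continuous_on_compose2[OF contA] continuous_on_compose2[OF contB])
       (use that I'I U'U in \<open>auto intro!: continuous_on_Pair continuous_on_id continuous_on_const\<close>)
  have eqLv: "blinfun_apply (L (t, p)) v = prim (\<lambda>s. FD F (s, p, Z (s, p)) (0, v, blinfun_apply (L (s, p)) v)) t"
    if tp: "t \<in> I'" "p \<in> U'" for t p v
  proof -
    have "blinfun_apply (L (t, p)) v = t *\<^sub>R integral {0..1} (\<lambda>s. (A (s * t, p) + (B (s * t, p) o\<^sub>L L (s * t, p))) v)"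
      by (subst eqL[OF tp], simp only: prim_def blinfun.scaleR_left)
         (subst blinfun_apply_integral, rule integrable_continuous_interval[OF I'.continuous_scaled[OF contG[OF tp(2)] tp(1)]], rule refl)
    also have "\<dots> = prim (\<lambda>s. (A (s, p) + (B (s, p) o\<^sub>L L (s, p))) v) t" by (simp add: prim_def)
    also have "\<dots> = prim (\<lambda>s. FD F (s, p, Z (s, p)) (0, v, blinfun_apply (L (s, p)) v)) t"
      by (rule I'.prim_cong[OF tp(1)])
         (use tp I'I U'U in \<open>simp add: blinfun.add_left A B FDadd[of _ _ v "blinfun_apply _ v"]\<close>)
    finally show ?thesis .
  qed
  have derL: "((\<lambda>p. Z (t, p)) has_derivative blinfun_apply (L (t, p))) (at p)" if tp: "t \<in> I'" "p \<in> U'" for t p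
    unfolding has_derivative_at_alt
  proof (intro conjI allI impI)
    show "bounded_linear (blinfun_apply (L (t, p)))" by (rule blinfun.bounded_linear_right)
    fix e :: real assume e: "e > 0"
    \<comment> \<open>The 8 is the factor 4 of \<open>self_bound\<close> times the factor 2 of the
      integration; \<open>1 + 4 * K\<close> arises because the increment of \<open>Z\<close> in the
      remainder \<open>E\<close> is at most \<open>norm (R s) + 4 * K * norm h\<close>.\<close>
    define C where "C = 8 * (1 + 4 * K)"
    have C: "C > 0" using K_nn by (simp add: C_def)
    define e' where "e' = min (e / C) (1 / 8)"
    have e': "e' > 0" "e' \<le> 1 / 8" "e' * C \<le> e"
      using e C by (simp_all add: e'_def min_def field_simps)
    define K1 where "K1 = (\<lambda>s. (s, p, Z (s, p))) ` closure I'"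
    have contZp: "continuous_on I (\<lambda>s. Z (s, p))"
      by (rule continuous_on_compose2[OF O(4)]) (use U'U tp in \<open>auto intro!: continuous_on_Pair continuous_on_id continuous_on_const\<close>)
    have K1: "compact K1" "K1 \<subseteq> W"
      unfolding K1_def
      by (intro compact_continuous_image clI' continuous_intros continuous_on_subset[OF contZp] I'(2))
         (use I'(2) O(5) U'U tp in auto)
    obtain d where d: "d > 0" "\<And>x y. x \<in> K1 \<Longrightarrow> norm (y - x) < d \<Longrightarrow>
        norm (F y - F x - FD F x (y - x)) \<le> e' * norm (y - x)"
      using uniform_derivative[OF O(3) F K1 e'(1)] by blast
    have "uniformly_continuous_on (closure I' \<times> closure U') Z"
      by (intro compact_uniformly_continuous compact_Times clI' U'(2) continuous_on_subset[OF O(4)])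
         (use I'(2) U'(3) in auto)
    then obtain d1 where d1: "d1 > 0" "\<And>x y. x \<in> closure I' \<times> closure U' \<Longrightarrow> y \<in> closure I' \<times> closure U' \<Longrightarrow>
        dist y x < d1 \<Longrightarrow> dist (Z y) (Z x) < d / 2"
      unfolding uniformly_continuous_on_def using d(1) by (metis half_gt_zero)
    obtain d2 where d2: "d2 > 0" "ball p d2 \<subseteq> U'" using U'(1) tp(2) open_contains_ball by blast
    show "\<exists>d>0. \<forall>y. norm (y - p) < d \<longrightarrow> norm (Z (t, y) - Z (t, p) - blinfun_apply (L (t, p)) (y - p)) \<le> e * norm (y - p)"
    proof (intro exI[of _ "min (d / 2) (min d1 d2)"] conjI allI impI)
      show "0 < min (d / 2) (min d1 d2)" using d d1 d2 by simp
      fix q assume q: "norm (q - p) < min (d / 2) (min d1 d2)"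
      define h where "h = q - p"
      have qU': "q \<in> U'" using q d2(2) by (auto simp: dist_norm norm_minus_commute)
      have qp: "q \<in> U" "p \<in> U" using qU' tp U'U by auto
      define \<Delta> where "\<Delta> = (\<lambda>s. Z (s, q) - Z (s, p))"
      define R where "R = (\<lambda>s. \<Delta> s - blinfun_apply (L (s, p)) h)"
      define E where "E = (\<lambda>s. F (s, q, Z (s, q)) - F (s, p, Z (s, p)) - FD F (s, p, Z (s, p)) (0, h, \<Delta> s))"
      have \<Delta>d: "norm (\<Delta> s) < d / 2" if "s \<in> I'" for s
      proof -
        have "dist (Z (s, q)) (Z (s, p)) < d / 2"
          by (rule d1(2)) (use that qU' tp q in \<open>auto simp: dist_Pair_Pair dist_norm intro!: subsetD[OF closure_subset]\<close>)
        then show ?thesis by (simp add: \<Delta>_def dist_norm)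
      qed
      have E: "norm (E s) \<le> e' * (norm h + norm (\<Delta> s))" if "s \<in> I'" for s
      proof -
        have diff: "(s, q, Z (s, q)) - (s, p, Z (s, p)) = (0, h, \<Delta> s)" by (simp add: h_def \<Delta>_def)
        have n: "norm (0 :: real, h, \<Delta> s) \<le> norm h + norm (\<Delta> s)"
          using norm_Pair_le[of "0 :: real" "(h, \<Delta> s)"] norm_Pair_le[of h "\<Delta> s"] by simp
        have "norm h < d / 2" using q by (simp add: h_def)
        then have "norm ((s, q, Z (s, q)) - (s, p, Z (s, p))) < d"
          unfolding diff using n \<Delta>d[OF that] by linarith
        moreover have "(s, p, Z (s, p)) \<in> K1" using that closure_subset unfolding K1_def by blast
        ultimately have "norm (E s) \<le> e' * norm (0 :: real, h, \<Delta> s)"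
          using d(2)[of "(s, p, Z (s, p))" "(s, q, Z (s, q))"] unfolding diff E_def by blast
        then show ?thesis using n e'(1) by (meson mult_left_mono less_imp_le order_trans)
      qed
      have cont1: "continuous_on I' (\<lambda>s. F (s, q, Z (s, q)))" if "q \<in> U" for q
        by (rule continuous_on_compose2[OF Ck_on_imp_continuous_on[OF F]])
           (use that O(5) I'I in \<open>auto intro!: continuous_intros continuous_on_compose2[OF O(4)]\<close>)
      have cont2: "continuous_on I' (\<lambda>s. FD F (s, p, Z (s, p)) (0, h, blinfun_apply (L (s, p)) h))"
      proof (rule continuous_on_eq)
        show "continuous_on I' (\<lambda>s. blinfun_apply (A (s, p) + (B (s, p) o\<^sub>L L (s, p))) h)"
          by (rule bounded_linear.continuous_on[OF blinfun.bounded_linear_left contG[OF tp(2)]])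
      qed (use tp I'I U'U in \<open>simp add: blinfun.add_left A B FDadd[of _ _ h "blinfun_apply _ h"]\<close>)
      have Req: "R s = prim (\<lambda>s. F (s, q, Z (s, q)) - F (s, p, Z (s, p)) -
            FD F (s, p, Z (s, p)) (0, h, blinfun_apply (L (s, p)) h)) s" if "s \<in> I'" for s
        unfolding R_def \<Delta>_def
        using O(6)[OF I'I[OF that] qp(1)] O(6)[OF I'I[OF that] qp(2)] eqLv[OF that tp(2), of h]
          I'.prim_diff[OF cont1[OF qp(1)] cont1[OF qp(2)] that]
          I'.prim_diff[OF continuous_on_diff[OF cont1[OF qp(1)] cont1[OF qp(2)]] cont2 that]
        by simp
      \<comment> \<open>The linear part in the unknown contributes \<open>m / 4\<close>; the Taylor
        remainder contributes at most \<open>m / 8\<close>, by the cap on \<open>e'\<close>, and a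
        multiple of \<open>norm h\<close>. Doubled by the integration, \<open>3 / 8\<close> becomes
        the \<open>3 / 4\<close> of \<open>self_bound\<close>.\<close>
      have bound: "norm (F (s, q, Z (s, q)) - F (s, p, Z (s, p)) - FD F (s, p, Z (s, p)) (0, h, blinfun_apply (L (s, p)) h))
          \<le> 3 / 8 * m + e' * ((1 + 4 * K) * norm h)" if s: "s \<in> I'" and m: "norm (R s) \<le> m" for s m
      proof -
        have "FD F (s, p, Z (s, p)) (0, h, \<Delta> s) - FD F (s, p, Z (s, p)) (0, h, blinfun_apply (L (s, p)) h) =
            FD F (s, p, Z (s, p)) ((0, h, \<Delta> s) - (0, h, blinfun_apply (L (s, p)) h))"
          by (rule linear_diff[OF bounded_linear.linear[OF bl], symmetric]) (use I'I[OF s] qp in auto)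
        also have "\<dots> = blinfun_apply (B (s, p)) (R s)" by (simp add: B[OF I'I[OF s] qp(2)] R_def)
        finally have eq: "F (s, q, Z (s, q)) - F (s, p, Z (s, p)) - FD F (s, p, Z (s, p)) (0, h, blinfun_apply (L (s, p)) h) =
            E s + blinfun_apply (B (s, p)) (R s)" by (simp add: E_def algebra_simps)
        have LK: "norm (blinfun_apply (L (s, p)) h) \<le> 4 * K * norm h"
          using norm_blinfun[of "L (s, p)" h] normL[OF s tp(2)] mult_right_mono[OF _ norm_ge_zero]
            order_trans by blast
        have "norm (\<Delta> s) \<le> norm (R s) + norm (blinfun_apply (L (s, p)) h)"
          unfolding R_def by (metis add.commute norm_triangle_sub)
        then have "norm (\<Delta> s) \<le> m + 4 * K * norm h" using m LK by linarith
        then have "norm (E s) \<le> e' * (norm h + (m + 4 * K * norm h))"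
          using E[OF s] e'(1) by (meson add_left_mono less_imp_le mult_left_mono order_trans)
        moreover have "norm (blinfun_apply (B (s, p)) (R s)) \<le> m / 4"
          using normB[OF I'I[OF s] qp(2), of "R s"] m by linarith
        moreover have "e' * m \<le> 1 / 8 * m"
          using e'(2) order_trans[OF norm_ge_zero m] by (rule mult_right_mono)
        ultimately show ?thesis
          unfolding eq using norm_triangle_ineq[of "E s" "blinfun_apply (B (s, p)) (R s)"]
          by (simp add: algebra_simps)
      qed
      have "norm (R t) \<le> 4 * (2 * (e' * ((1 + 4 * K) * norm h)))"
      proof (rule I'.self_bound)
        show "norm (R s) \<le> d / 2 + 4 * K * norm h" if "s \<in> I'" for s
        proof -
          have "norm (blinfun_apply (L (s, p)) h) \<le> 4 * K * norm h"
            using norm_blinfun[of "L (s, p)" h] normL[OF that tp(2)] mult_right_mono[OF _ norm_ge_zero]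
              order_trans by blast
          then show ?thesis unfolding R_def using \<Delta>d[OF that]
            using norm_triangle_ineq4[of "\<Delta> s" "blinfun_apply (L (s, p)) h"] by linarith
        qed
        fix s m assume s: "s \<in> I'" and m: "0 \<le> m" "\<And>s. s \<in> I' \<Longrightarrow> norm (R s) \<le> m"
        have "norm (R s) \<le> 2 * (3 / 8 * m + e' * ((1 + 4 * K) * norm h))"
          unfolding Req[OF s]
          by (rule I'.prim_bound[OF continuous_on_diff[OF continuous_on_diff[OF cont1[OF qp(1)] cont1[OF qp(2)]] cont2] s])
             (rule bound[OF _ m(2)])
        then show "norm (R s) \<le> 2 * (e' * ((1 + 4 * K) * norm h)) + 3 / 4 * m" by simp
      qed (rule tp(1))
      also have "\<dots> = e' * C * norm h" by (simp add: C_def)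
      also have "\<dots> \<le> e * norm h" using e'(3) by (rule mult_right_mono) simp
      finally show "norm (Z (t, q) - Z (t, p) - blinfun_apply (L (t, p)) (q - p)) \<le> e * norm (q - p)"
        by (simp add: R_def \<Delta>_def h_def)
    qed
  qed
  show ?thesis by (rule that[OF contL derL eqLv])
qed


lemma (in time_interval) cofinal_interval:
  assumes "t \<in> I"
  obtains I' where "time_interval I'" "closure I' \<subseteq> I" "t \<in> I'"
proof -
  obtain c d where cd: "c < 0" "c < t" "0 < d" "t < d" "{c..d} \<subseteq> I" using sub_interval[OF assms] by blast
  have "\<bar>u\<bar> \<le> 2" if "u \<in> {c<..<d}" for u
    by (rule bound_I[OF subsetD[OF cd(5)]]) (use that in auto)
  then have "time_interval {c<..<d}"
    by unfold_locales (use cd in auto)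
  moreover have "closure {c<..<d} \<subseteq> I" using cd by (simp add: closure_greaterThanLessThan)
  ultimately show ?thesis using that cd by auto
qed

text \<open>The derivative of \<open>Z\<close> in a parameter direction solves an equation of the
  same class, whose right-hand side is built from \<open>Z\<close> and first derivatives of
  \<open>F\<close> and is therefore of class \<open>k\<close> by induction. Hence the induction is
  over all equations and solutions simultaneously. The time derivative is \<open>F\<close> along the
  solution.\<close>

lemma param_ode_Ck:
  assumes "param_ode I U W F Z" "Ck_on k W F"
  shows "Ck_on k (I \<times> U) Z"
  using assms
proof (induction k arbitrary: I U W F Z)
  case 0
  then show ?case by (simp add: param_odeD(4))
next
  case (Suc k)
  note O = param_odeD[OF Suc.prems(1)] and F = Suc.prems(2)
  interpret I: time_interval I by (rule O(1))
  have Zk: "Ck_on k (I \<times> U) Z" by (rule Suc.IH[OF Suc.prems(1) Ck_on_pred[OF F]])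
  have F1: "Ck_on (Suc 0) W F" by (rule Ck_on_mono[OF F]) simp
  have oIU: "open (I \<times> U)" by (rule open_Times[OF I.open_I O(2)])
  show ?case
  proof (rule Ck_on_local)
    fix x assume "x \<in> I \<times> U"
    then obtain t0 p0 where x: "x = (t0, p0)" "t0 \<in> I" "p0 \<in> U" by blast
    obtain I' where I': "time_interval I'" "closure I' \<subseteq> I" "t0 \<in> I'" using I.cofinal_interval[OF x(2)] by blast
    interpret I': time_interval I' by (rule I'(1))
    obtain r where r: "r > 0" "cball p0 r \<subseteq> U" using O(2) x(3) open_contains_cball by blast
    define U' where "U' = ball p0 r"
    have U': "open U'" "compact (closure U')" "closure U' \<subseteq> U" "p0 \<in> U'" "convex U'"
      using r by (auto simp: U'_def)
    have I'I: "t \<in> I" if "t \<in> I'" for t using that I'(2) closure_subset by blast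
    have U'U: "p \<in> U" if "p \<in> U'" for p using that U'(3) closure_subset by blast
    obtain L where contL: "continuous_on (I' \<times> U') L"
      and derL: "\<And>t p. t \<in> I' \<Longrightarrow> p \<in> U' \<Longrightarrow> ((\<lambda>p. Z (t, p)) has_derivative blinfun_apply (L (t, p))) (at p)"
      and eqL: "\<And>t p v. t \<in> I' \<Longrightarrow> p \<in> U' \<Longrightarrow>
       blinfun_apply (L (t, p)) v = prim (\<lambda>s. FD F (s, p, Z (s, p)) (0, v, blinfun_apply (L (s, p)) v)) t"
      using param_ode_derivative[OF Suc.prems(1) F1 I'(1,2) U'(1-3)] by blast
    have oI'U': "open (I' \<times> U')" by (rule open_Times[OF I'.open_I U'(1)])
    have Zk': "Ck_on k (I' \<times> U') Z" by (rule Ck_on_subset[OF Zk]) (use I'I U'U in auto)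
    have fst': "Ck_on k S (\<lambda>x. fst x)" "Ck_on k S (\<lambda>x. snd x)" for S :: "('x::real_normed_vector \<times> 'y::real_normed_vector) set"
      by (auto intro: Ck_on_bounded_linear bounded_linear_fst bounded_linear_snd)
    have Pair: "Ck_on k S (\<lambda>x. (f x, g x))" if "open S" "Ck_on k S f" "Ck_on k S g"
      for S :: "'x::real_normed_vector set" and f :: "'x \<Rightarrow> 'y::real_normed_vector" and g :: "'x \<Rightarrow> 'z::real_normed_vector"
    proof -
      have "Ck_on k S (\<lambda>x. (f x, 0) + (0, g x))"
        by (rule Ck_on_add[OF that(1)]; rule Ck_on_linear_comp[OF _ _ that(1)])
           (use that in \<open>auto intro!: bounded_linear_Pair bounded_linear_zero bounded_linear_ident\<close>)
      then show ?thesis by simp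
    qed
    have graph: "Ck_on k (I' \<times> U') (\<lambda>x. (fst x, snd x, Z x))"
      by (intro Pair oI'U' fst' Zk')
    have Lk: "Ck_on k (I' \<times> U') (\<lambda>x. blinfun_apply (L x) v)" for v
    proof -
      \<comment> \<open>Affine in the unknown \<open>l\<close>, with linear part bounded by
        \<open>1/4\<close>, so its domain can be unbounded in \<open>l\<close>.\<close>
      define F' where "F' = (\<lambda>(t, p, l). FD F (t, p, Z (t, p)) (0, v, l))"
      have bl: "bounded_linear (FD F (t, p, Z (t, p)))" if "t \<in> I'" "p \<in> U'" for t p
        by (rule has_derivative_bounded_linear[OF Ck_on_has_derivative[OF F1 O(5)]]) (use that I'I U'U in auto)
      have "param_ode I' U' (I' \<times> U' \<times> UNIV) F' (\<lambda>x. blinfun_apply (L x) v)"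
        unfolding param_ode_def
      proof (intro conjI ballI allI impI)
        show "open (I' \<times> U' \<times> (UNIV :: 'b set))" by (intro open_Times I'.open_I U'(1) open_UNIV)
        show "continuous_on (I' \<times> U') (\<lambda>x. blinfun_apply (L x) v)"
          by (intro continuous_intros contL)
        show "blinfun_apply (L (t, p)) v = prim (\<lambda>s. F' (s, p, blinfun_apply (L (s, p)) v)) t"
          if "t \<in> I'" "p \<in> U'" for t p
          unfolding F'_def using eqL[OF that] by simp
        fix t p and z z' :: 'b assume "(t, p, z) \<in> I' \<times> U' \<times> UNIV"
        then have tp: "t \<in> I'" "p \<in> U'" "t \<in> I" "p \<in> U" using I'I U'U by auto
        have "F' (t, p, z) - F' (t, p, z') = FD F (t, p, Z (t, p)) (0, 0, z - z')"
          using linear_diff[OF bounded_linear.linear[OF bl[OF tp(1,2)]], of "(0, v, z)" "(0, v, z')"]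
          by (simp add: F'_def)
        then show "norm (F' (t, p, z) - F' (t, p, z')) \<le> norm (z - z') / 4"
          using partial_derivative_bound[OF O(3) O(5)[OF tp(3,4)] Ck_on_has_derivative[OF F1 O(5)[OF tp(3,4)]] O(7), of "z - z'"]
          by simp
      qed (use I'(1) U'(1) in auto)
      moreover have "Ck_on k (I' \<times> U' \<times> UNIV) F'"
      proof -
        have o: "open (I' \<times> U' \<times> (UNIV :: 'b set))" by (intro open_Times I'.open_I U'(1) open_UNIV)
        have tp: "Ck_on k (I' \<times> U' \<times> (UNIV :: 'b set)) (\<lambda>x. (fst x, fst (snd x)))"
          by (intro Ck_on_bounded_linear bounded_linear_Pair bounded_linear_fst
                bounded_linear_compose[OF bounded_linear_fst bounded_linear_snd])
        have g3: "Ck_on k (I' \<times> U' \<times> (UNIV :: 'b set)) (\<lambda>x. (fst x, fst (snd x), Z (fst x, fst (snd x))))"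
        proof -
          have "(\<lambda>x. (fst x, fst (snd x))) ` (I' \<times> U' \<times> (UNIV :: 'b set)) \<subseteq> I' \<times> U'" by auto
          from Ck_on_compose[OF o tp graph oI'U' this] show ?thesis by simp
        qed
        have FDb: "Ck_on k (I' \<times> U' \<times> (UNIV :: 'b set)) (\<lambda>x. FD F (fst x, fst (snd x), Z (fst x, fst (snd x))) b)" for b
        proof -
          have "Ck_on k W (\<lambda>x. FD F x b)" using F by (simp only: Ck_on.simps)
          moreover have "(\<lambda>x. (fst x, fst (snd x), Z (fst x, fst (snd x)))) ` (I' \<times> U' \<times> (UNIV :: 'b set)) \<subseteq> W"
            using O(5) I'I U'U by auto
          ultimately show ?thesis using Ck_on_compose[OF o g3 _ O(3)] by blast
        qed
        have h: "Ck_on k (I' \<times> U' \<times> (UNIV :: 'b set)) (\<lambda>x. (0 :: real, v, snd (snd x)))"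
          by (intro Pair o Ck_on_const Ck_on_bounded_linear bounded_linear_compose[OF bounded_linear_snd bounded_linear_snd])
        have "Ck_on k (I' \<times> U' \<times> (UNIV :: 'b set))
            (\<lambda>x. \<Sum>b\<in>Basis. ((0 :: real, v, snd (snd x)) \<bullet> b) *\<^sub>R FD F (fst x, fst (snd x), Z (fst x, fst (snd x))) b)"
          by (intro Ck_on_sum[OF o] Ck_on_bilinear[OF bounded_bilinear_scaleR o] FDb
                Ck_on_bilinear[OF bounded_bilinear_inner o] h Ck_on_const)
        then show ?thesis
        proof (rule Ck_on_cong[OF o, rotated])
          fix x :: "real \<times> 'a \<times> 'b" assume "x \<in> I' \<times> U' \<times> UNIV"
          then obtain t p l where tpl: "x = (t, p, l)" "t \<in> I'" "p \<in> U'" by blast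
          interpret bounded_linear "FD F (t, p, Z (t, p))" by (rule bl[OF tpl(2,3)])
          have "F' x = FD F (t, p, Z (t, p)) (\<Sum>b\<in>Basis. ((0, v, l) \<bullet> b) *\<^sub>R b)"
            by (simp only: euclidean_representation) (simp add: F'_def tpl)
          also have "\<dots> = (\<Sum>b\<in>Basis. ((0, v, l) \<bullet> b) *\<^sub>R FD F (t, p, Z (t, p)) b)"
            by (simp only: sum scaleR)
          finally show "(\<Sum>b\<in>Basis. ((0 :: real, v, snd (snd x)) \<bullet> b) *\<^sub>R FD F (fst x, fst (snd x), Z (fst x, fst (snd x))) b) = F' x"
            by (simp add: tpl)
        qed
      qed
      ultimately show ?thesis by (rule Suc.IH)
    qed
    have contZp: "continuous_on I' (\<lambda>s. F (s, p, Z (s, p)))" if "p \<in> U'" for p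
      by (rule continuous_on_compose2[OF Ck_on_imp_continuous_on[OF F]])
         (use that O(5) I'I U'U in \<open>auto intro!: continuous_intros continuous_on_compose2[OF O(4)]\<close>)
    have "Ck_on (Suc k) (I' \<times> U') Z"
    proof (rule Ck_on_SucI[OF oI'U', where f' = "\<lambda>x h. fst h *\<^sub>R F (fst x, snd x, Z x) + blinfun_apply (L x) (snd h)"])
      fix x assume "x \<in> I' \<times> U'"
      then obtain t p where tp: "x = (t, p)" "t \<in> I'" "p \<in> U'" by blast
      have "((\<lambda>t. Z (t, p)) has_vector_derivative F (t, p, Z (t, p))) (at t)"
      proof (rule has_vector_derivative_transform_within_open[OF I'.prim_derivative[OF contZp[OF tp(3)] tp(2)] I'.open_I tp(2)])
        show "prim (\<lambda>s. F (s, p, Z (s, p))) s = Z (s, p)" if "s \<in> I'" for s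
          using O(6)[OF I'I[OF that] U'U[OF tp(3)]] by simp
      qed
      then have "((\<lambda>t. Z (t, p)) has_derivative (\<lambda>h. h *\<^sub>R F (t, p, Z (t, p)))) (at t within I')"
        by (simp add: has_vector_derivative_def has_derivative_at_withinI)
      \<comment> \<open>A time derivative and a continuous parameter derivative combine to the total
        derivative.\<close>
      from has_derivative_partialsI[where f = "\<lambda>t p. Z (t, p)" and fy = "\<lambda>t p. L (t, p)" and X = I' and Y = U', OF this]
      have "((\<lambda>(t, p). Z (t, p)) has_derivative (\<lambda>(h, v). h *\<^sub>R F (t, p, Z (t, p)) + blinfun_apply (L (t, p)) v)) (at (t, p) within I' \<times> U')"
        using derL contL tp U'(5) by (auto simp: continuous_on_eq_continuous_within has_derivative_at_withinI)
      then show "(Z has_derivative (\<lambda>h. fst h *\<^sub>R F (fst x, snd x, Z x) + blinfun_apply (L x) (snd h))) (at x)"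
        using tp by (simp add: split_def at_within_open[OF _ oI'U'])
    next
      fix h :: "real \<times> 'a"
      have "Ck_on k (I' \<times> U') (\<lambda>x. F (fst x, snd x, Z x))"
        by (rule Ck_on_compose[OF oI'U' graph Ck_on_pred[OF F] O(3)]) (use O(5) I'I U'U in auto)
      then show "Ck_on k (I' \<times> U') (\<lambda>x. fst h *\<^sub>R F (fst x, snd x, Z x) + blinfun_apply (L x) (snd h))"
        by (intro Ck_on_add[OF oI'U'] Lk Ck_on_bilinear[OF bounded_bilinear_scaleR oI'U'] Ck_on_const)
    qed
    then show "\<exists>T. open T \<and> x \<in> T \<and> Ck_on (Suc k) T Z"
      using oI'U' x I'(3) U'(4) by blast
  qed
qed

text \<open>The tube lemma around the compact slice \<open>T \<times> {a}\<close>, on which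
  \<open>g\<close> is constant.\<close>

lemma compact_uniform_small:
  fixes g :: "'t::metric_space \<times> 'x::metric_space \<Rightarrow> 'y::metric_space"
  assumes "compact T" "open V" "a \<in> V" "continuous_on (T \<times> V) g" "\<And>t. t \<in> T \<Longrightarrow> g (t, a) = b" "e > 0"
  obtains d where "d > 0" "ball a d \<subseteq> V" "\<And>t x. t \<in> T \<Longrightarrow> x \<in> ball a d \<Longrightarrow> dist (g (t, x)) b \<le> e"
proof -
  have "continuous_on (V \<times> T) (\<lambda>(x, t). g (t, x))"
    unfolding split_def
    by (rule continuous_on_compose2[OF assms(4)]) (intro continuous_intros, auto)
  from continuous_on_prod_compactE[OF this assms(1,3,6)]
  obtain X0 where X0: "a \<in> X0" "open X0" "\<forall>x\<in>X0 \<inter> V. \<forall>t\<in>T. dist (g (t, x)) (g (t, a)) \<le> e"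
    unfolding split_beta fst_conv snd_conv by metis
  have "open (X0 \<inter> V)" "a \<in> X0 \<inter> V" using X0 assms(2,3) by auto
  then obtain d where d: "d > 0" "ball a d \<subseteq> X0 \<inter> V"
    using open_contains_ball by blast
  show ?thesis
  proof (rule that[OF d(1)])
    show "ball a d \<subseteq> V" using d(2) by blast
    fix t x assume t: "t \<in> T" and "x \<in> ball a d"
    then have "x \<in> X0 \<inter> V" using d(2) by blast
    from bspec[OF bspec[OF X0(3) this] t] show "dist (g (t, x)) b \<le> e"
      by (simp only: assms(5)[OF t])
  qed
qed

text \<open>\<open>F\<close> and its derivative in the unknown vanish at the origin at all times, so
  they are small near it, uniformly over a compact time interval. On a small cylinder the Lipschitz
  constant is then at most \<open>1/4\<close>, and \<open>F (t, p, 0)\<close> at most a quarter of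
  the radius, which is what \<open>picard\<close> and \<open>param_ode\<close> ask for.\<close>

theorem parametrized_flow:
  fixes F :: "real \<times> 'p::euclidean_space \<times> 'e::euclidean_space \<Rightarrow> 'e"
  assumes R: "R > 0" and F: "smooth_on ({-1<..<2} \<times> ball 0 R \<times> ball 0 R) F"
    and F0: "\<And>t. t \<in> {-1<..<2} \<Longrightarrow> F (t, 0, 0) = 0"
    and DF0: "\<And>t w. t \<in> {-1<..<2} \<Longrightarrow> FD F (t, 0, 0) (0, 0, w) = 0"
  obtains \<rho> Z where "0 < \<rho>" "\<rho> \<le> R" "smooth_on (ball 0 \<rho>) (\<lambda>p. Z (1, p))"
    "\<And>t p. t \<in> {0..1} \<Longrightarrow> p \<in> ball 0 \<rho> \<Longrightarrow> norm (Z (t, p)) < R"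
    "\<And>p. Z (0, p) = 0"
    "\<And>t. t \<in> {0..1} \<Longrightarrow> Z (t, 0) = 0"
    "\<And>t p. t \<in> {0..1} \<Longrightarrow> p \<in> ball 0 \<rho> \<Longrightarrow>
       ((\<lambda>t. Z (t, p)) has_vector_derivative F (t, p, Z (t, p))) (at t)"
    "\<And>t p. t \<in> {0..1} \<Longrightarrow> p \<in> ball 0 \<rho> \<Longrightarrow> (\<lambda>p. Z (t, p)) differentiable (at p)"
    "\<And>t p v. t \<in> {0..1} \<Longrightarrow> p \<in> ball 0 \<rho> \<Longrightarrow>
       ((\<lambda>t. FD (\<lambda>p. Z (t, p)) p v) has_vector_derivative
         FD F (t, p, Z (t, p)) (0, v, FD (\<lambda>p. Z (t, p)) p v)) (at t)"
proof -
  \<comment> \<open>Nested intervals around \<open>{0..1}\<close>: \<open>T\<close> is compact for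
    the uniform estimates, the solution lives on \<open>I\<close>, and its parameter derivative on
    \<open>J\<close>, whose closure lies in \<open>I\<close>.\<close>
  define T where "T = {-1/2..3/2 :: real}"
  define I where "I = {-1/2<..<3/2 :: real}"
  define J where "J = {-1/4<..<5/4 :: real}"
  define W0 where "W0 = {-1<..<2 :: real} \<times> ball (0 :: 'p) R \<times> ball (0 :: 'e) R"
  have T: "compact T" "T \<subseteq> {-1<..<2}" "I \<subseteq> T" by (auto simp: T_def I_def)
  have I: "time_interval I" and J: "time_interval J" "closure J \<subseteq> I"
    by (unfold_locales) (auto simp: I_def J_def closure_greaterThanLessThan)
  interpret I: time_interval I by (rule I)
  interpret J: time_interval J by (rule J)
  note F = F[folded W0_def]
  have der: "(F has_derivative FD F x) (at x)" if "x \<in> W0" for x by (rule smooth_on_has_derivative[OF F that])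
  define B where "B = (\<lambda>x. Blinfun (\<lambda>w. FD F x (0, 0, w)))"
  have B: "blinfun_apply (B x) = (\<lambda>w. FD F x (0, 0, w))" if "x \<in> W0" for x
    unfolding B_def
    by (intro bounded_linear_Blinfun_apply bounded_linear_compose[OF has_derivative_bounded_linear[OF der[OF that]]]
          bounded_linear_Pair bounded_linear_zero bounded_linear_ident)
  have contB: "continuous_on W0 B"
  proof (rule continuous_on_blinfun_componentwise)
    fix i :: 'e
    show "continuous_on W0 (\<lambda>x. blinfun_apply (B x) i)"
      by (rule continuous_on_eq[OF smooth_on_imp_continuous_on[OF smooth_on_FD[OF F, of "(0, 0, i)"]]]) (simp add: B)
  qed
  have oRR: "open (ball (0 :: 'p) R \<times> ball (0 :: 'e) R)" by (rule open_Times[OF open_ball open_ball])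
  have z0: "(0 :: 'p \<times> 'e) \<in> ball 0 R \<times> ball 0 R" using R by (simp add: zero_prod_def)
  have contBT: "continuous_on (T \<times> (ball 0 R \<times> ball 0 R)) B"
    by (rule continuous_on_subset[OF contB]) (use T in \<open>auto simp: W0_def\<close>)
  have B0: "B (t, 0) = 0" if "t \<in> T" for t
    by (rule blinfun_eqI) (use that T DF0 R in \<open>auto simp: B W0_def zero_prod_def\<close>)
  obtain d where d: "d > 0" "ball 0 d \<subseteq> ball (0 :: 'p) R \<times> ball (0 :: 'e) R"
      "\<And>t x. t \<in> T \<Longrightarrow> x \<in> ball 0 d \<Longrightarrow> dist (B (t, x)) 0 \<le> 1 / 4"
    by (rule compact_uniform_small[where e = "1 / 4", OF T(1) oRR z0 contBT B0]) auto
  \<comment> \<open>If \<open>norm p \<le> r\<close> and \<open>norm z < 2 * r\<close>, then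
    \<open>(p, z)\<close> has norm below \<open>d\<close>. The open ball of radius
    \<open>2 * r\<close> serves as domain of the equation, while the solution stays in the closed
    ball of radius \<open>r\<close>.\<close>
  define r where "r = min (d / 4) (R / 2)"
  have r: "r > 0" "r < R" using d R by (auto simp: r_def)
  have near: "(p, z) \<in> ball 0 d" if "norm p \<le> r" "norm z < 2 * r" for p :: 'p and z :: 'e
  proof -
    have "r \<le> d / 4" by (simp add: r_def)
    then have "norm (p, z) < d" using norm_Pair_le[of p z] that r by linarith
    then show ?thesis by (simp only: mem_ball_0)
  qed
  have lip: "norm (F (t, p, z) - F (t, p, z')) \<le> norm (z - z') / 4"
    if t: "t \<in> I" and p: "norm p \<le> r" and z: "norm z < 2 * r" "norm z' < 2 * r" for t p z z'
  proof -
    have "norm (F (t, p, z) - F (t, p, z')) \<le> 1 / 4 * norm (z - z')"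
    proof (rule differentiable_bound[where S = "ball 0 (2 * r)" and f' = "\<lambda>z. blinfun_apply (B (t, p, z))" and f = "\<lambda>z. F (t, p, z)"])
      fix y :: 'e assume y: "y \<in> ball 0 (2 * r)"
      have in0: "(p, y) \<in> ball 0 d" using near p y by simp
      then have W0: "(t, p, y) \<in> W0" using d(2) t T by (auto simp: W0_def)
      have "((\<lambda>z. (t, p, z)) has_derivative (\<lambda>w. (0, 0, w))) (at y)" by (auto intro!: derivative_eq_intros)
      from has_derivative_compose[OF this der[OF W0]]
      show "((\<lambda>z. F (t, p, z)) has_derivative blinfun_apply (B (t, p, y))) (at y within ball 0 (2 * r))"
        by (simp add: B[OF W0] has_derivative_at_withinI)
      show "onorm (blinfun_apply (B (t, p, y))) \<le> 1 / 4"
        using d(3)[OF _ in0, of t] t T by (auto simp: norm_blinfun.rep_eq)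
    qed (use z in auto)
    then show ?thesis by simp
  qed
  have contF0: "continuous_on (T \<times> ball 0 R) (\<lambda>x. F (fst x, snd x, 0))"
    by (rule continuous_on_compose2[OF smooth_on_imp_continuous_on[OF F]])
       (use T R in \<open>auto simp: W0_def intro!: continuous_intros\<close>)
  have FT0: "F (fst (t, 0), snd (t, 0), 0) = 0" if "t \<in> T" for t
    unfolding fst_conv snd_conv by (rule F0[OF subsetD[OF T(2) that]])
  have r4: "r / 4 > 0" and 0: "0 \<in> ball (0 :: 'p) R" using r R by auto
  obtain d' where d': "d' > 0" "ball 0 d' \<subseteq> ball (0 :: 'p) R"
      "\<And>t x. t \<in> T \<Longrightarrow> x \<in> ball 0 d' \<Longrightarrow> dist (F (t, x, 0)) 0 \<le> r / 4"
    using compact_uniform_small[OF T(1) open_ball 0 contF0 FT0 r4] unfolding fst_conv snd_conv by blast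
  define U where "U = ball (0 :: 'p) (min d' r)"
  have U: "norm p \<le> r" "norm p < r" "p \<in> ball 0 d'" if "p \<in> U" for p using that by (auto simp: U_def)
  define W where "W = I \<times> U \<times> ball (0 :: 'e) (2 * r)"
  have oW: "open W" by (simp add: W_def U_def I_def open_Times)
  have WW0: "W \<subseteq> W0"
  proof -
    have "(p, z) \<in> ball 0 R \<times> ball 0 R" if "p \<in> U" "norm z < 2 * r" for p and z :: 'e
      using near[OF U(1)[OF that(1)] that(2)] d(2) by blast
    then show ?thesis using T by (auto simp: W_def W0_def)
  qed
  have contF: "continuous_on (I \<times> U \<times> cball 0 r) F"
    by (rule continuous_on_subset[OF smooth_on_imp_continuous_on[OF smooth_on_subset[OF F WW0]]])
       (use r in \<open>auto simp: W_def\<close>)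
  obtain Z where Z: "continuous_on (I \<times> U) Z"
    "\<And>t p. t \<in> I \<Longrightarrow> p \<in> U \<Longrightarrow> norm (Z (t, p)) \<le> r"
    "\<And>t p. t \<in> I \<Longrightarrow> p \<in> U \<Longrightarrow> Z (t, p) = prim (\<lambda>s. F (s, p, Z (s, p))) t"
  proof (rule I.picard[OF contF])
    show "norm (F (t, p, 0)) \<le> r / 4" if "t \<in> I" "p \<in> U" for t p
      using d'(3)[of t p] that U T by auto
  qed (use lip U r in auto)
  have ode: "param_ode I U W F Z"
    unfolding param_ode_def
  proof (intro conjI ballI allI impI)
    fix t p assume tp: "t \<in> I" "p \<in> U"
    show "(t, p, Z (t, p)) \<in> W" using tp Z(2)[OF tp] r by (auto simp: W_def)
    show "Z (t, p) = prim (\<lambda>s. F (s, p, Z (s, p))) t" by (rule Z(3)[OF tp])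
  next
    fix t p z z' assume "(t, p, z) \<in> W" "(t, p, z') \<in> W"
    then show "norm (F (t, p, z) - F (t, p, z')) \<le> norm (z - z') / 4"
      by (intro lip) (use U in \<open>auto simp: W_def\<close>)
  qed (use I oW Z(1) in \<open>auto simp: U_def\<close>)
  have Zsm: "smooth_on (I \<times> U) Z"
    unfolding smooth_on_def using param_ode_Ck[OF ode] smooth_on_subset[OF F WW0] by (auto simp: smooth_on_def)
  define \<rho> where "\<rho> = min d' r / 2"
  define U' where "U' = ball (0 :: 'p) \<rho>"
  have \<rho>: "\<rho> > 0" "\<rho> \<le> R" using d'(1) r by (auto simp: \<rho>_def)
  have U': "open U'" "compact (closure U')" "closure U' \<subseteq> U"
    using \<rho> by (auto simp: U'_def U_def \<rho>_def)
  have JI: "t \<in> I" if "t \<in> J" for t using that by (auto simp: I_def J_def)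
  have U'U: "p \<in> U" if "p \<in> U'" for p using that U'(3) closure_subset by blast
  have F1: "Ck_on (Suc 0) W F" using smooth_on_subset[OF F WW0] unfolding smooth_on_def by blast
  obtain L where contL: "continuous_on (J \<times> U') L"
    and derL: "\<And>t p. t \<in> J \<Longrightarrow> p \<in> U' \<Longrightarrow> ((\<lambda>p. Z (t, p)) has_derivative blinfun_apply (L (t, p))) (at p)"
    and eqL: "\<And>t p v. t \<in> J \<Longrightarrow> p \<in> U' \<Longrightarrow>
       blinfun_apply (L (t, p)) v = prim (\<lambda>s. FD F (s, p, Z (s, p)) (0, v, blinfun_apply (L (s, p)) v)) t"
    using param_ode_derivative[OF ode F1 J U'] by blast
  have FDL: "FD (\<lambda>p. Z (t, p)) p = blinfun_apply (L (t, p))" if "t \<in> J" "p \<in> U'" for t p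
    by (rule FD_eq[OF derL[OF that]])
  have J01: "t \<in> J" if "t \<in> {0..1}" for t using that by (auto simp: J_def)
  have inW: "(t, p, Z (t, p)) \<in> W" if "t \<in> I" "p \<in> U" for t p by (rule param_odeD(5)[OF ode that])
  have contZp: "continuous_on I (\<lambda>s. (s, p, Z (s, p)))" if "p \<in> U" for p
    using that by (auto intro!: continuous_intros continuous_on_compose2[OF Z(1)])
  \<comment> \<open>The values of \<open>Z\<close> outside \<open>U\<close> are arbitrary; resetting
    those at time 0 makes the initial condition hold for every \<open>p\<close>.\<close>
  define Z' where "Z' = (\<lambda>(t, p). if t = 0 then 0 else Z (t, p))"
  have Z0: "Z (0, p) = 0" if "p \<in> U" for p using Z(3)[OF I.zero_I that] by (simp add: prim_def)
  have ZZ': "Z' (t, p) = Z (t, p)" if "p \<in> U" for t p using Z0[OF that] by (simp add: Z'_def)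
  have FDZ': "FD (\<lambda>p. Z' (t, p)) p = FD (\<lambda>p. Z (t, p)) p" if "p \<in> U" for t p
    by (rule FD_cong[of U]) (use that ZZ' in \<open>auto simp: U_def\<close>)
  show ?thesis
  proof (rule that[of \<rho> Z'])
    show "smooth_on (ball 0 \<rho>) (\<lambda>p. Z' (1, p))"
      unfolding Z'_def using Zsm U'U
      by (auto simp: U'_def I_def intro!: smooth_on_compose[OF open_ball, of "I \<times> U" Z] smooth_on_Pair smooth_on_const
           smooth_on_id open_Times) (auto simp: U_def I_def)
    fix t :: real assume t: "t \<in> {0..1}"
    note tJ = J01[OF t] and tI = JI[OF J01[OF t]]
    have 0: "0 \<in> U" using d' r by (simp add: U_def)
    \<comment> \<open>At \<open>p = 0\<close> the zero function is a solution as well;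
      \<open>self_bound\<close> with \<open>c = 0\<close> gives uniqueness.\<close>
    have "norm (Z (t, 0)) \<le> 4 * 0"
    proof (rule I.self_bound[OF Z(2)[OF _ 0] _ tI])
      fix s m assume s: "s \<in> I" and m: "0 \<le> m" "\<And>s. s \<in> I \<Longrightarrow> norm (Z (s, 0)) \<le> m"
      have "norm (prim (\<lambda>s. F (s, 0, Z (s, 0))) s) \<le> 2 * (m / 4)"
      proof (rule I.prim_bound[OF _ s])
        show "continuous_on I (\<lambda>s. F (s, 0, Z (s, 0)))"
          by (rule continuous_on_compose2[OF Ck_on_imp_continuous_on[OF F1] contZp[OF 0]]) (use inW 0 in auto)
        fix u assume u: "u \<in> I"
        have "norm (F (u, 0, Z (u, 0)) - F (u, 0, 0)) \<le> norm (Z (u, 0) - 0) / 4"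
          by (rule lip) (use u r Z(2)[OF u 0] in auto)
        then show "norm (F (u, 0, Z (u, 0))) \<le> m / 4" using F0[of u] u T m(2)[OF u] by auto
      qed
      then show "norm (Z (s, 0)) \<le> 0 + 3 / 4 * m" using Z(3)[OF s 0] m(1) by simp
    qed
    then show "Z' (t, 0) = 0" using ZZ'[OF 0] by simp
    fix p :: 'p assume "p \<in> ball 0 \<rho>"
    then have p: "p \<in> U'" "p \<in> U" using U'U by (auto simp: U'_def)
    show "norm (Z' (t, p)) < R" using Z(2)[OF tI p(2)] r ZZ'[OF p(2)] by simp
    have "((\<lambda>t. Z (t, p)) has_vector_derivative F (t, p, Z (t, p))) (at t)"
    proof (rule has_vector_derivative_transform_within_open[OF I.prim_derivative[OF _ tI] I.open_I tI])
      show "continuous_on I (\<lambda>s. F (s, p, Z (s, p)))"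
        by (rule continuous_on_compose2[OF Ck_on_imp_continuous_on[OF F1] contZp[OF p(2)]]) (use inW p in auto)
    qed (use Z(3) p in auto)
    then show "((\<lambda>t. Z' (t, p)) has_vector_derivative F (t, p, Z' (t, p))) (at t)" by (simp add: ZZ' p)
    show "(\<lambda>p. Z' (t, p)) differentiable (at p)"
      by (rule differentiable_cong_open[of U p "\<lambda>p. Z (t, p)"])
         (use p derL[OF tJ p(1)] ZZ' in \<open>auto simp: U_def differentiable_def\<close>)
    fix v :: 'p
    have cont: "continuous_on J (\<lambda>s. FD F (s, p, Z (s, p)) (0, v, blinfun_apply (L (s, p)) v))"
    proof -
      have FDc: "continuous_on J (\<lambda>s. FD F (s, p, Z (s, p)) h)" for h
        by (rule continuous_on_compose2[of W "\<lambda>x. FD F x h"])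
           (use F1 inW p JI in \<open>auto intro!: continuous_on_subset[OF contZp[OF p(2)]] simp del: split_paired_All\<close>)
      have Lc: "continuous_on J (\<lambda>s. blinfun_apply (L (s, p)) v)"
        using p by (auto intro!: continuous_intros continuous_on_compose2[OF contL])
      have "continuous_on J (\<lambda>s. \<Sum>b\<in>Basis. ((0 :: real, v, blinfun_apply (L (s, p)) v) \<bullet> b) *\<^sub>R FD F (s, p, Z (s, p)) b)"
        by (intro continuous_intros FDc Lc)
      then show ?thesis
      proof (rule continuous_on_eq)
        fix s assume s: "s \<in> J"
        interpret bounded_linear "FD F (s, p, Z (s, p))"
          by (rule has_derivative_bounded_linear[OF Ck_on_has_derivative[OF F1 inW]]) (use s JI p in auto)
        have "FD F (s, p, Z (s, p)) (0, v, blinfun_apply (L (s, p)) v) =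
            FD F (s, p, Z (s, p)) (\<Sum>b\<in>Basis. ((0, v, blinfun_apply (L (s, p)) v) \<bullet> b) *\<^sub>R b)"
          by (simp only: euclidean_representation)
        then show "(\<Sum>b\<in>Basis. ((0 :: real, v, blinfun_apply (L (s, p)) v) \<bullet> b) *\<^sub>R FD F (s, p, Z (s, p)) b) =
            FD F (s, p, Z (s, p)) (0, v, blinfun_apply (L (s, p)) v)"
          by (simp only: sum scaleR)
      qed
    qed
    have "((\<lambda>t. FD (\<lambda>p. Z (t, p)) p v) has_vector_derivative
        FD F (t, p, Z (t, p)) (0, v, blinfun_apply (L (t, p)) v)) (at t)"
      by (rule has_vector_derivative_transform_within_open[OF J.prim_derivative[OF cont tJ] J.open_I tJ])
         (use eqL FDL p in auto)
    then show "((\<lambda>t. FD (\<lambda>p. Z' (t, p)) p v) has_vector_derivative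
         FD F (t, p, Z' (t, p)) (0, v, FD (\<lambda>p. Z' (t, p)) p v)) (at t)"
      by (simp add: FDZ'[OF p(2)] ZZ'[OF p(2)] FDL[OF tJ p(1)])
  qed (use \<rho> in \<open>auto simp: Z'_def\<close>)
qed

section \<open>Moser's method\<close>

lemma bounded_bilinear_matrix_vector_mult:
  "bounded_bilinear ((*v) :: real ^ 'n ^ 'm \<Rightarrow> real ^ 'n \<Rightarrow> real ^ 'm)"
  unfolding bilinear_conv_bounded_bilinear[symmetric] bilinear_def
  by (auto intro!: linearI simp: matrix_vector_mult_add_rdistrib matrix_vector_right_distrib
      scaleR_matrix_vector_assoc matrix_vector_mult_scaleR)

interpretation mv: bounded_bilinear "(*v) :: real ^ 'n ^ 'm \<Rightarrow> real ^ 'n \<Rightarrow> real ^ 'm"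
  by (rule bounded_bilinear_matrix_vector_mult)

lemma det_nonzero_iff_inj:
  fixes A :: "real ^ 'n ^ 'n"
  shows "det A \<noteq> 0 \<longleftrightarrow> (\<forall>u. A *v u = 0 \<longrightarrow> u = 0)"
  using matrix_left_invertible_ker[of A] invertible_left_inverse[of A] invertible_det_nz[of A] by blast

definition outer :: "real ^ 'n \<Rightarrow> real ^ 'n ^ 'n" where
  "outer e = (\<chi> i j. e $ i * e $ j)"

lemma outer_mult: "outer e *v u = (e \<bullet> u) *\<^sub>R e"
  by (simp add: outer_def matrix_vector_mult_def vec_eq_iff inner_vec_def sum_distrib_left mult_ac)

lemma constant_on_unit_interval:
  fixes f :: "real \<Rightarrow> real"
  assumes "\<And>t. t \<in> {0..1} \<Longrightarrow> (f has_vector_derivative 0) (at t)"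
  shows "f 1 = f 0"
proof -
  have "DERIV f t :> (\<lambda>t. 0) t" if "0 \<le> t" "t \<le> 1" for t
    using assms[of t] that by (simp add: has_real_derivative_iff_has_vector_derivative)
  from MVT2[OF zero_less_one this] show ?thesis by auto
qed

text \<open>The vector \<open>e\<close> is \<open>0\<close> or a unit vector; the leaves are the fibres of \<open>x \<mapsto> e \<bullet> x\<close>.\<close>

locale transversal =
  fixes e :: "real ^ 'n"
  assumes ee: "(e \<bullet> e) *\<^sub>R e = e"
begin

definition Q :: "real ^ 'n \<Rightarrow> real ^ 'n" where "Q x = x - (e \<bullet> x) *\<^sub>R e"

lemma ee_inner: "(e \<bullet> e) * (e \<bullet> x) = e \<bullet> x"
  using arg_cong[OF ee, of "\<lambda>y. y \<bullet> x"] by simp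

lemma Q_leaf: "e \<bullet> Q x = 0"
  using ee_inner[of x] by (simp add: Q_def inner_diff_right mult.commute)

lemma Q_leaf_id: "e \<bullet> x = 0 \<Longrightarrow> Q x = x"
  by (simp add: Q_def)

lemma Q_0: "Q 0 = 0" by (simp add: Q_def)

lemma bounded_linear_Q: "bounded_linear Q"
  unfolding Q_def
  by (intro bounded_linear_sub bounded_linear_ident bounded_linear_scaleR_const bounded_linear_inner_right)

lemma norm_e: "norm e \<le> 1"
proof -
  have "e = 0 \<or> e \<bullet> e = 1" using ee by (metis scaleR_cancel_right scaleR_one)
  then show ?thesis by (auto simp: norm_eq_sqrt_inner)
qed

lemma norm_normal_part: "norm ((e \<bullet> x) *\<^sub>R e) \<le> norm x"
proof -
  have "\<bar>e \<bullet> x\<bar> \<le> norm e * norm x" by (rule Cauchy_Schwarz_ineq2)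
  also have "\<dots> \<le> 1 * norm x" using norm_e by (rule mult_right_mono) simp
  finally have "\<bar>e \<bullet> x\<bar> * norm e \<le> norm x * 1"
    by (intro mult_mono) (use norm_e in auto)
  then show ?thesis by simp
qed

lemma norm_Q: "norm (Q x) \<le> 2 * norm x"
  unfolding Q_def using norm_triangle_ineq4[of x "(e \<bullet> x) *\<^sub>R e"] norm_normal_part[of x] by linarith

text \<open>A homotopy shrinking each leaf linearly to its point on the axis spanned by
  \<open>e\<close>: it runs from \<open>(e \<bullet> x) *\<^sub>R e\<close> at \<open>s = 0\<close>
  to the identity at \<open>s = 1\<close>. For \<open>e = 0\<close> it is the usual contraction to
  the origin.\<close>

definition contract_leaf :: "real \<Rightarrow> real ^ 'n \<Rightarrow> real ^ 'n" where
  "contract_leaf s x = x - (1 - s) *\<^sub>R Q x"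

lemma norm_contract_leaf: "0 \<le> s \<Longrightarrow> s \<le> 1 \<Longrightarrow> norm (contract_leaf s x) \<le> norm x"
proof -
  assume s: "0 \<le> s" "s \<le> 1"
  have "contract_leaf s x = s *\<^sub>R x + (1 - s) *\<^sub>R ((e \<bullet> x) *\<^sub>R e)"
    by (simp add: contract_leaf_def Q_def algebra_simps)
  then have "norm (contract_leaf s x) \<le> s * norm x + (1 - s) * norm ((e \<bullet> x) *\<^sub>R e)"
    using norm_triangle_ineq[of "s *\<^sub>R x" "(1 - s) *\<^sub>R ((e \<bullet> x) *\<^sub>R e)"] s by (simp only: norm_scaleR)
  also have "\<dots> \<le> s * norm x + (1 - s) * norm x"
    by (intro add_left_mono mult_left_mono norm_normal_part) (use s in auto)
  finally show ?thesis by (simp add: algebra_simps)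
qed

lemma bounded_linear_contract_leaf: "bounded_linear (contract_leaf s)"
  unfolding contract_leaf_def
  by (intro bounded_linear_sub bounded_linear_ident
        bounded_linear_compose[OF bounded_linear_scaleR_right bounded_linear_Q])

end

text \<open>\<open>\<omega> x\<close> is the matrix of the 2-form with value
  \<open>u \<bullet> (\<omega> x *v v)\<close> on \<open>u\<close> and \<open>v\<close>;
  \<open>closed\<close> is the vanishing of its exterior derivative on leaf vectors. Nondegeneracy
  at 0 is spread to a ball in \<open>ext_invertible\<close>.\<close>

locale leafwise_form = transversal e for e :: "real ^ 'n" +
  fixes \<omega> :: "real ^ 'n \<Rightarrow> real ^ 'n ^ 'n" and R :: real
  assumes R: "R > 0" and smooth: "smooth_on (ball 0 R) \<omega>"
    and skew: "\<And>x u v. x \<in> ball 0 R \<Longrightarrow> u \<bullet> (\<omega> x *v v) = - (v \<bullet> (\<omega> x *v u))"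
    and kernel: "\<And>x. x \<in> ball 0 R \<Longrightarrow> \<omega> x *v e = 0"
    and nondeg: "\<And>u. \<omega> 0 *v u + (e \<bullet> u) *\<^sub>R e = 0 \<Longrightarrow> u = 0"
    and closed: "\<And>x u v w. x \<in> ball 0 R \<Longrightarrow> e \<bullet> u = 0 \<Longrightarrow> e \<bullet> v = 0 \<Longrightarrow> e \<bullet> w = 0 \<Longrightarrow>
        v \<bullet> (FD \<omega> x u *v w) + w \<bullet> (FD \<omega> x v *v u) + u \<bullet> (FD \<omega> x w *v v) = 0"
begin

section \<open>A leafwise primitive of a closed form\<close>

lemma zero_ball: "0 \<in> ball (0 :: real ^ 'n) R" using R by simp

lemma leaf: "x \<in> ball 0 R \<Longrightarrow> e \<bullet> (\<omega> x *v u) = 0"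
  using skew[of x e u] kernel[of x] by simp

lemma deriv: "x \<in> ball 0 R \<Longrightarrow> (\<omega> has_derivative FD \<omega> x) (at x)"
  by (rule smooth_on_has_derivative[OF smooth])

lemma FD_skew: 
  assumes x: "x \<in> ball 0 R"
  shows "u \<bullet> (FD \<omega> x h *v v) = - (v \<bullet> (FD \<omega> x h *v u))"
proof -
  have "((\<lambda>y. u \<bullet> (\<omega> y *v v) + v \<bullet> (\<omega> y *v u)) has_derivative
      (\<lambda>h. u \<bullet> (FD \<omega> x h *v v) + v \<bullet> (FD \<omega> x h *v u))) (at x)"
    by (intro has_derivative_add bounded_linear.has_derivative[OF bounded_linear_inner_right]
          bounded_linear.has_derivative[OF mv.bounded_linear_left] deriv x)
  moreover have "((\<lambda>y. u \<bullet> (\<omega> y *v v) + v \<bullet> (\<omega> y *v u)) has_derivative (\<lambda>h. 0)) (at x)"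
    by (rule has_derivative_transform_within_open[OF has_derivative_const open_ball x])
       (subst skew[of _ u v], simp_all)
  ultimately have "u \<bullet> (FD \<omega> x h *v v) + v \<bullet> (FD \<omega> x h *v u) = 0"
    by (rule has_derivative_unique[THEN fun_cong])
  then show ?thesis by simp
qed

text \<open>The homotopy operator of the Poincare lemma for \<open>contract_leaf\<close>, applied to
  \<open>\<omega> - \<omega> 0\<close>. Both the matrix factor and \<open>Q x\<close> vanish at
  \<open>x = 0\<close>, which is the source of the second-order vanishing of the primitive.\<close>

definition integrand :: "(real ^ 'n) \<times> real \<Rightarrow> real ^ 'n" where
  "integrand = (\<lambda>(x, s). s *\<^sub>R ((\<omega> (contract_leaf s x) - \<omega> 0) *v Q x))"

definition \<alpha> :: "real ^ 'n \<Rightarrow> real ^ 'n" where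
  "\<alpha> x = integral {0..1} (\<lambda>s. integrand (x, s))"

text \<open>An open neighbourhood of \<open>ball 0 R \<times> {0..1}\<close>, as smoothness of the
  integrand and differentiation under the integral require.\<close>

definition dom :: "((real ^ 'n) \<times> real) set" where
  "dom = (\<lambda>(x, s). contract_leaf s x) -` ball 0 R"

lemma smooth_contract_leaf: "smooth_on UNIV (\<lambda>p. contract_leaf (snd p) (fst p))"
  unfolding contract_leaf_def
  by (intro smooth_on_diff smooth_on_scaleR smooth_on_const smooth_on_bounded_linear bounded_linear_fst
        bounded_linear_snd bounded_linear_compose[OF bounded_linear_Q bounded_linear_fst] open_UNIV)

lemma open_dom: "open dom"
  unfolding dom_def split_def
  by (rule open_vimage[OF open_ball]) (rule smooth_on_imp_continuous_on[OF smooth_contract_leaf])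

lemma ball_dom: "x \<in> ball 0 R \<Longrightarrow> s \<in> {0..1} \<Longrightarrow> (x, s) \<in> dom"
  using norm_contract_leaf[of s x] by (simp add: dom_def)

lemma smooth_integrand: "smooth_on dom integrand"
proof -
  have 1: "smooth_on dom (\<lambda>p. \<omega> (contract_leaf (snd p) (fst p)))"
    by (rule smooth_on_compose[OF open_dom smooth smooth_on_subset[OF smooth_contract_leaf]])
       (auto simp: dom_def split_def)
  show ?thesis
    unfolding integrand_def split_def
    by (intro smooth_on_scaleR smooth_on_const smooth_on_bounded_linear bounded_linear_snd open_dom
          smooth_on_matrix_vector_mult smooth_on_diff 1 bounded_linear_compose[OF bounded_linear_Q bounded_linear_fst])
qed

lemma smooth_\<alpha>: "smooth_on (ball 0 R) \<alpha>"
  unfolding \<alpha>_def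
  by (rule smooth_on_integral[OF open_ball _ smooth_integrand]) (use ball_dom in auto)

lemma FD_integrand_general:
  assumes x: "x \<in> ball 0 R" and s: "s \<in> {0..1}"
  shows "FD integrand (x, s) (v, 0) = s *\<^sub>R ((\<omega> (contract_leaf s x) - \<omega> 0) *v Q v +
      FD \<omega> (contract_leaf s x) (contract_leaf s v) *v Q x)"
proof -
  have S: "contract_leaf s x \<in> ball 0 R" using ball_dom[OF x s] by (simp add: dom_def)
  have "((\<lambda>y. (y, s)) has_derivative (\<lambda>h. (h, 0))) (at x)" by (auto intro!: derivative_eq_intros)
  from has_derivative_compose[OF this smooth_on_has_derivative[OF smooth_integrand ball_dom[OF x s]]]
  have 1: "((\<lambda>y. integrand (y, s)) has_derivative (\<lambda>h. FD integrand (x, s) (h, 0))) (at x)" .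
  have "((\<lambda>y. \<omega> (contract_leaf s y)) has_derivative (\<lambda>h. FD \<omega> (contract_leaf s x) (contract_leaf s h))) (at x)"
    by (rule has_derivative_compose[OF bounded_linear_imp_has_derivative[OF bounded_linear_contract_leaf] deriv[OF S]])
  then have "((\<lambda>y. \<omega> (contract_leaf s y) - \<omega> 0) has_derivative (\<lambda>h. FD \<omega> (contract_leaf s x) (contract_leaf s h))) (at x)"
    by (auto intro!: derivative_eq_intros)
  from has_derivative_scaleR_right[OF mv.FDERIV[OF this bounded_linear_imp_has_derivative[OF bounded_linear_Q]], of s]
  have 2: "((\<lambda>y. integrand (y, s)) has_derivative (\<lambda>h. s *\<^sub>R ((\<omega> (contract_leaf s x) - \<omega> 0) *v Q h +
      FD \<omega> (contract_leaf s x) (contract_leaf s h) *v Q x))) (at x)"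
    by (simp add: integrand_def)
  show ?thesis using fun_cong[OF has_derivative_unique[OF 1 2], of v] .
qed

text \<open>On leaf vectors \<open>contract_leaf s\<close> is multiplication by \<open>s\<close>,
  whence the square.\<close>

lemma FD_integrand:
  assumes x: "x \<in> ball 0 R" and s: "s \<in> {0..1}" and v: "e \<bullet> v = 0"
  shows "FD integrand (x, s) (v, 0) = s\<^sup>2 *\<^sub>R (FD \<omega> (contract_leaf s x) v *v Q x) +
     s *\<^sub>R ((\<omega> (contract_leaf s x) - \<omega> 0) *v v)"
proof -
  have S: "contract_leaf s x \<in> ball 0 R" using ball_dom[OF x s] by (simp add: dom_def)
  have "contract_leaf s v = s *\<^sub>R v" by (simp add: contract_leaf_def Q_leaf_id[OF v] algebra_simps)
  moreover have "FD \<omega> (contract_leaf s x) (s *\<^sub>R v) = s *\<^sub>R FD \<omega> (contract_leaf s x) v"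
    by (rule linear_scale[OF has_derivative_linear[OF deriv[OF S]]])
  ultimately show ?thesis
    unfolding FD_integrand_general[OF x s]
    by (simp add: Q_leaf_id[OF v] mv.scaleR_left power2_eq_square scaleR_add_right)
qed

lemma FD_\<alpha>:
  assumes x: "x \<in> ball 0 R"
  shows "((\<lambda>s. FD integrand (x, s) (v, 0)) has_integral FD \<alpha> x v) {0..1}"
proof -
  have k: "Ck_on (Suc 0) dom integrand" using smooth_integrand by (simp only: smooth_on_def)
  have "(\<alpha> has_derivative (\<lambda>v. integral {0..1} (\<lambda>s. FD integrand (x, s) (v, 0)))) (at x)"
    unfolding \<alpha>_def
    by (rule has_derivative_param_integral[OF open_ball _ k x]) (use ball_dom in auto)
  then have "FD \<alpha> x v = integral {0..1} (\<lambda>s. FD integrand (x, s) (v, 0))" by (simp add: FD_eq)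
  moreover have "continuous_on {0..1} (\<lambda>s. FD integrand (x, s) (v, 0))"
    by (rule continuous_on_compose2[OF smooth_on_imp_continuous_on[OF smooth_on_FD[OF smooth_integrand, of "(v, 0)"]]])
       (use ball_dom[OF x] in \<open>auto intro!: continuous_on_Pair continuous_on_const continuous_on_id\<close>)
  ultimately show ?thesis by (metis integrable_continuous_interval integrable_integral)
qed

text \<open>The leafwise Poincare lemma: \<open>d\<alpha> = \<omega> - \<omega>(0)\<close> along the leaves.\<close>

lemma curl_\<alpha>:
  assumes x: "x \<in> ball 0 R" and u: "e \<bullet> u = 0" and v: "e \<bullet> v = 0"
  shows "v \<bullet> FD \<alpha> x u - u \<bullet> FD \<alpha> x v = v \<bullet> ((\<omega> x - \<omega> 0) *v u)"
proof -
  define S where "S = (\<lambda>s. contract_leaf s x)"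
  have SR: "S s \<in> ball 0 R" if "s \<in> {0..1}" for s
    using ball_dom[OF x that] by (simp add: dom_def S_def)
  have 1: "((\<lambda>s. v \<bullet> FD integrand (x, s) (u, 0) - u \<bullet> FD integrand (x, s) (v, 0)) has_integral
      v \<bullet> FD \<alpha> x u - u \<bullet> FD \<alpha> x v) {0..1}"
    using has_integral_diff[OF has_integral_linear[OF FD_\<alpha>[OF x, of u] bounded_linear_inner_right[of v]]
       has_integral_linear[OF FD_\<alpha>[OF x, of v] bounded_linear_inner_right[of u]]]
    by (simp add: o_def)
  \<comment> \<open>The integrand of the curl is a total derivative in \<open>s\<close>. The factor
    \<open>s\<^sup>2\<close> kills the contribution of \<open>s = 0\<close>, where
    \<open>S 0\<close> is the centre of the leaf and \<open>\<omega> (S 0)\<close> need not equal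
    \<open>\<omega> 0\<close>.\<close>
  have "((\<lambda>s. s\<^sup>2 * (v \<bullet> ((\<omega> (S s) - \<omega> 0) *v u))) has_vector_derivative
      v \<bullet> FD integrand (x, s) (u, 0) - u \<bullet> FD integrand (x, s) (v, 0)) (at s within {0..1})"
    if s: "s \<in> {0..1}" for s
  proof -
    have "((\<lambda>s. S s) has_vector_derivative Q x) (at s within {0..1})"
      unfolding S_def contract_leaf_def by (auto intro!: derivative_eq_intros)
    then have "(S has_derivative (\<lambda>h. h *\<^sub>R Q x)) (at s within {0..1})"
      by (simp add: has_vector_derivative_def)
    from has_derivative_compose[OF this deriv[OF SR[OF s]]]
    have "((\<lambda>s. \<omega> (S s)) has_vector_derivative FD \<omega> (S s) (Q x)) (at s within {0..1})"
      using linear_scale[OF has_derivative_linear[OF deriv[OF SR[OF s]]]] by (simp add: has_vector_derivative_def)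
    then have "((\<lambda>s. \<omega> (S s) - \<omega> 0) has_vector_derivative FD \<omega> (S s) (Q x)) (at s within {0..1})"
      by (auto intro!: derivative_eq_intros)
    from bounded_linear.has_vector_derivative[OF mv.bounded_linear_left this, of u]
    have "((\<lambda>s. v \<bullet> ((\<omega> (S s) - \<omega> 0) *v u)) has_vector_derivative v \<bullet> (FD \<omega> (S s) (Q x) *v u)) (at s within {0..1})"
      by (rule bounded_linear.has_vector_derivative[OF bounded_linear_inner_right])
    moreover have "((\<lambda>s. s\<^sup>2) has_vector_derivative 2 * s) (at s within {0..1})"
      by (auto intro!: derivative_eq_intros simp flip: has_real_derivative_iff_has_vector_derivative)
    ultimately have "((\<lambda>s. s\<^sup>2 * (v \<bullet> ((\<omega> (S s) - \<omega> 0) *v u))) has_vector_derivative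
      s\<^sup>2 * (v \<bullet> (FD \<omega> (S s) (Q x) *v u)) + 2 * s * (v \<bullet> ((\<omega> (S s) - \<omega> 0) *v u))) (at s within {0..1})"
      using bounded_bilinear.has_vector_derivative[OF bounded_bilinear_mult] by blast
    moreover have "v \<bullet> FD integrand (x, s) (u, 0) - u \<bullet> FD integrand (x, s) (v, 0) =
      s\<^sup>2 * (v \<bullet> (FD \<omega> (S s) (Q x) *v u)) + 2 * s * (v \<bullet> ((\<omega> (S s) - \<omega> 0) *v u))"
    proof -
      \<comment> \<open>Closedness exchanges the derivatives in the directions \<open>u\<close> and
        \<open>v\<close> for one in the direction \<open>Q x\<close>, the velocity of
        \<open>S\<close>.\<close>
      have c: "v \<bullet> (FD \<omega> (S s) u *v Q x) - u \<bullet> (FD \<omega> (S s) v *v Q x) = v \<bullet> (FD \<omega> (S s) (Q x) *v u)"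
        using closed[OF SR[OF s] u v Q_leaf[of x]] FD_skew[OF SR[OF s], of u v "Q x"]
          FD_skew[OF SR[OF s], of u "Q x" v] by linarith
      have k: "u \<bullet> ((\<omega> (S s) - \<omega> 0) *v v) = - (v \<bullet> ((\<omega> (S s) - \<omega> 0) *v u))"
        using skew[OF SR[OF s], of u v] skew[OF zero_ball, of u v] by (simp add: mv.diff_left inner_diff_right)
      have "v \<bullet> FD integrand (x, s) (u, 0) - u \<bullet> FD integrand (x, s) (v, 0) =
        s\<^sup>2 * (v \<bullet> (FD \<omega> (S s) u *v Q x) - u \<bullet> (FD \<omega> (S s) v *v Q x)) +
        s * (v \<bullet> ((\<omega> (S s) - \<omega> 0) *v u) - u \<bullet> ((\<omega> (S s) - \<omega> 0) *v v))"
        unfolding FD_integrand[OF x s u] FD_integrand[OF x s v]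
        by (simp add: S_def inner_add_right algebra_simps)
      then show ?thesis unfolding c k by (simp add: algebra_simps)
    qed
    ultimately show ?thesis by simp
  qed
  from fundamental_theorem_of_calculus[OF _ this]
  have "((\<lambda>s. v \<bullet> FD integrand (x, s) (u, 0) - u \<bullet> FD integrand (x, s) (v, 0)) has_integral
      1\<^sup>2 * (v \<bullet> ((\<omega> (S 1) - \<omega> 0) *v u)) - 0\<^sup>2 * (v \<bullet> ((\<omega> (S 0) - \<omega> 0) *v u))) {0..1}" by simp
  moreover have "S 1 = x" by (simp add: S_def contract_leaf_def)
  ultimately show ?thesis using has_integral_unique[OF 1] by simp
qed

lemma \<alpha>_0: "\<alpha> 0 = 0"
  by (simp add: \<alpha>_def integrand_def Q_0)

text \<open>By the product rule each term retains one of the two factors of \<open>integrand\<close>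
  that vanish at 0. This makes Moser's vector field contracting near the origin.\<close>

lemma FD_\<alpha>_0: "FD \<alpha> 0 w = 0"
proof -
  have "FD integrand (0, s) (w, 0) = 0" if "s \<in> {0..1}" for s
    by (simp add: FD_integrand_general[OF zero_ball that] Q_0 contract_leaf_def)
  then have "((\<lambda>s. FD integrand (0, s) (w, 0)) has_integral 0) {0..1}"
    by (rule has_integral_is_0)
  then show ?thesis using FD_\<alpha>[OF zero_ball, of w] has_integral_unique by blast
qed

lemma leaf_\<alpha>: 
  assumes x: "x \<in> ball 0 R"
  shows "e \<bullet> \<alpha> x = 0"
proof -
  have "continuous_on {0..1} (\<lambda>s. integrand (x, s))"
    by (rule continuous_on_compose2[OF smooth_on_imp_continuous_on[OF smooth_integrand]])
       (use ball_dom[OF x] in \<open>auto intro!: continuous_on_Pair continuous_on_const continuous_on_id\<close>)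
  then have "(\<lambda>s. integrand (x, s)) integrable_on {0..1}" by (rule integrable_continuous_interval)
  then have "((\<lambda>s. integrand (x, s)) has_integral \<alpha> x) {0..1}"
    unfolding \<alpha>_def by (rule integrable_integral)
  from has_integral_linear[OF this bounded_linear_inner_right[of e]]
  have "((\<lambda>s. e \<bullet> integrand (x, s)) has_integral e \<bullet> \<alpha> x) {0..1}" by (simp add: o_def)
  moreover have "e \<bullet> integrand (x, s) = 0" if "s \<in> {0..1}" for s
    using leaf[of "contract_leaf s x" "Q x"] leaf[OF zero_ball, of "Q x"] ball_dom[OF x that]
    by (simp add: integrand_def dom_def mv.diff_left inner_diff_right)
  then have "((\<lambda>s. e \<bullet> integrand (x, s)) has_integral 0) {0..1}" by (rule has_integral_is_0)
  ultimately show ?thesis using has_integral_unique by blast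
qed

text \<open>The segment from \<open>\<omega>(0)\<close> to \<open>\<omega>\<close>, and its extension to a family of invertible matrices.\<close>

definition seg :: "real \<Rightarrow> real ^ 'n \<Rightarrow> real ^ 'n ^ 'n" where
  "seg t x = \<omega> 0 + t *\<^sub>R (\<omega> x - \<omega> 0)"

definition ext :: "real \<times> (real ^ 'n) \<Rightarrow> real ^ 'n ^ 'n" where
  "ext = (\<lambda>(t, x). seg t x + outer e)"

text \<open>Moser's vector field. The equation to be solved along the leaves is
  \<open>seg t x *v X (t, x) = - \<alpha> x\<close>; inverting \<open>ext\<close> in place of the
  degenerate \<open>seg\<close> gives a formula smooth in \<open>(t, x)\<close>.\<close>

definition X :: "real \<times> (real ^ 'n) \<Rightarrow> real ^ 'n" where
  "X = (\<lambda>(t, x). - (matrix_inv (ext (t, x)) *v \<alpha> x))"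

section \<open>Moser's vector field and its flow\<close>

lemma open_cyl: "open (UNIV \<times> ball 0 r :: (real \<times> (real ^ 'n)) set)"
  by (simp add: open_Times)

lemma smooth_snd_cyl:
  fixes f :: "real ^ 'n \<Rightarrow> 'b::real_normed_vector"
  shows "smooth_on (ball 0 R) f \<Longrightarrow> smooth_on (UNIV \<times> ball 0 R :: (real \<times> (real ^ 'n)) set) (\<lambda>p. f (snd p))"
  using smooth_on_compose[OF open_cyl[of R], where g = f and f = snd and T = "ball 0 R"]
    smooth_on_bounded_linear[OF open_cyl[of R] bounded_linear_snd] by auto

lemma smooth_ext: "smooth_on (UNIV \<times> ball 0 R) ext"
proof -
  have 1: "smooth_on (UNIV \<times> ball 0 R) (\<lambda>p :: real \<times> (real ^ 'n). fst p)"
    by (rule smooth_on_bounded_linear[OF open_cyl bounded_linear_fst])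
  have 2: "smooth_on (UNIV \<times> ball 0 R) (\<lambda>p :: real \<times> (real ^ 'n). \<omega> (snd p) - \<omega> 0)"
    by (rule smooth_on_diff[OF open_cyl smooth_snd_cyl[OF smooth] smooth_on_const[OF open_cyl]])
  have 3: "smooth_on (UNIV \<times> ball 0 R) (\<lambda>p :: real \<times> (real ^ 'n). \<omega> 0 + fst p *\<^sub>R (\<omega> (snd p) - \<omega> 0))"
    by (rule smooth_on_add[OF open_cyl smooth_on_const[OF open_cyl] smooth_on_scaleR[OF open_cyl 1 2]])
  show ?thesis
    unfolding ext_def seg_def split_def
    by (rule smooth_on_add[OF open_cyl 3 smooth_on_const[OF open_cyl]])
qed

text \<open>Every \<open>ext (t, 0)\<close> equals \<open>\<omega> 0 + outer e\<close>, which
  \<open>nondeg\<close> makes invertible; compactness in \<open>t\<close> gives one ball for all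
  times.\<close>

lemma ext_invertible:
  obtains r where "0 < r" "r \<le> R" "\<And>t x. t \<in> {-1..2} \<Longrightarrow> x \<in> ball 0 r \<Longrightarrow> det (ext (t, x)) \<noteq> 0"
proof -
  define D where "D = det (\<omega> 0 + outer e)"
  have D: "D \<noteq> 0"
    unfolding D_def det_nonzero_iff_inj by (intro allI impI, rule nondeg) (simp add: mv.add_left outer_mult)
  have c: "continuous_on ({-1..2} \<times> ball 0 R) (\<lambda>p. det (ext p))"
    by (rule continuous_on_subset[OF smooth_on_imp_continuous_on[OF smooth_on_det[OF open_cyl smooth_ext]]]) auto
  have D0: "det (ext (t, 0)) = D" for t by (simp add: D_def ext_def seg_def)
  have eps: "\<bar>D\<bar> / 2 > 0" using D by simp
  obtain r where r: "r > 0" "ball 0 r \<subseteq> ball (0 :: real ^ 'n) R"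
    "\<And>t x. t \<in> {-1..2} \<Longrightarrow> x \<in> ball 0 r \<Longrightarrow> dist (det (ext (t, x))) D \<le> \<bar>D\<bar> / 2"
    using compact_uniform_small[OF compact_Icc open_ball zero_ball c D0 eps] by blast
  have "det (ext (t, x)) \<noteq> 0" if "t \<in> {-1..2}" "x \<in> ball 0 r" for t x
    using r(3)[OF that] D by (auto simp: dist_real_def)
  then show ?thesis using r(1) R by (intro that[of "min r R"]) auto
qed

text \<open>\<open>\<alpha> x\<close> and the range of \<open>seg t x\<close> are orthogonal to
  \<open>e\<close>, so the solution of the extended system has no component along \<open>e\<close>,
  and the summand \<open>outer e\<close> drops out.\<close>

lemma X_equation:
  assumes "det (ext (t, x)) \<noteq> 0" "x \<in> ball 0 R"
  shows "e \<bullet> X (t, x) = 0" "seg t x *v X (t, x) = - \<alpha> x"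
proof -
  have eq: "ext (t, x) *v X (t, x) = - \<alpha> x"
    unfolding X_def using matrix_inv_mult_vec(1)[OF assms(1)] by (simp add: mv.minus_right)
  have "e \<bullet> (seg t x *v u) = 0" for u
    using leaf[OF assms(2)] leaf[OF zero_ball]
    by (simp add: seg_def mv.add_left mv.diff_left mv.scaleR_left inner_add_right inner_diff_right)
  then have "e \<bullet> (ext (t, x) *v X (t, x)) = e \<bullet> X (t, x)"
    using ee_inner[of "X (t, x)"] by (simp add: ext_def mv.add_left outer_mult inner_add_right mult.commute)
  then show 1: "e \<bullet> X (t, x) = 0" using eq leaf_\<alpha>[OF assms(2)] by simp
  show "seg t x *v X (t, x) = - \<alpha> x" using eq 1 by (simp add: ext_def mv.add_left outer_mult)
qed

text \<open>The Lie derivative of \<open>seg t\<close> along \<open>X\<close> plus the time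
  derivative \<open>\<omega> - \<omega> 0\<close> vanishes on leaf vectors. In Cartan's terms:
  \<open>seg t\<close> is closed on the leaves, so the Lie derivative is the exterior derivative of
  its contraction with \<open>X\<close>, and \<open>\<alpha>\<close> is chosen so that this cancels
  \<open>\<omega> - \<omega> 0\<close>.\<close>

lemma moser_infinitesimal:
  assumes x: "x \<in> ball 0 R" and t: "t \<in> {-1<..<2}" and r: "x \<in> ball 0 r" "r \<le> R"
    and inv: "\<And>t x. t \<in> {-1<..<2} \<Longrightarrow> x \<in> ball 0 r \<Longrightarrow> det (ext (t, x)) \<noteq> 0"
    and X: "X differentiable (at (t, x))"
    and u: "e \<bullet> u = 0" and v: "e \<bullet> v = 0"
  shows "FD X (t, x) (0, v) \<bullet> (seg t x *v u) + v \<bullet> (seg t x *v FD X (t, x) (0, u)) +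
      v \<bullet> (((\<omega> x - \<omega> 0) + t *\<^sub>R FD \<omega> x (X (t, x))) *v u) = 0"
proof -
  have br: "ball (0 :: real ^ 'n) r \<subseteq> ball 0 R" using r(2) by auto
  have seg': "((\<lambda>y. seg t y) has_derivative (\<lambda>h. t *\<^sub>R FD \<omega> x h)) (at x)"
    unfolding seg_def by (auto intro!: derivative_eq_intros deriv x)
  have X': "((\<lambda>y. X (t, y)) has_derivative (\<lambda>h. FD X (t, x) (0, h))) (at x)"
  proof -
    have "((\<lambda>y. (t, y)) has_derivative (\<lambda>h. (0, h))) (at x)" by (auto intro!: derivative_eq_intros)
    from has_derivative_compose[OF this FD_works[OF X]] show ?thesis .
  qed
  have 1: "((\<lambda>y. seg t y *v X (t, y)) has_derivative
      (\<lambda>h. seg t x *v FD X (t, x) (0, h) + (t *\<^sub>R FD \<omega> x h) *v X (t, x))) (at x)"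
    by (rule mv.FDERIV[OF seg' X'])
  have 2: "((\<lambda>y. seg t y *v X (t, y)) has_derivative (\<lambda>h. - FD \<alpha> x h)) (at x)"
  proof (rule has_derivative_transform_within_open[OF _ open_ball r(1)])
    show "((\<lambda>y. - \<alpha> y) has_derivative (\<lambda>h. - FD \<alpha> x h)) (at x)"
      by (intro has_derivative_minus smooth_on_has_derivative[OF smooth_\<alpha> x])
    show "- \<alpha> y = seg t y *v X (t, y)" if "y \<in> ball 0 r" for y
      using X_equation(2)[OF inv[OF t that]] br that by auto
  qed
  \<comment> \<open>The derivative of \<open>X\<close> enters only after multiplication by
    \<open>seg t x\<close>; this product is found by differentiating the equation that
    \<open>X\<close> solves, without a formula for the derivative of an inverse matrix.\<close>
  have D: "seg t x *v FD X (t, x) (0, h) = - FD \<alpha> x h - t *\<^sub>R (FD \<omega> x h *v X (t, x))" for h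
    using fun_cong[OF has_derivative_unique[OF 1 2], of h] by (simp add: mv.scaleR_left algebra_simps)
  have sk: "a \<bullet> (seg t x *v b) = - (b \<bullet> (seg t x *v a))" for a b
    using skew[OF x, of a b] skew[OF zero_ball, of a b]
    by (simp add: seg_def mv.add_left mv.diff_left mv.scaleR_left inner_add_right inner_diff_right algebra_simps)
  have eX: "e \<bullet> X (t, x) = 0" by (rule X_equation(1)[OF inv[OF t r(1)] x])
  have c: "v \<bullet> (FD \<omega> x u *v X (t, x)) - u \<bullet> (FD \<omega> x v *v X (t, x)) = v \<bullet> (FD \<omega> x (X (t, x)) *v u)"
    using closed[OF x u v eX] FD_skew[OF x, of u v "X (t, x)"] FD_skew[OF x, of u "X (t, x)" v] by linarith
  have "FD X (t, x) (0, v) \<bullet> (seg t x *v u) = - (u \<bullet> (seg t x *v FD X (t, x) (0, v)))" by (rule sk)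
  also have "\<dots> = u \<bullet> FD \<alpha> x v + t * (u \<bullet> (FD \<omega> x v *v X (t, x)))"
    by (simp add: D inner_diff_right)
  finally have "FD X (t, x) (0, v) \<bullet> (seg t x *v u) + v \<bullet> (seg t x *v FD X (t, x) (0, u)) =
      - (v \<bullet> FD \<alpha> x u - u \<bullet> FD \<alpha> x v) -
      t * (v \<bullet> (FD \<omega> x u *v X (t, x)) - u \<bullet> (FD \<omega> x v *v X (t, x)))"
    by (simp add: D inner_diff_right algebra_simps)
  also have "\<dots> = - (v \<bullet> ((\<omega> x - \<omega> 0) *v u)) - t * (v \<bullet> (FD \<omega> x (X (t, x)) *v u))"
    by (simp only: c curl_\<alpha>[OF x u v])
  finally show ?thesis
    by (simp add: mv.add_left mv.scaleR_left inner_add_right)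
qed

text \<open>The flow is the identity plus a displacement \<open>Z\<close> that is 0 at time 0. It
  preserves the leaves, and by \<open>moser_infinitesimal\<close> its pullback of
  \<open>seg t\<close> does not depend on \<open>t\<close>; comparing the times 0 and 1 gives the
  pullback of \<open>\<omega>\<close>.\<close>

theorem moser_form:
  obtains \<rho> \<phi> where "0 < \<rho>" "smooth_on (ball 0 \<rho>) \<phi>" "\<phi> 0 = 0"
    "\<And>x. x \<in> ball 0 \<rho> \<Longrightarrow> \<phi> x \<in> ball 0 R"
    "\<And>x v. x \<in> ball 0 \<rho> \<Longrightarrow> e \<bullet> FD \<phi> x v = e \<bullet> v"
    "\<And>x u v. x \<in> ball 0 \<rho> \<Longrightarrow> e \<bullet> u = 0 \<Longrightarrow> e \<bullet> v = 0 \<Longrightarrow>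
       FD \<phi> x v \<bullet> (\<omega> (\<phi> x) *v FD \<phi> x u) = v \<bullet> (\<omega> 0 *v u)"
proof -
  obtain r where r: "0 < r" "r \<le> R" and inv: "\<And>t x. t \<in> {-1..2} \<Longrightarrow> x \<in> ball 0 r \<Longrightarrow> det (ext (t, x)) \<noteq> 0"
    using ext_invertible by blast
  have br: "x \<in> ball 0 R" if "x \<in> ball 0 r" for x :: "real ^ 'n" using r that by auto
  define C where "C = {-1<..<2 :: real} \<times> ball (0 :: real ^ 'n) r"
  have oC: "open C" by (simp add: C_def open_Times)
  have CR: "C \<subseteq> UNIV \<times> ball 0 R" using br by (auto simp: C_def)
  have Msm: "smooth_on C (\<lambda>p. matrix_inv (ext p))"
    by (rule smooth_on_matrix_inv[OF oC smooth_on_subset[OF smooth_ext CR]]) (use inv in \<open>auto simp: C_def\<close>)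
  have Xsm: "smooth_on C X"
    unfolding X_def split_def prod.collapse
    by (intro smooth_on_minus[OF oC] smooth_on_matrix_vector_mult[OF oC] Msm
          smooth_on_subset[OF smooth_snd_cyl[OF smooth_\<alpha>] CR])
  \<comment> \<open>Initial point plus displacement has to stay in the ball of radius
    \<open>r\<close>.\<close>
  define R' where "R' = r / 2"
  have R': "R' > 0" using r by (simp add: R'_def)
  define dom' where "dom' = {-1<..<2 :: real} \<times> ball (0 :: real ^ 'n) R' \<times> ball (0 :: real ^ 'n) R'"
  have od: "open dom'" by (simp add: dom'_def open_Times)
  \<comment> \<open>The parameter is the initial point and the unknown is the displacement, so that
    the origin of both is a rest point at all times.\<close>
  define F where "F = (\<lambda>q :: real \<times> (real ^ 'n) \<times> (real ^ 'n). X (fst q, fst (snd q) + snd (snd q)))"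
  define P where "P = (\<lambda>q :: real \<times> (real ^ 'n) \<times> (real ^ 'n). (fst q, fst (snd q) + snd (snd q)))"
  have P: "bounded_linear P"
    unfolding P_def
    by (intro bounded_linear_Pair bounded_linear_fst bounded_linear_add
         bounded_linear_compose[OF bounded_linear_fst bounded_linear_snd]
         bounded_linear_compose[OF bounded_linear_snd bounded_linear_snd])
  have PC: "P q \<in> C" if "q \<in> dom'" for q
    using that norm_triangle_ineq[of "fst (snd q)" "snd (snd q)"]
    by (auto simp: P_def C_def dom'_def R'_def)
  have F_P: "F = (\<lambda>q. X (P q))" by (simp add: F_def P_def)
  have Fsm: "smooth_on dom' F"
    unfolding F_P by (rule smooth_on_compose[OF od Xsm smooth_on_bounded_linear[OF od P] oC PC])
  have FDF: "FD F q h = FD X (P q) (P h)" if "q \<in> dom'" for q h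
    using FD_eq[OF has_derivative_compose[OF bounded_linear_imp_has_derivative[OF P]
          smooth_on_has_derivative[OF Xsm PC[OF that]]]] by (simp add: F_P)
  have X0: "X (t, 0) = 0" for t by (simp add: X_def \<alpha>_0)
  have tC: "(t, 0) \<in> C" if "t \<in> {-1<..<2}" for t using that r by (auto simp: C_def)
  have DX0: "FD X (t, 0) (0, w) = 0" if t: "t \<in> {-1<..<2}" for t w
  proof -
    have "((\<lambda>p. \<alpha> (snd p)) has_derivative (\<lambda>h. FD \<alpha> 0 (snd h))) (at (t, 0))"
      using has_derivative_compose[OF bounded_linear_imp_has_derivative[OF bounded_linear_snd], of \<alpha> "FD \<alpha> 0" "(t, 0)" UNIV]
        smooth_on_has_derivative[OF smooth_\<alpha> zero_ball] by simp
    from has_derivative_minus[OF mv.FDERIV[OF smooth_on_has_derivative[OF Msm tC[OF t]] this]]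
    have "(X has_derivative (\<lambda>h. - (matrix_inv (ext (t, 0)) *v FD \<alpha> 0 (snd h) +
        FD (\<lambda>p. matrix_inv (ext p)) (t, 0) h *v \<alpha> 0))) (at (t, 0))"
      by (simp add: X_def split_def)
    from FD_eq[OF this] show ?thesis by (simp add: \<alpha>_0 FD_\<alpha>_0)
  qed
  have td: "(t, 0, 0) \<in> dom'" if "t \<in> {-1<..<2}" for t using that R' by (auto simp: dom'_def)
  obtain \<rho> Z where \<rho>: "0 < \<rho>" "\<rho> \<le> R'" and Zsm: "smooth_on (ball 0 \<rho>) (\<lambda>p. Z (1, p))"
    and ZR: "\<And>t p. t \<in> {0..1} \<Longrightarrow> p \<in> ball 0 \<rho> \<Longrightarrow> norm (Z (t, p)) < R'"
    and Z0: "\<And>p. Z (0, p) = 0" and Z00: "\<And>t. t \<in> {0..1} \<Longrightarrow> Z (t, 0) = 0"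
    and Zt: "\<And>t p. t \<in> {0..1} \<Longrightarrow> p \<in> ball 0 \<rho> \<Longrightarrow>
       ((\<lambda>t. Z (t, p)) has_vector_derivative F (t, p, Z (t, p))) (at t)"
    and Zd: "\<And>t p. t \<in> {0..1} \<Longrightarrow> p \<in> ball 0 \<rho> \<Longrightarrow> (\<lambda>p. Z (t, p)) differentiable (at p)"
    and ZL: "\<And>t p v. t \<in> {0..1} \<Longrightarrow> p \<in> ball 0 \<rho> \<Longrightarrow>
       ((\<lambda>t. FD (\<lambda>p. Z (t, p)) p v) has_vector_derivative
         FD F (t, p, Z (t, p)) (0, v, FD (\<lambda>p. Z (t, p)) p v)) (at t)"
    by (rule parametrized_flow[OF R' Fsm[unfolded dom'_def]])
       (use DX0 X0 FDF[OF td] in \<open>auto simp: F_def P_def\<close>)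
  define \<phi> where "\<phi> = (\<lambda>t x. x + Z (t, x))"
  define J where "J = (\<lambda>x v t. v + FD (\<lambda>p. Z (t, p)) x v)"
  have I01: "t \<in> {-1<..<2}" if "t \<in> {0..1}" for t :: real using that by auto
  have \<phi>r: "\<phi> t x \<in> ball 0 r" if "t \<in> {0..1}" "x \<in> ball 0 \<rho>" for t x
    using ZR[OF that] that(2) \<rho>(2) norm_triangle_ineq[of x "Z (t, x)"] by (simp add: \<phi>_def R'_def)
  have qd: "(t, x, Z (t, x)) \<in> dom'" if "t \<in> {0..1}" "x \<in> ball 0 \<rho>" for t x
    using ZR[OF that] that \<rho>(2) by (auto simp: dom'_def)
  have \<phi>C: "(t, \<phi> t x) \<in> C" if "t \<in> {0..1}" "x \<in> ball 0 \<rho>" for t x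
    using \<phi>r[OF that] that by (auto simp: C_def)
  have \<phi>t: "((\<lambda>t. \<phi> t x) has_vector_derivative X (t, \<phi> t x)) (at t)" if "t \<in> {0..1}" "x \<in> ball 0 \<rho>" for t x
    unfolding \<phi>_def using Zt[OF that] by (auto intro!: derivative_eq_intros simp: F_def)
  have Jt: "((\<lambda>t. J x v t) has_vector_derivative FD X (t, \<phi> t x) (0, J x v t)) (at t)"
    if "t \<in> {0..1}" "x \<in> ball 0 \<rho>" for t x v
    unfolding J_def \<phi>_def using ZL[OF that, of v] FDF[OF qd[OF that], of "(0, v, FD (\<lambda>p. Z (t, p)) x v)"]
    by (auto intro!: derivative_eq_intros simp: P_def)
  have J\<phi>: "FD (\<phi> t) x v = J x v t" if "t \<in> {0..1}" "x \<in> ball 0 \<rho>" for t x v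
  proof -
    have "(\<phi> t has_derivative (\<lambda>v. v + FD (\<lambda>p. Z (t, p)) x v)) (at x)"
      unfolding \<phi>_def by (intro has_derivative_add has_derivative_ident FD_works Zd that)
    from FD_eq[OF this] show ?thesis by (simp add: J_def)
  qed
  have J0: "J x v 0 = v" for x v
  proof -
    have "FD (\<lambda>p. Z (0, p)) x = (\<lambda>v. 0)" by (rule FD_eq) (simp add: Z0)
    then show ?thesis by (simp add: J_def)
  qed
  have eDX: "e \<bullet> FD X p h = 0" if "p \<in> C" for p h
  proof -
    have "FD (\<lambda>p. e \<bullet> X p) p h = e \<bullet> FD X p h"
      by (rule FD_linear_comp[OF bounded_linear_inner_right smooth_on_differentiable[OF Xsm that]])
    moreover have "FD (\<lambda>p. e \<bullet> X p) p = FD (\<lambda>p. 0) p"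
      by (rule FD_cong[OF oC that]) (use X_equation(1) inv br in \<open>auto simp: C_def\<close>)
    ultimately show ?thesis by (simp add: FD_eq[OF has_derivative_const])
  qed
  have eJ1: "e \<bullet> J x v t = e \<bullet> v" if "t \<in> {0..1}" "x \<in> ball 0 \<rho>" for t x v
  proof (rule has_derivative_zero_unique[of "{0..1}" "\<lambda>t. e \<bullet> J x v t" t 0, unfolded J0])
    show "((\<lambda>t. e \<bullet> J x v t) has_derivative (\<lambda>h. 0)) (at s within {0..1})" if s: "s \<in> {0..1}" for s
      using bounded_linear.has_vector_derivative[OF bounded_linear_inner_right Jt[OF s \<open>x \<in> ball 0 \<rho>\<close>, of v], of e]
        eDX[OF \<phi>C[OF s \<open>x \<in> ball 0 \<rho>\<close>]]
      by (simp add: has_vector_derivative_def has_derivative_at_withinI)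
  qed (use that in auto)
  have const: "J x v 1 \<bullet> (\<omega> (\<phi> 1 x) *v J x u 1) = v \<bullet> (\<omega> 0 *v u)"
    if x: "x \<in> ball 0 \<rho>" and u: "e \<bullet> u = 0" and v: "e \<bullet> v = 0" for x u v
  proof -
    \<comment> \<open>The product rule gives the terms of \<open>moser_infinitesimal\<close> for the
      vectors \<open>J x u t\<close> and \<open>J x v t\<close>, which by \<open>eJ1\<close> remain
      tangent to the leaves.\<close>
    have "((\<lambda>t. J x v t \<bullet> (seg t (\<phi> t x) *v J x u t)) has_vector_derivative 0) (at t)" if t: "t \<in> {0..1}" for t
    proof -
      note in_r = \<phi>r[OF t x] and in_R = br[OF \<phi>r[OF t x]]
      have "((\<lambda>t. \<phi> t x) has_derivative (\<lambda>h. h *\<^sub>R X (t, \<phi> t x))) (at t)"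
        using \<phi>t[OF t x] by (simp add: has_vector_derivative_def)
      from has_derivative_compose[OF this deriv[OF in_R]]
      have "((\<lambda>t. \<omega> (\<phi> t x)) has_vector_derivative FD \<omega> (\<phi> t x) (X (t, \<phi> t x))) (at t)"
        using linear_scale[OF has_derivative_linear[OF deriv[OF in_R]]] by (simp add: has_vector_derivative_def)
      then have seg': "((\<lambda>t. seg t (\<phi> t x)) has_vector_derivative
          (\<omega> (\<phi> t x) - \<omega> 0) + t *\<^sub>R FD \<omega> (\<phi> t x) (X (t, \<phi> t x))) (at t)"
        unfolding seg_def by (auto intro!: derivative_eq_intros)
      have "((\<lambda>t. J x v t \<bullet> (seg t (\<phi> t x) *v J x u t)) has_vector_derivative
          J x v t \<bullet> (seg t (\<phi> t x) *v FD X (t, \<phi> t x) (0, J x u t) +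
            ((\<omega> (\<phi> t x) - \<omega> 0) + t *\<^sub>R FD \<omega> (\<phi> t x) (X (t, \<phi> t x))) *v J x u t) +
          FD X (t, \<phi> t x) (0, J x v t) \<bullet> (seg t (\<phi> t x) *v J x u t)) (at t)"
        by (intro bounded_bilinear.has_vector_derivative[OF bounded_bilinear_inner] mv.has_vector_derivative Jt seg' t x)
      moreover have "FD X (t, \<phi> t x) (0, J x v t) \<bullet> (seg t (\<phi> t x) *v J x u t) +
          J x v t \<bullet> (seg t (\<phi> t x) *v FD X (t, \<phi> t x) (0, J x u t)) +
          J x v t \<bullet> (((\<omega> (\<phi> t x) - \<omega> 0) + t *\<^sub>R FD \<omega> (\<phi> t x) (X (t, \<phi> t x))) *v J x u t) = 0"
        by (rule moser_infinitesimal[OF in_R I01[OF t] in_r r(2)])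
           (use inv smooth_on_differentiable[OF Xsm \<phi>C[OF t x]] eJ1[OF t x] u v in auto)
      ultimately show ?thesis by (simp add: inner_add_right add_ac)
    qed
    from constant_on_unit_interval[OF this]
    have "J x v 1 \<bullet> (seg 1 (\<phi> 1 x) *v J x u 1) = J x v 0 \<bullet> (seg 0 (\<phi> 0 x) *v J x u 0)" .
    then show ?thesis by (simp add: J0 seg_def)
  qed
  show ?thesis
  proof (rule that[OF \<rho>(1)])
    show "smooth_on (ball 0 \<rho>) (\<phi> 1)"
      unfolding \<phi>_def by (intro smooth_on_add smooth_on_id Zsm open_ball)
  qed (use Z00[of 1] \<phi>r[of 1] br const eJ1[of 1] J\<phi>[of 1] in \<open>auto simp: \<phi>_def\<close>)
qed

end


text \<open>The Darboux theorem for a bivector field \<open>V\<close> of corank \<open>0\<close> (\<open>e = 0\<close>) or \<open>1\<close> (\<open>e\<close> a unit vector):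
  \<open>V + e e\<^sup>T\<close> is invertible, and \<open>(V + e e\<^sup>T)\<^sup>-\<^sup>1 - e e\<^sup>T\<close> is the leafwise symplectic form.\<close>

locale bivector = transversal e for e :: "real ^ 'n" +
  fixes V :: "real ^ 'n \<Rightarrow> real ^ 'n ^ 'n" and R :: real
  assumes R: "R > 0" and smooth: "smooth_on (ball 0 R) V"
    and skew: "\<And>x u v. x \<in> ball 0 R \<Longrightarrow> u \<bullet> (V x *v v) = - (v \<bullet> (V x *v u))"
    and kernel: "\<And>x. x \<in> ball 0 R \<Longrightarrow> V x *v e = 0"
    and nondeg: "\<And>x u. x \<in> ball 0 R \<Longrightarrow> V x *v u + (e \<bullet> u) *\<^sub>R e = 0 \<Longrightarrow> u = 0"
    and jacobi: "\<And>x a b c. x \<in> ball 0 R \<Longrightarrow> b \<bullet> (FD V x (V x *v a) *v c) +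
        c \<bullet> (FD V x (V x *v b) *v a) + a \<bullet> (FD V x (V x *v c) *v b) = 0"
begin

section \<open>The leafwise symplectic form of a bivector field\<close>

definition \<Theta> :: "real ^ 'n \<Rightarrow> real ^ 'n ^ 'n" where "\<Theta> x = matrix_inv (V x + outer e)"
definition \<omega> :: "real ^ 'n \<Rightarrow> real ^ 'n ^ 'n" where "\<omega> x = \<Theta> x - outer e"

context
  fixes x :: "real ^ 'n"
  assumes x: "x \<in> ball 0 R"
begin

lemma det_V: "det (V x + outer e) \<noteq> 0"
  unfolding det_nonzero_iff_inj by (intro allI impI, rule nondeg[OF x]) (simp add: mv.add_left outer_mult)

lemma leaf_V: "e \<bullet> (V x *v u) = 0"
  using skew[OF x, of e u] kernel[OF x] by simp

lemma \<Theta>_left: "\<Theta> x *v (V x *v u + (e \<bullet> u) *\<^sub>R e) = u"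
  using matrix_inv_mult_vec(2)[OF det_V] by (simp add: \<Theta>_def mv.add_left outer_mult)

lemma \<Theta>_right: "V x *v (\<Theta> x *v u) + (e \<bullet> (\<Theta> x *v u)) *\<^sub>R e = u"
  using matrix_inv_mult_vec(1)[OF det_V] by (simp add: \<Theta>_def mv.add_left outer_mult)

lemma \<Theta>_e: "\<Theta> x *v e = e"
  using \<Theta>_left[of e] kernel[OF x] ee by simp

lemma e_\<Theta>: "e \<bullet> (\<Theta> x *v u) = e \<bullet> u"
  using arg_cong[OF \<Theta>_right[of u], of "\<lambda>y. e \<bullet> y"] leaf_V[of "\<Theta> x *v u"] ee_inner[of "\<Theta> x *v u"]
  by (simp add: inner_add_right mult.commute)

lemma \<omega>_V: "\<omega> x *v (V x *v u) = Q u"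
  using \<Theta>_left[of u] leaf_V[of u] \<Theta>_e
  by (simp add: \<omega>_def mv.diff_left outer_mult mv.add_right mv.scaleR_right Q_def algebra_simps)

lemma V_\<omega>: "V x *v (\<omega> x *v u) = Q u"
  using \<Theta>_right[of u] kernel[OF x]
  by (simp add: \<omega>_def e_\<Theta> mv.diff_left outer_mult mv.diff_right mv.scaleR_right Q_def algebra_simps)

lemma \<omega>_e: "\<omega> x *v e = 0"
  using \<Theta>_e ee by (simp add: \<omega>_def mv.diff_left outer_mult)

text \<open>Skewness passes to the leafwise inverse: paired with a vector of the leaf,
  \<open>a\<close> may be replaced by \<open>V x *v (\<omega> x *v a)\<close>.\<close>

lemma \<omega>_skew: "u \<bullet> (\<omega> x *v v) = - (v \<bullet> (\<omega> x *v u))"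
proof -
  have leaf: "e \<bullet> (\<omega> x *v v) = 0" for v
    using e_\<Theta>[of v] ee_inner[of v] by (simp add: \<omega>_def mv.diff_left outer_mult inner_diff_right mult.commute)
  have Q: "a \<bullet> (\<omega> x *v b) = (V x *v (\<omega> x *v a)) \<bullet> (\<omega> x *v b)" for a b
    using leaf[of b] by (simp add: V_\<omega> Q_def inner_diff_left)
  have "u \<bullet> (\<omega> x *v v) = (\<omega> x *v v) \<bullet> (V x *v (\<omega> x *v u))"
    unfolding Q[of u v] by (simp add: inner_commute)
  also have "\<dots> = - ((\<omega> x *v u) \<bullet> (V x *v (\<omega> x *v v)))" by (rule skew[OF x])
  also have "\<dots> = - (v \<bullet> (\<omega> x *v u))" unfolding Q[of v u] by (simp add: inner_commute)
  finally show ?thesis .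
qed

end

lemma smooth_\<omega>: "smooth_on (ball 0 R) \<omega>"
proof -
  have "smooth_on (ball 0 R) (\<lambda>x. V x + outer e)"
    by (rule smooth_on_add[OF open_ball smooth smooth_on_const[OF open_ball]])
  from smooth_on_matrix_inv[OF open_ball this det_V] have "smooth_on (ball 0 R) \<Theta>"
    unfolding \<Theta>_def .
  then show ?thesis unfolding \<omega>_def by (rule smooth_on_diff[OF open_ball _ smooth_on_const[OF open_ball]])
qed

text \<open>The derivative of an inverse, obtained from the constancy of
  \<open>\<omega> y *v (V y *v b)\<close> in \<open>y\<close>; skewness then moves the outer
  \<open>\<omega> x\<close> to the other side of the inner product and absorbs the sign.\<close>

lemma FD_\<omega>:
  assumes x: "x \<in> ball 0 R" and v: "e \<bullet> v = 0"
  shows "w \<bullet> (FD \<omega> x h *v v) = (\<omega> x *v w) \<bullet> (FD V x h *v (\<omega> x *v v))"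
proof -
  define b where "b = \<omega> x *v v"
  have Vb: "V x *v b = v" unfolding b_def V_\<omega>[OF x] by (rule Q_leaf_id[OF v])
  have "((\<lambda>y. V y *v b) has_derivative (\<lambda>h. FD V x h *v b)) (at x)"
    by (rule bounded_linear.has_derivative[OF mv.bounded_linear_left smooth_on_has_derivative[OF smooth x]])
  from mv.FDERIV[OF smooth_on_has_derivative[OF smooth_\<omega> x] this]
  have 1: "((\<lambda>y. \<omega> y *v (V y *v b)) has_derivative (\<lambda>h. \<omega> x *v (FD V x h *v b) + FD \<omega> x h *v (V x *v b))) (at x)" .
  have 2: "((\<lambda>y. \<omega> y *v (V y *v b)) has_derivative (\<lambda>h. 0)) (at x)"
    by (rule has_derivative_transform_within_open[OF has_derivative_const open_ball x]) (rule \<omega>_V[symmetric])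
  have "FD \<omega> x h *v v = - (\<omega> x *v (FD V x h *v b))"
    using fun_cong[OF has_derivative_unique[OF 1 2], of h] by (simp add: Vb add_eq_0_iff)
  then have "w \<bullet> (FD \<omega> x h *v v) = - (w \<bullet> (\<omega> x *v (FD V x h *v b)))" by simp
  also have "\<dots> = (FD V x h *v b) \<bullet> (\<omega> x *v w)" by (subst \<omega>_skew[OF x]) simp
  finally show ?thesis by (simp add: b_def inner_commute)
qed

text \<open>By \<open>FD_\<omega>\<close>, closedness on the leaf vectors \<open>u\<close>,
  \<open>v\<close>, \<open>w\<close> is the Jacobi identity at their images under
  \<open>\<omega> x\<close>: the duality of Poisson and symplectic structures on each leaf.\<close>

sublocale form: leafwise_form e \<omega> R
proof unfold_locales
  fix x u v w :: "real ^ 'n" assume x: "x \<in> ball 0 R" and l: "e \<bullet> u = 0" "e \<bullet> v = 0" "e \<bullet> w = 0"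
  have V\<omega>: "V x *v (\<omega> x *v a) = a" if "e \<bullet> a = 0" for a
    unfolding V_\<omega>[OF x] by (rule Q_leaf_id[OF that])
  show "v \<bullet> (FD \<omega> x u *v w) + w \<bullet> (FD \<omega> x v *v u) + u \<bullet> (FD \<omega> x w *v v) = 0"
    using jacobi[OF x, of "\<omega> x *v v" "\<omega> x *v u" "\<omega> x *v w"]
    by (simp add: FD_\<omega>[OF x] l V\<omega>)
next
  fix u :: "real ^ 'n" assume "\<omega> 0 *v u + (e \<bullet> u) *\<^sub>R e = 0"
  then have "\<Theta> 0 *v u = 0" by (simp add: \<omega>_def mv.diff_left outer_mult)
  then show "u = 0" using \<Theta>_right[of 0 u] R by simp
qed (rule R smooth_\<omega> | (rule \<omega>_skew \<omega>_e, assumption))+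

text \<open>Passes from forms to bivectors. The map of \<open>moser_form\<close> preserves the
  component along \<open>e\<close> and pulls the leafwise form back to its value at 0, so its
  derivative carries \<open>V 0\<close>, the leafwise inverse of that value, to
  \<open>V (\<phi> x)\<close>.\<close>

theorem darboux:
  obtains \<rho> \<phi> where "0 < \<rho>" "smooth_on (ball 0 \<rho>) \<phi>" "\<phi> 0 = 0"
    "\<And>x. x \<in> ball 0 \<rho> \<Longrightarrow> \<phi> x \<in> ball 0 R"
    "\<And>x. x \<in> ball 0 \<rho> \<Longrightarrow> det (matrix (FD \<phi> x)) \<noteq> 0"
    "\<And>x u. x \<in> ball 0 \<rho> \<Longrightarrow> FD \<phi> x (V 0 *v (transpose (matrix (FD \<phi> x)) *v u)) = V (\<phi> x) *v u"
proof -
  obtain \<rho> \<phi> where \<rho>: "0 < \<rho>" "smooth_on (ball 0 \<rho>) \<phi>" "\<phi> 0 = 0"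
    and \<phi>R: "\<And>x. x \<in> ball 0 \<rho> \<Longrightarrow> \<phi> x \<in> ball 0 R"
    and e\<phi>: "\<And>x v. x \<in> ball 0 \<rho> \<Longrightarrow> e \<bullet> FD \<phi> x v = e \<bullet> v"
    and sym: "\<And>x u v. x \<in> ball 0 \<rho> \<Longrightarrow> e \<bullet> u = 0 \<Longrightarrow> e \<bullet> v = 0 \<Longrightarrow>
       FD \<phi> x v \<bullet> (\<omega> (\<phi> x) *v FD \<phi> x u) = v \<bullet> (\<omega> 0 *v u)"
    using form.moser_form by blast
  have 0: "0 \<in> ball (0 :: real ^ 'n) R" using R by simp
  have J: "matrix (FD \<phi> x) *v v = FD \<phi> x v" if "x \<in> ball 0 \<rho>" for x v
    by (rule matrix_FD_vector_mult[OF smooth_on_differentiable[OF \<rho>(2) that]])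
  have det: "det (matrix (FD \<phi> x)) \<noteq> 0" if x: "x \<in> ball 0 \<rho>" for x
    unfolding det_nonzero_iff_inj J[OF x]
  proof (intro allI impI)
    fix u assume u0: "FD \<phi> x u = 0"
    \<comment> \<open>The kernel of the derivative is thus tangent to the leaf, and by the pullback
      identity it lies in the kernel of \<open>\<omega> 0\<close>, which contains no leaf vector but
      0.\<close>
    then have u: "e \<bullet> u = 0" using e\<phi>[OF x, of u] by simp
    have "v \<bullet> (\<omega> 0 *v u) = 0" for v
    proof -
      have "Q v \<bullet> (\<omega> 0 *v u) = 0" using sym[OF x u Q_leaf[of v]] u0 by simp
      then show ?thesis using form.leaf[OF 0, of u] by (simp add: Q_def inner_diff_left)
    qed
    then have "\<omega> 0 *v u = 0" by (metis inner_eq_zero_iff)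
    then show "u = 0" using V_\<omega>[OF 0, of u] Q_leaf_id[OF u] by simp
  qed
  have "FD \<phi> x (V 0 *v (transpose (matrix (FD \<phi> x)) *v a)) = V (\<phi> x) *v a" if x: "x \<in> ball 0 \<rho>" for x a
  proof -
    note y = \<phi>R[OF x]
    define z where "z = V 0 *v (transpose (matrix (FD \<phi> x)) *v a)"
    have ez: "e \<bullet> z = 0" unfolding z_def by (rule leaf_V[OF 0])
    have tr: "v \<bullet> (transpose (matrix (FD \<phi> x)) *v a) = FD \<phi> x v \<bullet> a" for v
      by (metis J[OF x] dot_lmul_matrix inner_commute transpose_matrix_vector)
    \<comment> \<open>A leaf vector \<open>v\<close> is the image of a leaf vector
      \<open>v'\<close>, to which the pullback identity applies. So the difference is a multiple of
      \<open>e\<close>, and \<open>V (\<phi> x)\<close> annihilates it.\<close>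
    have test: "v \<bullet> (\<omega> (\<phi> x) *v FD \<phi> x z - a) = 0" if ev: "e \<bullet> v = 0" for v
    proof -
      define v' where "v' = matrix_inv (matrix (FD \<phi> x)) *v v"
      have v: "FD \<phi> x v' = v"
        using matrix_inv_mult_vec(1)[OF det[OF x]] J[OF x, of v'] by (simp add: v'_def)
      have ev': "e \<bullet> v' = 0" using e\<phi>[OF x, of v'] v ev by simp
      have "v \<bullet> (\<omega> (\<phi> x) *v FD \<phi> x z) = v' \<bullet> (\<omega> 0 *v z)" using sym[OF x ez ev'] v by simp
      also have "\<dots> = v' \<bullet> Q (transpose (matrix (FD \<phi> x)) *v a)" by (simp only: z_def \<omega>_V[OF 0])
      also have "\<dots> = v' \<bullet> (transpose (matrix (FD \<phi> x)) *v a)"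
        using ev' by (simp add: Q_def inner_diff_right inner_commute)
      also have "\<dots> = v \<bullet> a" unfolding tr v ..
      finally show ?thesis by (simp add: inner_diff_right)
    qed
    define d where "d = \<omega> (\<phi> x) *v FD \<phi> x z - a"
    have "Q d \<bullet> Q d = Q d \<bullet> d" using Q_leaf[of d] by (simp add: Q_def inner_diff_right inner_commute)
    also have "\<dots> = 0" using test[OF Q_leaf] by (simp add: d_def)
    finally have Qd: "Q d = 0" by simp
    have VQ: "V (\<phi> x) *v Q b = V (\<phi> x) *v b" for b
      using kernel[OF y] by (simp add: Q_def mv.diff_right mv.scaleR_right)
    have "V (\<phi> x) *v (\<omega> (\<phi> x) *v FD \<phi> x z) - V (\<phi> x) *v a = V (\<phi> x) *v d"
      by (simp add: d_def mv.diff_right)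
    also have "\<dots> = 0" using VQ[of d] Qd by simp
    finally have "V (\<phi> x) *v a = Q (FD \<phi> x z)" by (simp add: V_\<omega>[OF y])
    then show ?thesis using e\<phi>[OF x, of z] ez Q_leaf_id[of "FD \<phi> x z"] by (simp add: z_def)
  qed
  then show ?thesis using that \<rho> \<phi>R det by blast
qed

end

section \<open>Integrable hyperplane fields\<close>

text \<open>The hyperplane field is the kernel of \<open>w\<close>, and \<open>integrable\<close>
  says that the exterior derivative of \<open>w\<close> vanishes on it. The normalization makes the
  hyperplanes transverse to \<open>e\<close>, so that leaves can be sought as graphs over the
  hyperplane orthogonal to \<open>e\<close>.\<close>

locale integrable_covector = transversal e for e :: "real ^ 'n" +
  fixes w :: "real ^ 'n \<Rightarrow> real ^ 'n" and R :: real
  assumes R: "R > 0" and smooth: "smooth_on (ball 0 R) w"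
    and normalized: "\<And>x. x \<in> ball 0 R \<Longrightarrow> e \<bullet> w x = 1" and at_0: "w 0 = e"
    and integrable: "\<And>x u v. x \<in> ball 0 R \<Longrightarrow> w x \<bullet> u = 0 \<Longrightarrow> w x \<bullet> v = 0 \<Longrightarrow>
        v \<bullet> FD w x u = u \<bullet> FD w x v"
begin

lemma ee1: "e \<bullet> e = 1"
  using normalized[of 0] R at_0 by simp

text \<open>The slope of the hyperplanes: for \<open>u\<close> orthogonal to \<open>e\<close>, the
  vector \<open>u + (a x \<bullet> u) *\<^sub>R e\<close> lies in the kernel of
  \<open>w x\<close>.\<close>

definition a :: "real ^ 'n \<Rightarrow> real ^ 'n" where "a x = e - w x"

lemma a_deriv: "x \<in> ball 0 R \<Longrightarrow> (a has_derivative (\<lambda>h. - FD w x h)) (at x)"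
  unfolding a_def
  by (auto intro!: derivative_eq_intros smooth_on_has_derivative[OF smooth])

lemma smooth_a: "smooth_on (ball 0 R) a"
  unfolding a_def by (rule smooth_on_diff[OF open_ball smooth_on_const[OF open_ball] smooth])

lemma e_a: "x \<in> ball 0 R \<Longrightarrow> e \<bullet> a x = 0"
  by (simp add: a_def inner_diff_right normalized ee1)

lemma FD_a: "x \<in> ball 0 R \<Longrightarrow> FD a x h = - FD w x h"
  using FD_eq[OF a_deriv] by metis

lemma e_FD_a:
  assumes "x \<in> ball 0 R"
  shows "e \<bullet> FD a x h = 0"
proof -
  have "FD (\<lambda>x. e \<bullet> a x) x h = e \<bullet> FD a x h"
    by (rule FD_linear_comp[OF bounded_linear_inner_right smooth_on_differentiable[OF smooth_a assms]])
  moreover have "FD (\<lambda>x. e \<bullet> a x) x = FD (\<lambda>x. 0) x"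
    by (rule FD_cong[OF open_ball assms]) (simp add: e_a)
  ultimately show ?thesis by (simp add: FD_eq[OF has_derivative_const])
qed

text \<open>Integrability tested on the lifts of \<open>u\<close> and \<open>v\<close> to the
  hyperplane. It is the symmetry of the second derivatives of a height function whose gradient along
  its graph is \<open>a\<close>.\<close>

lemma integrable_a:
  assumes x: "x \<in> ball 0 R" and u: "e \<bullet> u = 0" and v: "e \<bullet> v = 0"
  shows "FD a x (u + (a x \<bullet> u) *\<^sub>R e) \<bullet> v = FD a x (v + (a x \<bullet> v) *\<^sub>R e) \<bullet> u"
proof -
  have w: "w x \<bullet> (u + (a x \<bullet> u) *\<^sub>R e) = 0" if "e \<bullet> u = 0" for u
    using that normalized[OF x] by (simp add: a_def inner_add_right inner_diff_left inner_diff_right inner_commute)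
  have e: "FD a x h \<bullet> (u + c *\<^sub>R e) = FD a x h \<bullet> u" for h u c
    using e_FD_a[OF x, of h] by (simp add: inner_add_right inner_commute[of _ e])
  show ?thesis
    using integrable[OF x w[OF u] w[OF v]]
    by (subst (1 2) e[symmetric, where c = "a x \<bullet> _"]) (simp add: FD_a[OF x] inner_commute)
qed

text \<open>The leaf through \<open>c e\<close> is a graph over the hyperplane orthogonal to \<open>e\<close>; its height over the
  ray \<open>t \<mapsto> t Q x\<close> solves a differential equation in \<open>t\<close>.\<close>

definition \<xi> :: "real \<times> (real ^ 'n) \<times> real \<Rightarrow> real ^ 'n" where
  "\<xi> = (\<lambda>(t, x, z). t *\<^sub>R Q x + (e \<bullet> x + z) *\<^sub>R e)"

text \<open>The slope in the direction of the ray. The unknown \<open>z\<close> is the height above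
  the initial height \<open>e \<bullet> x\<close>; the factor \<open>Q x\<close> makes the
  right-hand side vanish for \<open>x = 0\<close>, whatever \<open>z\<close> is.\<close>

definition F :: "real \<times> (real ^ 'n) \<times> real \<Rightarrow> real" where
  "F = (\<lambda>(t, x, z). a (\<xi> (t, x, z)) \<bullet> Q x)"

text \<open>As \<open>\<bar>t\<bar> \<le> 2\<close> and \<open>norm (Q x) \<le> 2 * norm x\<close>,
  the radius \<open>R / 8\<close> bounds the three terms of \<open>\<xi>\<close> by
  \<open>R / 2\<close>, \<open>R / 8\<close> and \<open>R / 8\<close>.\<close>

definition dom :: "(real \<times> (real ^ 'n) \<times> real) set" where
  "dom = {-1<..<2} \<times> ball 0 (R / 8) \<times> ball 0 (R / 8)"

lemma open_dom: "open dom" by (simp add: dom_def open_Times)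

lemma \<xi>_ball:
  assumes "q \<in> dom"
  shows "\<xi> q \<in> ball 0 R"
proof -
  obtain t x z where q: "q = (t, x, z)" by (cases q)
  have b: "\<bar>t\<bar> \<le> 2" "norm x < R / 8" "\<bar>z\<bar> < R / 8" using assms by (auto simp: q dom_def)
  have "norm (t *\<^sub>R Q x) \<le> 2 * (2 * norm x)"
    unfolding norm_scaleR by (intro mult_mono norm_Q b) auto
  moreover have "norm ((e \<bullet> x) *\<^sub>R e) \<le> norm x" by (rule norm_normal_part)
  moreover have "norm (z *\<^sub>R e) \<le> \<bar>z\<bar> * 1" unfolding norm_scaleR using norm_e by (intro mult_left_mono) auto
  moreover have "norm (\<xi> q) \<le> norm (t *\<^sub>R Q x) + norm ((e \<bullet> x) *\<^sub>R e) + norm (z *\<^sub>R e)"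
    unfolding q \<xi>_def prod.case scaleR_add_left add.assoc[symmetric]
    by (meson add_right_mono norm_triangle_ineq order_trans)
  ultimately show ?thesis using b by simp
qed

lemma \<xi>_deriv: "(\<xi> has_derivative (\<lambda>(\<tau>, u, \<zeta>). \<tau> *\<^sub>R Q x + t *\<^sub>R Q u + (e \<bullet> u + \<zeta>) *\<^sub>R e)) (at (t, x, z))"
proof -
  have Q: "((\<lambda>q :: real \<times> (real ^ 'n) \<times> real. Q (fst (snd q))) has_derivative (\<lambda>h. Q (fst (snd h)))) (at (t, x, z))"
    by (intro bounded_linear_imp_has_derivative bounded_linear_compose[OF bounded_linear_Q]
          bounded_linear_compose[OF bounded_linear_fst bounded_linear_snd])
  have e: "((\<lambda>q :: real \<times> (real ^ 'n) \<times> real. e \<bullet> fst (snd q)) has_derivative (\<lambda>h. e \<bullet> fst (snd h))) (at (t, x, z))"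
    by (intro bounded_linear_imp_has_derivative bounded_linear_compose[OF bounded_linear_inner_right]
          bounded_linear_compose[OF bounded_linear_fst bounded_linear_snd])
  have z: "((\<lambda>q :: real \<times> (real ^ 'n) \<times> real. snd (snd q)) has_derivative (\<lambda>h. snd (snd h))) (at (t, x, z))"
    by (intro bounded_linear_imp_has_derivative bounded_linear_compose[OF bounded_linear_snd bounded_linear_snd])
  have t: "((\<lambda>q :: real \<times> (real ^ 'n) \<times> real. fst q) has_derivative fst) (at (t, x, z))"
    by (intro bounded_linear_imp_has_derivative bounded_linear_fst)
  have "((\<lambda>q. fst q *\<^sub>R Q (fst (snd q)) + (e \<bullet> fst (snd q) + snd (snd q)) *\<^sub>R e) has_derivative
      (\<lambda>h. (t *\<^sub>R Q (fst (snd h)) + fst h *\<^sub>R Q x) + (e \<bullet> fst (snd h) + snd (snd h)) *\<^sub>R e)) (at (t, x, z))"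
    by (intro has_derivative_add has_derivative_scaleR_left e z
         bounded_bilinear.FDERIV[OF bounded_bilinear_scaleR t Q, unfolded fst_conv snd_conv])
  then show ?thesis unfolding \<xi>_def split_def by (simp add: add.commute)
qed

lemma FD_F:
  assumes "(t, x, z) \<in> dom"
  shows "FD F (t, x, z) (0, u, \<zeta>) = a (\<xi> (t, x, z)) \<bullet> Q u +
     FD a (\<xi> (t, x, z)) (t *\<^sub>R Q u + (e \<bullet> u + \<zeta>) *\<^sub>R e) \<bullet> Q x"
proof -
  have Q: "((\<lambda>q :: real \<times> (real ^ 'n) \<times> real. Q (fst (snd q))) has_derivative (\<lambda>h. Q (fst (snd h)))) (at (t, x, z))"
    by (intro bounded_linear_imp_has_derivative bounded_linear_compose[OF bounded_linear_Q]
          bounded_linear_compose[OF bounded_linear_fst bounded_linear_snd])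
  have "((\<lambda>q. a (\<xi> q) \<bullet> Q (fst (snd q))) has_derivative
      (\<lambda>h. a (\<xi> (t, x, z)) \<bullet> Q (fst (snd h)) +
        FD a (\<xi> (t, x, z)) ((\<lambda>(\<tau>, u, \<zeta>). \<tau> *\<^sub>R Q x + t *\<^sub>R Q u + (e \<bullet> u + \<zeta>) *\<^sub>R e) h) \<bullet> Q x)) (at (t, x, z))"
    using bounded_bilinear.FDERIV[OF bounded_bilinear_inner
        has_derivative_compose[OF \<xi>_deriv smooth_on_has_derivative[OF smooth_a \<xi>_ball[OF assms]]] Q]
    by simp
  moreover have "F = (\<lambda>q. a (\<xi> q) \<bullet> Q (fst (snd q)))" by (auto simp: F_def)
  ultimately show ?thesis by (simp add: FD_eq)
qed

lemma smooth_F: "smooth_on dom F"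
proof -
  have "smooth_on dom (\<lambda>q. Q (fst (snd q)))"
    by (intro smooth_on_bounded_linear[OF open_dom] bounded_linear_compose[OF bounded_linear_Q]
          bounded_linear_compose[OF bounded_linear_fst bounded_linear_snd])
  moreover have "smooth_on dom \<xi>"
  proof -
    have 1: "smooth_on dom fst" "smooth_on dom (\<lambda>q. Q (fst (snd q)))"
      "smooth_on dom (\<lambda>q. e \<bullet> fst (snd q) + snd (snd q))"
      by (intro smooth_on_bounded_linear[OF open_dom] bounded_linear_compose[OF bounded_linear_Q]
          bounded_linear_compose[OF bounded_linear_fst bounded_linear_snd] bounded_linear_fst bounded_linear_add
          bounded_linear_compose[OF bounded_linear_inner_right]
          bounded_linear_compose[OF bounded_linear_snd bounded_linear_snd])+
    show ?thesis unfolding \<xi>_def split_def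
      by (rule smooth_on_add[OF open_dom smooth_on_scaleR[OF open_dom 1(1,2)]
            smooth_on_scaleR[OF open_dom 1(3) smooth_on_const[OF open_dom]]])
  qed
  from smooth_on_compose[OF open_dom smooth_a this open_ball \<xi>_ball]
  have "smooth_on dom (\<lambda>q. a (\<xi> q))" .
  ultimately have "smooth_on dom (\<lambda>q. a (\<xi> q) \<bullet> Q (fst (snd q)))"
    by (intro smooth_on_inner open_dom)
  moreover have "F = (\<lambda>q. a (\<xi> q) \<bullet> Q (fst (snd q)))" by (auto simp: F_def)
  ultimately show ?thesis by simp
qed

text \<open>Integrating factor: \<open>exp (- G t) * W t\<close> is constant for an antiderivative
  \<open>G\<close> of \<open>c\<close>.\<close>

lemma linear_ode_zero:
  fixes W c :: "real \<Rightarrow> real"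
  assumes W: "\<And>t. t \<in> {0..1} \<Longrightarrow> (W has_vector_derivative c t * W t) (at t)"
    and c: "continuous_on {0..1} c" and W0: "W 0 = 0"
  shows "W 1 = 0"
proof -
  obtain G where G: "\<And>t. t \<in> {0..1} \<Longrightarrow> (G has_vector_derivative c t) (at t within {0..1})"
    using antiderivative_continuous[OF c] by blast
  have "((\<lambda>t. exp (- G t) * W t) has_derivative (\<lambda>h. 0)) (at t within {0..1})" if t: "t \<in> {0..1}" for t
  proof -
    have "(G has_real_derivative c t) (at t within {0..1})"
      using G[OF t] by (simp add: has_real_derivative_iff_has_vector_derivative)
    moreover have "(W has_real_derivative c t * W t) (at t within {0..1})"
      using has_vector_derivative_at_within[OF W[OF t]] by (simp add: has_real_derivative_iff_has_vector_derivative)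
    ultimately have "((\<lambda>t. exp (- G t) * W t) has_real_derivative 0) (at t within {0..1})"
      by (auto intro!: derivative_eq_intros simp: algebra_simps)
    then show ?thesis by (simp add: has_field_derivative_def lambda_zero)
  qed
  from has_derivative_zero_unique[OF convex_real_interval(5) this, of 1 0] W0 show ?thesis by simp
qed

text \<open>A surface swept out by rays has the prescribed slope along the rays by construction;
  integrability provides the right slope in every direction \<open>u\<close> orthogonal to
  \<open>e\<close>. The defect satisfies a homogeneous linear equation along the ray and vanishes at
  its start.\<close>

theorem frobenius:
  obtains \<rho> \<phi> where "0 < \<rho>" "smooth_on (ball 0 \<rho>) \<phi>" "\<phi> 0 = 0"
    "\<And>x. x \<in> ball 0 \<rho> \<Longrightarrow> \<phi> x \<in> ball 0 R"
    "\<And>v. FD \<phi> 0 v = v"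
    "\<And>x u. x \<in> ball 0 \<rho> \<Longrightarrow> e \<bullet> u = 0 \<Longrightarrow> w (\<phi> x) \<bullet> FD \<phi> x u = 0"
proof -
  have R8: "R / 8 > 0" using R by simp
  have t0: "(t, 0, 0) \<in> dom" if "t \<in> {-1<..<2}" for t using that R by (auto simp: dom_def)
  have a0: "a 0 = 0" by (simp add: a_def at_0)
  obtain \<rho> Z where \<rho>: "0 < \<rho>" "\<rho> \<le> R / 8" and Zsm: "smooth_on (ball 0 \<rho>) (\<lambda>p. Z (1, p))"
    and ZR: "\<And>t p. t \<in> {0..1} \<Longrightarrow> p \<in> ball 0 \<rho> \<Longrightarrow> norm (Z (t, p)) < R / 8"
    and Z0: "\<And>p. Z (0, p) = 0" and Z00: "\<And>t. t \<in> {0..1} \<Longrightarrow> Z (t, 0) = 0"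
    and Zt: "\<And>t p. t \<in> {0..1} \<Longrightarrow> p \<in> ball 0 \<rho> \<Longrightarrow>
       ((\<lambda>t. Z (t, p)) has_vector_derivative F (t, p, Z (t, p))) (at t)"
    and Zd: "\<And>t p. t \<in> {0..1} \<Longrightarrow> p \<in> ball 0 \<rho> \<Longrightarrow> (\<lambda>p. Z (t, p)) differentiable (at p)"
    and ZL: "\<And>t p v. t \<in> {0..1} \<Longrightarrow> p \<in> ball 0 \<rho> \<Longrightarrow>
       ((\<lambda>t. FD (\<lambda>p. Z (t, p)) p v) has_vector_derivative
         FD F (t, p, Z (t, p)) (0, v, FD (\<lambda>p. Z (t, p)) p v)) (at t)"
    by (rule parametrized_flow[OF R8 smooth_F[unfolded dom_def]])
       (use FD_F[OF t0] Q_0 in \<open>auto simp: F_def\<close>)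
  define \<phi> where "\<phi> = (\<lambda>x. x + Z (1, x) *\<^sub>R e)"
  define L where "L = (\<lambda>x u t. FD (\<lambda>p. Z (t, p)) x u)"
  have qd: "(t, x, Z (t, x)) \<in> dom" if "t \<in> {0..1}" "x \<in> ball 0 \<rho>" for t x
    using ZR[OF that] that \<rho>(2) by (auto simp: dom_def)
  have L0: "L x u 0 = 0" for x u
  proof -
    have "FD (\<lambda>p. Z (0, p)) x = (\<lambda>v. 0)" by (rule FD_eq) (simp add: Z0)
    then show ?thesis by (simp add: L_def)
  qed
  have Lt: "((\<lambda>t. L x u t) has_vector_derivative a (\<xi> (t, x, Z (t, x))) \<bullet> Q u +
      FD a (\<xi> (t, x, Z (t, x))) (t *\<^sub>R Q u + (e \<bullet> u + L x u t) *\<^sub>R e) \<bullet> Q x) (at t)"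
    if "t \<in> {0..1}" "x \<in> ball 0 \<rho>" for t x u
    using ZL[OF that, of u] unfolding FD_F[OF qd[OF that]] L_def .
  have \<phi>': "FD \<phi> x u = u + L x u 1 *\<^sub>R e" if x: "x \<in> ball 0 \<rho>" for x u
  proof -
    have "(\<phi> has_derivative (\<lambda>u. u + L x u 1 *\<^sub>R e)) (at x)"
      unfolding \<phi>_def L_def
      by (intro has_derivative_add has_derivative_ident has_derivative_scaleR_left FD_works Zd x) auto
    from FD_eq[OF this] show ?thesis by simp
  qed
  have \<phi>\<xi>: "\<phi> x = \<xi> (1, x, Z (1, x))" for x by (simp add: \<phi>_def \<xi>_def Q_def algebra_simps)
  have key: "L x u 1 = a (\<phi> x) \<bullet> u" if x: "x \<in> ball 0 \<rho>" and u: "e \<bullet> u = 0" for x u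
  proof -
    define y where "y = (\<lambda>t. \<xi> (t, x, Z (t, x)))"
    \<comment> \<open>Moving the end of the ray by \<open>u\<close> moves its point at time
      \<open>t\<close> by \<open>t *\<^sub>R u\<close>, so the height should vary by
      \<open>t * (a (y t) \<bullet> u)\<close>; \<open>W\<close> is the defect.\<close>
    define W where "W = (\<lambda>t. L x u t - t * (a (y t) \<bullet> u))"
    have yR: "y t \<in> ball 0 R" if "t \<in> {0..1}" for t unfolding y_def by (rule \<xi>_ball[OF qd[OF that x]])
    have y': "(y has_vector_derivative Q x + (a (y t) \<bullet> Q x) *\<^sub>R e) (at t)" if t: "t \<in> {0..1}" for t
    proof -
      have "((\<lambda>t. t *\<^sub>R Q x + (e \<bullet> x + Z (t, x)) *\<^sub>R e) has_vector_derivative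
          Q x + F (t, x, Z (t, x)) *\<^sub>R e) (at t)"
        using Zt[OF t x]
        by (auto intro!: derivative_eq_intros simp: has_real_derivative_iff_has_vector_derivative)
      then show ?thesis by (simp add: y_def \<xi>_def F_def)
    qed
    have ay: "((\<lambda>t. a (y t)) has_vector_derivative FD a (y t) (Q x + (a (y t) \<bullet> Q x) *\<^sub>R e)) (at t)"
      if t: "t \<in> {0..1}" for t
    proof -
      note d = smooth_on_has_derivative[OF smooth_a yR[OF t]]
      have "(y has_derivative (\<lambda>h. h *\<^sub>R (Q x + (a (y t) \<bullet> Q x) *\<^sub>R e))) (at t)"
        using y'[OF t] by (simp add: has_vector_derivative_def)
      from has_derivative_compose[OF this d] show ?thesis
        using linear_scale[OF has_derivative_linear[OF d]] by (simp add: has_vector_derivative_def)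
    qed
    define c where "c = (\<lambda>t. FD a (y t) e \<bullet> Q x)"
    have "(W has_vector_derivative c t * W t) (at t)" if t: "t \<in> {0..1}" for t
    proof -
      note d = smooth_on_has_derivative[OF smooth_a yR[OF t]]
      note lin = has_derivative_linear[OF d]
      have "((\<lambda>t. a (y t) \<bullet> u) has_vector_derivative FD a (y t) (Q x + (a (y t) \<bullet> Q x) *\<^sub>R e) \<bullet> u) (at t)"
        by (rule bounded_linear.has_vector_derivative[OF bounded_linear_inner_left ay[OF t]])
      then have "(W has_vector_derivative (a (y t) \<bullet> Q u + FD a (y t) (t *\<^sub>R Q u + (e \<bullet> u + L x u t) *\<^sub>R e) \<bullet> Q x) -
          (t * (FD a (y t) (Q x + (a (y t) \<bullet> Q x) *\<^sub>R e) \<bullet> u) + 1 * (a (y t) \<bullet> u))) (at t)"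
        unfolding W_def y_def
        by (intro has_vector_derivative_diff Lt[OF t x]
              bounded_bilinear.has_vector_derivative[OF bounded_bilinear_mult]) (auto intro!: derivative_eq_intros)
      moreover have "(a (y t) \<bullet> Q u + FD a (y t) (t *\<^sub>R Q u + (e \<bullet> u + L x u t) *\<^sub>R e) \<bullet> Q x) -
          (t * (FD a (y t) (Q x + (a (y t) \<bullet> Q x) *\<^sub>R e) \<bullet> u) + 1 * (a (y t) \<bullet> u)) = c t * W t"
      proof -
        \<comment> \<open>The variation of the point on the ray is \<open>t\<close> times a vector
          of the hyperplane plus the defect along \<open>e\<close>. By \<open>integrable_a\<close>
          the first part cancels against the derivative of the slope along the ray, and a multiple
          of \<open>W t\<close> remains.\<close>
        have "t *\<^sub>R Q u + (e \<bullet> u + L x u t) *\<^sub>R e = t *\<^sub>R (u + (a (y t) \<bullet> u) *\<^sub>R e) + W t *\<^sub>R e"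
          by (simp add: u Q_leaf_id[OF u] W_def algebra_simps)
        then have "FD a (y t) (t *\<^sub>R Q u + (e \<bullet> u + L x u t) *\<^sub>R e) =
            t *\<^sub>R FD a (y t) (u + (a (y t) \<bullet> u) *\<^sub>R e) + W t *\<^sub>R FD a (y t) e"
          by (simp only: linear_add[OF lin] linear_scale[OF lin])
        then have "FD a (y t) (t *\<^sub>R Q u + (e \<bullet> u + L x u t) *\<^sub>R e) \<bullet> Q x =
            t * (FD a (y t) (u + (a (y t) \<bullet> u) *\<^sub>R e) \<bullet> Q x) + W t * c t"
          by (simp add: inner_add_left c_def)
        then show ?thesis
          using integrable_a[OF yR[OF t] u Q_leaf[of x]] by (simp add: Q_leaf_id[OF u])
      qed
      ultimately show ?thesis by simp
    qed
    moreover have "continuous_on {0..1} c"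
    proof -
      have "continuous_on {0..1} y"
        using y' by (meson continuous_at_imp_continuous_on has_vector_derivative_continuous)
      then have "continuous_on {0..1} (\<lambda>t. FD a (y t) e)"
        by (rule continuous_on_compose2[OF smooth_on_imp_continuous_on[OF smooth_on_FD[OF smooth_a, of e]]])
           (use yR in auto)
      then show ?thesis unfolding c_def by (intro continuous_intros)
    qed
    moreover have "W 0 = 0" by (simp add: W_def L0)
    ultimately have "W 1 = 0" by (rule linear_ode_zero)
    then show ?thesis by (simp add: W_def y_def \<phi>\<xi>)
  qed
  show ?thesis
  proof (rule that[OF \<rho>(1)])
    show "smooth_on (ball 0 \<rho>) \<phi>"
      unfolding \<phi>_def
      by (rule smooth_on_add[OF open_ball smooth_on_id[OF open_ball] smooth_on_scaleR[OF open_ball Zsm smooth_on_const[OF open_ball]]])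
    show "\<phi> 0 = 0" using Z00[of 1] by (simp add: \<phi>_def)
    show "\<phi> x \<in> ball 0 R" if "x \<in> ball 0 \<rho>" for x
      unfolding \<phi>\<xi> by (rule \<xi>_ball[OF qd[OF _ that]]) simp
    have 0: "0 \<in> ball (0 :: real ^ 'n) \<rho>" using \<rho> by simp
    show "FD \<phi> 0 v = v" for v
    proof -
      have "((\<lambda>t. L 0 v t) has_vector_derivative 0) (at t)" if "t \<in> {0..1}" for t
        using Lt[OF that 0, of v] Z00[OF that] by (simp add: \<xi>_def Q_0 a0)
      from constant_on_unit_interval[OF this] show ?thesis by (simp add: \<phi>'[OF 0] L0)
    qed
    show "w (\<phi> x) \<bullet> FD \<phi> x u = 0" if x: "x \<in> ball 0 \<rho>" and u: "e \<bullet> u = 0" for x u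
    proof -
      have "\<phi> x \<in> ball 0 R" unfolding \<phi>\<xi> by (rule \<xi>_ball[OF qd[OF _ x]]) simp
      then show ?thesis
        using normalized[of "\<phi> x"] u
        by (simp add: \<phi>'[OF x] key[OF x u] inner_add_right a_def inner_diff_left inner_diff_right inner_commute)
    qed
  qed
qed

end

lemma diffeomorphism_on_ball:
  fixes \<phi> :: "real ^ 'n \<Rightarrow> real ^ 'n"
  assumes "0 < \<rho>" "smooth_on (ball 0 \<rho>) \<phi>" "det (matrix (FD \<phi> 0)) \<noteq> 0"
  obtains \<rho>' where "0 < \<rho>'" "\<rho>' \<le> \<rho>" "inj_on \<phi> (ball 0 \<rho>')"
    "\<And>x. x \<in> ball 0 \<rho>' \<Longrightarrow> det (matrix (FD \<phi> x)) \<noteq> 0"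
proof -
  obtain U where U: "open U" "0 \<in> U" "inj_on \<phi> U" "\<And>y. y \<in> U \<Longrightarrow> det (matrix (FD \<phi> y)) \<noteq> 0"
    using smooth_locally_injective[OF open_ball _ assms(2,3)] assms(1) by (metis centre_in_ball)
  obtain r where r: "r > 0" "ball 0 r \<subseteq> U" using U(1,2) open_contains_ball by blast
  have "ball 0 (min r \<rho>) \<subseteq> U" using r(2) by auto
  then show ?thesis
    using U(3,4) r(1) assms(1) by (intro that[of "min r \<rho>"]) (auto intro: inj_on_subset)
qed

section \<open>Charts, tangent and cotangent spaces\<close>

lemma chart_inv_left:
  assumes "is_chart M c" "p \<in> fst c"
  shows "chart_inv c (snd c p) = p"
proof -
  have "homeomorphic_map (subtopology M (fst c)) (top_of_set (snd c ` fst c)) (snd c)" "fst c \<subseteq> topspace M"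
    using assms(1) openin_subset by (auto simp: is_chart_def)
  then have "inj_on (snd c) (fst c)"
    using homeomorphic_imp_injective_map[of "subtopology M (fst c)"] by (simp add: Int_absorb1)
  then show ?thesis unfolding chart_inv_def using assms(2) by simp
qed

lemma chart_inv_right:
  assumes "y \<in> snd c ` fst c"
  shows "chart_inv c y \<in> fst c" "snd c (chart_inv c y) = y"
  unfolding chart_inv_def using assms by (auto intro: inv_into_into f_inv_into_f)

lemma chart_open_image:
  assumes "is_chart M c" "openin M U"
  shows "open (snd c ` (fst c \<inter> U))"
proof -
  have h: "homeomorphic_map (subtopology M (fst c)) (top_of_set (snd c ` fst c)) (snd c)"
    and o: "open (snd c ` fst c)" using assms(1) by (auto simp: is_chart_def)
  have "openin (subtopology M (fst c)) (fst c \<inter> U)"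
    using assms(2) by (simp add: openin_subtopology_Int2)
  then have "openin (top_of_set (snd c ` fst c)) (snd c ` (fst c \<inter> U))"
    using homeomorphic_imp_open_map[OF h] unfolding open_map_def by blast
  then show ?thesis using o openin_open_trans by blast
qed

lemma chart_open_preimage:
  assumes "is_chart M c" "open S"
  shows "openin M {p \<in> fst c. snd c p \<in> S}"
proof -
  have h: "homeomorphic_map (subtopology M (fst c)) (top_of_set (snd c ` fst c)) (snd c)"
    and o: "openin M (fst c)" using assms(1) by (auto simp: is_chart_def)
  have "openin (subtopology M (fst c)) {p \<in> topspace (subtopology M (fst c)). snd c p \<in> S \<inter> snd c ` fst c}"
    by (rule openin_continuous_map_preimage[OF homeomorphic_imp_continuous_map[OF h]])
       (use openin_open_Int[OF assms(2), of "snd c ` fst c"] in \<open>simp add: Int_commute\<close>)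
  moreover have "{p \<in> topspace (subtopology M (fst c)). snd c p \<in> S \<inter> snd c ` fst c} = {p \<in> fst c. snd c p \<in> S}"
    using openin_subset[OF o] by auto
  ultimately show ?thesis using o by (metis openin_trans_full)
qed

lemma linear_real_representation:
  fixes f :: "real ^ 'n \<Rightarrow> real"
  assumes "linear f"
  shows "f x = (\<chi> i. f (axis i 1)) \<bullet> x"
proof -
  have "f x = f (\<Sum>i\<in>UNIV. (x $ i) *\<^sub>R axis i 1)"
    using basis_expansion[of x] by (simp add: scalar_mult_eq_scaleR)
  also have "\<dots> = (\<Sum>i\<in>UNIV. (x $ i) * f (axis i 1))"
    by (simp add: linear_sum[OF assms] linear_scale[OF assms])
  finally show ?thesis by (simp add: inner_vec_def mult.commute)
qed

locale manifold =
  fixes M :: "'m topology" and A :: "('m, 'n::finite) chart set"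
  assumes manifold: "smooth_manifold M A"
begin

lemma is_chart: "c \<in> A \<Longrightarrow> is_chart M c"
  using manifold by (simp add: smooth_manifold_def)

lemma chart_ex:
  assumes "p \<in> topspace M"
  obtains c where "c \<in> A" "p \<in> fst c"
  using manifold assms unfolding smooth_manifold_def by blast

lemma chart_openin: "c \<in> A \<Longrightarrow> openin M (fst c)"
  using is_chart by (auto simp: is_chart_def)

lemma chart_topspace: "c \<in> A \<Longrightarrow> p \<in> fst c \<Longrightarrow> p \<in> topspace M"
  using chart_openin openin_subset by blast

lemma open_overlap: "c \<in> A \<Longrightarrow> openin M U \<Longrightarrow> open (snd c ` (fst c \<inter> U))"
  by (rule chart_open_image[OF is_chart])

lemma open_chart_image: "c \<in> A \<Longrightarrow> open (snd c ` fst c)"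
  using is_chart by (auto simp: is_chart_def)

lemma inv_left [simp]: "c \<in> A \<Longrightarrow> p \<in> fst c \<Longrightarrow> chart_inv c (snd c p) = p"
  by (rule chart_inv_left[OF is_chart])

lemma transition_apply [simp]: "c \<in> A \<Longrightarrow> p \<in> fst c \<Longrightarrow> transition c c' (snd c p) = snd c' p"
  by (simp add: transition_def)

lemma smooth_transition: "c \<in> A \<Longrightarrow> c' \<in> A \<Longrightarrow> smooth_on (snd c ` (fst c \<inter> fst c')) (transition c c')"
  using manifold by (auto simp: smooth_manifold_def compatible_def)

definition jac :: "('m, 'n) chart \<Rightarrow> ('m, 'n) chart \<Rightarrow> 'm \<Rightarrow> real ^ 'n \<Rightarrow> real ^ 'n" where
  "jac c c' p = FD (transition c c') (snd c p)"

lemma transition_deriv: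
  assumes "c \<in> A" "c' \<in> A" "p \<in> fst c" "p \<in> fst c'"
  shows "(transition c c' has_derivative jac c c' p) (at (snd c p))"
  unfolding jac_def by (rule smooth_on_has_derivative[OF smooth_transition]) (use assms in auto)

lemma linear_jac: "c \<in> A \<Longrightarrow> c' \<in> A \<Longrightarrow> p \<in> fst c \<Longrightarrow> p \<in> fst c' \<Longrightarrow> linear (jac c c' p)"
  using transition_deriv has_derivative_linear by blast

lemma matrix_jac:
  assumes "c \<in> A" "c' \<in> A" "p \<in> fst c" "p \<in> fst c'"
  shows "matrix (jac c c' p) *v v = jac c c' p v"
  using matrix_works[of "jac c c' p"] linear_jac[OF assms] by simp

lemma jac_chain:
  assumes "c \<in> A" "c' \<in> A" "c'' \<in> A" "p \<in> fst c" "p \<in> fst c'" "p \<in> fst c''"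
  shows "jac c' c'' p (jac c c' p v) = jac c c'' p v"
proof -
  define S where "S = snd c ` (fst c \<inter> fst c')"
  have S: "open S" "snd c p \<in> S" using open_overlap chart_openin assms by (auto simp: S_def)
  have "(transition c' c'' has_derivative jac c' c'' p) (at (transition c c' (snd c p)))"
    using transition_deriv[of c' c'' p] assms by simp
  from has_derivative_compose[OF transition_deriv this] assms
  have 1: "((\<lambda>y. transition c' c'' (transition c c' y)) has_derivative (\<lambda>v. jac c' c'' p (jac c c' p v))) (at (snd c p))"
    by blast
  have "(transition c c'' has_derivative (\<lambda>v. jac c' c'' p (jac c c' p v))) (at (snd c p))"
    by (rule has_derivative_transform_within_open[OF 1 S]) (use assms in \<open>auto simp: S_def\<close>)
  from FD_eq[OF this] show ?thesis unfolding jac_def[of c c''] by simp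
qed

lemma jac_self:
  assumes "c \<in> A" "p \<in> fst c"
  shows "jac c c p v = v"
proof -
  have "(transition c c has_derivative (\<lambda>v. v)) (at (snd c p))"
    by (rule has_derivative_transform_within_open[OF has_derivative_ident open_chart_image[OF assms(1)]])
       (use assms in auto)
  from FD_eq[OF this] show ?thesis by (simp add: jac_def)
qed

text \<open>The coordinate isomorphism onto the tangent space: the tangent vector at
  \<open>p\<close> with component vector \<open>v\<close> in the chart \<open>c\<close>.\<close>

definition tv :: "('m, 'n) chart \<Rightarrow> 'm \<Rightarrow> real ^ 'n \<Rightarrow> ('m, 'n) tvec" where
  "tv c p v = (\<lambda>c'. if c' \<in> A \<and> p \<in> fst c' then jac c c' p v else 0)"

lemma coord_vec_eq: "coord_vec A c i p = tv c p (axis i 1)"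
  unfolding coord_vec_def tv_def jac_def ..

lemma tangent_jac:
  "v \<in> tangent_space A p \<Longrightarrow> c \<in> A \<Longrightarrow> c' \<in> A \<Longrightarrow> p \<in> fst c \<Longrightarrow> p \<in> fst c' \<Longrightarrow> v c' = jac c c' p (v c)"
  unfolding tangent_space_def jac_def by blast

lemma tangent_outside: "v \<in> tangent_space A p \<Longrightarrow> \<not> (c \<in> A \<and> p \<in> fst c) \<Longrightarrow> v c = 0"
  unfolding tangent_space_def by blast

lemma tangentI:
  assumes "\<And>c c'. c \<in> A \<Longrightarrow> c' \<in> A \<Longrightarrow> p \<in> fst c \<Longrightarrow> p \<in> fst c' \<Longrightarrow> v c' = jac c c' p (v c)"
    and "\<And>c. \<not> (c \<in> A \<and> p \<in> fst c) \<Longrightarrow> v c = 0"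
  shows "v \<in> tangent_space A p"
  unfolding tangent_space_def mem_Collect_eq
proof (intro conjI ballI allI impI)
  fix c c' assume "c \<in> A" "c' \<in> A" "p \<in> fst c \<inter> fst c'"
  then show "v c' = FD (transition c c') (snd c p) (v c)"
    unfolding jac_def[symmetric] by (intro assms(1)) simp_all
qed (rule assms(2))

context
  fixes c :: "('m, 'n) chart" and p :: 'm
  assumes c: "c \<in> A" and p: "p \<in> fst c"
begin

lemma tv_tangent: "tv c p v \<in> tangent_space A p"
  by (rule tangentI) (auto simp: tv_def jac_chain c p)

lemma tv_apply [simp]: "tv c p v c = v"
  by (simp add: tv_def c p jac_self)

lemma tv_eq: "v \<in> tangent_space A p \<Longrightarrow> tv c p (v c) = v"
  using tangent_jac[OF _ c _ p] tangent_outside by (fastforce simp: tv_def)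

lemma tv_add: "tv c p (u + v) = tv c p u + tv c p v"
  using linear_add[OF linear_jac[OF c _ p]] by (auto simp: tv_def fun_eq_iff)

lemma tv_scaleR: "tv c p (r *\<^sub>R v) = r *\<^sub>R tv c p v"
  using linear_scale[OF linear_jac[OF c _ p]] by (auto simp: tv_def fun_eq_iff)

definition cov :: "real ^ 'n \<Rightarrow> ('m, 'n) covec" where
  "cov a = (\<lambda>v. if v \<in> tangent_space A p then a \<bullet> v c else 0)"

lemma tangent_add: "u \<in> tangent_space A p \<Longrightarrow> v \<in> tangent_space A p \<Longrightarrow> u + v \<in> tangent_space A p"
  by (metis tv_add tv_eq tv_tangent)

lemma tangent_scaleR: "u \<in> tangent_space A p \<Longrightarrow> r *\<^sub>R u \<in> tangent_space A p"
  by (metis tv_scaleR tv_eq tv_tangent)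

lemma cov_tangent: "v \<in> tangent_space A p \<Longrightarrow> cov a v = a \<bullet> v c"
  by (simp add: cov_def)

lemma cov_tv [simp]: "cov a (tv c p v) = a \<bullet> v"
  by (simp add: cov_def tv_tangent)

lemma cov_cotangent: "cov a \<in> cotangent_space A p"
  unfolding cotangent_space_def linear_form_on_def
  by (auto simp: cov_def tangent_add tangent_scaleR inner_add_right)

lemma cotangent_linear:
  assumes "w \<in> cotangent_space A p"
  shows "linear (\<lambda>v. w (tv c p v))"
  using assms tv_tangent unfolding cotangent_space_def linear_form_on_def
  by (auto intro!: linearI simp: tv_add tv_scaleR)

lemma cotangent_rep:
  assumes "w \<in> cotangent_space A p"
  shows "w = cov (\<chi> i. w (tv c p (axis i 1)))"
proof
  fix v
  show "w v = cov (\<chi> i. w (tv c p (axis i 1))) v"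
  proof (cases "v \<in> tangent_space A p")
    case True
    then show ?thesis
      using linear_real_representation[OF cotangent_linear[OF assms], of "v c"] tv_eq[OF True]
      by (simp add: cov_def)
  next
    case False
    then show ?thesis using assms by (simp add: cotangent_space_def cov_def)
  qed
qed

lemma cotangentE:
  assumes "w \<in> cotangent_space A p"
  obtains a where "w = cov a"
  using cotangent_rep[OF assms] by blast

lemma coord_diff_eq: "coord_diff A c i p = cov (axis i 1)"
  by (auto simp: coord_diff_def cov_def inner_axis' )

lemma cov_eq_iff: "cov a = cov b \<longleftrightarrow> a = b"
proof
  assume "cov a = cov b"
  then have "a \<bullet> v = b \<bullet> v" for v by (metis cov_tv)
  then show "a = b" using vector_eq_rdot by blast
qed simp

lemma cov_add: "cov (a + b) = cov a + cov b"
  by (auto simp: cov_def fun_eq_iff inner_add_left)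

lemma cov_scaleR: "cov (r *\<^sub>R a) = r *\<^sub>R cov a"
  by (auto simp: cov_def fun_eq_iff)

end

lemma cov_change:
  assumes "c \<in> A" "c' \<in> A" "p \<in> fst c" "p \<in> fst c'"
  shows "cov c' p b = cov c p (transpose (matrix (jac c c' p)) *v b)"
proof
  fix v
  have "b \<bullet> v c' = (transpose (matrix (jac c c' p)) *v b) \<bullet> v c" if "v \<in> tangent_space A p"
    using tangent_jac[OF that assms(1,2,3,4)] matrix_jac[OF assms, of "v c"]
    by (simp add: dot_lmul_matrix)
  then show "cov c' p b v = cov c p (transpose (matrix (jac c c' p)) *v b) v"
    by (auto simp: cov_def assms)
qed

section \<open>New charts from local diffeomorphisms\<close>

text \<open>Maximality of the atlas: \<open>snd c\<close> followed by the inverse of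
  \<open>\<phi>\<close> is a homeomorphism onto \<open>U\<close> whose transitions are old ones
  composed with \<open>\<phi>\<close> or with its smooth inverse, so it belongs to \<open>A\<close>.
  Thus \<open>\<phi>\<close> leads from the new coordinates to the old ones.\<close>

lemma new_chart:
  fixes \<phi> :: "real ^ 'n \<Rightarrow> real ^ 'n"
  assumes c: "c \<in> A" and U: "open U" and \<phi>: "smooth_on U \<phi>" "inj_on \<phi> U" "\<phi> ` U \<subseteq> snd c ` fst c"
    and det: "\<And>u. u \<in> U \<Longrightarrow> det (matrix (FD \<phi> u)) \<noteq> 0"
  obtains c' where "c' \<in> A" "fst c' \<subseteq> fst c" "snd c' ` fst c' = U"
    "\<And>u. u \<in> U \<Longrightarrow> chart_inv c' u = chart_inv c (\<phi> u)" "\<And>u. u \<in> U \<Longrightarrow> transition c' c u = \<phi> u"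
proof -
  define \<theta> where "\<theta> = inv_into U \<phi>"
  have \<theta>\<phi>: "\<theta> (\<phi> u) = u" if "u \<in> U" for u using \<phi>(2) that by (simp add: \<theta>_def)
  have o: "open (\<phi> ` U)" and \<theta>: "smooth_on (\<phi> ` U) \<theta>"
    using smooth_on_inverse_map[OF U \<phi>(1) \<theta>\<phi> det] by auto
  define c' :: "('m, 'n) chart" where "c' = (chart_inv c ` \<phi> ` U, \<theta> \<circ> snd c)"
  have inU: "snd c (chart_inv c (\<phi> u)) = \<phi> u" "chart_inv c (\<phi> u) \<in> fst c" if "u \<in> U" for u
    using chart_inv_right[of "\<phi> u" c] \<phi>(3) that by auto
  have fst': "fst c' = {p \<in> fst c. snd c p \<in> \<phi> ` U}"
  proof
    show "fst c' \<subseteq> {p \<in> fst c. snd c p \<in> \<phi> ` U}" using inU by (auto simp: c'_def)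
    show "{p \<in> fst c. snd c p \<in> \<phi> ` U} \<subseteq> fst c'"
    proof
      fix p assume p: "p \<in> {p \<in> fst c. snd c p \<in> \<phi> ` U}"
      then have "p = chart_inv c (snd c p)" using c by simp
      then show "p \<in> fst c'" using p unfolding c'_def by auto
    qed
  qed
  have snd': "snd c' (chart_inv c (\<phi> u)) = u" if "u \<in> U" for u
    using inU[OF that] \<theta>\<phi>[OF that] by (simp add: c'_def)
  have img: "snd c' ` fst c' = U"
  proof
    show "snd c' ` fst c' \<subseteq> U" using snd' by (auto simp: c'_def)
    show "U \<subseteq> snd c' ` fst c'"
    proof
      fix u assume u: "u \<in> U"
      then have "chart_inv c (\<phi> u) \<in> fst c'" by (auto simp: c'_def)
      then show "u \<in> snd c' ` fst c'" using snd'[OF u] by force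
    qed
  qed
  have op: "openin M (fst c')" unfolding fst' by (rule chart_open_preimage[OF is_chart[OF c] o])
  have inj: "inj_on (snd c') (fst c')"
  proof (rule inj_onI)
    fix p q assume "p \<in> fst c'" "q \<in> fst c'" "snd c' p = snd c' q"
    then show "p = q" unfolding c'_def using inU \<theta>\<phi> by auto
  qed
  have inv': "chart_inv c' u = chart_inv c (\<phi> u)" if u: "u \<in> U" for u
  proof -
    have "chart_inv c (\<phi> u) \<in> fst c'" using u by (auto simp: c'_def)
    then have "inv_into (fst c') (snd c') (snd c' (chart_inv c (\<phi> u))) = chart_inv c (\<phi> u)"
      by (rule inv_into_f_f[OF inj])
    then show ?thesis unfolding chart_inv_def[of c'] snd'[OF u] .
  qed
  have hc: "homeomorphic_map (subtopology M (fst c)) (top_of_set (snd c ` fst c)) (snd c)"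
    using is_chart[OF c] by (simp add: is_chart_def)
  have top: "topspace (subtopology M (fst c')) = fst c'" using openin_subset[OF op] by auto
  have chart': "is_chart M c'"
    unfolding is_chart_def
  proof (intro conjI op)
    show "open (snd c' ` fst c')" using U img by simp
    show "homeomorphic_map (subtopology M (fst c')) (top_of_set (snd c' ` fst c')) (snd c')"
    proof (rule bijective_open_imp_homeomorphic_map)
      show "continuous_map (subtopology M (fst c')) (top_of_set (snd c' ` fst c')) (snd c')"
      proof -
        have "continuous_map (subtopology M (fst c)) euclidean (snd c)"
          using homeomorphic_imp_continuous_map[OF hc] continuous_map_into_fulltopology by blast
        then have "continuous_map (subtopology M (fst c')) euclidean (snd c)"
          by (rule continuous_map_from_subtopology_mono) (simp add: fst')
        then have "continuous_map (subtopology M (fst c')) (top_of_set (\<phi> ` U)) (snd c)"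
          using top by (auto simp: continuous_map_in_subtopology fst')
        then have "continuous_map (subtopology M (fst c')) euclidean (\<theta> \<circ> snd c)"
          by (rule continuous_map_compose) (use smooth_on_imp_continuous_on[OF \<theta>] in simp)
        then show ?thesis
          using top by (auto simp: continuous_map_in_subtopology c'_def)
      qed
      show "open_map (subtopology M (fst c')) (top_of_set (snd c' ` fst c')) (snd c')"
        unfolding open_map_def
      proof (intro allI impI)
        fix S assume "openin (subtopology M (fst c')) S"
        then have S: "openin M S" "S \<subseteq> fst c'"
          using op openin_trans_full openin_subset top by (blast, metis)
        have "open (snd c ` (fst c \<inter> S))" by (rule open_overlap[OF c S(1)])
        then have "open (U \<inter> \<phi> -` (snd c ` (fst c \<inter> S)))"
          by (rule continuous_open_preimage[OF smooth_on_imp_continuous_on[OF \<phi>(1)] U])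
        moreover have "snd c' ` S = U \<inter> \<phi> -` (snd c ` (fst c \<inter> S))"
        proof
          show "snd c' ` S \<subseteq> U \<inter> \<phi> -` (snd c ` (fst c \<inter> S))"
          proof
            fix y assume "y \<in> snd c' ` S"
            then obtain p where p: "p \<in> S" "y = snd c' p" by blast
            then obtain u where u: "u \<in> U" "p = chart_inv c (\<phi> u)" using S(2) by (auto simp: c'_def)
            then show "y \<in> U \<inter> \<phi> -` (snd c ` (fst c \<inter> S))"
              using p snd'[OF u(1)] inU[OF u(1)] by (auto intro!: rev_image_eqI[of p])
          qed
          show "U \<inter> \<phi> -` (snd c ` (fst c \<inter> S)) \<subseteq> snd c' ` S"
          proof
            fix u assume "u \<in> U \<inter> \<phi> -` (snd c ` (fst c \<inter> S))"
            then obtain p where p: "u \<in> U" "p \<in> S" "p \<in> fst c" "\<phi> u = snd c p" by auto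
            then have "p = chart_inv c (\<phi> u)" using c by simp
            then show "u \<in> snd c' ` S" using p snd'[OF p(1)] by force
          qed
        qed
        ultimately show "openin (top_of_set (snd c' ` fst c')) (snd c' ` S)"
          using S(2) by (auto simp: openin_open_eq[OF U] img)
      qed
    qed (use top inj in auto)
  qed
  have compat: "compatible c' c''" if c'': "c'' \<in> A" for c''
    unfolding compatible_def
  proof
    have o1: "open (snd c' ` (fst c' \<inter> fst c''))"
      by (rule chart_open_image[OF chart' chart_openin[OF c'']])
    have sub: "snd c' ` (fst c' \<inter> fst c'') \<subseteq> U" using img by blast
    have "\<phi> u \<in> snd c ` (fst c \<inter> fst c'')" if uu: "u \<in> snd c' ` (fst c' \<inter> fst c'')" for u
    proof -
      obtain p where p: "p \<in> fst c'" "p \<in> fst c''" "u = snd c' p" using uu by blast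
      then obtain u' where u': "u' \<in> U" "p = chart_inv c (\<phi> u')" by (auto simp: c'_def)
      then have "u' = u" using snd'[of u'] p by simp
      then show ?thesis using u' inU[of u'] p by (metis Int_iff imageI)
    qed
    from smooth_on_compose[OF o1 smooth_transition[OF c c''] smooth_on_subset[OF \<phi>(1) sub] _ this]
    have "smooth_on (snd c' ` (fst c' \<inter> fst c'')) (\<lambda>u. transition c c'' (\<phi> u))"
      using open_overlap[OF c chart_openin[OF c'']] by blast
    then show "smooth_on (snd c' ` (fst c' \<inter> fst c'')) (transition c' c'')"
      by (rule smooth_on_cong[OF o1, rotated]) (use sub inv' in \<open>auto simp: transition_def subset_iff\<close>)
    have o2: "open (snd c'' ` (fst c'' \<inter> fst c'))" by (rule open_overlap[OF c'' op])
    have 1: "smooth_on (snd c'' ` (fst c'' \<inter> fst c')) (transition c'' c)"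
      by (rule smooth_on_subset[OF smooth_transition[OF c'' c]]) (auto simp: fst')
    have 2: "transition c'' c y \<in> \<phi> ` U" if "y \<in> snd c'' ` (fst c'' \<inter> fst c')" for y
      using that c'' by (auto simp: fst')
    have "smooth_on (snd c'' ` (fst c'' \<inter> fst c')) (\<lambda>y. \<theta> (transition c'' c y))"
      by (rule smooth_on_compose[OF o2 \<theta> 1 o 2])
    then show "smooth_on (snd c'' ` (fst c' \<inter> fst c'')) (transition c'' c')"
      by (simp add: transition_def c'_def o_def Int_commute)
  qed
  have "c' \<in> A"
    using manifold chart' compat unfolding smooth_manifold_def by blast
  moreover have "transition c' c u = \<phi> u" if "u \<in> U" for u
    using inv'[OF that] inU[OF that] by (simp add: transition_def)
  ultimately show ?thesis using that img inv' fst' by auto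
qed

end

section \<open>Multivector fields in coordinates\<close>

lemma wedge_2:
  assumes "w1 \<in> cotangent_space A p" "w2 \<in> cotangent_space A p"
  shows "wedge A p [v1, v2] [w1, w2] = w1 v1 * w2 v2 - w1 v2 * w2 v1"
proof -
  have f: "finite {1 :: nat}" "0 \<notin> {1 :: nat}" by auto
  have "{..<length [v1, v2]} = {0, 1}" by auto
  then show ?thesis
    unfolding wedge_def using assms
    by (simp only: sum_over_permutations_insert[OF f] permutes_sing)
       (simp add: sign_swap_id sign_id transpose_def)
qed

lemma wedge_3:
  assumes "w1 \<in> cotangent_space A p" "w2 \<in> cotangent_space A p" "w3 \<in> cotangent_space A p"
  shows "wedge A p [v1, v2, v3] [w1, w2, w3] =
    w1 v1 * w2 v2 * w3 v3 + w1 v2 * w2 v3 * w3 v1 + w1 v3 * w2 v1 * w3 v2 -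
    w1 v1 * w2 v3 * w3 v2 - w1 v2 * w2 v1 * w3 v3 - w1 v3 * w2 v2 * w3 v1"
proof -
  have f1: "finite {1, 2 :: nat}" "0 \<notin> {1, 2 :: nat}" by auto
  have f2: "finite {2 :: nat}" "1 \<notin> {2 :: nat}" by auto
  have "{..<length [v1, v2, v3]} = {0, 1, 2}" by auto
  then show ?thesis
    unfolding wedge_def using assms
    by (simp only: sum_over_permutations_insert[OF f1] sum_over_permutations_insert[OF f2] permutes_sing)
       (simp add: sign_swap_id permutation_swap_id sign_compose sign_id transpose_def)
qed

lemma wedge_outside:
  "\<not> (length ws = length vs \<and> set ws \<subseteq> cotangent_space A p) \<Longrightarrow> wedge A p vs ws = 0"
  by (auto simp: wedge_def)

lemma sum_list_fun_apply: "(\<Sum>x\<leftarrow>xs. f x) y = (\<Sum>x\<leftarrow>xs. f x y)" for f :: "'a \<Rightarrow> 'b \<Rightarrow> 'c::comm_monoid_add"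
  by (induction xs) auto

text \<open>The component matrix of the wedge product of \<open>u\<close> and
  \<open>v\<close>.\<close>

definition wm :: "real ^ 'n \<Rightarrow> real ^ 'n \<Rightarrow> real ^ 'n ^ 'n" where
  "wm u v = (\<chi> i j. u $ i * v $ j - v $ i * u $ j)"

lemma wm_mult: "wm u v *v b = (b \<bullet> v) *\<^sub>R u - (b \<bullet> u) *\<^sub>R v"
  by (simp add: wm_def matrix_vector_mult_def vec_eq_iff inner_vec_def sum_distrib_left sum_subtractf
      algebra_simps)

lemma bounded_bilinear_wm: "bounded_bilinear (wm :: real ^ 'n \<Rightarrow> real ^ 'n \<Rightarrow> real ^ 'n ^ 'n)"
  unfolding bilinear_conv_bounded_bilinear[symmetric] bilinear_def
  by (auto intro!: linearI simp: wm_def vec_eq_iff algebra_simps)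

lemma matrix_eqI_inner:
  fixes P N :: "real ^ 'n ^ 'm"
  assumes "\<And>a b. a \<bullet> (P *v b) = a \<bullet> (N *v b)"
  shows "P = N"
  using assms by (metis matrix_eq vector_eq_ldot)

text \<open>The product rule for a vector field pushed forward by \<open>\<tau>\<close>. The first
  term is a second derivative of \<open>\<tau>\<close>, and by symmetry it cancels in Lie
  brackets.\<close>

lemma FD_compose_field:
  fixes \<tau> g :: "real ^ 'n \<Rightarrow> real ^ 'n"
  assumes S: "open S" "z \<in> S" and \<tau>: "smooth_on S \<tau>" and g: "smooth_on S g"
  shows "FD (\<lambda>y. FD \<tau> y (g y)) z h = FD (\<lambda>y. FD \<tau> y (g z)) z h + FD \<tau> z (FD g z h)"
proof -
  define N where "N = (\<lambda>y. matrix (FD \<tau> y))"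
  have N: "N y *v v = FD \<tau> y v" if "y \<in> S" for y v
    unfolding N_def by (rule matrix_FD_vector_mult[OF smooth_on_differentiable[OF \<tau> that]])
  have Nd: "(N has_derivative FD N z) (at z)"
    unfolding N_def by (rule smooth_on_has_derivative[OF smooth_on_matrix_FD[OF S(1) \<tau>] S(2)])
  have "FD (\<lambda>y. FD \<tau> y (g y)) z = FD (\<lambda>y. N y *v g y) z"
    by (rule FD_cong[OF S]) (simp add: N)
  also have "\<dots> = (\<lambda>h. N z *v FD g z h + FD N z h *v g z)"
    by (rule FD_eq[OF mv.FDERIV[OF Nd smooth_on_has_derivative[OF g S(2)]]])
  finally have 1: "FD (\<lambda>y. FD \<tau> y (g y)) z h = N z *v FD g z h + FD N z h *v g z" by simp
  have "FD (\<lambda>y. FD \<tau> y (g z)) z = FD (\<lambda>y. N y *v g z) z"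
    by (rule FD_cong[OF S]) (simp add: N)
  also have "\<dots> = (\<lambda>h. FD N z h *v g z)"
    by (rule FD_eq[OF bounded_linear.has_derivative[OF mv.bounded_linear_left Nd]])
  finally show ?thesis using 1 by (simp add: N[OF S(2)])
qed

text \<open>The Jacobiator of two matrix fields in the coordinate expression of the bracket.\<close>

definition jcb :: "(real ^ 'n \<Rightarrow> real ^ 'n ^ 'n) \<Rightarrow> (real ^ 'n \<Rightarrow> real ^ 'n ^ 'n) \<Rightarrow> real ^ 'n \<Rightarrow>
    real ^ 'n \<Rightarrow> real ^ 'n \<Rightarrow> real ^ 'n \<Rightarrow> real" where
  "jcb P N z a b d = b \<bullet> (FD N z (P z *v a) *v d) + d \<bullet> (FD N z (P z *v b) *v a) + a \<bullet> (FD N z (P z *v d) *v b)"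

lemma jcb_cong:
  assumes "open S" "z \<in> S" "\<And>y. y \<in> S \<Longrightarrow> P y = P' y" "\<And>y. y \<in> S \<Longrightarrow> N y = N' y"
  shows "jcb P N z = jcb P' N' z"
  unfolding jcb_def using FD_cong[OF assms(1,2,4)] assms(2,3) by simp

lemma jcb_sum_left:
  fixes P :: "'a \<Rightarrow> real ^ 'n \<Rightarrow> real ^ 'n ^ 'n"
  assumes "N differentiable (at z)"
  shows "jcb (\<lambda>y. \<Sum>x\<leftarrow>xs. P x y) N z a b d = (\<Sum>x\<leftarrow>xs. jcb (P x) N z a b d)"
proof (induction xs)
  case Nil
  show ?case using linear_0[OF has_derivative_linear[OF FD_works[OF assms]]] by (simp add: jcb_def)
next
  case (Cons x xs)
  then show ?case
    using linear_add[OF has_derivative_linear[OF FD_works[OF assms]]]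
    by (simp add: jcb_def mv.add_left inner_add_right)
qed

lemma differentiable_sum_list:
  assumes "\<And>x. x \<in> set xs \<Longrightarrow> N x differentiable (at z)"
  shows "(\<lambda>y. \<Sum>x\<leftarrow>xs. N x y) differentiable (at z)"
  using assms by (induction xs) auto

lemma jcb_sum_right:
  fixes N :: "'a \<Rightarrow> real ^ 'n \<Rightarrow> real ^ 'n ^ 'n"
  assumes "\<And>x. x \<in> set xs \<Longrightarrow> N x differentiable (at z)"
  shows "jcb P (\<lambda>y. \<Sum>x\<leftarrow>xs. N x y) z a b d = (\<Sum>x\<leftarrow>xs. jcb P (N x) z a b d)"
  using assms
proof (induction xs)
  case Nil
  show ?case by (simp add: jcb_def FD_eq[OF has_derivative_const])
next
  case (Cons x xs)
  have "FD (\<lambda>y. \<Sum>x\<leftarrow>x # xs. N x y) z h = FD (N x) z h + FD (\<lambda>y. \<Sum>x\<leftarrow>xs. N x y) z h" for h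
    using FD_eq[OF has_derivative_add[OF FD_works[of "N x"] FD_works[OF differentiable_sum_list[of xs N]]]] Cons.prems
    by simp
  then show ?case using Cons by (simp add: jcb_def mv.add_left inner_add_right)
qed

lemma smooth_on_wm:
  assumes "open S" "smooth_on S f" "smooth_on S g"
  shows "smooth_on S (\<lambda>y. wm (f y) (g y))"
  by (rule smooth_on_bilinear[OF assms(1) bounded_bilinear_wm assms(2,3)])

text \<open>\<open>br\<close> is the Lie bracket in coordinates and \<open>dt\<close> the
  determinant of a triple wedge, so the left-hand side is the bracket of \<open>x1 \<and> x2\<close>
  and \<open>y1 \<and> y2\<close>. After the product rule both sides are the same polynomial in
  values and first derivatives. The right-hand side sees only the component matrices; independence
  of the decomposition comes from this.\<close>

lemma jcb_wm:
  fixes x1 x2 y1 y2 :: "real ^ 'n \<Rightarrow> real ^ 'n"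
  assumes "x1 differentiable (at z)" "x2 differentiable (at z)" "y1 differentiable (at z)" "y2 differentiable (at z)"
  defines "br \<equiv> \<lambda>f g :: real ^ 'n \<Rightarrow> real ^ 'n. FD g z (f z) - FD f z (g z)"
  defines "dt \<equiv> \<lambda>u v w a b d :: real ^ 'n.
    (a \<bullet> u) * (b \<bullet> v) * (d \<bullet> w) + (a \<bullet> v) * (b \<bullet> w) * (d \<bullet> u) + (a \<bullet> w) * (b \<bullet> u) * (d \<bullet> v) -
    (a \<bullet> u) * (b \<bullet> w) * (d \<bullet> v) - (a \<bullet> v) * (b \<bullet> u) * (d \<bullet> w) - (a \<bullet> w) * (b \<bullet> v) * (d \<bullet> u)"
  shows "dt (br x1 y1) (x2 z) (y2 z) a b d - dt (br x1 y2) (x2 z) (y1 z) a b d -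
      dt (br x2 y1) (x1 z) (y2 z) a b d + dt (br x2 y2) (x1 z) (y1 z) a b d =
    - (jcb (\<lambda>y. wm (x1 y) (x2 y)) (\<lambda>y. wm (y1 y) (y2 y)) z a b d +
       jcb (\<lambda>y. wm (y1 y) (y2 y)) (\<lambda>y. wm (x1 y) (x2 y)) z a b d)"
proof -
  have D: "FD (\<lambda>y. wm (f y) (g y)) z h = wm (f z) (FD g z h) + wm (FD f z h) (g z)"
    if "f differentiable (at z)" "g differentiable (at z)" for f g :: "real ^ 'n \<Rightarrow> real ^ 'n" and h
    using FD_eq[OF bounded_bilinear.FDERIV[OF bounded_bilinear_wm FD_works[OF that(1)] FD_works[OF that(2)]]] by simp
  have lin: "FD f z (r *\<^sub>R u - s *\<^sub>R v) = r *\<^sub>R FD f z u - s *\<^sub>R FD f z v"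
    if "f differentiable (at z)" for f :: "real ^ 'n \<Rightarrow> real ^ 'n" and r s u v
    using has_derivative_linear[OF FD_works[OF that]] by (simp add: linear_diff linear_scale)
  show ?thesis
    unfolding jcb_def D[OF assms(1,2)] D[OF assms(3,4)] wm_mult
    by (simp only: lin assms(1-4) wm_mult mv.add_left inner_diff_right inner_add_right inner_scaleR_right
        inner_diff_left inner_scaleR_left br_def dt_def) (simp add: algebra_simps)
qed

section \<open>Brackets of decomposable fields in a chart\<close>

context manifold
begin

definition loc :: "('m, 'n) chart \<Rightarrow> ('m, 'n) vfield \<Rightarrow> real ^ 'n \<Rightarrow> real ^ 'n" where
  "loc c X y = X (chart_inv c y) c"

lemma smooth_loc: "c \<in> A \<Longrightarrow> vector_field_on A U X \<Longrightarrow> smooth_on (snd c ` (fst c \<inter> U)) (loc c X)"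
  unfolding vector_field_on_def loc_def by blast

lemma loc_apply: "c \<in> A \<Longrightarrow> p \<in> fst c \<Longrightarrow> loc c X (snd c p) = X p c"
  by (simp add: loc_def)

lemma lie_bracket_loc:
  "c \<in> A \<Longrightarrow> p \<in> fst c \<Longrightarrow> lie_bracket A X Y p c =
     FD (loc c Y) (snd c p) (loc c X (snd c p)) - FD (loc c X) (snd c p) (loc c Y (snd c p))"
  unfolding lie_bracket_def loc_apply by (simp add: loc_def[abs_def])

text \<open>The second derivatives of the transition map occur in both halves of the bracket and
  cancel by their symmetry, leaving the transformation by the Jacobian.\<close>

lemma lie_bracket_tangent:
  assumes U: "openin M U" "p \<in> U" and X: "vector_field_on A U X" and Y: "vector_field_on A U Y"
  shows "lie_bracket A X Y p \<in> tangent_space A p"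
proof (rule tangentI)
  fix c c' assume c: "c \<in> A" "p \<in> fst c" and c': "c' \<in> A" "p \<in> fst c'"
  define S where "S = snd c ` (fst c \<inter> (fst c' \<inter> U))"
  define \<tau> where "\<tau> = transition c c'"
  define z where "z = snd c p"
  have S: "open S" "z \<in> S"
    unfolding S_def z_def using open_overlap[OF c(1)] openin_Int[OF chart_openin[OF c'(1)] U(1)] c c' U by auto
  have \<tau>: "smooth_on S \<tau>" unfolding \<tau>_def S_def
    by (rule smooth_on_subset[OF smooth_transition[OF c(1) c'(1)]]) auto
  have change: "loc c' X (\<tau> y) = FD \<tau> y (loc c X y)" if X: "vector_field_on A U X" and y: "y \<in> S" for X y
  proof -
    obtain q where q: "q \<in> fst c" "q \<in> fst c'" "q \<in> U" "y = snd c q" using y by (auto simp: S_def)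
    have "X q \<in> tangent_space A q" using X q(3) by (simp add: vector_field_on_def)
    from tangent_jac[OF this c(1) c'(1) q(1,2)] show ?thesis
      using q c c' by (simp add: \<tau>_def loc_def jac_def)
  qed
  have sm: "smooth_on S (loc c X)" if "vector_field_on A U X" for X
    by (rule smooth_on_subset[OF smooth_loc[OF c(1) that]]) (auto simp: S_def)
  have der: "FD (loc c' Y) (snd c' p) (loc c' X (snd c' p)) =
      FD (\<lambda>y. FD \<tau> y (loc c Y z)) z (loc c X z) + FD \<tau> z (FD (loc c Y) z (loc c X z))"
    if X: "vector_field_on A U X" and Y: "vector_field_on A U Y" for X Y
  proof -
    have \<tau>z: "\<tau> z = snd c' p" using c by (simp add: \<tau>_def z_def)
    have "(loc c' Y has_derivative FD (loc c' Y) (\<tau> z)) (at (\<tau> z))"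
      unfolding \<tau>z by (rule smooth_on_has_derivative[OF smooth_loc[OF c'(1) Y]]) (use c' U in auto)
    from FD_eq[OF has_derivative_compose[OF smooth_on_has_derivative[OF \<tau> S(2)] this]]
    have 1: "FD (\<lambda>y. loc c' Y (\<tau> y)) z (loc c X z) = FD (loc c' Y) (\<tau> z) (FD \<tau> z (loc c X z))" by simp
    have 2: "FD (\<lambda>y. loc c' Y (\<tau> y)) z = FD (\<lambda>y. FD \<tau> y (loc c Y y)) z"
      by (rule FD_cong[OF S change[OF Y]])
    show ?thesis
      using 1 unfolding 2 FD_compose_field[OF S \<tau> sm[OF Y]] \<tau>z[symmetric] change[OF X S(2)] by simp
  qed
  have sym: "FD (\<lambda>y. FD \<tau> y (loc c Y z)) z (loc c X z) = FD (\<lambda>y. FD \<tau> y (loc c X z)) z (loc c Y z)"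
    by (rule FD_symmetric[OF S \<tau>])
  have lin: "linear (FD \<tau> z)" by (rule has_derivative_linear[OF smooth_on_has_derivative[OF \<tau> S(2)]])
  have "lie_bracket A X Y p c' = FD \<tau> z (FD (loc c Y) z (loc c X z)) - FD \<tau> z (FD (loc c X) z (loc c Y z))"
    unfolding lie_bracket_loc[OF c'] der[OF X Y] der[OF Y X] sym by simp
  also have "\<dots> = FD \<tau> z (lie_bracket A X Y p c)"
    unfolding lie_bracket_loc[OF c] z_def[symmetric] by (rule linear_diff[OF lin, symmetric])
  finally show "lie_bracket A X Y p c' = jac c c' p (lie_bracket A X Y p c)" by (simp add: jac_def \<tau>_def z_def)
qed (auto simp: lie_bracket_def)

lemma decomposable_bracket_formula:
  assumes U: "openin M U" "p \<in> U" and c: "c \<in> A" "p \<in> fst c"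
    and X: "vector_field_on A U X1" "vector_field_on A U X2"
    and Y: "vector_field_on A U Y1" "vector_field_on A U Y2"
  shows "decomposable_bracket A [X1, X2] [Y1, Y2] p [cov c p a, cov c p b, cov c p d] =
    - (jcb (\<lambda>y. wm (loc c X1 y) (loc c X2 y)) (\<lambda>y. wm (loc c Y1 y) (loc c Y2 y)) (snd c p) a b d +
       jcb (\<lambda>y. wm (loc c Y1 y) (loc c Y2 y)) (\<lambda>y. wm (loc c X1 y) (loc c X2 y)) (snd c p) a b d)"
proof -
  have df: "loc c X differentiable (at (snd c p))" if "vector_field_on A U X" for X
    by (rule smooth_on_differentiable[OF smooth_loc[OF c(1) that]]) (use c U in auto)
  have t: "X p \<in> tangent_space A p" if "vector_field_on A U X" for X
    using that U(2) by (simp add: vector_field_on_def)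
  have cv: "cov c p a (X p) = a \<bullet> loc c X (snd c p)" if "vector_field_on A U X" for X a
    using cov_tangent[OF c t[OF that]] c by (simp add: loc_def)
  have cl: "cov c p a (lie_bracket A X Y p) =
     a \<bullet> (FD (loc c Y) (snd c p) (loc c X (snd c p)) - FD (loc c X) (snd c p) (loc c Y (snd c p)))"
    if "vector_field_on A U X" "vector_field_on A U Y" for X Y a
    unfolding cov_tangent[OF c lie_bracket_tangent[OF U that]] lie_bracket_loc[OF c] ..
  have two: "{..<length [u, v]} = {0, 1}" for u v :: "('m, 'n) vfield" by auto
  have "decomposable_bracket A [X1, X2] [Y1, Y2] p [cov c p a, cov c p b, cov c p d] =
     wedge A p [lie_bracket A X1 Y1 p, X2 p, Y2 p] [cov c p a, cov c p b, cov c p d] -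
     wedge A p [lie_bracket A X1 Y2 p, X2 p, Y1 p] [cov c p a, cov c p b, cov c p d] -
     wedge A p [lie_bracket A X2 Y1 p, X1 p, Y2 p] [cov c p a, cov c p b, cov c p d] +
     wedge A p [lie_bracket A X2 Y2 p, X1 p, Y1 p] [cov c p a, cov c p b, cov c p d]"
    unfolding decomposable_bracket_def two by (simp add: omit_nth_def)
  also have "\<dots> = - (jcb (\<lambda>y. wm (loc c X1 y) (loc c X2 y)) (\<lambda>y. wm (loc c Y1 y) (loc c Y2 y)) (snd c p) a b d +
       jcb (\<lambda>y. wm (loc c Y1 y) (loc c Y2 y)) (\<lambda>y. wm (loc c X1 y) (loc c X2 y)) (snd c p) a b d)"
    unfolding jcb_wm[OF df[OF X(1)] df[OF X(2)] df[OF Y(1)] df[OF Y(2)], symmetric]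
    by (simp only: wedge_3[OF cov_cotangent[OF c] cov_cotangent[OF c] cov_cotangent[OF c]]
        cv[OF X(1)] cv[OF X(2)] cv[OF Y(1)] cv[OF Y(2)]
        cl[OF X(1) Y(1)] cl[OF X(1) Y(2)] cl[OF X(2) Y(1)] cl[OF X(2) Y(2)])
  finally show ?thesis .
qed

definition wl :: "('m, 'n) chart \<Rightarrow> ('m, 'n) vfield list \<Rightarrow> real ^ 'n \<Rightarrow> real ^ 'n ^ 'n" where
  "wl c Xs = (\<lambda>y. wm (loc c (Xs ! 0) y) (loc c (Xs ! 1) y))"

text \<open>By bilinearity the case of two decomposable fields suffices. The summands enter only
  through the total matrices \<open>P D\<close> and \<open>P E\<close>.\<close>

lemma bracket_sum_formula:
  assumes U: "openin M U" "p \<in> U" and c: "c \<in> A" "p \<in> fst c"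
    and D: "\<And>Xs. Xs \<in> set D \<Longrightarrow> length Xs = 2 \<and> (\<forall>X\<in>set Xs. vector_field_on A U X)"
    and E: "\<And>Xs. Xs \<in> set E \<Longrightarrow> length Xs = 2 \<and> (\<forall>X\<in>set Xs. vector_field_on A U X)"
  defines "P \<equiv> \<lambda>D y. \<Sum>Xs\<leftarrow>D. wl c Xs y"
  shows "(\<Sum>Xs\<leftarrow>D. \<Sum>Ys\<leftarrow>E. decomposable_bracket A Xs Ys p) [cov c p a, cov c p b, cov c p d] =
     - (jcb (P D) (P E) (snd c p) a b d + jcb (P E) (P D) (snd c p) a b d)"
proof -
  have o: "open (snd c ` (fst c \<inter> U))" "snd c p \<in> snd c ` (fst c \<inter> U)"
    using open_overlap[OF c(1) U(1)] c U by auto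
  have pair: "\<exists>X1 X2. Xs = [X1, X2] \<and> vector_field_on A U X1 \<and> vector_field_on A U X2"
    if "length Xs = 2 \<and> (\<forall>X\<in>set Xs. vector_field_on A U X)" for Xs
    using that by (auto simp: numeral_2_eq_2 length_Suc_conv)
  have df: "wl c Xs differentiable (at (snd c p))"
    if Xs: "length Xs = 2 \<and> (\<forall>X\<in>set Xs. vector_field_on A U X)" for Xs
  proof -
    obtain X1 X2 where X: "Xs = [X1, X2]" "vector_field_on A U X1" "vector_field_on A U X2"
      using pair[OF Xs] by blast
    show ?thesis unfolding wl_def
      by (rule smooth_on_differentiable[OF smooth_on_wm[OF o(1)] o(2)]) (use X smooth_loc[OF c(1)] in auto)
  qed
  have 1: "decomposable_bracket A Xs Ys p [cov c p a, cov c p b, cov c p d] =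
      - (jcb (wl c Xs) (wl c Ys) (snd c p) a b d + jcb (wl c Ys) (wl c Xs) (snd c p) a b d)"
    if XY: "Xs \<in> set D" "Ys \<in> set E" for Xs Ys
  proof -
    obtain X1 X2 where X: "Xs = [X1, X2]" "vector_field_on A U X1" "vector_field_on A U X2"
      using pair[OF D[OF XY(1)]] by blast
    obtain Y1 Y2 where Y: "Ys = [Y1, Y2]" "vector_field_on A U Y1" "vector_field_on A U Y2"
      using pair[OF E[OF XY(2)]] by blast
    show ?thesis unfolding X Y wl_def using decomposable_bracket_formula[OF U c X(2,3) Y(2,3)] by simp
  qed
  have neg_sum: "(\<Sum>x\<leftarrow>xs. - (f x + g x)) = - ((\<Sum>x\<leftarrow>xs. f x) + (\<Sum>x\<leftarrow>xs. g x))"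
    for xs :: "('m, 'n) vfield list list" and f g :: "_ \<Rightarrow> real"
    by (induction xs) auto
  have dP: "P E differentiable (at (snd c p))" unfolding P_def
    by (rule differentiable_sum_list) (rule df[OF E])
  have "(\<Sum>Xs\<leftarrow>D. \<Sum>Ys\<leftarrow>E. decomposable_bracket A Xs Ys p) [cov c p a, cov c p b, cov c p d] =
     (\<Sum>Xs\<leftarrow>D. \<Sum>Ys\<leftarrow>E. - (jcb (wl c Xs) (wl c Ys) (snd c p) a b d + jcb (wl c Ys) (wl c Xs) (snd c p) a b d))"
    unfolding sum_list_fun_apply by (intro arg_cong[where f = sum_list] map_cong refl) (rule 1)
  also have "\<dots> = (\<Sum>Xs\<leftarrow>D. - (jcb (wl c Xs) (P E) (snd c p) a b d + jcb (P E) (wl c Xs) (snd c p) a b d))"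
    unfolding P_def neg_sum
    by (intro arg_cong[where f = uminus] arg_cong2[where f = "(+)"] arg_cong[where f = sum_list] map_cong refl)
       (simp_all add: jcb_sum_right[OF df[OF E]] jcb_sum_left[OF df[OF D]])
  also have "\<dots> = - (jcb (P D) (P E) (snd c p) a b d + jcb (P E) (P D) (snd c p) a b d)"
    unfolding neg_sum P_def by (simp add: jcb_sum_left[OF dP[unfolded P_def]] jcb_sum_right[OF df[OF D]])
  finally show ?thesis .
qed

lemma vector_field_tv:
  assumes c: "c \<in> A" and f: "smooth_on (snd c ` fst c) f"
  shows "vector_field_on A (fst c) (\<lambda>p. tv c p (f (snd c p)))"
  unfolding vector_field_on_def
proof (intro conjI ballI)
  show "tv c p (f (snd c p)) \<in> tangent_space A p" if "p \<in> fst c" for p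
    by (rule tv_tangent[OF c that])
  fix c' assume c': "c' \<in> A"
  define S where "S = snd c' ` (fst c' \<inter> fst c)"
  have S: "open S" unfolding S_def by (rule open_overlap[OF c' chart_openin[OF c]])
  have 1: "smooth_on S (transition c' c)" unfolding S_def by (rule smooth_transition[OF c' c])
  have in1: "transition c' c y \<in> snd c ` fst c" if "y \<in> S" for y using that c' by (auto simp: S_def)
  have in2: "transition c' c y \<in> snd c ` (fst c \<inter> fst c')" if "y \<in> S" for y using that c' by (auto simp: S_def)
  have o2: "open (snd c ` (fst c \<inter> fst c'))" by (rule open_overlap[OF c chart_openin[OF c']])
  have "smooth_on S (\<lambda>y. matrix (FD (transition c c') (transition c' c y)) *v f (transition c' c y))"
    by (intro smooth_on_matrix_vector_mult[OF S] smooth_on_compose[OF S f 1 open_chart_image[OF c] in1]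
          smooth_on_compose[OF S smooth_on_matrix_FD[OF o2 smooth_transition[OF c c']] 1 o2 in2])
  then show "smooth_on (snd c' ` (fst c' \<inter> fst c)) (\<lambda>y. tv c (chart_inv c' y) (f (snd c (chart_inv c' y))) c')"
    unfolding S_def[symmetric]
  proof (rule smooth_on_cong[OF S, rotated])
    fix y assume "y \<in> S"
    then obtain q where q: "q \<in> fst c'" "q \<in> fst c" "y = snd c' q" by (auto simp: S_def)
    show "matrix (FD (transition c c') (transition c' c y)) *v f (transition c' c y) =
        tv c (chart_inv c' y) (f (snd c (chart_inv c' y))) c'"
      using q c c' matrix_jac[OF c c' q(2,1)] by (simp add: tv_def jac_def)
  qed
qed

end

section \<open>The component matrix of a bivector field\<close>

locale bivector_manifold = manifold M A for M :: "'m topology" and A :: "('m, 'n::finite) chart set" +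
  fixes V :: "'m \<Rightarrow> ('m, 'n) mvec"
  assumes field: "multivector_field M A 2 V"
begin

definition B :: "('m, 'n) chart \<Rightarrow> 'm \<Rightarrow> real ^ 'n ^ 'n" where
  "B c p = (\<chi> i j. V p [coord_diff A c i p, coord_diff A c j p])"

definition Bl :: "('m, 'n) chart \<Rightarrow> real ^ 'n \<Rightarrow> real ^ 'n ^ 'n" where
  "Bl c y = B c (chart_inv c y)"

lemma V_mult: "p \<in> topspace M \<Longrightarrow> V p \<in> multivectors A p 2"
  using field by (simp add: multivector_field_def)

lemma V_outside:
  "p \<in> topspace M \<Longrightarrow> \<not> (length ws = 2 \<and> set ws \<subseteq> cotangent_space A p) \<Longrightarrow> V p ws = 0"
  using V_mult unfolding multivectors_def by blast

lemma V_linear: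
  assumes "p \<in> topspace M" "w \<in> cotangent_space A p"
  shows "linear_form_on (cotangent_space A p) (\<lambda>v. V p [v, w])"
    "linear_form_on (cotangent_space A p) (\<lambda>v. V p [w, v])" "V p [w, w] = 0"
proof -
  have ws: "length [w, w] = 2 \<and> set [w, w] \<subseteq> cotangent_space A p" using assms(2) by simp
  have 1: "\<forall>i<2. linear_form_on (cotangent_space A p) (\<lambda>v. V p ([w, w][i := v]))"
    and 2: "\<forall>i j. i < j \<and> j < 2 \<and> [w, w] ! i = [w, w] ! j \<longrightarrow> V p [w, w] = 0"
    using V_mult[OF assms(1)] ws unfolding multivectors_def by blast+
  show "linear_form_on (cotangent_space A p) (\<lambda>v. V p [v, w])" using spec[OF 1, of 0] by simp
  show "linear_form_on (cotangent_space A p) (\<lambda>v. V p [w, v])" using spec[OF 1, of 1] by simp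
  show "V p [w, w] = 0" using spec[OF spec[OF 2, of 0], of 1] by simp
qed

lemma smooth_Bl: 
  assumes "c \<in> A"
  shows "smooth_on (snd c ` fst c) (Bl c)"
proof -
  have sm: "\<forall>is. length is = 2 \<longrightarrow>
      smooth_on (snd c ` fst c) (\<lambda>y. V (chart_inv c y) (map (\<lambda>i. coord_diff A c i (chart_inv c y)) is))"
    using field assms unfolding multivector_field_def by blast
  have "smooth_on (snd c ` fst c) (\<lambda>y. V (chart_inv c y) [coord_diff A c i (chart_inv c y), coord_diff A c j (chart_inv c y)])"
    for i j using spec[OF sm, of "[i, j]"] by simp
  then show ?thesis
    unfolding Bl_def B_def by (intro smooth_on_vec_lambda open_chart_image[OF assms])
qed

lemma Bl_apply: "c \<in> A \<Longrightarrow> p \<in> fst c \<Longrightarrow> Bl c (snd c p) = B c p"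
  by (simp add: Bl_def)

context
  fixes c :: "('m, 'n) chart" and p :: 'm
  assumes c: "c \<in> A" and p: "p \<in> fst c"
begin

lemma V_cov: "V p [cov c p a, cov c p b] = a \<bullet> (B c p *v b)"
proof -
  note lf = V_linear[OF chart_topspace[OF c p] cov_cotangent[OF c p]]
  have 1: "linear (\<lambda>a. V p [cov c p a, cov c p b])" for b
    using lf(1)[of b] cov_cotangent[OF c p] unfolding linear_form_on_def
    by (auto intro!: linearI simp: cov_add[OF c p] cov_scaleR[OF c p])
  have 2: "linear (\<lambda>b. V p [cov c p a, cov c p b])" for a
    using lf(2)[of a] cov_cotangent[OF c p] unfolding linear_form_on_def
    by (auto intro!: linearI simp: cov_add[OF c p] cov_scaleR[OF c p])
  have "(B c p *v b) $ i = V p [cov c p (axis i 1), cov c p b]" for i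
    unfolding linear_real_representation[OF 2[of "axis i 1"], of b]
    by (simp add: B_def coord_diff_eq[OF c p] matrix_vector_mult_def inner_vec_def)
  then have "B c p *v b = (\<chi> i. V p [cov c p (axis i 1), cov c p b])" by (simp add: vec_eq_iff)
  then show ?thesis using linear_real_representation[OF 1[of b], of a] by (simp add: inner_commute)
qed

lemma B_skew: "a \<bullet> (B c p *v b) = - (b \<bullet> (B c p *v a))"
proof -
  have z: "u \<bullet> (B c p *v u) = 0" for u
    using V_linear(3)[OF chart_topspace[OF c p] cov_cotangent[OF c p], of u] by (simp add: V_cov)
  show ?thesis
    using z[of "a + b"] z[of a] z[of b] by (simp add: mv.add_right inner_add_left inner_add_right)
qed

lemma annihilator_iff: "cov c p a \<in> annihilator A V p \<longleftrightarrow> B c p *v a = 0"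
proof
  assume "cov c p a \<in> annihilator A V p"
  then have "V p [cov c p a, cov c p b] = 0" for b
    by (simp add: annihilator_def contract_def fun_eq_iff)
  then have "b \<bullet> (B c p *v a) = 0" for b using B_skew[of b a] by (simp add: V_cov)
  then show "B c p *v a = 0" by (metis inner_eq_zero_iff)
next
  assume a: "B c p *v a = 0"
  have "V p (cov c p a # ws) = 0" for ws
  proof (cases "length (cov c p a # ws) = 2 \<and> set (cov c p a # ws) \<subseteq> cotangent_space A p")
    case True
    then obtain w where w: "ws = [w]" "w \<in> cotangent_space A p" by (auto simp: length_Suc_conv numeral_2_eq_2)
    then obtain b where "w = cov c p b" using cotangentE[OF c p] by blast
    then show ?thesis using w a B_skew[of a b] by (simp add: V_cov)
  qed (use V_outside[OF chart_topspace[OF c p]] in blast)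
  then show "cov c p a \<in> annihilator A V p"
    by (simp add: annihilator_def contract_def fun_eq_iff cov_cotangent[OF c p])
qed

text \<open>\<open>rank_at\<close> is the dimension of a space of functions on lists of covectors;
  the linear injection \<open>H\<close> identifies that space with the range of the matrix.\<close>

lemma rank_eq: "rank_at A V p = dim (range ((*v) (B c p)))"
proof -
  define coef where "coef = (\<lambda>w :: ('m, 'n) covec. \<chi> i. w (tv c p (axis i 1)))"
  \<comment> \<open>Contraction fills the first argument, which stands to the left of the matrix in
    \<open>V_cov\<close>; moving it to the right by skewness costs the sign.\<close>
  define H where "H = (\<lambda>y ws. if length ws = 1 \<and> set ws \<subseteq> cotangent_space A p then - (coef (hd ws) \<bullet> y) else 0)"
  have coef: "cov c p (coef w) = w" if "w \<in> cotangent_space A p" for w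
    unfolding coef_def by (rule cotangent_rep[OF c p that, symmetric])
  have coef_cov: "coef (cov c p b) = b" for b
    using coef[OF cov_cotangent[OF c p, of b]] cov_eq_iff[OF c p] by blast
  have "contract (cov c p a) (V p) ws = H (B c p *v a) ws" for a ws
  proof (cases "length ws = 1 \<and> set ws \<subseteq> cotangent_space A p")
    case True
    then obtain w where w: "ws = [w]" "w \<in> cotangent_space A p" by (auto simp: length_Suc_conv)
    have "V p [cov c p a, w] = - (coef w \<bullet> (B c p *v a))"
      using V_cov[of a "coef w"] B_skew[of a "coef w"] by (simp add: coef[OF w(2)])
    then show ?thesis using w by (simp add: contract_def H_def)
  next
    case False
    then have "\<not> (length (cov c p a # ws) = 2 \<and> set (cov c p a # ws) \<subseteq> cotangent_space A p)" by auto
    from V_outside[OF chart_topspace[OF c p] this] show ?thesis using False by (auto simp: contract_def H_def)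
  qed
  then have eq: "contract (cov c p a) (V p) = H (B c p *v a)" for a by (rule ext)
  have img: "(\<lambda>w. contract w (V p)) ` cotangent_space A p = H ` range ((*v) (B c p))"
  proof
    show "(\<lambda>w. contract w (V p)) ` cotangent_space A p \<subseteq> H ` range ((*v) (B c p))"
    proof (rule image_subsetI)
      fix w assume "w \<in> cotangent_space A p"
      from coef[OF this] have "contract w (V p) = H (B c p *v coef w)" using eq[of "coef w"] by simp
      then show "contract w (V p) \<in> H ` range ((*v) (B c p))" by blast
    qed
    show "H ` range ((*v) (B c p)) \<subseteq> (\<lambda>w. contract w (V p)) ` cotangent_space A p"
    proof clarify
      fix a
      show "H (B c p *v a) \<in> (\<lambda>w. contract w (V p)) ` cotangent_space A p"
        unfolding eq[symmetric] by (rule imageI) (rule cov_cotangent[OF c p])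
    qed
  qed
  have lin: "linear H"
    by (rule linearI) (auto simp: H_def fun_eq_iff inner_add_right)
  have "inj H"
  proof (rule injI)
    fix y y' assume "H y = H y'"
    then have "H y [cov c p b] = H y' [cov c p b]" for b by simp
    then have "b \<bullet> y = b \<bullet> y'" for b by (simp add: H_def cov_cotangent[OF c p] coef_cov)
    then show "y = y'" using vector_eq_ldot by blast
  qed
  then have "dim (H ` range ((*v) (B c p))) = dim (range ((*v) (B c p)))"
    by (intro dim_image_eq[OF lin]) (auto intro: inj_on_subset)
  then show ?thesis by (simp add: rank_at_def img)
qed

text \<open>The kernel of a skew matrix is the orthogonal complement of its range.\<close>

lemma dim_kernel: "dim {x. B c p *v x = 0} + rank_at A V p = CARD('n)"
proof -
  have "B c p *v x = 0 \<longleftrightarrow> (\<forall>y\<in>range ((*v) (B c p)). orthogonal y x)" for x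
  proof -
    have "B c p *v x = 0 \<longleftrightarrow> (\<forall>b. b \<bullet> (B c p *v x) = 0)" by (metis inner_eq_zero_iff inner_zero_right)
    also have "\<dots> \<longleftrightarrow> (\<forall>b. (B c p *v b) \<bullet> x = 0)"
      using B_skew[of _ x] by (simp add: inner_commute[of x])
    finally show ?thesis by (simp add: orthogonal_def)
  qed
  then have "{x. B c p *v x = 0} = {x \<in> UNIV. \<forall>y\<in>range ((*v) (B c p)). orthogonal y x}" by simp
  moreover have "subspace (range ((*v) (B c p)))"
    by (rule linear_subspace_image) auto
  ultimately show ?thesis
    using dim_subspace_orthogonal_to_vectors[of "range ((*v) (B c p))" UNIV]
    by (simp add: rank_eq dim_UNIV)
qed

lemma rank_full:
  assumes "rank_at A V p = CARD('n)" "B c p *v a = 0"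
  shows "a = 0"
proof -
  have "dim {x. B c p *v x = 0} = 0" using assms(1) dim_kernel by simp
  then have "{x. B c p *v x = 0} \<subseteq> {0}" by (simp add: dim_eq_0)
  then show ?thesis using assms(2) by blast
qed

lemma rank_corank_1:
  assumes "rank_at A V p = CARD('n) - 1"
  obtains k where "norm k = 1" "B c p *v k = 0" "\<And>a. B c p *v a = 0 \<Longrightarrow> a = (k \<bullet> a) *\<^sub>R k"
proof -
  define K where "K = {x. B c p *v x = 0}"
  have sub: "subspace K" unfolding K_def by (rule subspaceI) (auto simp: mv.add_right mv.scaleR_right)
  have "CARD('n) > 0" by (rule zero_less_card_finite)
  then have d: "dim K = 1" using assms dim_kernel unfolding K_def by linarith
  obtain b where b: "b \<in> K" "b \<noteq> 0" using d by (metis dim_eq_0 subsetI singletonI zero_neq_one)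
  define k where "k = b /\<^sub>R norm b"
  have k: "k \<in> K" "norm k = 1" using b subspace_scale[OF sub] by (auto simp: k_def)
  have sp: "span {k} \<subseteq> K" by (rule span_minimal) (use k sub in auto)
  have "dim (span {k}) = 1" using k(2) by (auto simp: dim_singleton)
  then have eqK: "span {k} = K"
    using dim_eq_span[OF span_superset] subspace_dim_equal[OF subspace_span sub sp] d by simp
  have "a = (k \<bullet> a) *\<^sub>R k" if "B c p *v a = 0" for a
  proof -
    have "a \<in> span {k}" using that eqK by (simp add: K_def)
    then obtain r where "a = r *\<^sub>R k" by (auto simp: span_singleton)
    moreover have "k \<bullet> k = 1" using k(2) by (simp add: dot_square_norm)
    ultimately show ?thesis by simp
  qed
  then show ?thesis using that k by (simp add: K_def)
qed

end

lemma B_change: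
  assumes "c \<in> A" "c' \<in> A" "p \<in> fst c" "p \<in> fst c'"
  shows "B c' p *v b = jac c c' p (B c p *v (transpose (matrix (jac c c' p)) *v b))"
proof -
  have "a \<bullet> (B c' p *v b) = a \<bullet> jac c c' p (B c p *v (transpose (matrix (jac c c' p)) *v b))" for a
  proof -
    have "a \<bullet> (B c' p *v b) = V p [cov c' p a, cov c' p b]" using V_cov[OF assms(2,4)] by simp
    also have "\<dots> = (transpose (matrix (jac c c' p)) *v a) \<bullet> (B c p *v (transpose (matrix (jac c c' p)) *v b))"
      unfolding cov_change[OF assms] by (rule V_cov[OF assms(1,3)])
    also have "\<dots> = a \<bullet> jac c c' p (B c p *v (transpose (matrix (jac c c' p)) *v b))"
      by (simp add: dot_lmul_matrix flip: matrix_jac[OF assms])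
    finally show ?thesis .
  qed
  then show ?thesis using vector_eq_ldot by blast
qed

section \<open>The Schouten bracket in coordinates\<close>

text \<open>Whatever the summands are, their matrices add up to the component matrix; hence
  \<open>bracket_sum_formula\<close> takes the same value on all decompositions.\<close>

lemma decomposition_coords:
  assumes U: "openin M U" and c: "c \<in> A" and D: "decomposes A 2 U V D" and y: "y \<in> snd c ` (fst c \<inter> U)"
  shows "(\<Sum>Xs\<leftarrow>D. wl c Xs y) = Bl c y"
proof (rule matrix_eqI_inner)
  fix a b
  obtain q where q: "q \<in> fst c" "q \<in> U" "y = snd c q" using y by blast
  have D1: "length Xs = 2 \<and> (\<forall>X\<in>set Xs. vector_field_on A U X)" if "Xs \<in> set D" for Xs
    using D that unfolding decomposes_def by blast
  have "a \<bullet> (Bl c y *v b) = V q [cov c q a, cov c q b]"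
    using V_cov[OF c q(1)] c q by (simp add: Bl_def)
  also have "\<dots> = (\<Sum>Xs\<leftarrow>D. wedge A q (map (\<lambda>X. X q) Xs) [cov c q a, cov c q b])"
    using D q(2) by (simp add: decomposes_def sum_list_fun_apply)
  also have "\<dots> = (\<Sum>Xs\<leftarrow>D. a \<bullet> (wl c Xs y *v b))"
  proof (intro arg_cong[where f = sum_list] map_cong refl)
    fix Xs assume "Xs \<in> set D"
    then obtain X1 X2 where X: "Xs = [X1, X2]" "vector_field_on A U X1" "vector_field_on A U X2"
      using D1 by (fastforce simp: numeral_2_eq_2 length_Suc_conv)
    have t: "X1 q \<in> tangent_space A q" "X2 q \<in> tangent_space A q"
      using X q(2) by (auto simp: vector_field_on_def)
    show "wedge A q (map (\<lambda>X. X q) Xs) [cov c q a, cov c q b] = a \<bullet> (wl c Xs y *v b)"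
      using c q by (simp add: X wedge_2[OF cov_cotangent[OF c q(1)] cov_cotangent[OF c q(1)]]
          cov_tangent[OF c q(1) t(1)] cov_tangent[OF c q(1) t(2)] wl_def wm_mult loc_def inner_diff_right mult.commute)
  qed
  also have "\<dots> = a \<bullet> ((\<Sum>Xs\<leftarrow>D. wl c Xs y) *v b)"
    by (induction D) (simp_all add: mv.add_left inner_add_right)
  finally show "a \<bullet> ((\<Sum>Xs\<leftarrow>D. wl c Xs y) *v b) = a \<bullet> (Bl c y *v b)" by simp
qed

lemma decomposition_exists:
  assumes c: "c \<in> A"
  obtains D where "decomposes A 2 (fst c) V D"
proof -
  obtain xs :: "('n \<times> 'n) list" where xs: "set xs = UNIV" "distinct xs"
    using finite_distinct_list[of "UNIV :: ('n \<times> 'n) set"] by (metis finite)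
  \<comment> \<open>The sum runs over all ordered pairs \<open>(i, j)\<close>, so each wedge of
    coordinate fields occurs twice; therefore the coefficients are halved.\<close>
  define D where "D = map (\<lambda>(i, j). [\<lambda>p. tv c p ((Bl c (snd c p) $ i $ j / 2) *\<^sub>R axis i 1), \<lambda>p. tv c p (axis j 1)]) xs"
  have vf1: "vector_field_on A (fst c) (\<lambda>p. tv c p ((Bl c (snd c p) $ i $ j / 2) *\<^sub>R axis i 1))" for i j
    by (rule vector_field_tv[OF c, where f = "\<lambda>y. (Bl c y $ i $ j / 2) *\<^sub>R axis i 1"])
       (intro smooth_on_scaleR[OF open_chart_image[OF c]] smooth_on_const[OF open_chart_image[OF c]]
          smooth_on_divide[OF open_chart_image[OF c]] smooth_on_nth[OF open_chart_image[OF c]] smooth_Bl c, simp)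
  have vf2: "vector_field_on A (fst c) (\<lambda>p. tv c p (axis j 1))" for j
    by (rule vector_field_tv[OF c smooth_on_const[OF open_chart_image[OF c]]])
  have "V p = (\<Sum>Xs\<leftarrow>D. wedge A p (map (\<lambda>X. X p) Xs))" if p: "p \<in> fst c" for p
  proof
    fix ws
    show "V p ws = (\<Sum>Xs\<leftarrow>D. wedge A p (map (\<lambda>X. X p) Xs)) ws"
    proof (cases "length ws = 2 \<and> set ws \<subseteq> cotangent_space A p")
      case True
      then obtain w1 w2 where w: "ws = [w1, w2]" "w1 \<in> cotangent_space A p" "w2 \<in> cotangent_space A p"
        by (auto simp: length_Suc_conv numeral_2_eq_2)
      obtain a b where ab: "w1 = cov c p a" "w2 = cov c p b"
        using cotangentE[OF c p w(2)] cotangentE[OF c p w(3)] by metis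
      have "(\<Sum>Xs\<leftarrow>D. wedge A p (map (\<lambda>X. X p) Xs)) ws =
          (\<Sum>(i, j)\<leftarrow>xs. B c p $ i $ j / 2 * (a $ i * b $ j - a $ j * b $ i))"
        unfolding sum_list_fun_apply D_def map_map o_def w(1) ab
        by (intro arg_cong[where f = sum_list] map_cong refl)
           (auto simp: wedge_2[OF cov_cotangent[OF c p] cov_cotangent[OF c p]] cov_tv[OF c p] inner_axis
              Bl_apply[OF c p] algebra_simps)
      also have "\<dots> = (\<Sum>ij\<in>UNIV. case ij of (i, j) \<Rightarrow> B c p $ i $ j / 2 * (a $ i * b $ j - a $ j * b $ i))"
        using sum_list_distinct_conv_sum_set[OF xs(2)] xs(1) by simp
      also have "\<dots> = (\<Sum>i\<in>UNIV. \<Sum>j\<in>UNIV. B c p $ i $ j / 2 * (a $ i * b $ j - a $ j * b $ i))"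
        by (simp add: sum.cartesian_product UNIV_Times_UNIV[symmetric] del: UNIV_Times_UNIV)
      also have "\<dots> = (\<Sum>i\<in>UNIV. \<Sum>j\<in>UNIV. a $ i * (B c p $ i $ j * b $ j)) / 2 -
          (\<Sum>i\<in>UNIV. \<Sum>j\<in>UNIV. b $ i * (B c p $ i $ j * a $ j)) / 2"
        by (simp add: sum_subtractf[symmetric] sum_divide_distrib algebra_simps diff_divide_distrib)
      also have "\<dots> = (a \<bullet> (B c p *v b)) / 2 - (b \<bullet> (B c p *v a)) / 2"
        by (simp add: inner_vec_def matrix_vector_mult_def sum_distrib_left)
      also have "\<dots> = V p ws" using B_skew[OF c p, of a b] by (simp add: w(1) ab V_cov[OF c p])
      finally show ?thesis by simp
    next
      case False
      have "(\<Sum>Xs\<leftarrow>D. wedge A p (map (\<lambda>X. X p) Xs)) ws = (\<Sum>Xs\<leftarrow>D. 0)"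
        unfolding sum_list_fun_apply
        by (intro arg_cong[where f = sum_list] map_cong refl wedge_outside) (use False in \<open>auto simp: D_def\<close>)
      then show ?thesis using V_outside[OF chart_topspace[OF c p] False] by simp
    qed
  qed
  then have "decomposes A 2 (fst c) V D"
    unfolding decomposes_def using vf1 vf2 by (auto simp: D_def)
  then show ?thesis by (rule that)
qed

text \<open>The definite description in \<open>schouten\<close> yields its value only once existence
  and uniqueness are known. Both decompositions have the matrix \<open>Bl c\<close> near the point,
  so the two Jacobiators of \<open>bracket_sum_formula\<close> coincide and give the factor 2. Every
  candidate is 0 on lists other than triples of covectors, so the values on triples determine
  it.\<close>

lemma schouten_formula:
  assumes c: "c \<in> A" and p: "p \<in> fst c"
  shows "schouten M A 2 2 V V p [cov c p a, cov c p b, cov c p d] = - 2 * jcb (Bl c) (Bl c) (snd c p) a b d"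
    and "\<not> (length ws = 3 \<and> set ws \<subseteq> cotangent_space A p) \<Longrightarrow> schouten M A 2 2 V V p ws = 0"
proof -
  define R where "R = (\<lambda>T. \<exists>U D E. openin M U \<and> p \<in> U \<and> decomposes A 2 U V D \<and> decomposes A 2 U V E \<and>
        T = (\<Sum>Xs\<leftarrow>D. \<Sum>Ys\<leftarrow>E. decomposable_bracket A Xs Ys p))"
  have val: "T [cov c p a, cov c p b, cov c p d] = - 2 * jcb (Bl c) (Bl c) (snd c p) a b d" if "R T" for T a b d
  proof -
    obtain U D E where U: "openin M U" "p \<in> U" and D: "decomposes A 2 U V D" and E: "decomposes A 2 U V E"
      and T: "T = (\<Sum>Xs\<leftarrow>D. \<Sum>Ys\<leftarrow>E. decomposable_bracket A Xs Ys p)" using \<open>R T\<close> unfolding R_def by blast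
    have o: "open (snd c ` (fst c \<inter> U))" "snd c p \<in> snd c ` (fst c \<inter> U)"
      using open_overlap[OF c U(1)] p U by auto
    have D1: "length Xs = 2 \<and> (\<forall>X\<in>set Xs. vector_field_on A U X)" if "Xs \<in> set D" for Xs
      using D that unfolding decomposes_def by blast
    have E1: "length Xs = 2 \<and> (\<forall>X\<in>set Xs. vector_field_on A U X)" if "Xs \<in> set E" for Xs
      using E that unfolding decomposes_def by blast
    note cD = decomposition_coords[OF U(1) c D] and cE = decomposition_coords[OF U(1) c E]
    have "T [cov c p a, cov c p b, cov c p d] =
      - (jcb (\<lambda>y. \<Sum>Xs\<leftarrow>D. wl c Xs y) (\<lambda>y. \<Sum>Xs\<leftarrow>E. wl c Xs y) (snd c p) a b d +
         jcb (\<lambda>y. \<Sum>Xs\<leftarrow>E. wl c Xs y) (\<lambda>y. \<Sum>Xs\<leftarrow>D. wl c Xs y) (snd c p) a b d)"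
      unfolding T by (rule bracket_sum_formula[OF U c p]) (fact D1 E1)+
    moreover have "jcb (\<lambda>y. \<Sum>Xs\<leftarrow>D. wl c Xs y) (\<lambda>y. \<Sum>Xs\<leftarrow>E. wl c Xs y) (snd c p) = jcb (Bl c) (Bl c) (snd c p)"
      by (rule jcb_cong[OF o]) (fact cD cE)+
    moreover have "jcb (\<lambda>y. \<Sum>Xs\<leftarrow>E. wl c Xs y) (\<lambda>y. \<Sum>Xs\<leftarrow>D. wl c Xs y) (snd c p) = jcb (Bl c) (Bl c) (snd c p)"
      by (rule jcb_cong[OF o]) (fact cD cE)+
    ultimately show ?thesis by simp
  qed
  have outside: "T ws = 0" if "R T" "\<not> (length ws = 3 \<and> set ws \<subseteq> cotangent_space A p)" for T ws
  proof -
    obtain U D E where U: "openin M U" "p \<in> U" and D: "decomposes A 2 U V D" and E: "decomposes A 2 U V E"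
      and T: "T = (\<Sum>Xs\<leftarrow>D. \<Sum>Ys\<leftarrow>E. decomposable_bracket A Xs Ys p)" using \<open>R T\<close> unfolding R_def by blast
    have 0: "decomposable_bracket A Xs Ys p ws = 0" if "Xs \<in> set D" "Ys \<in> set E" for Xs Ys
    proof -
      have "length Xs = 2" "length Ys = 2" using D E that unfolding decomposes_def by auto
      then obtain X1 X2 Y1 Y2 where XY: "Xs = [X1, X2]" "Ys = [Y1, Y2]"
        by (auto simp: numeral_2_eq_2 length_Suc_conv)
      have two: "{..<length [u, v]} = {0, 1}" for u v :: "('m, 'n) vfield" by auto
      have w: "wedge A p [u, v, w] ws = 0" for u v w
        by (rule wedge_outside) (use \<open>\<not> (length ws = 3 \<and> set ws \<subseteq> cotangent_space A p)\<close> in auto)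
      show ?thesis unfolding XY decomposable_bracket_def two by (simp add: omit_nth_def w)
    qed
    have "(\<Sum>Xs\<leftarrow>D. \<Sum>Ys\<leftarrow>E. decomposable_bracket A Xs Ys p ws) = (\<Sum>Xs\<leftarrow>D. \<Sum>Ys\<leftarrow>E. 0)"
      by (intro arg_cong[where f = sum_list] map_cong refl) (rule 0)
    then show ?thesis by (simp add: T sum_list_fun_apply)
  qed
  have "\<exists>!T. R T"
  proof (rule ex_ex1I)
    obtain D where "decomposes A 2 (fst c) V D" using decomposition_exists[OF c] .
    then show "\<exists>T. R T" unfolding R_def using chart_openin[OF c] p by blast
    fix T T' assume T: "R T" "R T'"
    show "T = T'"
    proof
      fix ws
      show "T ws = T' ws"
      proof (cases "length ws = 3 \<and> set ws \<subseteq> cotangent_space A p")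
        case True
        then obtain w1 w2 w3 where w: "ws = [w1, w2, w3]" "w1 \<in> cotangent_space A p" "w2 \<in> cotangent_space A p" "w3 \<in> cotangent_space A p"
          by (auto simp: length_Suc_conv numeral_3_eq_3)
        obtain a b d where "w1 = cov c p a" "w2 = cov c p b" "w3 = cov c p d"
          using cotangentE[OF c p w(2)] cotangentE[OF c p w(3)] cotangentE[OF c p w(4)] by metis
        then show ?thesis using val[OF T(1)] val[OF T(2)] w(1) by simp
      next
        case False
        show ?thesis unfolding outside[OF T(1) False] outside[OF T(2) False] ..
      qed
    qed
  qed
  then have "R (schouten M A 2 2 V V p)" unfolding schouten_def R_def[symmetric] by (rule theI')
  from val[OF this] outside[OF this] show
    "schouten M A 2 2 V V p [cov c p a, cov c p b, cov c p d] = - 2 * jcb (Bl c) (Bl c) (snd c p) a b d"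
    "\<not> (length ws = 3 \<and> set ws \<subseteq> cotangent_space A p) \<Longrightarrow> schouten M A 2 2 V V p ws = 0" by auto
qed

lemma schouten_zero_iff:
  assumes c: "c \<in> A" and p: "p \<in> fst c"
  shows "schouten M A 2 2 V V p = 0 \<longleftrightarrow> (\<forall>a b d. jcb (Bl c) (Bl c) (snd c p) a b d = 0)"
proof
  assume "schouten M A 2 2 V V p = 0"
  then show "\<forall>a b d. jcb (Bl c) (Bl c) (snd c p) a b d = 0"
    using schouten_formula(1)[OF c p] by (simp add: fun_eq_iff)
next
  assume j: "\<forall>a b d. jcb (Bl c) (Bl c) (snd c p) a b d = 0"
  show "schouten M A 2 2 V V p = 0"
  proof
    fix ws
    show "schouten M A 2 2 V V p ws = 0 ws"
    proof (cases "length ws = 3 \<and> set ws \<subseteq> cotangent_space A p")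
      case True
      then obtain w1 w2 w3 where w: "ws = [w1, w2, w3]" "w1 \<in> cotangent_space A p" "w2 \<in> cotangent_space A p" "w3 \<in> cotangent_space A p"
        by (auto simp: length_Suc_conv numeral_3_eq_3)
      obtain a b d where "w1 = cov c p a" "w2 = cov c p b" "w3 = cov c p d"
        using cotangentE[OF c p w(2)] cotangentE[OF c p w(3)] cotangentE[OF c p w(4)] by metis
      then show ?thesis using schouten_formula(1)[OF c p, of a b d] j w(1) by simp
    qed (use schouten_formula(2)[OF c p] in simp)
  qed
qed

end

section \<open>One-forms and exterior derivatives in coordinates\<close>

context manifold
begin

definition cf :: "('m, 'n) chart \<Rightarrow> ('m, 'n) form1 \<Rightarrow> real ^ 'n \<Rightarrow> real ^ 'n" where
  "cf c \<omega> y = (\<chi> j. \<omega> (chart_inv c y) (coord_vec A c j (chart_inv c y)))"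

lemma cf_rep:
  assumes "c \<in> A" "q \<in> fst c" "\<omega> q \<in> cotangent_space A q"
  shows "\<omega> q = cov c q (cf c \<omega> (snd c q))"
  using cotangent_rep[OF assms] assms(1,2) by (simp add: cf_def coord_vec_eq)

lemma smooth_cf:
  assumes "c \<in> A" "openin M U" "form1_on A U \<omega>"
  shows "smooth_on (snd c ` (fst c \<inter> U)) (cf c \<omega>)"
  unfolding cf_def
  by (rule smooth_on_vec_lambda[OF open_overlap[OF assms(1,2)]])
     (use assms(1,3) in \<open>simp add: form1_on_def\<close>)

lemma form1_cov:
  assumes c: "c \<in> A" and U: "openin M U" "U \<subseteq> fst c" and f: "smooth_on (snd c ` U) f"
  shows "form1_on A U (\<lambda>p. cov c p (f (snd c p)))"
  unfolding form1_on_def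
proof (intro conjI ballI allI)
  show "cov c p (f (snd c p)) \<in> cotangent_space A p" if "p \<in> U" for p
    by (rule cov_cotangent[OF c]) (use that U in auto)
  fix c' i assume c': "c' \<in> A"
  define S where "S = snd c' ` (fst c' \<inter> U)"
  have S: "open S" unfolding S_def by (rule open_overlap[OF c' U(1)])
  have oU: "open (snd c ` U)" using open_overlap[OF c U(1)] U(2) by (simp add: Int_absorb1)
  have \<sigma>: "smooth_on S (transition c' c)"
    unfolding S_def by (rule smooth_on_subset[OF smooth_transition[OF c' c]]) (use U(2) in auto)
  have in1: "transition c' c y \<in> snd c ` U" if "y \<in> S" for y using that c' by (auto simp: S_def)
  have "smooth_on S (\<lambda>y. f (transition c' c y) \<bullet> FD (transition c' c) y (axis i 1))"
    by (intro smooth_on_inner[OF S] smooth_on_compose[OF S f \<sigma> oU in1] smooth_on_FD \<sigma>)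
  then show "smooth_on (snd c' ` (fst c' \<inter> U))
     (\<lambda>y. cov c (chart_inv c' y) (f (snd c (chart_inv c' y))) (coord_vec A c' i (chart_inv c' y)))"
    unfolding S_def[symmetric]
  proof (rule smooth_on_cong[OF S, rotated])
    fix y assume "y \<in> S"
    then obtain q where q: "q \<in> fst c'" "q \<in> U" "y = snd c' q" by (auto simp: S_def)
    have qc: "q \<in> fst c" using q U by blast
    show "f (transition c' c y) \<bullet> FD (transition c' c) y (axis i 1) =
        cov c (chart_inv c' y) (f (snd c (chart_inv c' y))) (coord_vec A c' i (chart_inv c' y))"
      using q c' qc c cov_tangent[OF c qc tv_tangent[OF c' q(1)]]
      by (simp add: coord_vec_eq) (simp add: tv_def jac_def)
  qed
qed

text \<open>Pulling back by the transition map adds a term with its second derivative, which is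
  symmetric in the two vectors and disappears on antisymmetrization.\<close>

lemma ext_deriv_change:
  assumes U: "openin M U" "p \<in> U" and \<omega>: "form1_on A U \<omega>"
    and c: "c \<in> A" "p \<in> fst c" and c': "c' \<in> A" "p \<in> fst c'"
    and u: "u \<in> tangent_space A p" and v: "v \<in> tangent_space A p"
  shows "v c \<bullet> FD (cf c \<omega>) (snd c p) (u c) - u c \<bullet> FD (cf c \<omega>) (snd c p) (v c) =
     v c' \<bullet> FD (cf c' \<omega>) (snd c' p) (u c') - u c' \<bullet> FD (cf c' \<omega>) (snd c' p) (v c')"
proof -
  define S where "S = snd c ` (fst c \<inter> (fst c' \<inter> U))"
  define \<tau> where "\<tau> = transition c c'"
  define z where "z = snd c p"
  have S: "open S" "z \<in> S"
    unfolding S_def z_def using open_overlap[OF c(1)] openin_Int[OF chart_openin[OF c'(1)] U(1)] c c' U by auto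
  have \<tau>: "smooth_on S \<tau>" unfolding \<tau>_def S_def
    by (rule smooth_on_subset[OF smooth_transition[OF c(1) c'(1)]]) auto
  have \<tau>z: "\<tau> z = snd c' p" using c by (simp add: \<tau>_def z_def)
  have change: "cf c \<omega> y \<bullet> h = cf c' \<omega> (\<tau> y) \<bullet> FD \<tau> y h" if y: "y \<in> S" for y h
  proof -
    obtain q where q: "q \<in> fst c" "q \<in> fst c'" "q \<in> U" "y = snd c q" using y by (auto simp: S_def)
    have \<omega>q: "\<omega> q \<in> cotangent_space A q" using \<omega> q(3) by (simp add: form1_on_def)
    have "cf c \<omega> y \<bullet> h = \<omega> q (tv c q h)"
      by (subst cf_rep[where \<omega> = \<omega>, OF c(1) q(1) \<omega>q]) (use q c in simp)
    also have "\<dots> = cf c' \<omega> (snd c' q) \<bullet> tv c q h c'"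
      by (subst cf_rep[where \<omega> = \<omega>, OF c'(1) q(2) \<omega>q]) (rule cov_tangent[OF c'(1) q(2) tv_tangent[OF c(1) q(1)]])
    also have "\<dots> = cf c' \<omega> (\<tau> y) \<bullet> FD \<tau> y h"
      using q c c' by (simp add: tv_def jac_def \<tau>_def)
    finally show ?thesis .
  qed
  have d: "(cf c \<omega> has_derivative FD (cf c \<omega>) z) (at z)"
    unfolding z_def by (rule smooth_on_has_derivative[OF smooth_cf[OF c(1) U(1) \<omega>]]) (use c U in auto)
  have d': "(cf c' \<omega> has_derivative FD (cf c' \<omega>) (\<tau> z)) (at (\<tau> z))"
    unfolding \<tau>z by (rule smooth_on_has_derivative[OF smooth_cf[OF c'(1) U(1) \<omega>]]) (use c' U in auto)
  have key: "FD (cf c \<omega>) z g \<bullet> h = FD (cf c' \<omega>) (\<tau> z) (FD \<tau> z g) \<bullet> FD \<tau> z h +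
      cf c' \<omega> (\<tau> z) \<bullet> FD (\<lambda>y. FD \<tau> y h) z g" for g h
  proof -
    have 1: "((\<lambda>y. cf c \<omega> y \<bullet> h) has_derivative (\<lambda>g. FD (cf c \<omega>) z g \<bullet> h)) (at z)"
      by (rule bounded_linear.has_derivative[OF bounded_linear_inner_left d])
    have "((\<lambda>y. cf c' \<omega> (\<tau> y) \<bullet> FD \<tau> y h) has_derivative
       (\<lambda>g. cf c' \<omega> (\<tau> z) \<bullet> FD (\<lambda>y. FD \<tau> y h) z g + FD (cf c' \<omega>) (\<tau> z) (FD \<tau> z g) \<bullet> FD \<tau> z h)) (at z)"
      by (rule bounded_bilinear.FDERIV[OF bounded_bilinear_inner
            has_derivative_compose[OF smooth_on_has_derivative[OF \<tau> S(2)] d']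
            smooth_on_has_derivative[OF smooth_on_FD[OF \<tau>] S(2)]])
    then have "((\<lambda>y. cf c \<omega> y \<bullet> h) has_derivative
       (\<lambda>g. cf c' \<omega> (\<tau> z) \<bullet> FD (\<lambda>y. FD \<tau> y h) z g + FD (cf c' \<omega>) (\<tau> z) (FD \<tau> z g) \<bullet> FD \<tau> z h)) (at z)"
      by (rule has_derivative_transform_within_open[OF _ S]) (simp add: change)
    from fun_cong[OF has_derivative_unique[OF 1 this], of g] show ?thesis by simp
  qed
  have uv: "FD \<tau> z (u c) = u c'" "FD \<tau> z (v c) = v c'"
    using tangent_jac[OF u c(1) c'(1) c(2) c'(2)] tangent_jac[OF v c(1) c'(1) c(2) c'(2)]
    by (simp_all add: jac_def \<tau>_def z_def)
  show ?thesis
    using key[of "u c" "v c"] key[of "v c" "u c"] FD_symmetric[OF S \<tau>, of "u c" "v c"]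
    by (simp add: uv \<tau>z z_def[symmetric] inner_commute)
qed

text \<open>\<open>ext_deriv\<close> computes in a chart picked by choice; invariance allows the
  chart at hand instead.\<close>

lemma ext_deriv_chart:
  assumes U: "openin M U" "p \<in> U" and \<omega>: "form1_on A U \<omega>" and c: "c \<in> A" "p \<in> fst c"
    and u: "u \<in> tangent_space A p" and v: "v \<in> tangent_space A p"
  shows "ext_deriv A \<omega> p u v = v c \<bullet> FD (cf c \<omega>) (snd c p) (u c) - u c \<bullet> FD (cf c \<omega>) (snd c p) (v c)"
proof -
  define c' where "c' = (SOME c. c \<in> A \<and> p \<in> fst c)"
  have c': "c' \<in> A" "p \<in> fst c'"
    using someI[of "\<lambda>c. c \<in> A \<and> p \<in> fst c" c] c unfolding c'_def by blast+
  have df: "cf c' \<omega> differentiable (at (snd c' p))"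
    by (rule smooth_on_differentiable[OF smooth_cf[OF c'(1) U(1) \<omega>]]) (use c' U in auto)
  have comp: "FD (\<lambda>y. \<omega> (chart_inv c' y) (coord_vec A c' j (chart_inv c' y))) (snd c' p) h = FD (cf c' \<omega>) (snd c' p) h $ j" for j h
    using FD_linear_comp[OF bounded_linear_vec_nth df, of j h] by (simp add: cf_def)
  have "ext_deriv A \<omega> p u v = v c' \<bullet> FD (cf c' \<omega>) (snd c' p) (u c') - u c' \<bullet> FD (cf c' \<omega>) (snd c' p) (v c')"
    unfolding ext_deriv_def Let_def c'_def[symmetric] comp
    by (simp add: inner_vec_def sum_subtractf mult.commute)
  then show ?thesis unfolding ext_deriv_change[OF U \<omega> c' c u v] .
qed

section \<open>Adapted charts\<close>

text \<open>The ball is shrunk until \<open>\<phi>\<close> is injective with nonvanishing Jacobian,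
  as \<open>new_chart\<close> requires; \<open>\<phi>\<close> and its derivative then describe the
  change from the new chart to the old one.\<close>

lemma new_chart_ball:
  fixes \<phi> :: "real ^ 'n \<Rightarrow> real ^ 'n"
  assumes c: "c \<in> A" "x \<in> fst c" and \<phi>: "0 < \<rho>" "smooth_on (ball 0 \<rho>) \<phi>" "\<phi> 0 = snd c x"
    "\<And>u. u \<in> ball 0 \<rho> \<Longrightarrow> \<phi> u \<in> snd c ` fst c" and det: "det (matrix (FD \<phi> 0)) \<noteq> 0"
  obtains c' \<rho>' where "c' \<in> A" "x \<in> fst c'" "snd c' x = 0" "0 < \<rho>'" "\<rho>' \<le> \<rho>" "snd c' ` fst c' = ball 0 \<rho>'"
    "fst c' \<subseteq> fst c"
    "\<forall>p\<in>fst c'. snd c p = \<phi> (snd c' p) \<and> (\<forall>v. jac c' c p v = FD \<phi> (snd c' p) v)"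
    "\<forall>u\<in>ball 0 \<rho>'. det (matrix (FD \<phi> u)) \<noteq> 0"
proof -
  obtain \<rho>' where \<rho>': "0 < \<rho>'" "\<rho>' \<le> \<rho>" "inj_on \<phi> (ball 0 \<rho>')"
    "\<And>u. u \<in> ball 0 \<rho>' \<Longrightarrow> det (matrix (FD \<phi> u)) \<noteq> 0"
    using diffeomorphism_on_ball[OF \<phi>(1,2) det] by blast
  have sub: "ball 0 \<rho>' \<subseteq> ball (0 :: real ^ 'n) \<rho>" using \<rho>'(2) by auto
  obtain c' where c': "c' \<in> A" "fst c' \<subseteq> fst c" "snd c' ` fst c' = ball 0 \<rho>'"
    and inv': "\<And>u. u \<in> ball 0 \<rho>' \<Longrightarrow> chart_inv c' u = chart_inv c (\<phi> u)"
    and tr: "\<And>u. u \<in> ball 0 \<rho>' \<Longrightarrow> transition c' c u = \<phi> u"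
    by (rule new_chart[OF c(1) open_ball smooth_on_subset[OF \<phi>(2) sub] \<rho>'(3) _ \<rho>'(4)])
       (use \<phi>(4) sub in auto)
  have 0: "0 \<in> ball (0 :: real ^ 'n) \<rho>'" using \<rho>' by simp
  have x: "chart_inv c' 0 = x" using inv'[OF 0] \<phi>(3) c by simp
  have xc': "x \<in> fst c'" "snd c' x = 0"
    using chart_inv_right[of 0 c'] 0 unfolding c'(3) x by auto
  have img: "snd c' p \<in> ball 0 \<rho>'" if "p \<in> fst c'" for p using c'(3) that by blast
  have 1: "snd c p = \<phi> (snd c' p)" if "p \<in> fst c'" for p
    using tr[OF img[OF that]] c'(1) that by simp
  have 2: "jac c' c p v = FD \<phi> (snd c' p) v" if "p \<in> fst c'" for p v
    unfolding jac_def using FD_cong[OF open_ball img[OF that] tr] by simp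
  show ?thesis by (rule that[OF c'(1) xc' \<rho>'(1,2) c'(3,2)]) (use 1 2 \<rho>'(4) in blast)+
qed

lemma centered_chart:
  assumes x: "x \<in> topspace M"
  obtains c R where "c \<in> A" "x \<in> fst c" "snd c x = 0" "0 < R" "ball 0 R \<subseteq> snd c ` fst c"
proof -
  obtain c where c: "c \<in> A" "x \<in> fst c" using chart_ex[OF x] by blast
  obtain r where r: "r > 0" "ball (snd c x) r \<subseteq> snd c ` fst c"
    using open_chart_image[OF c(1)] c(2) open_contains_ball by blast
  define \<phi> where "\<phi> = (\<lambda>u. snd c x + u)"
  have sm: "smooth_on (ball 0 r) \<phi>" unfolding \<phi>_def
    by (rule smooth_on_add[OF open_ball smooth_on_const[OF open_ball] smooth_on_id[OF open_ball]])
  have "(\<phi> has_derivative (\<lambda>h. h)) (at 0)" unfolding \<phi>_def by (auto intro!: derivative_eq_intros)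
  then have "FD \<phi> 0 = id" by (simp add: FD_eq id_def)
  then have det: "det (matrix (FD \<phi> 0)) \<noteq> 0" by (simp add: matrix_id_mat_1 det_I)
  have im: "\<phi> u \<in> snd c ` fst c" if "u \<in> ball 0 r" for u
    by (rule subsetD[OF r(2)]) (use that in \<open>simp add: \<phi>_def dist_norm\<close>)
  have \<phi>0: "\<phi> 0 = snd c x" by (simp add: \<phi>_def)
  show ?thesis
  proof (rule new_chart_ball[OF c r(1) sm \<phi>0 im det])
    fix c' \<rho>' assume "c' \<in> A" "x \<in> fst c'" "snd c' x = 0" "0 < \<rho>'" "snd c' ` fst c' = ball 0 \<rho>'"
    then show thesis by (intro that[of c' \<rho>']) simp_all
  qed
qed

end

section \<open>Charts with constant coefficients and charts adapted to the annihilator\<close>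

context bivector_manifold
begin

lemma B_new_chart:
  assumes "c \<in> A" "c' \<in> A" "p \<in> fst c" "p \<in> fst c'"
    and det: "det (matrix (jac c' c p)) \<noteq> 0"
  shows "jac c' c p (B c' p *v (transpose (matrix (jac c' c p)) *v b)) = B c p *v b"
    "jac c' c p v = 0 \<Longrightarrow> v = 0"
    "\<exists>b. a = transpose (matrix (jac c' c p)) *v b"
proof -
  show "jac c' c p (B c' p *v (transpose (matrix (jac c' c p)) *v b)) = B c p *v b"
    by (rule B_change[symmetric]) (use assms in auto)
  have J: "matrix (jac c' c p) *v v = jac c' c p v" for v by (rule matrix_jac) (use assms in auto)
  show "jac c' c p v = 0 \<Longrightarrow> v = 0" using det J unfolding det_nonzero_iff_inj by metis
  have "det (transpose (matrix (jac c' c p))) \<noteq> 0" using det by (simp add: det_transpose)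
  from matrix_inv_mult_vec(1)[OF this, of a] show "\<exists>b. a = transpose (matrix (jac c' c p)) *v b" by metis
qed

text \<open>The map of \<open>darboux\<close> becomes the coordinate change. It carries the constant
  matrix \<open>Bl c 0\<close> to \<open>Bl c\<close>, and since its Jacobian is invertible, this
  property determines the component matrix in the new chart. The two coranks differ only in the
  choice of \<open>e\<close>.\<close>

lemma constant_chart:
  assumes c: "c \<in> A" "x \<in> fst c" "snd c x = 0" and e: "(e \<bullet> e) *\<^sub>R e = e" and R: "0 < R" "ball 0 R \<subseteq> snd c ` fst c"
    and kernel: "\<And>p. p \<in> fst c \<Longrightarrow> snd c p \<in> ball 0 R \<Longrightarrow> B c p *v e = 0"
    and nondeg: "\<And>p u. p \<in> fst c \<Longrightarrow> snd c p \<in> ball 0 R \<Longrightarrow> B c p *v u + (e \<bullet> u) *\<^sub>R e = 0 \<Longrightarrow> u = 0"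
    and schouten: "\<And>p. p \<in> topspace M \<Longrightarrow> schouten M A 2 2 V V p = 0"
  shows "\<exists>c\<in>A. x \<in> fst c \<and> snd c x = 0 \<and>
        (\<forall>i j. \<exists>k. \<forall>p\<in>fst c. V p [coord_diff A c i p, coord_diff A c j p] = k)"
proof -
  have pt: "\<exists>p. p \<in> fst c \<and> y = snd c p \<and> Bl c y = B c p" if "y \<in> ball 0 R" for y
  proof -
    obtain p where "p \<in> fst c" "y = snd c p" using R(2) \<open>y \<in> ball 0 R\<close> by blast
    then show ?thesis using Bl_apply[OF c(1)] by metis
  qed
  interpret D: bivector e "Bl c" R
  proof unfold_locales
    show "smooth_on (ball 0 R) (Bl c)" by (rule smooth_on_subset[OF smooth_Bl[OF c(1)] R(2)])
    fix y :: "real ^ 'n" assume y: "y \<in> ball 0 R"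
    obtain p where p: "p \<in> fst c" "y = snd c p" "Bl c y = B c p" using pt[OF y] by blast
    show "u \<bullet> (Bl c y *v v) = - (v \<bullet> (Bl c y *v u))" for u v
      unfolding p(3) by (rule B_skew[OF c(1) p(1)])
    show "Bl c y *v e = 0" unfolding p(3) by (rule kernel[OF p(1)]) (use y p in simp)
    show "u = 0" if "Bl c y *v u + (e \<bullet> u) *\<^sub>R e = 0" for u
      by (rule nondeg[OF p(1)]) (use y p that in auto)
    show "b \<bullet> (FD (Bl c) y (Bl c y *v a) *v d) + d \<bullet> (FD (Bl c) y (Bl c y *v b) *v a) +
        a \<bullet> (FD (Bl c) y (Bl c y *v d) *v b) = 0" for a b d
      using schouten_zero_iff[OF c(1) p(1)] schouten[OF chart_topspace[OF c(1) p(1)]]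
      by (simp add: jcb_def p(2))
  qed (use e R in auto)
  obtain \<rho> \<phi> where \<phi>: "0 < \<rho>" "smooth_on (ball 0 \<rho>) \<phi>" "\<phi> 0 = 0"
    and \<phi>R: "\<And>x. x \<in> ball 0 \<rho> \<Longrightarrow> \<phi> x \<in> ball 0 R"
    and \<phi>det: "\<And>x. x \<in> ball 0 \<rho> \<Longrightarrow> det (matrix (FD \<phi> x)) \<noteq> 0"
    and \<phi>B: "\<And>x u. x \<in> ball 0 \<rho> \<Longrightarrow>
      FD \<phi> x (Bl c 0 *v (transpose (matrix (FD \<phi> x)) *v u)) = Bl c (\<phi> x) *v u"
    using D.darboux by blast
  have \<phi>0: "\<phi> 0 = snd c x" using \<phi>(3) c(3) by simp
  have \<phi>im: "\<phi> u \<in> snd c ` fst c" if "u \<in> ball 0 \<rho>" for u using \<phi>R[OF that] R(2) by blast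
  have det0: "det (matrix (FD \<phi> 0)) \<noteq> 0" by (rule \<phi>det) (use \<phi>(1) in simp)
  obtain c' \<rho>' where c': "c' \<in> A" "x \<in> fst c'" "snd c' x = 0" and \<rho>': "\<rho>' \<le> \<rho>" "snd c' ` fst c' = ball 0 \<rho>'"
    and sub: "fst c' \<subseteq> fst c"
    and jac0: "\<forall>p\<in>fst c'. snd c p = \<phi> (snd c' p) \<and> (\<forall>v. jac c' c p v = FD \<phi> (snd c' p) v)"
    using new_chart_ball[OF c(1,2) \<phi>(1,2) \<phi>0 \<phi>im det0] by metis
  have cc': "\<And>p. p \<in> fst c' \<Longrightarrow> snd c p = \<phi> (snd c' p)"
    and jac: "\<And>p v. p \<in> fst c' \<Longrightarrow> jac c' c p v = FD \<phi> (snd c' p) v" using jac0 by blast+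
  have const: "B c' p = Bl c 0" if p: "p \<in> fst c'" for p
  proof -
    define u where "u = snd c' p"
    have "u \<in> ball 0 \<rho>'" unfolding u_def using \<rho>'(2) p by blast
    then have u: "u \<in> ball 0 \<rho>" using \<rho>'(1) by simp
    have pc: "p \<in> fst c" using sub p by blast
    have jacu: "jac c' c p = FD \<phi> u" using jac[OF p] by (auto simp: u_def)
    have det: "det (matrix (jac c' c p)) \<noteq> 0" unfolding jacu by (rule \<phi>det[OF u])
    note N = B_new_chart[OF c(1) c'(1) pc p det]
    have "B c' p *v a = Bl c 0 *v a" for a
    proof -
      obtain b where b: "a = transpose (matrix (jac c' c p)) *v b" using N(3) by blast
      have "jac c' c p (Bl c 0 *v a) = Bl c (\<phi> u) *v b" unfolding b jacu by (rule \<phi>B[OF u])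
      also have "\<dots> = B c p *v b" using cc'[OF p] Bl_apply[OF c(1) pc] by (simp add: u_def)
      also have "\<dots> = jac c' c p (B c' p *v a)" unfolding b by (rule N(1)[symmetric])
      finally have "jac c' c p (B c' p *v a - Bl c 0 *v a) = 0"
        using linear_diff[OF linear_jac[OF c'(1) c(1) p pc]] by simp
      then show ?thesis using N(2) by fastforce
    qed
    then show ?thesis using matrix_eq by blast
  qed
  have "V p [coord_diff A c' i p, coord_diff A c' j p] = Bl c 0 $ i $ j" if "p \<in> fst c'" for p i j
    using const[OF that] by (simp add: B_def vec_eq_iff)
  then show ?thesis using c' by blast
qed

lemma constant_chart_B:
  assumes "\<forall>i j. \<exists>k. \<forall>p\<in>fst c. V p [coord_diff A c i p, coord_diff A c j p] = k"
  obtains K where "\<And>p. p \<in> fst c \<Longrightarrow> B c p = K"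
proof -
  obtain k where k: "\<And>i j p. p \<in> fst c \<Longrightarrow> V p [coord_diff A c i p, coord_diff A c j p] = k i j"
    using assms by metis
  have "B c p = (\<chi> i j. k i j)" if "p \<in> fst c" for p
    using k[OF that] by (simp add: B_def)
  then show ?thesis using that by blast
qed

lemma constant_coefficients_schouten:
  assumes "constant_coefficients M A V" "x \<in> topspace M"
  shows "schouten M A 2 2 V V x = 0"
proof -
  obtain c where c: "c \<in> A" "x \<in> fst c"
    and k: "\<forall>i j. \<exists>k. \<forall>p\<in>fst c. V p [coord_diff A c i p, coord_diff A c j p] = k"
    using assms unfolding constant_coefficients_def by blast
  obtain K where K: "\<And>p. p \<in> fst c \<Longrightarrow> B c p = K" using constant_chart_B[OF k] by blast
  have z: "snd c x \<in> snd c ` fst c" using c by blast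
  have "FD (Bl c) (snd c x) = FD (\<lambda>y. K) (snd c x)"
    by (rule FD_cong[OF open_chart_image[OF c(1)] z]) (use K c in \<open>auto simp: Bl_def\<close>)
  then have "FD (Bl c) (snd c x) = (\<lambda>h. 0)" by (simp add: FD_eq[OF has_derivative_const])
  then show ?thesis by (simp add: schouten_zero_iff[OF c] jcb_def)
qed

theorem even_case:
  assumes rank: "\<forall>x\<in>topspace M. rank_at A V x = CARD('n)"
  shows "constant_coefficients M A V \<longleftrightarrow> (\<forall>x\<in>topspace M. schouten M A 2 2 V V x = 0)"
proof
  assume s: "\<forall>x\<in>topspace M. schouten M A 2 2 V V x = 0"
  show "constant_coefficients M A V"
    unfolding constant_coefficients_def
  proof
    fix x assume "x \<in> topspace M"
    then obtain c R where c: "c \<in> A" "x \<in> fst c" "snd c x = 0" "0 < R" "ball 0 R \<subseteq> snd c ` fst c"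
      using centered_chart by blast
    show "\<exists>c\<in>A. x \<in> fst c \<and> snd c x = 0 \<and>
        (\<forall>i j. \<exists>k. \<forall>p\<in>fst c. V p [coord_diff A c i p, coord_diff A c j p] = k)"
    \<comment> \<open>For \<open>e = 0\<close> the whole chart is a single leaf.\<close>
    proof (rule constant_chart[OF c(1-3) _ c(4,5), where e = 0])
      show "u = 0" if "p \<in> fst c" "B c p *v u + (0 \<bullet> u) *\<^sub>R 0 = 0" for p u
        using rank_full[OF c(1) that(1) bspec[OF rank chart_topspace[OF c(1) that(1)]]] that(2) by simp
    qed (use s in auto)
  qed
qed (use constant_coefficients_schouten in blast)

text \<open>In a chart with constant matrix the annihilator is spanned by a constant covector
  \<open>e\<close>. A section is a function \<open>g\<close> times it, and its exterior derivative
  is the wedge of the differential of \<open>g\<close> with the constant form, so a single product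
  is enough for the ideal.\<close>

lemma constant_coefficients_integrable:
  assumes const: "constant_coefficients M A V"
    and rank: "\<forall>x\<in>topspace M. rank_at A V x = CARD('n) - 1"
  shows "pfaff_integrable M A (annihilator A V)"
  unfolding pfaff_integrable_def
proof (intro allI impI ballI)
  fix U \<omega> x assume "openin M U \<and> local_section A (annihilator A V) U \<omega>" and x: "x \<in> U"
  then have U: "openin M U" and \<omega>: "form1_on A U \<omega>" and ann: "\<And>p. p \<in> U \<Longrightarrow> \<omega> p \<in> annihilator A V p"
    by (auto simp: local_section_def)
  have xM: "x \<in> topspace M" using U x openin_subset by blast
  obtain c where c: "c \<in> A" "x \<in> fst c"
    and k: "\<forall>i j. \<exists>k. \<forall>p\<in>fst c. V p [coord_diff A c i p, coord_diff A c j p] = k"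
    using const xM unfolding constant_coefficients_def by blast
  obtain K where K: "\<And>p. p \<in> fst c \<Longrightarrow> B c p = K" using constant_chart_B[OF k] by blast
  obtain e where e: "norm e = 1" "K *v e = 0" "\<And>a. K *v a = 0 \<Longrightarrow> a = (e \<bullet> a) *\<^sub>R e"
    using rank_corank_1[OF c bspec[OF rank xM]] K[OF c(2)] by metis
  define W where "W = U \<inter> fst c"
  have W: "openin M W" "x \<in> W" "W \<subseteq> U" "W \<subseteq> fst c"
    using U x c chart_openin[OF c(1)] by (auto simp: W_def)
  have oW: "open (snd c ` W)" using open_overlap[OF c(1) W(1)] W(4) by (simp add: Int_absorb1)
  have fsm: "smooth_on (snd c ` W) (cf c \<omega>)"
    using smooth_cf[OF c(1) U \<omega>] by (simp add: W_def Int_commute)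
  define g where "g = (\<lambda>y. e \<bullet> cf c \<omega> y)"
  have gsm: "smooth_on (snd c ` W) g"
    unfolding g_def by (rule smooth_on_inner[OF oW smooth_on_const[OF oW] fsm])
  have fg: "cf c \<omega> y = g y *\<^sub>R e" if "y \<in> snd c ` W" for y
  proof -
    obtain q where q: "q \<in> W" "y = snd c q" using \<open>y \<in> snd c ` W\<close> by blast
    have qc: "q \<in> U" "q \<in> fst c" using q(1) by (auto simp: W_def)
    have "\<omega> q = cov c q (cf c \<omega> y)"
      unfolding q(2) by (rule cf_rep[where \<omega> = \<omega>, OF c(1) qc(2)]) (use \<omega> qc in \<open>simp add: form1_on_def\<close>)
    then have "B c q *v cf c \<omega> y = 0" using annihilator_iff[OF c(1) qc(2)] ann[OF qc(1)] by simp
    then show ?thesis unfolding g_def K[OF qc(2)] by (rule e(3))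
  qed
  define \<alpha> where "\<alpha> = (\<lambda>p. cov c p (\<chi> i. FD g (snd c p) (axis i 1)))"
  define \<theta> where "\<theta> = (\<lambda>p. cov c p e)"
  have "form1_on A W \<alpha>"
    unfolding \<alpha>_def by (rule form1_cov[OF c(1) W(1,4), where f = "\<lambda>y. \<chi> i. FD g y (axis i 1)"])
      (intro smooth_on_vec_lambda[OF oW] smooth_on_FD gsm)
  moreover have "form1_on A W \<theta>"
    unfolding \<theta>_def by (rule form1_cov[OF c(1) W(1,4) smooth_on_const[OF oW]])
  moreover have "\<theta> p \<in> annihilator A V p" if "p \<in> W" for p
  proof -
    have pc: "p \<in> fst c" using that W by blast
    show ?thesis unfolding \<theta>_def annihilator_iff[OF c(1) pc] K[OF pc] by (rule e(2))
  qed
  moreover have "ext_deriv A \<omega> p u v = \<alpha> p u * \<theta> p v - \<alpha> p v * \<theta> p u"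
    if p: "p \<in> W" and u: "u \<in> tangent_space A p" and v: "v \<in> tangent_space A p" for p u v
  proof -
    have pc: "p \<in> U" "p \<in> fst c" and z: "snd c p \<in> snd c ` W" using p by (auto simp: W_def)
    have gd: "(g has_derivative FD g (snd c p)) (at (snd c p))" by (rule smooth_on_has_derivative[OF gsm z])
    have "FD (cf c \<omega>) (snd c p) = FD (\<lambda>y. g y *\<^sub>R e) (snd c p)" by (rule FD_cong[OF oW z fg])
    also have "\<dots> = (\<lambda>h. FD g (snd c p) h *\<^sub>R e)" by (rule FD_eq[OF has_derivative_scaleR_left[OF gd]])
    finally have "ext_deriv A \<omega> p u v = v c \<bullet> (FD g (snd c p) (u c) *\<^sub>R e) - u c \<bullet> (FD g (snd c p) (v c) *\<^sub>R e)"
      using ext_deriv_chart[OF U pc(1) \<omega> c(1) pc(2) u v] by simp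
    then show ?thesis
      using linear_real_representation[OF has_derivative_linear[OF gd], of "u c"]
        linear_real_representation[OF has_derivative_linear[OF gd], of "v c"]
      by (simp add: \<alpha>_def \<theta>_def cov_tangent[OF c(1) pc(2) u] cov_tangent[OF c(1) pc(2) v] inner_commute)
  qed
  ultimately show "\<exists>W L. openin M W \<and> x \<in> W \<and> W \<subseteq> U \<and>
           (\<forall>(\<alpha>, \<theta>)\<in>set L. form1_on A W \<alpha> \<and> local_section A (annihilator A V) W \<theta>) \<and>
           (\<forall>p\<in>W. \<forall>u\<in>tangent_space A p. \<forall>v\<in>tangent_space A p.
              ext_deriv A \<omega> p u v = (\<Sum>(\<alpha>, \<theta>)\<leftarrow>L. \<alpha> p u * \<theta> p v - \<alpha> p v * \<theta> p u))"
    using W(1-3) by (intro exI[of _ W] exI[of _ "[(\<alpha>, \<theta>)]"]) (auto simp: local_section_def)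
qed

text \<open>A smooth generator \<open>w\<close> of the annihilator comes from inverting
  \<open>N\<close>, the component matrix made nondegenerate by \<open>outer e\<close>. The map of
  \<open>frobenius\<close> gives a chart in which the level sets of \<open>e \<bullet> y\<close> are
  tangent to the kernel of \<open>w\<close>; there the annihilator is spanned by \<open>e\<close> at
  every point.\<close>

lemma adapted_chart:
  assumes rank: "\<forall>x\<in>topspace M. rank_at A V x = CARD('n) - 1"
    and int: "pfaff_integrable M A (annihilator A V)" and x: "x \<in> topspace M"
  obtains c e R where "c \<in> A" "x \<in> fst c" "snd c x = 0" "norm e = 1" "0 < R" "ball 0 R = snd c ` fst c"
    "\<forall>p\<in>fst c. B c p *v e = 0 \<and> (\<forall>a. B c p *v a = 0 \<longrightarrow> a = (e \<bullet> a) *\<^sub>R e)"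
proof -
  obtain c R0 where c: "c \<in> A" "x \<in> fst c" "snd c x = 0" and R0: "0 < R0" "ball 0 R0 \<subseteq> snd c ` fst c"
    using centered_chart[OF x] by blast
  obtain e where e: "norm e = 1" "B c x *v e = 0" "\<And>a. B c x *v a = 0 \<Longrightarrow> a = (e \<bullet> a) *\<^sub>R e"
    using rank_corank_1[OF c(1,2) bspec[OF rank x]] by metis
  have ee: "e \<bullet> e = 1" using e(1) by (simp add: dot_square_norm)
  define N where "N = (\<lambda>y. Bl c y + outer e)"
  have Nsm: "smooth_on (snd c ` fst c) N" unfolding N_def
    using smooth_on_add[OF open_chart_image[OF c(1)] smooth_Bl[OF c(1)] smooth_on_const[OF open_chart_image[OF c(1)]]] .
  have Bl0: "Bl c 0 = B c x" using Bl_apply[OF c(1,2)] c(3) by simp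
  have det0: "det (N 0) \<noteq> 0"
    unfolding det_nonzero_iff_inj
  proof (intro allI impI)
    fix u assume "N 0 *v u = 0"
    then have eq: "B c x *v u + (e \<bullet> u) *\<^sub>R e = 0" by (simp add: N_def Bl0 mv.add_left outer_mult)
    have "e \<bullet> (B c x *v u) = 0" using B_skew[OF c(1,2), of e u] e(2) by simp
    then have "e \<bullet> u = 0" using arg_cong[OF eq, of "\<lambda>y. e \<bullet> y"] ee by (simp add: inner_add_right)
    then show "u = 0" using e(3)[of u] eq by simp
  qed
  have "continuous_on (ball 0 R0) (\<lambda>y. det (N y))"
    by (rule continuous_on_subset[OF smooth_on_imp_continuous_on[OF smooth_on_det[OF open_chart_image[OF c(1)] Nsm]] R0(2)])
  then have "open (ball 0 R0 \<inter> (\<lambda>y. det (N y)) -` (- {0}))"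
    by (rule continuous_open_preimage[OF _ open_ball]) (simp add: open_Compl)
  moreover have "0 \<in> ball 0 R0 \<inter> (\<lambda>y. det (N y)) -` (- {0})" using R0(1) det0 by simp
  ultimately obtain R where R: "0 < R" "ball 0 R \<subseteq> ball 0 R0 \<inter> (\<lambda>y. det (N y)) -` (- {0})"
    using open_contains_ball by blast
  have detN: "det (N y) \<noteq> 0" if "y \<in> ball 0 R" for y using R(2) that by blast
  have Rim: "ball 0 R \<subseteq> snd c ` fst c" using R(2) R0(2) by blast
  \<comment> \<open>At 0 this is \<open>e\<close> itself; nearby it is the kernel vector of the
    component matrix scaled to \<open>e \<bullet> w y = 1\<close>.\<close>
  define w where "w = (\<lambda>y. matrix_inv (N y) *v e)"
  have wsm: "smooth_on (ball 0 R) w"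
    unfolding w_def
    by (intro smooth_on_matrix_vector_mult[OF open_ball] smooth_on_const[OF open_ball]
          smooth_on_matrix_inv[OF open_ball smooth_on_subset[OF Nsm Rim] detN])
  have W: "e \<bullet> w (snd c p) = 1" "B c p *v w (snd c p) = 0" "B c p *v a = 0 \<Longrightarrow> a = (e \<bullet> a) *\<^sub>R w (snd c p)"
    if p: "p \<in> fst c" "snd c p \<in> ball 0 R" for p a
  proof -
    note dt = detN[OF p(2)]
    have NB: "N (snd c p) *v u = B c p *v u + (e \<bullet> u) *\<^sub>R e" for u
      using Bl_apply[OF c(1) p(1)] by (simp add: N_def mv.add_left outer_mult)
    obtain k where k: "norm k = 1" "B c p *v k = 0"
      using rank_corank_1[OF c(1) p(1) bspec[OF rank chart_topspace[OF c(1) p(1)]]] by metis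
    \<comment> \<open>Paired with the kernel vector \<open>k\<close>, the first term drops out by
      skewness and \<open>(e \<bullet> w) * (k \<bullet> e) = k \<bullet> e\<close> remains;
      invertibility of \<open>N\<close> excludes that \<open>k\<close> is orthogonal to
      \<open>e\<close>.\<close>
    have Nw: "B c p *v w (snd c p) + (e \<bullet> w (snd c p)) *\<^sub>R e = e"
      using matrix_inv_mult_vec(1)[OF dt, of e] unfolding NB w_def .
    have "e \<bullet> k \<noteq> 0"
    proof
      assume "e \<bullet> k = 0"
      then have "N (snd c p) *v k = 0" by (simp add: NB k)
      then have "k = 0" using dt unfolding det_nonzero_iff_inj by blast
      then show False using k(1) by simp
    qed
    moreover have "k \<bullet> (B c p *v w (snd c p)) = 0" using B_skew[OF c(1) p(1), of k "w (snd c p)"] k(2) by simp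
    ultimately show 1: "e \<bullet> w (snd c p) = 1"
      using arg_cong[OF Nw, of "\<lambda>y. k \<bullet> y"] by (simp add: inner_add_right inner_commute)
    then show 2: "B c p *v w (snd c p) = 0" using Nw by simp
    show "a = (e \<bullet> a) *\<^sub>R w (snd c p)" if "B c p *v a = 0"
    proof -
      have "N (snd c p) *v (a - (e \<bullet> a) *\<^sub>R w (snd c p)) = 0"
        using that 1 2 by (simp add: NB mv.diff_right mv.scaleR_right inner_diff_right)
      then have "a - (e \<bullet> a) *\<^sub>R w (snd c p) = 0" using dt unfolding det_nonzero_iff_inj by blast
      then show ?thesis by simp
    qed
  qed
  define W0 where "W0 = {p \<in> fst c. snd c p \<in> ball 0 R}"
  have W0: "openin M W0" "W0 \<subseteq> fst c" unfolding W0_def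
    by (rule chart_open_preimage[OF is_chart[OF c(1)] open_ball]) auto
  have W0im: "snd c ` W0 = ball 0 R" using Rim by (auto simp: W0_def)
  define \<theta> where "\<theta> = (\<lambda>p. cov c p (w (snd c p)))"
  have \<theta>: "form1_on A W0 \<theta>" unfolding \<theta>_def by (rule form1_cov[OF c(1) W0]) (simp add: W0im wsm)
  have \<theta>sec: "local_section A (annihilator A V) W0 \<theta>"
    unfolding local_section_def using \<theta> W(2) annihilator_iff[OF c(1)] by (auto simp: \<theta>_def W0_def)
  have cf\<theta>: "cf c \<theta> y = w y" if "y \<in> ball 0 R" for y
  proof -
    obtain q where q: "q \<in> W0" "y = snd c q" using \<open>y \<in> ball 0 R\<close> W0im by blast
    have qc: "q \<in> fst c" using q W0 by blast
    have "\<theta> q = cov c q (cf c \<theta> (snd c q))"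
      by (rule cf_rep[OF c(1) qc]) (use \<theta> q in \<open>simp add: form1_on_def\<close>)
    then show ?thesis using cov_eq_iff[OF c(1) qc] q(2) by (simp add: \<theta>_def)
  qed
  have integrable: "v \<bullet> FD w y u = u \<bullet> FD w y v" if y: "y \<in> ball 0 R" and wu: "w y \<bullet> u = 0" and wv: "w y \<bullet> v = 0" for y u v
  proof -
    obtain q where q: "q \<in> W0" "y = snd c q" using y W0im by blast
    have qc: "q \<in> fst c" "snd c q \<in> ball 0 R" using q by (auto simp: W0_def)
    obtain W1 L where H: "openin M W1 \<and> q \<in> W1 \<and> W1 \<subseteq> W0 \<and>
         (\<forall>(\<alpha>, \<theta>)\<in>set L. form1_on A W1 \<alpha> \<and> local_section A (annihilator A V) W1 \<theta>) \<and>
         (\<forall>p\<in>W1. \<forall>u\<in>tangent_space A p. \<forall>v\<in>tangent_space A p.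
            ext_deriv A \<theta> p u v = (\<Sum>(\<alpha>, \<theta>)\<leftarrow>L. \<alpha> p u * \<theta> p v - \<alpha> p v * \<theta> p u))"
      using int[unfolded pfaff_integrable_def, rule_format, OF conjI[OF W0(1) \<theta>sec] q(1)]
      by (elim exE)
    have W1: "q \<in> W1" using H by (elim conjE)
    have sec: "\<forall>(\<alpha>, \<theta>)\<in>set L. form1_on A W1 \<alpha> \<and> local_section A (annihilator A V) W1 \<theta>"
      using H by (elim conjE)
    have "\<forall>p\<in>W1. \<forall>u\<in>tangent_space A p. \<forall>v\<in>tangent_space A p.
            ext_deriv A \<theta> p u v = (\<Sum>(\<alpha>, \<theta>)\<leftarrow>L. \<alpha> p u * \<theta> p v - \<alpha> p v * \<theta> p u)"
      using H by (elim conjE)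
    note at_q = bspec[OF this W1]
    have L: "ext_deriv A \<theta> q u v = (\<Sum>(\<alpha>, \<theta>)\<leftarrow>L. \<alpha> q u * \<theta> q v - \<alpha> q v * \<theta> q u)"
      if "u \<in> tangent_space A q" "v \<in> tangent_space A q" for u v
      by (rule bspec[OF bspec[OF at_q that(1)] that(2)])
    \<comment> \<open>Any section of the annihilator is at \<open>q\<close> a multiple of
      \<open>w\<close>, so each product in the ideal, and with it the exterior derivative of
      \<open>\<theta>\<close>, vanishes on pairs of vectors from the kernel of
      \<open>w\<close>.\<close>
    have zero: "\<eta> q (tv c q h) = 0" if "(\<alpha>, \<eta>) \<in> set L" "w y \<bullet> h = 0" for \<alpha> \<eta> h
    proof -
      have ann: "\<eta> q \<in> annihilator A V q" using bspec[OF sec that(1)] W1 by (simp add: local_section_def)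
      then have "\<eta> q \<in> cotangent_space A q" by (simp add: annihilator_def)
      then obtain a where a: "\<eta> q = cov c q a" using cotangentE[OF c(1) qc(1)] by blast
      then have "B c q *v a = 0" using ann annihilator_iff[OF c(1) qc(1)] by simp
      from W(3)[OF qc this] have "a \<bullet> h = (e \<bullet> a) * (w y \<bullet> h)" unfolding q(2) by (metis inner_scaleR_left)
      then show ?thesis using a that(2) c(1) qc(1) by simp
    qed
    note tu = tv_tangent[OF c(1) qc(1), of u] and tv = tv_tangent[OF c(1) qc(1), of v]
    have "(\<Sum>(\<alpha>, \<theta>)\<leftarrow>L. \<alpha> q (tv c q u) * \<theta> q (tv c q v) - \<alpha> q (tv c q v) * \<theta> q (tv c q u)) = (\<Sum>x\<leftarrow>L. 0)"
      by (intro arg_cong[where f = sum_list] map_cong refl) (auto simp: zero[OF _ wu] zero[OF _ wv])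
    then have "ext_deriv A \<theta> q (tv c q u) (tv c q v) = 0" using L[OF tu tv] by simp
    moreover have "FD (cf c \<theta>) y = FD w y" by (rule FD_cong[OF open_ball y cf\<theta>])
    ultimately show ?thesis
      using ext_deriv_chart[OF W0(1) q(1) \<theta> c(1) qc(1) tu tv] c(1) qc(1) q(2) by simp
  qed
  have w0: "w 0 = e"
  proof -
    have "N 0 *v e = e" using e(2) ee by (simp add: N_def Bl0 mv.add_left outer_mult)
    then show ?thesis using matrix_inv_mult_vec(2)[OF det0, of e] by (simp add: w_def)
  qed
  interpret F: integrable_covector e w R
  proof unfold_locales
    show "e \<bullet> w y = 1" if y: "y \<in> ball 0 R" for y
    proof -
      obtain p where "p \<in> fst c" "y = snd c p" using Rim y by blast
      then show ?thesis using W(1)[of p] y by simp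
    qed
  qed (use R(1) wsm w0 ee integrable in auto)
  obtain \<rho> \<phi> where \<phi>: "0 < \<rho>" "smooth_on (ball 0 \<rho>) \<phi>" "\<phi> 0 = 0"
    and \<phi>R: "\<And>x. x \<in> ball 0 \<rho> \<Longrightarrow> \<phi> x \<in> ball 0 R" and \<phi>0': "\<And>v. FD \<phi> 0 v = v"
    and \<phi>w: "\<And>x u. x \<in> ball 0 \<rho> \<Longrightarrow> e \<bullet> u = 0 \<Longrightarrow> w (\<phi> x) \<bullet> FD \<phi> x u = 0"
    using F.frobenius by blast
  have \<phi>0: "\<phi> 0 = snd c x" using \<phi>(3) c(3) by simp
  have \<phi>im: "\<phi> u \<in> snd c ` fst c" if "u \<in> ball 0 \<rho>" for u using \<phi>R[OF that] Rim by blast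
  have "FD \<phi> 0 = id" using \<phi>0' by auto
  then have det1: "det (matrix (FD \<phi> 0)) \<noteq> 0" by (simp add: matrix_id_mat_1 det_I)
  obtain c' \<rho>' where c': "c' \<in> A" "x \<in> fst c'" "snd c' x = 0" and \<rho>': "0 < \<rho>'" "\<rho>' \<le> \<rho>" "snd c' ` fst c' = ball 0 \<rho>'"
    and sub: "fst c' \<subseteq> fst c"
    and jac0: "\<forall>p\<in>fst c'. snd c p = \<phi> (snd c' p) \<and> (\<forall>v. jac c' c p v = FD \<phi> (snd c' p) v)"
    and det0': "\<forall>u\<in>ball 0 \<rho>'. det (matrix (FD \<phi> u)) \<noteq> 0"
    using new_chart_ball[OF c(1,2) \<phi>(1,2) \<phi>0 \<phi>im det1] .
  have cc': "\<And>p. p \<in> fst c' \<Longrightarrow> snd c p = \<phi> (snd c' p)"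
    and jac: "\<And>p v. p \<in> fst c' \<Longrightarrow> jac c' c p v = FD \<phi> (snd c' p) v"
    and det': "\<And>u. u \<in> ball 0 \<rho>' \<Longrightarrow> det (matrix (FD \<phi> u)) \<noteq> 0" using jac0 det0' by blast+
  have ker: "B c' p *v e = 0" "\<And>a. B c' p *v a = 0 \<Longrightarrow> a = (e \<bullet> a) *\<^sub>R e" if p: "p \<in> fst c'" for p
  proof -
    define u where "u = snd c' p"
    have u': "u \<in> ball 0 \<rho>'" unfolding u_def using \<rho>'(3) p by blast
    then have u: "u \<in> ball 0 \<rho>" using \<rho>'(2) by simp
    have pc: "p \<in> fst c" using sub p by blast
    have jacu: "jac c' c p = FD \<phi> u" using jac[OF p] by (auto simp: u_def)
    have det: "det (matrix (jac c' c p)) \<noteq> 0" unfolding jacu by (rule det'[OF u'])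
    note N = B_new_chart[OF c(1) c'(1) pc p det]
    define wp where "wp = transpose (matrix (jac c' c p)) *v w (snd c p)"
    have pR: "snd c p \<in> ball 0 R" using \<phi>R[OF u] cc'[OF p] by (simp add: u_def)
    have wp: "wp \<bullet> h = w (snd c p) \<bullet> jac c' c p h" for h
      using matrix_jac[OF c'(1) c(1) p pc] by (simp add: wp_def dot_lmul_matrix)
    \<comment> \<open>\<open>wp\<close> is the covector \<open>w\<close> in the new coordinates. By
      \<open>\<phi>w\<close> it vanishes on all vectors orthogonal to \<open>e\<close>, in
      particular on its own component \<open>h\<close> orthogonal to \<open>e\<close>.\<close>
    have "wp - (e \<bullet> wp) *\<^sub>R e = 0"
    proof -
      define h where "h = wp - (e \<bullet> wp) *\<^sub>R e"
      have eh: "e \<bullet> h = 0" using ee by (simp add: h_def inner_diff_right)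
      have "wp \<bullet> h = 0" unfolding wp jacu using \<phi>w[OF u eh] cc'[OF p] by (simp add: u_def)
      then have "h \<bullet> h = 0" using eh by (simp add: h_def inner_diff_left)
      then show ?thesis by (simp add: h_def)
    qed
    then have wpe: "wp = (e \<bullet> wp) *\<^sub>R e" by simp
    have "wp \<noteq> 0"
    proof
      assume "wp = 0"
      then have "jac c' c p h = 0 \<or> w (snd c p) \<bullet> jac c' c p h = 0" for h using wp[of h] by simp
      moreover have "\<exists>h. jac c' c p h = e"
        using matrix_inv_mult_vec(1)[OF det, of e] matrix_jac[OF c'(1) c(1) p pc] by metis
      ultimately have "e = 0 \<or> w (snd c p) \<bullet> e = 0" by metis
      then show False using W(1)[OF pc pR] e(1) by (auto simp: inner_commute)
    qed
    then have nz: "e \<bullet> wp \<noteq> 0" using wpe by auto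
    have "jac c' c p (B c' p *v wp) = B c p *v w (snd c p)" unfolding wp_def by (rule N(1))
    also have "\<dots> = 0" by (rule W(2)[OF pc pR])
    finally have "B c' p *v wp = 0" by (rule N(2))
    then have "(e \<bullet> wp) *\<^sub>R (B c' p *v e) = 0" using wpe by (metis mv.scaleR_right)
    then show Be: "B c' p *v e = 0" using nz by simp
    fix a assume a: "B c' p *v a = 0"
    \<comment> \<open>The kernel in the new chart has dimension 1 and contains \<open>e\<close>, so
      \<open>e\<close> spans it.\<close>
    obtain k where k: "\<And>a. B c' p *v a = 0 \<Longrightarrow> a = (k \<bullet> a) *\<^sub>R k"
      using rank_corank_1[OF c'(1) p bspec[OF rank chart_topspace[OF c'(1) p]]] by metis
    have "a = (k \<bullet> a) *\<^sub>R k" "e = (k \<bullet> e) *\<^sub>R k" using k a Be by auto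
    moreover from this(2) ee have "k \<bullet> e \<noteq> 0" by (metis inner_zero_left scaleR_zero_left zero_neq_one)
    ultimately have "a = ((k \<bullet> a) / (k \<bullet> e)) *\<^sub>R e"
      by (metis (no_types, opaque_lifting) nonzero_divide_eq_eq scaleR_scaleR)
    then obtain r where "a = r *\<^sub>R e" by blast
    then show "a = (e \<bullet> a) *\<^sub>R e" using ee by simp
  qed
  show ?thesis by (rule that[OF c' e(1) \<rho>'(1) \<rho>'(3)[symmetric]]) (use ker in blast)
qed

text \<open>The slice \<open>e \<bullet> y = 0\<close> of an adapted chart, with the subspace
  topology, is a leaf. It lets the condition on integral submanifolds be used at an arbitrary
  point.\<close>

lemma leaf_exists:
  assumes rank: "\<forall>x\<in>topspace M. rank_at A V x = CARD('n) - 1"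
    and int: "pfaff_integrable M A (annihilator A V)" and x: "x \<in> topspace M"
  obtains N where "integral_submanifold M A (annihilator A V) N" "x \<in> topspace N"
proof -
  obtain c e R where c: "c \<in> A" "x \<in> fst c" "snd c x = 0" and e: "norm e = 1" and R: "0 < R" "ball 0 R = snd c ` fst c"
    and ker0: "\<forall>p\<in>fst c. B c p *v e = 0 \<and> (\<forall>a. B c p *v a = 0 \<longrightarrow> a = (e \<bullet> a) *\<^sub>R e)"
    using adapted_chart[OF rank int x] .
  have ker: "\<And>p. p \<in> fst c \<Longrightarrow> B c p *v e = 0"
    "\<And>p a. p \<in> fst c \<Longrightarrow> B c p *v a = 0 \<Longrightarrow> a = (e \<bullet> a) *\<^sub>R e"
    using ker0 by blast+
  define S where "S = {y. e \<bullet> y = 0}"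
  define T where "T = {p \<in> fst c. snd c p \<in> S}"
  define N where "N = subtopology M T"
  have TM: "T \<subseteq> topspace M" using chart_topspace[OF c(1)] by (auto simp: T_def)
  have topN: "topspace N = T" using TM by (auto simp: N_def)
  have "e \<noteq> 0" using e by auto
  then have S: "subspace S" "dim S = CARD('n) - 1"
    unfolding S_def by (simp_all add: subspace_hyperplane dim_hyperplane)
  have slice: "slice_chart M A (CARD('n) - 1) N c S"
    unfolding slice_chart_def T_def[symmetric]
    using c(1) S openin_topspace[of N] unfolding topN by (auto simp: N_def subtopology_subtopology)
  have haus: "Hausdorff_space M" "second_countable M"
    using manifold by (auto simp: smooth_manifold_def)
  have sub: "submanifold M A (CARD('n) - 1) N"
    unfolding submanifold_def
  proof (intro conjI ballI)
    show "topspace N \<subseteq> topspace M" by (simp add: topN TM)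
    show "Hausdorff_space N" unfolding N_def by (rule Hausdorff_space_subtopology[OF haus(1)])
    show "second_countable N" unfolding N_def by (rule second_countable_subtopology[OF haus(2)])
    show "\<exists>c S. slice_chart M A (CARD('n) - 1) N c S \<and> p \<in> fst c \<and> snd c p \<in> S" if "p \<in> topspace N" for p
      using slice that unfolding topN T_def by blast
  qed
  have tangent: "submanifold_tangent M A (CARD('n) - 1) N p = {v \<in> tangent_space A p. v c \<in> S}" if p: "p \<in> T" for p
  proof
    have pc: "p \<in> fst c" "snd c p \<in> S" using p by (auto simp: T_def)
    show "{v \<in> tangent_space A p. v c \<in> S} \<subseteq> submanifold_tangent M A (CARD('n) - 1) N p"
      unfolding submanifold_tangent_def using slice pc by blast
    \<comment> \<open>\<open>submanifold_tangent\<close> admits every slice chart of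
      \<open>N\<close>, so an arbitrary one, \<open>c2\<close>, has to be compared with
      \<open>c\<close>.\<close>
    show "submanifold_tangent M A (CARD('n) - 1) N p \<subseteq> {v \<in> tangent_space A p. v c \<in> S}"
    proof
      fix v assume "v \<in> submanifold_tangent M A (CARD('n) - 1) N p"
      then obtain c2 S2 where v: "v \<in> tangent_space A p" and sl: "slice_chart M A (CARD('n) - 1) N c2 S2"
        and p2: "p \<in> fst c2" "snd c2 p \<in> S2" "v c2 \<in> S2"
        unfolding submanifold_tangent_def by blast
      have c2: "c2 \<in> A" "subspace S2" and op: "openin N {p \<in> fst c2. snd c2 p \<in> S2}"
        using sl by (auto simp: slice_chart_def)
      have subT: "{p \<in> fst c2. snd c2 p \<in> S2} \<subseteq> T" using openin_subset[OF op] topN by simp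
      define z where "z = snd c2 p"
      have td: "(transition c2 c has_derivative jac c2 c p) (at z)"
        unfolding z_def by (rule transition_deriv[OF c2(1) c(1) p2(1) pc(1)])
      have "((\<lambda>t. z + t *\<^sub>R v c2) has_derivative (\<lambda>t. t *\<^sub>R v c2)) (at 0)"
        by (auto intro!: derivative_eq_intros)
      from has_derivative_compose[OF this, of "transition c2 c" "jac c2 c p"] td
      have "((\<lambda>t. transition c2 c (z + t *\<^sub>R v c2)) has_derivative (\<lambda>t. jac c2 c p (t *\<^sub>R v c2))) (at 0)" by simp
      from bounded_linear.has_derivative[OF bounded_linear_inner_right this]
      have d1: "((\<lambda>t. e \<bullet> transition c2 c (z + t *\<^sub>R v c2)) has_derivative (\<lambda>t. e \<bullet> jac c2 c p (t *\<^sub>R v c2))) (at 0)" .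
      have o: "open ((\<lambda>t. z + t *\<^sub>R v c2) -` (snd c2 ` fst c2))"
        by (rule open_vimage[OF open_chart_image[OF c2(1)]]) (intro continuous_intros)
      \<comment> \<open>Near \<open>z\<close> the line stays in the slice of \<open>c2\<close>,
        hence in \<open>T\<close>, where the coordinate \<open>e \<bullet> y\<close> of the chart
        \<open>c\<close> is 0.\<close>
      have d2: "((\<lambda>t. e \<bullet> transition c2 c (z + t *\<^sub>R v c2)) has_derivative (\<lambda>t. 0)) (at 0)"
      proof (rule has_derivative_transform_within_open[OF has_derivative_const o])
        show "0 \<in> (\<lambda>t. z + t *\<^sub>R v c2) -` (snd c2 ` fst c2)" using p2 by (simp add: z_def)
        fix t assume "t \<in> (\<lambda>t. z + t *\<^sub>R v c2) -` (snd c2 ` fst c2)"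
        then obtain q where q: "q \<in> fst c2" "z + t *\<^sub>R v c2 = snd c2 q" by auto
        have "snd c2 q \<in> S2" unfolding q(2)[symmetric] z_def
          by (intro subspace_add subspace_scale c2(2) p2)
        then have "q \<in> T" using subT q(1) by blast
        then show "0 = e \<bullet> transition c2 c (z + t *\<^sub>R v c2)"
          using q c2(1) by (simp add: T_def S_def)
      qed
      have "e \<bullet> jac c2 c p (v c2) = 0" using fun_cong[OF has_derivative_unique[OF d1 d2], of 1] by simp
      then have "v c \<in> S" using tangent_jac[OF v c2(1) c(1) p2(1) pc(1)] by (simp add: S_def)
      then show "v \<in> {v \<in> tangent_space A p. v c \<in> S}" using v by blast
    qed
  qed
  have kernel: "pfaff_kernel A (annihilator A V) p = {v \<in> tangent_space A p. v c \<in> S}" if p: "p \<in> T" for p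
  proof -
    have pc: "p \<in> fst c" using p by (auto simp: T_def)
    have "(\<forall>w\<in>annihilator A V p. w v = 0) \<longleftrightarrow> e \<bullet> v c = 0" if v: "v \<in> tangent_space A p" for v
    proof
      assume "\<forall>w\<in>annihilator A V p. w v = 0"
      then show "e \<bullet> v c = 0"
        using ker(1)[OF pc] annihilator_iff[OF c(1) pc] cov_tangent[OF c(1) pc v] by metis
    next
      assume ev: "e \<bullet> v c = 0"
      show "\<forall>w\<in>annihilator A V p. w v = 0"
      proof
        fix w assume w: "w \<in> annihilator A V p"
        then have "w \<in> cotangent_space A p" by (simp add: annihilator_def)
        then obtain a where a: "w = cov c p a" using cotangentE[OF c(1) pc] by blast
        then have "a = (e \<bullet> a) *\<^sub>R e" using w annihilator_iff[OF c(1) pc] ker(2)[OF pc] by simp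
        then have "a \<bullet> v c = 0" using ev by (metis inner_scaleR_left mult_zero_right)
        then show "w v = 0" using a cov_tangent[OF c(1) pc v] by simp
      qed
    qed
    then show ?thesis unfolding pfaff_kernel_def S_def by blast
  qed
  have "integral_submanifold M A (annihilator A V) N"
    unfolding integral_submanifold_def topN using sub tangent kernel by simp
  moreover have "x \<in> topspace N" unfolding topN T_def S_def using c by simp
  ultimately show ?thesis by (rule that)
qed

theorem odd_case:
  assumes rank: "\<forall>x\<in>topspace M. rank_at A V x = CARD('n) - 1"
  shows "constant_coefficients M A V \<longleftrightarrow> pfaff_integrable M A (annihilator A V) \<and>
      (\<forall>N. integral_submanifold M A (annihilator A V) N \<longrightarrow> (\<forall>x\<in>topspace N. schouten M A 2 2 V V x = 0))"
proof
  assume const: "constant_coefficients M A V"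
  have "x \<in> topspace M" if "integral_submanifold M A (annihilator A V) N" "x \<in> topspace N" for N x
    using that by (auto simp: integral_submanifold_def submanifold_def)
  then show "pfaff_integrable M A (annihilator A V) \<and>
      (\<forall>N. integral_submanifold M A (annihilator A V) N \<longrightarrow> (\<forall>x\<in>topspace N. schouten M A 2 2 V V x = 0))"
    using constant_coefficients_integrable[OF const rank] constant_coefficients_schouten[OF const] by blast
next
  assume h: "pfaff_integrable M A (annihilator A V) \<and>
      (\<forall>N. integral_submanifold M A (annihilator A V) N \<longrightarrow> (\<forall>x\<in>topspace N. schouten M A 2 2 V V x = 0))"
  then have int: "pfaff_integrable M A (annihilator A V)" by blast
  have s: "schouten M A 2 2 V V x = 0" if x: "x \<in> topspace M" for x
    using leaf_exists[OF rank int x] h by metis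
  show "constant_coefficients M A V"
    unfolding constant_coefficients_def
  proof
    fix x assume x: "x \<in> topspace M"
    obtain c e R where c: "c \<in> A" "x \<in> fst c" "snd c x = 0" and e: "norm e = 1" and R: "0 < R" "ball 0 R = snd c ` fst c"
      and ker0: "\<forall>p\<in>fst c. B c p *v e = 0 \<and> (\<forall>a. B c p *v a = 0 \<longrightarrow> a = (e \<bullet> a) *\<^sub>R e)"
      using adapted_chart[OF rank int x] .
    have ker: "\<And>p. p \<in> fst c \<Longrightarrow> B c p *v e = 0"
      "\<And>p a. p \<in> fst c \<Longrightarrow> B c p *v a = 0 \<Longrightarrow> a = (e \<bullet> a) *\<^sub>R e"
      using ker0 by blast+
    have ee: "e \<bullet> e = 1" using e by (simp add: dot_square_norm)
    show "\<exists>c\<in>A. x \<in> fst c \<and> snd c x = 0 \<and>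
        (\<forall>i j. \<exists>k. \<forall>p\<in>fst c. V p [coord_diff A c i p, coord_diff A c j p] = k)"
    proof (rule constant_chart[OF c _ R(1)])
      fix p u assume p: "p \<in> fst c" and eq: "B c p *v u + (e \<bullet> u) *\<^sub>R e = 0"
      \<comment> \<open>The range of the skew matrix is orthogonal to \<open>e\<close>; pairing the
        equation with \<open>e\<close> therefore leaves \<open>e \<bullet> u = 0\<close>, and then
        \<open>u\<close> lies in the kernel, which \<open>e\<close> spans.\<close>
      have "e \<bullet> (B c p *v u) = 0" using B_skew[OF c(1) p, of e u] ker(1)[OF p] by simp
      then have "e \<bullet> u = 0" using arg_cong[OF eq, of "\<lambda>y. e \<bullet> y"] ee by (simp add: inner_add_right)
      then show "u = 0" using eq ker(2)[OF p, of u] by simp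
    qed (use R(2) ker(1) s ee in auto)
  qed
qed

end

theorem corollary1p15:
  fixes M :: "'m topology"
    and A :: "('m, 'n::finite) chart set"
    and V :: "'m \<Rightarrow> ('m, 'n) mvec"
  assumes "smooth_manifold M A"
    and "multivector_field M A 2 V"
  shows "(even CARD('n) \<and> (\<forall>x\<in>topspace M. rank_at A V x = CARD('n)) \<longrightarrow>
           (constant_coefficients M A V \<longleftrightarrow> (\<forall>x\<in>topspace M. schouten M A 2 2 V V x = 0)))
       \<and> (odd CARD('n) \<and> (\<forall>x\<in>topspace M. rank_at A V x = CARD('n) - 1) \<longrightarrow>
           (constant_coefficients M A V \<longleftrightarrow>
              pfaff_integrable M A (annihilator A V) \<and>
              (\<forall>N. integral_submanifold M A (annihilator A V) N \<longrightarrow>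
                 (\<forall>x\<in>topspace N. schouten M A 2 2 V V x = 0))))"
proof -
  interpret bivector_manifold M A V
    by unfold_locales (use assms in auto)
  show ?thesis using even_case odd_case by blast
qed

end
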